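(* Let $n=3$. There are two simple Riemannian metrics on the closed unit ball $\bar B\subset\mathbb R^3$ whose induced distances $\ell$ and $\tilde\ell$ satisfy $\tilde\ell(y,z)\ge\ell(y,z)$ for all $y,z\in S^2$, but such that the top-degree form $$\hat\eta=\sum_{k=0}^{2}(dd_2\tilde\ell)^k\wedge(dd_2\ell)^{2-k}$$ on $\Pi=S^2\times S^2\setminus\mathrm{diagonal}$ is indefinite, and there is no simple reversible Finsler metric on $\bar B$ whose boundary distances are $\tilde\ell(y,z)+\ell(y,z)$, $y,z\in S^2$.
   Context: $\bar B$ is the closed Euclidean unit ball in $\mathbb R^3$ with boundary $S^2$. A reversible Finsler metric on $\bar B$ is a function $F:T\bar B\to[0,\infty)$ which is a norm on every $T_x\bar B$, depends smoothly on $x$ (smooth on $T\bar B\setminus\{0\}$), satisfies $F(-v)=F(v)$, and for which the bilinear form $g_w(u,v):=\frac12\frac{d^2}{ds\,dt}\big|_{s=t=0}F^2(w+su+tv)$ on $T_x\bar B$ is positive definite for every $w\in T_x\bar B\setminus\{0\}$; a Riemannian metric is regarded as the Finsler metric given by its norm. A Finsler metric $F$ on $\bar B$ is simple if $(\bar B,F)$ is convex, has no conjugate points, and any two points are connected by a unique geodesic segment. The induced distance of $F$ is $\ell(x,y)=\inf_c\int F(\dot c)$, the infimum over smooth curves $c$ in $\bar B$ connecting $x$ with $y$; its restriction to $S^2\times S^2$ gives the boundary distances. On $\Pi$, $d_1,d_2$ denote exterior differentiation with respect to the first and second factor, $d=d_1+d_2$; $dd_2\ell=d_1d_2\ell$ is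 the two-form given in local coordinates $(\xi,\upsilon)$ of the two factors by $\sum_{i,j}\frac{\partial^2\ell}{\partial\xi_i\partial\upsilon_j}\,d\xi_i\wedge d\upsilon_j$, and powers are wedge powers. A top-degree form on the connected orientable manifold $\Pi$ is indefinite if, with respect to a fixed orientation of $\Pi$, it takes both positive and negative values. *)

theory Defs
  imports "HOL-Analysis.Analysis"
begin

section \<open>Smooth maps\<close>

primrec Ck_on :: "nat \<Rightarrow> 'a::euclidean_space set \<Rightarrow> ('a \<Rightarrow> 'b::real_normed_vector) \<Rightarrow> bool" where
  "Ck_on 0 U f \<longleftrightarrow> continuous_on U f"
| "Ck_on (Suc k) U f \<longleftrightarrow>
     (\<forall>x\<in>U. f differentiable (at x)) \<and> (\<forall>h. Ck_on k U (\<lambda>x. frechet_derivative f (at x) h))"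

text \<open>The domains used below (closed ball, compact interval, tangent bundle of the ball) have
  boundary; as usual, smoothness up to the boundary means that there is a smooth extension to an
  open neighbourhood.\<close>

definition smooth_map_on :: "'a::euclidean_space set \<Rightarrow> ('a \<Rightarrow> 'b::real_normed_vector) \<Rightarrow> bool" where
  "smooth_map_on S f \<longleftrightarrow>
     (\<exists>U g. open U \<and> S \<subseteq> U \<and> (\<forall>k. Ck_on k U g) \<and> (\<forall>x\<in>S. f x = g x))"


section \<open>Finsler and Riemannian metrics on the closed unit ball\<close>

abbreviation Ball3 :: "(real^3) set" where "Ball3 \<equiv> cball 0 1"
abbreviation S2 :: "(real^3) set" where "S2 \<equiv> sphere 0 1"

text \<open>A metric is a function \<open>F x v\<close> of a base point \<open>x\<close> and a tangent vector \<open>v\<close>;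
  its values for \<open>x\<close> outside \<open>Ball3\<close> are irrelevant.\<close>

type_synonym metric = "real^3 \<Rightarrow> real^3 \<Rightarrow> real"

definition slit_TB :: "((real^3) \<times> (real^3)) set" where
  "slit_TB = Ball3 \<times> (- {0})"

definition is_norm :: "(real^3 \<Rightarrow> real) \<Rightarrow> bool" where
  "is_norm N \<longleftrightarrow> (\<forall>v. 0 \<le> N v) \<and> (\<forall>v. N v = 0 \<longleftrightarrow> v = 0) \<and>
     (\<forall>r v. N (r *\<^sub>R v) = \<bar>r\<bar> * N v) \<and> (\<forall>u v. N (u + v) \<le> N u + N v)"

definition fundamental_tensor :: "metric \<Rightarrow> real^3 \<Rightarrow> real^3 \<Rightarrow> real^3 \<Rightarrow> real^3 \<Rightarrow> real" where
  "fundamental_tensor F x w u v =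
     1/2 * deriv (\<lambda>s. deriv (\<lambda>t. (F x (w + s *\<^sub>R u + t *\<^sub>R v))\<^sup>2) 0) 0"

definition reversible_Finsler :: "metric \<Rightarrow> bool" where
  "reversible_Finsler F \<longleftrightarrow>
     (\<forall>x\<in>Ball3. is_norm (F x)) \<and>
     smooth_map_on slit_TB (\<lambda>(x, v). F x v) \<and>
     (\<forall>x\<in>Ball3. \<forall>v. F x (- v) = F x v) \<and>
     (\<forall>x\<in>Ball3. \<forall>w. w \<noteq> 0 \<longrightarrow> (\<forall>u. u \<noteq> 0 \<longrightarrow> fundamental_tensor F x w u u > 0))"

definition Riemannian :: "metric \<Rightarrow> bool" where
  "Riemannian F \<longleftrightarrow> (\<exists>g :: real^3 \<Rightarrow> real^3^3.
     smooth_map_on Ball3 g \<and>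
     (\<forall>x\<in>Ball3. transpose (g x) = g x \<and> (\<forall>v. v \<noteq> 0 \<longrightarrow> v \<bullet> (g x *v v) > 0)) \<and>
     (\<forall>x\<in>Ball3. \<forall>v. F x v = sqrt (v \<bullet> (g x *v v))))"

abbreviation velocity :: "(real \<Rightarrow> real^3) \<Rightarrow> real \<Rightarrow> real^3" where
  "velocity c t \<equiv> vector_derivative c (at t within {0..1})"

definition induced_dist :: "metric \<Rightarrow> real^3 \<Rightarrow> real^3 \<Rightarrow> real" where
  "induced_dist F x y =
     Inf {integral {0..1} (\<lambda>t. F (c t) (velocity c t)) | c.
            smooth_map_on {0..1} c \<and> c ` {0..1} \<subseteq> Ball3 \<and> c 0 = x \<and> c 1 = y}"


section \<open>Geodesics and simple metrics\<close>

definition energy :: "metric \<Rightarrow> (real^3) \<times> (real^3) \<Rightarrow> real" where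
  "energy F = (\<lambda>(x, v). (F x v)\<^sup>2 / 2)"

definition denergy :: "metric \<Rightarrow> (real^3) \<times> (real^3) \<Rightarrow> (real^3) \<times> (real^3) \<Rightarrow> real" where
  "denergy F p h = frechet_derivative (energy F) (at p within slit_TB) h"

definition ddenergy ::
    "metric \<Rightarrow> (real^3) \<times> (real^3) \<Rightarrow> (real^3) \<times> (real^3) \<Rightarrow> (real^3) \<times> (real^3) \<Rightarrow> real" where
  "ddenergy F p h k = frechet_derivative (\<lambda>q. denergy F q h) (at p within slit_TB) k"

text \<open>A geodesic segment is a regular smooth curve in \<open>Ball3\<close> satisfying the Euler-Lagrange equation
  \<open>d/dt (\<partial>E/\<partial>v) = \<partial>E/\<partial>x\<close> of the energy \<open>E = F\<^sup>2/2\<close>; solutions have constant speed, so that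
  parametrization by \<open>{0..1}\<close> normalizes the parameter completely.\<close>

definition geodesic :: "metric \<Rightarrow> (real \<Rightarrow> real^3) \<Rightarrow> bool" where
  "geodesic F c \<longleftrightarrow>
     smooth_map_on {0..1} c \<and> c ` {0..1} \<subseteq> Ball3 \<and> (\<forall>t\<in>{0..1}. velocity c t \<noteq> 0) \<and>
     (\<forall>t\<in>{0..1}. \<forall>w.
        ((\<lambda>s. denergy F (c s, velocity c s) (0, w)) has_real_derivative
           denergy F (c t, velocity c t) (w, 0)) (at t within {0..1}))"

text \<open>The Jacobi equation is the linearization of the Euler-Lagrange equation along a geodesic.\<close>

definition Jacobi_field :: "metric \<Rightarrow> (real \<Rightarrow> real^3) \<Rightarrow> (real \<Rightarrow> real^3) \<Rightarrow> bool" where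
  "Jacobi_field F c J \<longleftrightarrow>
     smooth_map_on {0..1} J \<and>
     (\<forall>t\<in>{0..1}. \<forall>w.
        ((\<lambda>s. ddenergy F (c s, velocity c s) (0, w) (J s, velocity J s)) has_real_derivative
           ddenergy F (c t, velocity c t) (w, 0) (J t, velocity J t)) (at t within {0..1}))"

text \<open>Subsegments of a geodesic are, after affine reparametrization, again geodesics in the above
  sense, so it suffices to compare the two endpoints.\<close>

definition no_conjugate_points :: "metric \<Rightarrow> bool" where
  "no_conjugate_points F \<longleftrightarrow>
     (\<forall>c J. geodesic F c \<longrightarrow> Jacobi_field F c J \<longrightarrow> J 0 = 0 \<longrightarrow> J 1 = 0 \<longrightarrow> (\<forall>t\<in>{0..1}. J t = 0))"

text \<open>\<open>a\<close> is the second derivative at \<open>x\<close> of the geodesic with velocity \<open>v\<close>: this is the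
  Euler-Lagrange equation with the time derivative carried out.  It makes sense also when that
  geodesic does not stay in \<open>Ball3\<close>.\<close>

definition geodesic_acceleration :: "metric \<Rightarrow> real^3 \<Rightarrow> real^3 \<Rightarrow> real^3 \<Rightarrow> bool" where
  "geodesic_acceleration F x v a \<longleftrightarrow>
     (\<forall>w. ddenergy F (x, v) (0, w) (v, a) = denergy F (x, v) (w, 0))"

text \<open>Convexity is convexity of the boundary (nonnegative second fundamental form): along the
  geodesics tangent to \<open>S2\<close> the boundary defining function \<open>(\<bar>x\<bar>\<^sup>2 - 1)/2\<close>, which is negative in the
  interior, has nonnegative second derivative \<open>v \<bullet> v + x \<bullet> a\<close> at the point of tangency.\<close>

definition convex_metric :: "metric \<Rightarrow> bool" where
  "convex_metric F \<longleftrightarrow>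
     (\<forall>x\<in>S2. \<forall>v a. v \<noteq> 0 \<and> x \<bullet> v = 0 \<and> geodesic_acceleration F x v a \<longrightarrow> v \<bullet> v + x \<bullet> a \<ge> 0)"

definition uniquely_geodesic :: "metric \<Rightarrow> bool" where
  "uniquely_geodesic F \<longleftrightarrow>
     (\<forall>x\<in>Ball3. \<forall>y\<in>Ball3. x \<noteq> y \<longrightarrow>
        (\<exists>c. geodesic F c \<and> c 0 = x \<and> c 1 = y \<and>
           (\<forall>b. geodesic F b \<and> b 0 = x \<and> b 1 = y \<longrightarrow> (\<forall>t\<in>{0..1}. b t = c t))))"

definition simple_Finsler :: "metric \<Rightarrow> bool" where
  "simple_Finsler F \<longleftrightarrow> reversible_Finsler F \<and>
     convex_metric F \<and> no_conjugate_points F \<and> uniquely_geodesic F"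

definition simple_Riemannian :: "metric \<Rightarrow> bool" where
  "simple_Riemannian F \<longleftrightarrow> Riemannian F \<and> simple_Finsler F"


section \<open>Differential forms on the space of pairs of distinct boundary points\<close>

definition Pairs :: "((real^3) \<times> (real^3)) set" where
  "Pairs = {(y, z). y \<in> S2 \<and> z \<in> S2 \<and> y \<noteq> z}"

definition tangent_Pairs :: "(real^3) \<times> (real^3) \<Rightarrow> ((real^3) \<times> (real^3)) set" where
  "tangent_Pairs p = {(u, w). fst p \<bullet> u = 0 \<and> snd p \<bullet> w = 0}"

text \<open>A form of degree \<open>k\<close> takes a point \<open>p\<close> and tangent vectors \<open>a 0, \<dots>, a (k - 1)\<close> at \<open>p\<close>; the
  degree is not part of the type, and only these values of \<open>a\<close> are used.\<close>

type_synonym form = "(real^3) \<times> (real^3) \<Rightarrow> (nat \<Rightarrow> (real^3) \<times> (real^3)) \<Rightarrow> real"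

definition wedge :: "nat \<Rightarrow> nat \<Rightarrow> form \<Rightarrow> form \<Rightarrow> form" where
  "wedge k l \<alpha> \<beta> p a =
     (\<Sum>\<sigma> | \<sigma> permutes {..<k + l}.
        of_int (sign \<sigma>) * \<alpha> p (\<lambda>i. a (\<sigma> i)) * \<beta> p (\<lambda>i. a (\<sigma> (k + i)))) / (fact k * fact l)"

text \<open>Wedge powers of a two-form; the \<open>k\<close>-th power has degree \<open>2 * k\<close>.\<close>

primrec wedge_power :: "form \<Rightarrow> nat \<Rightarrow> form" where
  "wedge_power \<omega> 0 = (\<lambda>p a. 1)"
| "wedge_power \<omega> (Suc k) = wedge 2 (2 * k) \<omega> (wedge_power \<omega> k)"

text \<open>The differential at \<open>y \<in> S2\<close>, on a tangent vector \<open>u\<close>, of a function on \<open>S2\<close>.  As \<open>sgn\<close> is the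
  radial retraction onto \<open>S2\<close>, \<open>f \<circ> sgn\<close> is an extension of \<open>f\<close> to a neighbourhood of \<open>S2\<close>.\<close>

definition S2_diff :: "(real^3 \<Rightarrow> real) \<Rightarrow> real^3 \<Rightarrow> real^3 \<Rightarrow> real" where
  "S2_diff f y u = frechet_derivative (\<lambda>x. f (sgn x)) (at y) u"

definition mixed_diff ::
    "(real^3 \<Rightarrow> real^3 \<Rightarrow> real) \<Rightarrow> (real^3) \<times> (real^3) \<Rightarrow> real^3 \<Rightarrow> real^3 \<Rightarrow> real" where
  "mixed_diff l p u w = S2_diff (\<lambda>y. S2_diff (l y) (snd p) w) (fst p) u"

text \<open>\<open>mixed_diff l p u w\<close> is \<open>\<Sum>i j. \<partial>\<^sup>2l/\<partial>\<xi>\<^sub>i\<partial>\<upsilon>\<^sub>j d\<xi>\<^sub>i(u) d\<upsilon>\<^sub>j(w)\<close> in local coordinates (see lemma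
  \<open>mixed_diff_coordinates\<close>), so that the following is the two-form
  \<open>\<Sum>i j. \<partial>\<^sup>2l/\<partial>\<xi>\<^sub>i\<partial>\<upsilon>\<^sub>j d\<xi>\<^sub>i \<and> d\<upsilon>\<^sub>j\<close> evaluated at two tangent vectors.\<close>

definition dd2 :: "(real^3 \<Rightarrow> real^3 \<Rightarrow> real) \<Rightarrow> form" where
  "dd2 l p a = mixed_diff l p (fst (a 0)) (snd (a 1)) - mixed_diff l p (fst (a 1)) (snd (a 0))"

definition eta_hat :: "(real^3 \<Rightarrow> real^3 \<Rightarrow> real) \<Rightarrow> (real^3 \<Rightarrow> real^3 \<Rightarrow> real) \<Rightarrow> form" where
  "eta_hat l' l p a =
     (\<Sum>k\<le>2. wedge (2 * k) (2 * (2 - k)) (wedge_power (dd2 l') k) (wedge_power (dd2 l) (2 - k)) p a)"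

text \<open>The product orientation of \<open>S2 \<times> S2\<close>, given by the exterior product of the area forms of the
  two factors.\<close>

definition orientation_form :: form where
  "orientation_form = wedge 2 2
     (\<lambda>p a. fst p \<bullet> cross3 (fst (a 0)) (fst (a 1)))
     (\<lambda>p a. snd p \<bullet> cross3 (snd (a 0)) (snd (a 1)))"

definition positive_frame :: "(real^3) \<times> (real^3) \<Rightarrow> (nat \<Rightarrow> (real^3) \<times> (real^3)) \<Rightarrow> bool" where
  "positive_frame p a \<longleftrightarrow> (\<forall>i<4. a i \<in> tangent_Pairs p) \<and> orientation_form p a > 0"

definition indefinite_top_form :: "form \<Rightarrow> bool" where
  "indefinite_top_form \<eta> \<longleftrightarrow>
     (\<exists>p\<in>Pairs. \<exists>a. positive_frame p a \<and> \<eta> p a > 0) \<and>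
     (\<exists>p\<in>Pairs. \<exists>a. positive_frame p a \<and> \<eta> p a < 0)"

text \<open>Here \<open>\<phi>\<close> and \<open>\<psi>\<close> are local parametrizations of the two factors.\<close>

lemma S2_diff_coordinates:
  fixes \<phi> :: "real^2 \<Rightarrow> real^3"
  assumes U: "open U" "\<xi> \<in> U" "\<phi> ` U \<subseteq> S2" and \<phi>: "\<phi> differentiable (at \<xi>)"
    and f: "(\<lambda>x. f (sgn x)) differentiable (at (\<phi> \<xi>))"
  shows "frechet_derivative (\<lambda>\<xi>. f (\<phi> \<xi>)) (at \<xi>) h
         = S2_diff f (\<phi> \<xi>) (frechet_derivative \<phi> (at \<xi>) h)"
proof -
  have 1: "(\<phi> has_derivative frechet_derivative \<phi> (at \<xi>)) (at \<xi>)"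
    using \<phi> by (simp add: frechet_derivative_works)
  have 2: "((\<lambda>x. f (sgn x)) has_derivative S2_diff f (\<phi> \<xi>)) (at (\<phi> \<xi>))"
    using f unfolding S2_diff_def by (simp add: frechet_derivative_works)
  have 3: "((\<lambda>\<xi>. f (sgn (\<phi> \<xi>))) has_derivative
      (\<lambda>h. S2_diff f (\<phi> \<xi>) (frechet_derivative \<phi> (at \<xi>) h))) (at \<xi>)"
    using has_derivative_compose[OF 1 2] .
  have "((\<lambda>\<xi>. f (\<phi> \<xi>)) has_derivative
      (\<lambda>h. S2_diff f (\<phi> \<xi>) (frechet_derivative \<phi> (at \<xi>) h))) (at \<xi>)"
  proof (rule has_derivative_transform_within_open[OF 3 U(1,2)])
    fix x assume "x \<in> U"
    then have "norm (\<phi> x) = 1" using U(3) by auto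
    then show "f (sgn (\<phi> x)) = f (\<phi> x)" by (simp add: sgn_div_norm)
  qed
  then show ?thesis by (simp add: frechet_derivative_at [symmetric])
qed

lemma mixed_diff_coordinates:
  fixes \<phi> \<psi> :: "real^2 \<Rightarrow> real^3"
  assumes "open U" "\<xi> \<in> U" "\<phi> ` U \<subseteq> S2" "\<phi> differentiable (at \<xi>)"
    and "open V" "\<upsilon> \<in> V" "\<psi> ` V \<subseteq> S2" "\<psi> differentiable (at \<upsilon>)"
    and l2: "\<And>y. y \<in> \<phi> ` U \<Longrightarrow> (\<lambda>x. l y (sgn x)) differentiable (at (\<psi> \<upsilon>))"
    and l12: "\<And>w. (\<lambda>x. S2_diff (l (sgn x)) (\<psi> \<upsilon>) w) differentiable (at (\<phi> \<xi>))"
  shows "frechet_derivative (\<lambda>\<xi>. frechet_derivative (\<lambda>\<upsilon>. l (\<phi> \<xi>) (\<psi> \<upsilon>)) (at \<upsilon>) k) (at \<xi>) h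
         = mixed_diff l (\<phi> \<xi>, \<psi> \<upsilon>) (frechet_derivative \<phi> (at \<xi>) h) (frechet_derivative \<psi> (at \<upsilon>) k)"
proof -
  let ?g = "\<lambda>y. S2_diff (l y) (\<psi> \<upsilon>) (frechet_derivative \<psi> (at \<upsilon>) k)"
  have eq: "?g (\<phi> \<xi>) = frechet_derivative (\<lambda>\<upsilon>. l (\<phi> \<xi>) (\<psi> \<upsilon>)) (at \<upsilon>) k" if "\<xi> \<in> U" for \<xi>
    by (rule S2_diff_coordinates [symmetric]) (use assms that in auto)
  have "(\<lambda>\<xi>. ?g (sgn (\<phi> \<xi>))) differentiable (at \<xi>)"
    using differentiable_chain_at[OF assms(4) l12] by (simp add: o_def)
  then have D: "((\<lambda>\<xi>. ?g (sgn (\<phi> \<xi>))) has_derivative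
      frechet_derivative (\<lambda>\<xi>. ?g (sgn (\<phi> \<xi>))) (at \<xi>)) (at \<xi>)"
    by (simp add: frechet_derivative_works)
  have S: "sgn (\<phi> x) = \<phi> x" if "x \<in> U" for x
    using that assms(3) by (auto simp: sgn_div_norm image_subset_iff)
  have "((\<lambda>\<xi>. ?g (\<phi> \<xi>)) has_derivative
      frechet_derivative (\<lambda>\<xi>. ?g (sgn (\<phi> \<xi>))) (at \<xi>)) (at \<xi>)"
    by (rule has_derivative_transform_within_open[OF D assms(1,2)]) (simp add: S)
  then have "(\<lambda>\<xi>. ?g (\<phi> \<xi>)) differentiable (at \<xi>)"
    by (rule differentiableI)
  then have "frechet_derivative (\<lambda>\<xi>. ?g (\<phi> \<xi>)) (at \<xi>)
      = frechet_derivative (\<lambda>\<xi>. frechet_derivative (\<lambda>\<upsilon>. l (\<phi> \<xi>) (\<psi> \<upsilon>)) (at \<upsilon>) k) (at \<xi>)"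
    using eq by (rule frechet_derivative_transform_within_open[OF _ assms(1,2)])
  then show ?thesis
    using S2_diff_coordinates[OF assms(1-4), of ?g h] l12 by (simp add: mixed_diff_def)
qed

end

theory Submission
  imports Defs
begin

text \<open>Let \<open>F\<close> be the Euclidean metric and \<open>F'\<close> its pullback by the twist \<open>\<phi>\<close> of the ball,
  \<open>\<phi> x = R A x\<close> with \<open>A\<close> the rotation about the third axis by the angle \<open>\<tau> x\<^sub>3\<close>. Pulling back by a
  diffeomorphism onto a round ball keeps all the simplicity conditions, and the boundary distances
  are \<open>\<bar>y - z\<bar>\<close> and \<open>\<bar>\<phi> y - \<phi> z\<bar>\<close>; the second dominates the first as soon as \<open>R \<ge> 1 + \<tau>\<close>.
  At the pair of the two poles the form is positive. At a pair of antipodal points of the equator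
  the shear of \<open>\<phi>\<close> contributes \<open>(2 - \<tau>\<^sup>2) R / 4\<close> to the middle term, which makes the form negative
  when \<open>\<tau>\<^sup>2 > 2 R + 2 + 2 / R\<close>. The values \<open>\<tau> = 2 \<pi>\<close> and \<open>R = 5 + 2 \<surd>6\<close> satisfy both conditions.

  The sum of the two boundary distances satisfies the strict triangle inequality. If it came from a
  Finsler metric, a minimal geodesic starting at \<open>y\<close> and ending at \<open>z\<close> would therefore meet the
  sphere only at its end points, and the differential of the distance from \<open>z\<close> at \<open>y\<close> would be,
  up to sign, the tangential part of its initial covector. As the latter is a unit covector and
  its vector points inwards, the differential would determine the geodesic, and hence \<open>z\<close>. But at the north
  pole the points \<open>(1, 0, 0)\<close> and \<open>(- \<surd>3 / 2, 0, 1 / 2)\<close> have the same differential: since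
  \<open>\<phi>\<close> turns the plane \<open>x\<^sub>3 = 1 / 2\<close> by \<open>\<pi>\<close>, the two contributions of the second point are opposite,
  and the chosen \<open>R\<close> balances them.\<close>

section \<open>Calculus of smooth maps\<close>

text \<open>The excluded metric \<open>G\<close> is known only through its boundary distances, so
  the contradiction is drawn from minimizers of its induced distance, whose existence, regularity
  and uniqueness have to be established. The obstacle is the boundary: a variation must not leave
  the closed ball. The strict triangle inequality helps by keeping a minimizer in the open ball
  except at its ends; at the starting point the Euler-Lagrange equation is recovered by continuity.
  Position and momentum serve as unknowns, since the velocity of a C1 minimizer is not known to be
  differentiable, whereas the equation itself differentiates the momentum. A twist is suitable
  because it maps spheres to spheres, so that the image of the ball stays convex, and because at an
  antipodal pair of the equator the square of a single \<open>dd2\<close> does not see the shear.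
  Only the product of two differently twisted distances does, and there the shear enters with a
  negative square.\<close>

definition Cinf_on :: "'a::euclidean_space set \<Rightarrow> ('a \<Rightarrow> 'b::real_normed_vector) \<Rightarrow> bool" where
  "Cinf_on U f \<longleftrightarrow> (\<forall>k. Ck_on k U f)"

text \<open>Openness of \<open>U\<close> makes the derivative at a point of \<open>U\<close> depend
  only on values in \<open>U\<close>, so agreement passes from each order to the next.\<close>

lemma Ck_on_cong:
  assumes "open U" "\<And>x. x \<in> U \<Longrightarrow> f x = g x" "Ck_on k U f"
  shows "Ck_on k U g"
  using assms(2,3)
proof (induction k arbitrary: f g)
  case 0
  then show ?case by (simp cong: continuous_on_cong)
next
  case (Suc k)
  have D: "(g has_derivative frechet_derivative f (at x)) (at x)" if "x \<in> U" for x
  proof -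
    have "(f has_derivative frechet_derivative f (at x)) (at x)"
      using Suc.prems(2) that by (simp add: frechet_derivative_works)
    then show ?thesis
      using has_derivative_transform_within_open assms(1) that Suc.prems(1) by blast
  qed
  have E: "frechet_derivative g (at x) = frechet_derivative f (at x)" if "x \<in> U" for x
    using frechet_derivative_at[OF D[OF that]] by simp
  have "Ck_on k U (\<lambda>x. frechet_derivative g (at x) h)" for h
    by (rule Suc.IH[of "\<lambda>x. frechet_derivative f (at x) h"]) (use Suc.prems E in auto)
  then show ?case using D by (auto simp: differentiable_def)
qed

text \<open>Frees the recursion of \<open>Ck_on\<close> from \<open>frechet_derivative\<close>: by
  uniqueness of derivatives, any explicit formula \<open>D\<close> may take its place.\<close>

lemma Ck_on_SucI:
  assumes "open U" "\<And>x. x \<in> U \<Longrightarrow> (f has_derivative D x) (at x)" "\<And>h. Ck_on k U (\<lambda>x. D x h)"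
  shows "Ck_on (Suc k) U f"
proof -
  have "Ck_on k U (\<lambda>x. frechet_derivative f (at x) h)" for h
    by (rule Ck_on_cong[OF assms(1) _ assms(3)[of h]])
       (use frechet_derivative_at[OF assms(2)] in simp)
  then show ?thesis using assms(2) by (auto simp: differentiable_def)
qed

lemma Ck_on_SucD:
  assumes "Ck_on (Suc k) U f" "x \<in> U"
  shows "(f has_derivative frechet_derivative f (at x)) (at x)"
  using assms by (simp add: frechet_derivative_works)

lemma Ck_on_Suc_imp: "Ck_on (Suc k) U f \<Longrightarrow> Ck_on k U f"
proof (induction k arbitrary: f)
  case 0
  then show ?case
    by (auto intro!: continuous_at_imp_continuous_on differentiable_imp_continuous_within)
next
  case (Suc k)
  then show ?case by (metis Ck_on.simps(2))
qed

lemma Ck_on_const: "Ck_on k U (\<lambda>x. c)"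
  by (induction k arbitrary: c) auto

lemma Ck_on_subset: "Ck_on k U f \<Longrightarrow> V \<subseteq> U \<Longrightarrow> Ck_on k V f"
  by (induction k arbitrary: f) (auto intro: continuous_on_subset)

lemma Ck_on_bounded_linear:
  assumes "open U" "bounded_linear L" "Ck_on k U f"
  shows "Ck_on k U (\<lambda>x. L (f x))"
  using assms(3)
proof (induction k arbitrary: f)
  case 0
  then show ?case using bounded_linear.continuous_on[OF assms(2)] by auto
next
  case (Suc k)
  show ?case
  proof (rule Ck_on_SucI[OF assms(1)])
    show "((\<lambda>x. L (f x)) has_derivative (\<lambda>h. L (frechet_derivative f (at x) h))) (at x)" if "x \<in> U" for x
      by (rule bounded_linear.has_derivative[OF assms(2) Ck_on_SucD[OF Suc.prems that]])
    show "Ck_on k U (\<lambda>x. L (frechet_derivative f (at x) h))" for h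
      using Suc by auto
  qed
qed

lemma Ck_on_add:
  assumes "open U" "Ck_on k U f" "Ck_on k U g"
  shows "Ck_on k U (\<lambda>x. f x + g x)"
  using assms(2,3)
proof (induction k arbitrary: f g)
  case (Suc k)
  show ?case
  proof (rule Ck_on_SucI[OF assms(1)])
    show "((\<lambda>x. f x + g x) has_derivative
        (\<lambda>h. frechet_derivative f (at x) h + frechet_derivative g (at x) h)) (at x)" if "x \<in> U" for x
      by (rule has_derivative_add[OF Ck_on_SucD[OF Suc.prems(1) that] Ck_on_SucD[OF Suc.prems(2) that]])
    show "Ck_on k U (\<lambda>x. frechet_derivative f (at x) h + frechet_derivative g (at x) h)" for h
      using Suc by auto
  qed
qed (auto intro: continuous_on_add)

lemma Ck_on_sum:
  assumes "open U" "finite I" "\<And>i. i \<in> I \<Longrightarrow> Ck_on k U (f i)"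
  shows "Ck_on k U (\<lambda>x. \<Sum>i\<in>I. f i x)"
  using assms(2,3) by induction (auto intro: Ck_on_const Ck_on_add[OF assms(1)])

lemma Ck_on_bilinear:
  assumes "open U" "bounded_bilinear B" "Ck_on k U f" "Ck_on k U g"
  shows "Ck_on k U (\<lambda>x. B (f x) (g x))"
  using assms(3,4)
proof (induction k arbitrary: f g)
  case 0
  then show ?case using bounded_bilinear.continuous_on[OF assms(2)] by auto
next
  case (Suc k)
  have "Ck_on k U (\<lambda>x. B (f x) (frechet_derivative g (at x) h)
                     + B (frechet_derivative f (at x) h) (g x))" for h
    by (intro Ck_on_add[OF assms(1)] Suc.IH) (use Suc.prems Ck_on_Suc_imp in auto)
  with bounded_bilinear.FDERIV[OF assms(2) Ck_on_SucD[OF Suc.prems(1)] Ck_on_SucD[OF Suc.prems(2)]]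
  show ?case by (rule Ck_on_SucI[OF assms(1)])
qed

text \<open>The chain rule applies the derivative of \<open>g\<close> to a direction that moves with
  \<open>x\<close>, while \<open>Ck_on\<close> speaks of fixed directions. Expanding in the basis
  turns it into a sum of products to which the induction hypothesis applies.\<close>

lemma Ck_on_compose:
  fixes f :: "'a::euclidean_space \<Rightarrow> 'b::euclidean_space" and g :: "'b \<Rightarrow> 'c::real_normed_vector"
  assumes "open U" "open V" "Ck_on k V g" "Ck_on k U f" "\<And>x. x \<in> U \<Longrightarrow> f x \<in> V"
  shows "Ck_on k U (\<lambda>x. g (f x))"
  using assms(3,4,5)
proof (induction k arbitrary: f g)
  case 0
  then show ?case by (auto intro: continuous_on_compose2)
next
  case (Suc k)
  let ?D = "\<lambda>x h. frechet_derivative g (at (f x)) (frechet_derivative f (at x) h)"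
  have D: "((\<lambda>x. g (f x)) has_derivative ?D x) (at x)" if "x \<in> U" for x
    using has_derivative_compose[OF Ck_on_SucD[OF Suc.prems(2) that]]
      Ck_on_SucD[OF Suc.prems(1) Suc.prems(3)[OF that]] by auto
  have eq: "?D x h = (\<Sum>b\<in>Basis. (frechet_derivative f (at x) h \<bullet> b) *\<^sub>R
      frechet_derivative g (at (f x)) b)" if "x \<in> U" for x h
  proof -
    have "linear (frechet_derivative g (at (f x)))"
      using Suc.prems that by (simp add: linear_frechet_derivative)
    then show ?thesis
      by (subst euclidean_representation[of "frechet_derivative f (at x) h", symmetric])
         (simp only: linear_sum linear_scale)
  qed
  have "Ck_on k U (\<lambda>x. \<Sum>b\<in>Basis. (frechet_derivative f (at x) h \<bullet> b) *\<^sub>R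
      frechet_derivative g (at (f x)) b)" for h
  proof (intro Ck_on_sum Ck_on_bilinear[OF assms(1) bounded_bilinear_scaleR] assms(1))
    fix b :: 'b
    show "Ck_on k U (\<lambda>x. frechet_derivative f (at x) h \<bullet> b)"
      by (rule Ck_on_bounded_linear[OF assms(1) bounded_linear_inner_left]) (use Suc.prems in auto)
    show "Ck_on k U (\<lambda>x. frechet_derivative g (at (f x)) b)"
      by (rule Suc.IH) (use Suc.prems Ck_on_Suc_imp in auto)
  qed auto
  then have "Ck_on k U (\<lambda>x. ?D x h)" for h
    by (rule Ck_on_cong[OF assms(1), rotated]) (simp add: eq)
  with D show ?case by (rule Ck_on_SucI[OF assms(1)])
qed

lemma Cinf_on_cong:
  "open U \<Longrightarrow> (\<And>x. x \<in> U \<Longrightarrow> f x = g x) \<Longrightarrow> Cinf_on U f \<Longrightarrow> Cinf_on U g"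
  unfolding Cinf_on_def by (metis Ck_on_cong)

lemma Cinf_on_const [intro, simp]: "Cinf_on U (\<lambda>x. c)"
  unfolding Cinf_on_def by (rule allI) (rule Ck_on_const)

lemma Cinf_on_subset: "Cinf_on U f \<Longrightarrow> V \<subseteq> U \<Longrightarrow> Cinf_on V f"
  unfolding Cinf_on_def by (metis Ck_on_subset)

lemma Cinf_on_bounded_linear: "open U \<Longrightarrow> bounded_linear L \<Longrightarrow> Cinf_on U f \<Longrightarrow> Cinf_on U (\<lambda>x. L (f x))"
  unfolding Cinf_on_def by (simp add: Ck_on_bounded_linear)

lemma Cinf_on_add: "open U \<Longrightarrow> Cinf_on U f \<Longrightarrow> Cinf_on U g \<Longrightarrow> Cinf_on U (\<lambda>x. f x + g x)"
  unfolding Cinf_on_def by (simp add: Ck_on_add)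

lemma Cinf_on_minus: "open U \<Longrightarrow> Cinf_on U f \<Longrightarrow> Cinf_on U (\<lambda>x. - f x)"
  by (rule Cinf_on_bounded_linear[OF _ bounded_linear_minus[OF bounded_linear_ident]])

lemma Cinf_on_diff: "open U \<Longrightarrow> Cinf_on U f \<Longrightarrow> Cinf_on U g \<Longrightarrow> Cinf_on U (\<lambda>x. f x - g x)"
  using Cinf_on_add[of U f "\<lambda>x. - g x"] Cinf_on_minus[of U g] by simp

lemma Cinf_on_sum:
  "open U \<Longrightarrow> finite I \<Longrightarrow> (\<And>i. i \<in> I \<Longrightarrow> Cinf_on U (f i)) \<Longrightarrow> Cinf_on U (\<lambda>x. \<Sum>i\<in>I. f i x)"
  unfolding Cinf_on_def by (simp add: Ck_on_sum)

lemma Cinf_on_bilinear: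
  "open U \<Longrightarrow> bounded_bilinear B \<Longrightarrow> Cinf_on U f \<Longrightarrow> Cinf_on U g \<Longrightarrow> Cinf_on U (\<lambda>x. B (f x) (g x))"
  unfolding Cinf_on_def by (simp add: Ck_on_bilinear)

lemmas Cinf_on_scaleR = Cinf_on_bilinear[OF _ bounded_bilinear_scaleR]
lemmas Cinf_on_inner = Cinf_on_bilinear[OF _ bounded_bilinear_inner]

lemma Cinf_on_mult:
  fixes f g :: "'a::euclidean_space \<Rightarrow> real"
  shows "open U \<Longrightarrow> Cinf_on U f \<Longrightarrow> Cinf_on U g \<Longrightarrow> Cinf_on U (\<lambda>x. f x * g x)"
  by (rule Cinf_on_bilinear[OF _ bounded_bilinear_mult])

lemma Cinf_on_power:
  fixes f :: "'a::euclidean_space \<Rightarrow> real"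
  shows "open U \<Longrightarrow> Cinf_on U f \<Longrightarrow> Cinf_on U (\<lambda>x. f x ^ n)"
  by (induction n) (auto intro: Cinf_on_mult)

lemma Cinf_on_compose:
  fixes f :: "'a::euclidean_space \<Rightarrow> 'b::euclidean_space" and g :: "'b \<Rightarrow> 'c::real_normed_vector"
  assumes "open U" "open V" "Cinf_on V g" "Cinf_on U f" "\<And>x. x \<in> U \<Longrightarrow> f x \<in> V"
  shows "Cinf_on U (\<lambda>x. g (f x))"
  using assms Ck_on_compose unfolding Cinf_on_def by blast

lemma Cinf_on_continuous_on: "Cinf_on U f \<Longrightarrow> continuous_on U f"
  unfolding Cinf_on_def by (metis Ck_on.simps(1))

lemma Cinf_on_has_derivative:
  "Cinf_on U f \<Longrightarrow> x \<in> U \<Longrightarrow> (f has_derivative frechet_derivative f (at x)) (at x)"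
  unfolding Cinf_on_def using Ck_on_SucD by blast

lemma Cinf_on_frechet_derivative: "Cinf_on U f \<Longrightarrow> Cinf_on U (\<lambda>x. frechet_derivative f (at x) h)"
  unfolding Cinf_on_def by (metis Ck_on.simps(2))

lemma Cinf_on_linear:
  assumes "open U" "bounded_linear L"
  shows "Cinf_on U L"
  unfolding Cinf_on_def
proof
  fix k
  show "Ck_on k U L"
  proof (cases k)
    case 0
    then show ?thesis using assms by (simp add: linear_continuous_on)
  next
    case (Suc n)
    then show ?thesis
      using Ck_on_SucI[OF assms(1) bounded_linear_imp_has_derivative[OF assms(2)] Ck_on_const] by simp
  qed
qed

lemma Cinf_on_id: "open U \<Longrightarrow> Cinf_on U (\<lambda>x. x)"
  by (rule Cinf_on_linear[OF _ bounded_linear_ident])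

text \<open>The basis expansion of the chain rule again, now with base point and direction both
  depending on \<open>x\<close>; it gives joint smoothness of derivatives on the tangent
  bundle.\<close>

lemma Cinf_on_frechet_derivative_varying:
  fixes f :: "'a::euclidean_space \<Rightarrow> 'b::real_normed_vector" and g :: "'c::euclidean_space \<Rightarrow> 'a"
  assumes "open U" "open V" "Cinf_on V f" "Cinf_on U g" "Cinf_on U h" "\<And>x. x \<in> U \<Longrightarrow> g x \<in> V"
  shows "Cinf_on U (\<lambda>x. frechet_derivative f (at (g x)) (h x))"
proof -
  have eq: "(\<Sum>b\<in>Basis. (h x \<bullet> b) *\<^sub>R frechet_derivative f (at (g x)) b) =
      frechet_derivative f (at (g x)) (h x)" if "x \<in> U" for x
  proof -
    have "linear (frechet_derivative f (at (g x)))"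
      using Cinf_on_has_derivative[OF assms(3)] assms(6)[OF that] has_derivative_linear by blast
    then show ?thesis
      by (subst (2) euclidean_representation[of "h x", symmetric]) (simp only: linear_sum linear_scale)
  qed
  have "Cinf_on U (\<lambda>x. \<Sum>b\<in>Basis. (h x \<bullet> b) *\<^sub>R frechet_derivative f (at (g x)) b)"
    by (intro Cinf_on_sum Cinf_on_scaleR Cinf_on_bounded_linear[OF _ bounded_linear_inner_left]
        Cinf_on_compose[OF _ assms(2) Cinf_on_frechet_derivative]) (use assms in auto)
  from Cinf_on_cong[OF assms(1) eq this] show ?thesis .
qed

section \<open>Smooth functions of one real variable\<close>

lemma Ck_on_real_SucI:
  fixes f :: "real \<Rightarrow> 'b::real_normed_vector"
  assumes "open U" "\<And>x. x \<in> U \<Longrightarrow> (f has_vector_derivative f' x) (at x)" "Ck_on k U f'"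
  shows "Ck_on (Suc k) U f"
proof (rule Ck_on_SucI[OF assms(1), where D = "\<lambda>x h. h *\<^sub>R f' x"])
  show "(f has_derivative (\<lambda>h. h *\<^sub>R f' x)) (at x)" if "x \<in> U" for x
    using assms(2)[OF that] by (simp add: has_vector_derivative_def)
  show "Ck_on k U (\<lambda>x. h *\<^sub>R f' x)" for h
    by (rule Ck_on_bounded_linear[OF assms(1) bounded_linear_scaleR_right assms(3)])
qed

lemma Cinf_on_vector_derivative:
  fixes f :: "real \<Rightarrow> 'b::real_normed_vector"
  assumes "open U" "Cinf_on U f"
  shows "Cinf_on U (\<lambda>x. vector_derivative f (at x))"
    and "\<And>x. x \<in> U \<Longrightarrow> (f has_vector_derivative vector_derivative f (at x)) (at x)"
proof -
  show *: "(f has_vector_derivative vector_derivative f (at x)) (at x)" if "x \<in> U" for x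
    using Cinf_on_has_derivative[OF assms(2) that] differentiableI_vector
    by (metis differentiableI vector_derivative_works)
  have "frechet_derivative f (at x) 1 = vector_derivative f (at x)" if "x \<in> U" for x
    using frechet_derivative_at[OF *[OF that, unfolded has_vector_derivative_def]] by (metis scaleR_one)
  from Cinf_on_cong[OF assms(1) this Cinf_on_frechet_derivative[OF assms(2)]]
  show "Cinf_on U (\<lambda>x. vector_derivative f (at x))" .
qed

lemma Cinf_on_sin_cos:
  fixes U :: "real set"
  assumes "open U"
  shows "Cinf_on U sin" "Cinf_on U cos"
proof -
  have "Ck_on k U sin \<and> Ck_on k U cos" for k
  proof (induction k)
    case (Suc k)
    have "Ck_on (Suc k) U sin"
      by (rule Ck_on_real_SucI[OF assms, where f' = cos])
         (use Suc DERIV_sin in \<open>auto simp: has_real_derivative_iff_has_vector_derivative[symmetric]\<close>)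
    moreover have "Ck_on (Suc k) U cos"
      by (rule Ck_on_real_SucI[OF assms, where f' = "\<lambda>x. - sin x"])
         (use Suc DERIV_cos Ck_on_bounded_linear[OF assms bounded_linear_minus[OF bounded_linear_ident]]
          in \<open>auto simp: has_real_derivative_iff_has_vector_derivative[symmetric]\<close>)
    ultimately show ?case by simp
  qed (auto intro: continuous_intros)
  then show "Cinf_on U sin" "Cinf_on U cos" by (auto simp: Cinf_on_def)
qed

text \<open>The derivative is a polynomial in the function itself, so the induction hypothesis
  suffices for the next order; the square root is treated alike, its derivative being expressed by
  \<open>inverse\<close> and \<open>sqrt\<close>.\<close>

lemma Cinf_on_inverse_real: "Cinf_on (- {0::real}) inverse"
  unfolding Cinf_on_def
proof
  have o: "open (- {0::real})" by auto
  fix k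
  show "Ck_on k (- {0::real}) inverse"
  proof (induction k)
    case (Suc k)
    show ?case
    proof (rule Ck_on_real_SucI[OF o, where f' = "\<lambda>x. - (inverse x * inverse x)"])
      fix x :: real assume "x \<in> - {0}"
      then show "(inverse has_vector_derivative - (inverse x * inverse x)) (at x)"
        using DERIV_inverse[of x UNIV]
        by (simp add: has_real_derivative_iff_has_vector_derivative[symmetric] power2_eq_square)
    next
      show "Ck_on k (- {0}) (\<lambda>x::real. - (inverse x * inverse x))"
        by (rule Ck_on_bounded_linear[OF o bounded_linear_minus[OF bounded_linear_ident]])
           (rule Ck_on_bilinear[OF o bounded_bilinear_mult Suc.IH Suc.IH])
    qed
  qed (auto intro: continuous_intros)
qed

lemma Cinf_on_sqrt: "Cinf_on {0<..} sqrt"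
  unfolding Cinf_on_def
proof
  have o: "open {0::real<..}" by auto
  fix k
  show "Ck_on k {0<..} sqrt"
  proof (induction k)
    case (Suc k)
    show ?case
    proof (rule Ck_on_real_SucI[OF o, where f' = "\<lambda>x. inverse (sqrt x) / 2"])
      fix x :: real assume "x \<in> {0<..}"
      then show "(sqrt has_vector_derivative inverse (sqrt x) / 2) (at x)"
        using DERIV_real_sqrt[of x] by (simp add: has_real_derivative_iff_has_vector_derivative[symmetric])
    next
      have "Ck_on k {0<..} (\<lambda>x. inverse (sqrt x))"
        by (rule Ck_on_compose[OF o _ _ Suc.IH, of "- {0}"])
           (use Cinf_on_inverse_real in \<open>auto simp: Cinf_on_def\<close>)
      from Ck_on_bounded_linear[OF o bounded_linear_divide this]
      show "Ck_on k {0<..} (\<lambda>x. inverse (sqrt x) / 2)" .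
    qed
  qed (auto intro: continuous_intros)
qed

lemma smooth_map_on_iff_Cinf:
  "smooth_map_on S f \<longleftrightarrow> (\<exists>U g. open U \<and> S \<subseteq> U \<and> Cinf_on U g \<and> (\<forall>x\<in>S. f x = g x))"
  by (simp add: smooth_map_on_def Cinf_on_def)

lemma smooth_map_onI: "open U \<Longrightarrow> S \<subseteq> U \<Longrightarrow> Cinf_on U g \<Longrightarrow> (\<And>x. x \<in> S \<Longrightarrow> f x = g x) \<Longrightarrow> smooth_map_on S f"
  unfolding smooth_map_on_iff_Cinf by blast

subsection \<open>Symmetry of second derivatives\<close>

text \<open>The second difference of \<open>f\<close> over the parallelogram spanned by
  \<open>t h\<close> and \<open>t k\<close> is symmetric in \<open>h\<close> and \<open>k\<close>,
  and two mean value steps express it as \<open>t^2\<close> times a value of \<open>D2\<close> near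
  \<open>x\<close>. Continuity of \<open>D2\<close> at \<open>x\<close> forces both orders to the
  same limit.\<close>

lemma second_derivative_symmetric_real:
  fixes f :: "'a::real_normed_vector \<Rightarrow> real"
  assumes "open U" "x \<in> U"
    and f: "\<And>y. y \<in> U \<Longrightarrow> (f has_derivative D y) (at y)"
    and D: "\<And>y v. y \<in> U \<Longrightarrow> ((\<lambda>y. D y v) has_derivative D2 y v) (at y)"
    and cont: "\<And>v w. isCont (\<lambda>y. D2 y v w) x"
  shows "D2 x h k = D2 x k h"
proof -
  have approx: "\<exists>d>0. \<forall>t. 0 < t \<and> t < d \<longrightarrow>
     \<bar>(f (x + t *\<^sub>R h + t *\<^sub>R k) - f (x + t *\<^sub>R h) - f (x + t *\<^sub>R k) + f x) / t^2 - D2 x h k\<bar> < e"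
    if e: "e > 0" for e h k
  proof -
    obtain r where r: "r > 0" "\<And>y. dist y x < r \<Longrightarrow> y \<in> U"
      using assms(1,2) unfolding open_dist by blast
    obtain s where s: "s > 0" "\<And>y. dist y x < s \<Longrightarrow> \<bar>D2 y h k - D2 x h k\<bar> < e"
      using cont[of h k] e unfolding continuous_at_eps_delta by (metis dist_real_def)
    define N where "N = norm h + norm k + 1"
    have N: "N > 0" by (simp add: N_def add_nonneg_pos)
    define d where "d = min r s / N"
    have d: "d > 0" using r s N by (simp add: d_def)
    have close: "dist (x + a *\<^sub>R h + b *\<^sub>R k) x < min r s"
      if "0 \<le> a" "a \<le> t" "0 \<le> b" "b \<le> t" "t < d" for a b t
    proof -
      have "norm (a *\<^sub>R h + b *\<^sub>R k) \<le> a * norm h + b * norm k"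
        using that by (metis abs_of_nonneg norm_scaleR norm_triangle_ineq)
      also have "\<dots> \<le> t * norm h + t * norm k" using that by (intro add_mono mult_right_mono) auto
      also have "\<dots> \<le> t * N" using that by (simp add: N_def algebra_simps)
      also have "\<dots> < d * N" using that N by simp
      also have "\<dots> = min r s" using N by (simp add: d_def)
      finally show ?thesis by (simp add: dist_norm add.assoc)
    qed
    show ?thesis
    proof (intro exI[of _ d] conjI allI impI d)
      fix t :: real assume t: "0 < t \<and> t < d"
      let ?g = "\<lambda>s. f (x + s *\<^sub>R h + t *\<^sub>R k) - f (x + s *\<^sub>R h)"
      have g: "(?g has_real_derivative D (x + s *\<^sub>R h + t *\<^sub>R k) h - D (x + s *\<^sub>R h) h) (at s)"
        if "0 \<le> s" "s \<le> t" for s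
      proof -
        have U: "x + s *\<^sub>R h + t *\<^sub>R k \<in> U" "x + s *\<^sub>R h \<in> U"
          using close[of s t t] close[of s t 0] that t r(2) by auto
        have 1: "((\<lambda>s. x + s *\<^sub>R h + t *\<^sub>R k) has_derivative (\<lambda>a. a *\<^sub>R h)) (at s)"
          by (auto intro!: derivative_eq_intros)
        have 2: "((\<lambda>s. x + s *\<^sub>R h) has_derivative (\<lambda>a. a *\<^sub>R h)) (at s)"
          by (auto intro!: derivative_eq_intros)
        have "(?g has_derivative (\<lambda>a. D (x + s *\<^sub>R h + t *\<^sub>R k) (a *\<^sub>R h) - D (x + s *\<^sub>R h) (a *\<^sub>R h))) (at s)"
          by (intro has_derivative_diff has_derivative_compose[OF 1 f[OF U(1)]]
              has_derivative_compose[OF 2 f[OF U(2)]])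
        moreover have "D y (a *\<^sub>R h) = D y h * a" if "y \<in> U" for y a
          using has_derivative_linear[OF f[OF that]] by (simp add: linear_scale)
        then have "(\<lambda>a. D (x + s *\<^sub>R h + t *\<^sub>R k) (a *\<^sub>R h) - D (x + s *\<^sub>R h) (a *\<^sub>R h))
            = times (D (x + s *\<^sub>R h + t *\<^sub>R k) h - D (x + s *\<^sub>R h) h)"
          by (intro ext) (simp only: U left_diff_distrib)
        ultimately show ?thesis unfolding has_field_derivative_def by simp
      qed
      from MVT2[of 0 t ?g, OF _ g] t obtain \<xi> where \<xi>: "0 < \<xi>" "\<xi> < t"
        "?g t - ?g 0 = t * (D (x + \<xi> *\<^sub>R h + t *\<^sub>R k) h - D (x + \<xi> *\<^sub>R h) h)" by auto
      let ?p = "\<lambda>s. D (x + \<xi> *\<^sub>R h + s *\<^sub>R k) h"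
      have p: "(?p has_real_derivative D2 (x + \<xi> *\<^sub>R h + s *\<^sub>R k) h k) (at s)"
        if "0 \<le> s" "s \<le> t" for s
      proof -
        have U: "x + \<xi> *\<^sub>R h + s *\<^sub>R k \<in> U" using close[of \<xi> t s] that t \<xi> r(2) by auto
        have 1: "((\<lambda>s. x + \<xi> *\<^sub>R h + s *\<^sub>R k) has_derivative (\<lambda>a. a *\<^sub>R k)) (at s)"
          by (auto intro!: derivative_eq_intros)
        have "(?p has_derivative (\<lambda>a. D2 (x + \<xi> *\<^sub>R h + s *\<^sub>R k) h (a *\<^sub>R k))) (at s)"
          by (rule has_derivative_compose[OF 1 D[OF U]])
        moreover have "(\<lambda>a. D2 (x + \<xi> *\<^sub>R h + s *\<^sub>R k) h (a *\<^sub>R k)) = times (D2 (x + \<xi> *\<^sub>R h + s *\<^sub>R k) h k)"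
          using has_derivative_linear[OF D[OF U]] by (intro ext) (simp add: linear_scale)
        ultimately show ?thesis unfolding has_field_derivative_def by simp
      qed
      from MVT2[of 0 t ?p, OF _ p] t obtain \<eta> where \<eta>: "0 < \<eta>" "\<eta> < t"
        "?p t - ?p 0 = t * D2 (x + \<xi> *\<^sub>R h + \<eta> *\<^sub>R k) h k" by auto
      have "f (x + t *\<^sub>R h + t *\<^sub>R k) - f (x + t *\<^sub>R h) - f (x + t *\<^sub>R k) + f x
          = t^2 * D2 (x + \<xi> *\<^sub>R h + \<eta> *\<^sub>R k) h k"
        using \<xi>(3) \<eta>(3) by (simp add: power2_eq_square algebra_simps)
      moreover have "\<bar>D2 (x + \<xi> *\<^sub>R h + \<eta> *\<^sub>R k) h k - D2 x h k\<bar> < e"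
        using s(2) close[of \<xi> t \<eta>] \<xi> \<eta> t by auto
      ultimately show "\<bar>(f (x + t *\<^sub>R h + t *\<^sub>R k) - f (x + t *\<^sub>R h) - f (x + t *\<^sub>R k) + f x) / t^2
          - D2 x h k\<bar> < e" using t by simp
    qed
  qed
  show ?thesis
  proof (rule ccontr)
    assume ne: "D2 x h k \<noteq> D2 x k h"
    define e where "e = \<bar>D2 x h k - D2 x k h\<bar> / 2"
    have e: "e > 0" using ne by (simp add: e_def)
    obtain d1 where d1: "d1 > 0" "\<And>t. 0 < t \<and> t < d1 \<Longrightarrow>
      \<bar>(f (x + t *\<^sub>R h + t *\<^sub>R k) - f (x + t *\<^sub>R h) - f (x + t *\<^sub>R k) + f x) / t^2 - D2 x h k\<bar> < e"
      using approx[OF e, of h k] by blast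
    obtain d2 where d2: "d2 > 0" "\<And>t. 0 < t \<and> t < d2 \<Longrightarrow>
      \<bar>(f (x + t *\<^sub>R k + t *\<^sub>R h) - f (x + t *\<^sub>R k) - f (x + t *\<^sub>R h) + f x) / t^2 - D2 x k h\<bar> < e"
      using approx[OF e, of k h] by blast
    define t where "t = min d1 d2 / 2"
    have t: "0 < t \<and> t < d1" "0 < t \<and> t < d2" using d1(1) d2(1) by (auto simp: t_def)
    have eq: "f (x + t *\<^sub>R k + t *\<^sub>R h) - f (x + t *\<^sub>R k) - f (x + t *\<^sub>R h) + f x
       = f (x + t *\<^sub>R h + t *\<^sub>R k) - f (x + t *\<^sub>R h) - f (x + t *\<^sub>R k) + f x"
      by (simp add: add_ac)
    have "False" if "\<bar>q - a\<bar> < \<bar>a - b\<bar> / 2" "\<bar>q - b\<bar> < \<bar>a - b\<bar> / 2" for q a b :: real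
      using that by (simp add: abs_if split: if_splits)
    from this[OF d1(2)[OF t(1), unfolded e_def] d2(2)[OF t(2), unfolded eq e_def]] show False .
  qed
qed

lemma Cinf_on_second_derivative_symmetric:
  fixes f :: "'a::euclidean_space \<Rightarrow> 'b::euclidean_space"
  assumes "open U" "Cinf_on U f" "x \<in> U"
  shows "frechet_derivative (\<lambda>y. frechet_derivative f (at y) h) (at x) k
       = frechet_derivative (\<lambda>y. frechet_derivative f (at y) k) (at x) h"
proof (rule euclidean_eqI)
  fix b :: 'b assume "b \<in> Basis"
  let ?D = "\<lambda>y h. frechet_derivative f (at y) h"
  let ?D2 = "\<lambda>y h k. frechet_derivative (\<lambda>y. ?D y h) (at y) k"
  note C = Cinf_on_frechet_derivative
  have "?D2 x h k \<bullet> b = ?D2 x k h \<bullet> b"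
  proof (rule second_derivative_symmetric_real[OF assms(1,3),
      where f = "\<lambda>y. f y \<bullet> b" and D = "\<lambda>y h. ?D y h \<bullet> b" and ?D2.0 = "\<lambda>y h k. ?D2 y h k \<bullet> b"])
    show "((\<lambda>y. f y \<bullet> b) has_derivative (\<lambda>h. ?D y h \<bullet> b)) (at y)" if "y \<in> U" for y
      by (intro has_derivative_inner_left Cinf_on_has_derivative[OF assms(2) that])
    show "((\<lambda>y. ?D y v \<bullet> b) has_derivative (\<lambda>h. ?D2 y v h \<bullet> b)) (at y)" if "y \<in> U" for y v
      by (intro has_derivative_inner_left Cinf_on_has_derivative[OF C[OF assms(2)] that])
    show "isCont (\<lambda>y. ?D2 y v w \<bullet> b) x" for v w
      using Cinf_on_continuous_on[OF C[OF C[OF assms(2)]]] assms(1,3)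
      by (intro continuous_intros) (simp add: continuous_on_eq_continuous_at)
  qed
  then show "?D2 x h k \<bullet> b = ?D2 x k h \<bullet> b" .
qed

subsection \<open>A smooth step function\<close>

text \<open>The factor \<open>inverse t ^ n\<close> makes the family closed under differentiation up
  to linear combinations, so smoothness is a single induction over the order with \<open>n\<close>
  arbitrary.\<close>

definition flat_exp :: "nat \<Rightarrow> real \<Rightarrow> real" where
  "flat_exp n t = (if t \<le> 0 then 0 else exp (- inverse t) * inverse t ^ n)"

lemma flat_exp_nonneg: "flat_exp n t \<ge> 0"
  by (simp add: flat_exp_def)

lemma flat_exp_tendsto_0: "(flat_exp n \<longlongrightarrow> 0) (at 0)"
proof -
  have "((\<lambda>t. (inverse t) ^ n / exp (inverse t)) \<longlongrightarrow> 0) (at_right (0::real))"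
    by (rule filterlim_compose[OF tendsto_power_div_exp_0 filterlim_inverse_at_top_right])
  then have r: "(flat_exp n \<longlongrightarrow> 0) (at_right 0)"
    by (rule Lim_transform_eventually)
       (auto simp: eventually_at_filter flat_exp_def exp_minus divide_inverse mult.commute)
  have l: "(flat_exp n \<longlongrightarrow> 0) (at_left 0)"
    by (rule tendsto_eventually) (auto simp: eventually_at_filter flat_exp_def)
  from filterlim_split_at[OF l r] show ?thesis .
qed

lemma flat_exp_has_derivative:
  "(flat_exp n has_real_derivative flat_exp (n + 2) t - real n * flat_exp (n + 1) t) (at t)"
proof (cases t "0::real" rule: linorder_cases)
  case less
  have "((\<lambda>_. 0) has_real_derivative flat_exp (n + 2) t - real n * flat_exp (n + 1) t) (at t)"
    using less by (simp add: flat_exp_def)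
  then show ?thesis
    by (rule has_field_derivative_transform_within[where d = "- t"]) (use less in \<open>auto simp: flat_exp_def dist_real_def\<close>)
next
  case equal
  \<comment> \<open>At 0 the difference quotient of \<open>flat_exp n\<close> is
    \<open>flat_exp (Suc n)\<close>, which tends to 0.\<close>
  have "((\<lambda>h. (flat_exp n (0 + h) - flat_exp n 0) / h) \<longlongrightarrow> 0) (at 0)"
  proof (rule Lim_transform_eventually[OF flat_exp_tendsto_0[of "Suc n"]])
    show "\<forall>\<^sub>F x in at 0. flat_exp (Suc n) x = (flat_exp n (0 + x) - flat_exp n 0) / x"
      by (auto simp: eventually_at_filter flat_exp_def divide_inverse)
  qed
  then show ?thesis using equal by (simp add: DERIV_def flat_exp_def)
next
  case greater
  have "((\<lambda>t. exp (- inverse t) * inverse t ^ n) has_real_derivative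
      flat_exp (n + 2) t - real n * flat_exp (n + 1) t) (at t)"
  proof -
    have "((\<lambda>t. exp (- inverse t) * inverse t ^ n) has_real_derivative
        exp (- inverse t) * (inverse t)\<^sup>2 * inverse t ^ n
        - exp (- inverse t) * (real n * inverse t ^ (n - 1) * (inverse t)\<^sup>2)) (at t)"
      using greater by (auto intro!: derivative_eq_intros simp: power2_eq_square)
    moreover have "exp (- inverse t) * (inverse t)\<^sup>2 * inverse t ^ n
        - exp (- inverse t) * (real n * inverse t ^ (n - 1) * (inverse t)\<^sup>2)
        = flat_exp (n + 2) t - real n * flat_exp (n + 1) t"
      using greater by (cases n) (auto simp: flat_exp_def power_add power2_eq_square)
    ultimately show ?thesis by simp
  qed
  then show ?thesis
    by (rule has_field_derivative_transform_within[where d = t]) (use greater in \<open>auto simp: flat_exp_def dist_real_def\<close>)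
qed

lemma Cinf_on_flat_exp: "Cinf_on UNIV (flat_exp n)"
  unfolding Cinf_on_def
proof
  fix k
  show "Ck_on k UNIV (flat_exp n)"
  proof (induction k arbitrary: n)
    case 0
    show ?case using flat_exp_has_derivative
      by (auto intro!: continuous_at_imp_continuous_on DERIV_isCont)
  next
    case (Suc k)
    show ?case
    proof (rule Ck_on_real_SucI)
      show "(flat_exp n has_vector_derivative flat_exp (n + 2) t + (- real n) * flat_exp (n + 1) t) (at t)" for t
        using flat_exp_has_derivative[of n t]
        by (simp add: has_real_derivative_iff_has_vector_derivative[symmetric])
      show "Ck_on k UNIV (\<lambda>t. flat_exp (n + 2) t + (- real n) * flat_exp (n + 1) t)"
        by (intro Ck_on_add Ck_on_bounded_linear[OF _ bounded_linear_mult_right] Suc.IH) auto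
    qed auto
  qed
qed

text \<open>The quotient of \<open>g t\<close> by \<open>g t + g (1 - t)\<close>: the denominator is
  positive because \<open>t\<close> and \<open>1 - t\<close> are never both nonpositive. The
  derivative is exported for use in a change of variables.\<close>

lemma smooth_step:
  obtains \<theta> \<theta>' :: "real \<Rightarrow> real" where
    "Cinf_on UNIV \<theta>" "\<And>t. (\<theta> has_real_derivative \<theta>' t) (at t)" "\<And>t. \<theta>' t \<ge> 0" "continuous_on UNIV \<theta>'"
    "\<And>t. t \<le> 0 \<Longrightarrow> \<theta> t = 0" "\<And>t. t \<ge> 1 \<Longrightarrow> \<theta> t = 1" "\<And>t. 0 \<le> \<theta> t" "\<And>t. \<theta> t \<le> 1"
proof -
  define g where "g = flat_exp 0"
  define q where "q t = g t + g (1 - t)" for t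
  define \<theta> where "\<theta> t = g t * inverse (q t)" for t
  define \<theta>' where "\<theta>' t = (flat_exp 2 t * q t - g t * (flat_exp 2 t - flat_exp 2 (1 - t))) / (q t)\<^sup>2" for t
  have g0: "g t \<ge> 0" "flat_exp 2 t \<ge> 0" for t by (auto simp: g_def flat_exp_nonneg)
  have gpos: "t > 0 \<Longrightarrow> g t > 0" for t by (simp add: g_def flat_exp_def)
  have q: "q t > 0" for t
    using gpos[of t] gpos[of "1 - t"] g0(1)[of t] g0(1)[of "1 - t"] unfolding q_def
    by (cases "t > 0") (auto intro: add_pos_nonneg add_nonneg_pos)
  have g': "(g has_real_derivative flat_exp 2 t) (at t)" for t
    using flat_exp_has_derivative[of 0 t] by (simp add: g_def numeral_2_eq_2)
  have D: "(\<theta> has_real_derivative \<theta>' t) (at t)" for t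
  proof -
    have 1: "((\<lambda>t. g (1 - t)) has_real_derivative flat_exp 2 (1 - t) * (- 1)) (at t)"
      by (rule DERIV_chain2[OF g']) (auto intro!: derivative_eq_intros)
    have 2: "(q has_real_derivative flat_exp 2 t + flat_exp 2 (1 - t) * (- 1)) (at t)"
      unfolding q_def by (intro DERIV_add g' 1)
    have "((\<lambda>t. g t / q t) has_real_derivative \<theta>' t) (at t)"
      unfolding \<theta>'_def using DERIV_divide[OF g' 2] q[of t] by (simp add: power2_eq_square)
    then show ?thesis by (simp add: \<theta>_def[abs_def] divide_inverse)
  qed
  have cg: "Cinf_on UNIV g" "Cinf_on UNIV (\<lambda>t. g (1 - t))"
    unfolding g_def
    by (rule Cinf_on_flat_exp, rule Cinf_on_compose[OF _ _ Cinf_on_flat_exp])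
       (auto intro!: Cinf_on_diff Cinf_on_id)
  have cq: "Cinf_on UNIV q" unfolding q_def by (intro Cinf_on_add cg) auto
  have "Cinf_on UNIV \<theta>"
    unfolding \<theta>_def
    by (intro Cinf_on_mult cg Cinf_on_compose[OF _ _ Cinf_on_inverse_real cq])
       (use q in \<open>auto simp: less_le\<close>)
  moreover have "\<theta>' t \<ge> 0" for t
  proof -
    have "flat_exp 2 t * q t - g t * (flat_exp 2 t - flat_exp 2 (1 - t))
        = flat_exp 2 t * g (1 - t) + g t * flat_exp 2 (1 - t)"
      by (simp add: q_def algebra_simps)
    then show ?thesis unfolding \<theta>'_def by (simp add: g0)
  qed
  moreover have "continuous_on UNIV \<theta>'"
  proof -
    have f: "continuous_on UNIV (flat_exp n)" for n by (rule Cinf_on_continuous_on[OF Cinf_on_flat_exp])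
    have "continuous_on UNIV (\<lambda>t. flat_exp 2 (1 - t))"
      by (rule continuous_on_compose2[OF f]) (auto intro: continuous_intros)
    then show ?thesis unfolding \<theta>'_def using q
      by (intro continuous_intros f Cinf_on_continuous_on[OF cq] Cinf_on_continuous_on[OF cg(1)])
         (auto simp: less_le)
  qed
  moreover have "\<theta> t = 0" if "t \<le> 0" for t using that by (simp add: \<theta>_def g_def flat_exp_def)
  moreover have "\<theta> t = 1" if "t \<ge> 1" for t
    using that q[of t] by (simp add: \<theta>_def q_def) (simp add: g_def flat_exp_def)
  moreover have "0 \<le> \<theta> t" "\<theta> t \<le> 1" for t
    using q[of t] g0(1)[of t] g0(1)[of "1 - t"] unfolding \<theta>_def q_def
    by (auto simp: divide_inverse[symmetric])
  ultimately show ?thesis using D that by blast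
qed

text \<open>The sets of interest, a ball times a sphere or a shell, are not convex. Hence the mean
  value inequality is applied on small balls only, and compactness merges the local constants into
  one.\<close>

lemma Cinf_on_compact_lipschitz:
  fixes f :: "'a::euclidean_space \<Rightarrow> 'b::real_normed_vector"
  assumes "open U" "Cinf_on U f" "compact K" "K \<subseteq> U"
  obtains L where "L \<ge> 0" "\<And>p q. p \<in> K \<Longrightarrow> q \<in> K \<Longrightarrow> norm (f p - f q) \<le> L * norm (p - q)"
proof -
  have "local_lipschitz {0::real} K (\<lambda>_. f)"
  proof (rule local_lipschitzI)
    fix p assume "p \<in> K"
    then obtain r where r: "r > 0" "cball p r \<subseteq> U"
      using assms(1,4) open_contains_cball by blast
    have "\<exists>B. \<forall>q\<in>cball p r. norm (frechet_derivative f (at q) b) \<le> B" for b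
    proof -
      have "continuous_on (cball p r) (\<lambda>q. frechet_derivative f (at q) b)"
        using Cinf_on_continuous_on[OF Cinf_on_frechet_derivative[OF assms(2)]] r(2)
        by (rule continuous_on_subset)
      from compact_imp_bounded[OF compact_continuous_image[OF this compact_cball]]
      show ?thesis unfolding bounded_iff by blast
    qed
    then obtain B where B: "\<And>b q. q \<in> cball p r \<Longrightarrow> norm (frechet_derivative f (at q) b) \<le> B b"
      by metis
    define L where "L = (\<Sum>b\<in>(Basis::'a set). B b)"
    have on: "onorm (frechet_derivative f (at q)) \<le> L" if q: "q \<in> cball p r" for q
    proof (rule onorm_le)
      fix h :: 'a
      have lin: "linear (frechet_derivative f (at q))"
        using Cinf_on_has_derivative[OF assms(2)] r(2) q has_derivative_linear by blast
      have "frechet_derivative f (at q) h = (\<Sum>b\<in>Basis. (h \<bullet> b) *\<^sub>R frechet_derivative f (at q) b)"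
        by (subst euclidean_representation[of h, symmetric]) (simp only: linear_sum[OF lin] linear_scale[OF lin])
      also have "norm \<dots> \<le> (\<Sum>b\<in>Basis. norm h * B b)"
      proof (rule sum_norm_le)
        fix b :: 'a assume "b \<in> Basis"
        then show "norm ((h \<bullet> b) *\<^sub>R frechet_derivative f (at q) b) \<le> norm h * B b"
          unfolding norm_scaleR using B[OF q] by (intro mult_mono) (auto simp: Basis_le_norm)
      qed
      finally show "norm (frechet_derivative f (at q) h) \<le> L * norm h"
        by (simp add: L_def sum_distrib_left mult.commute)
    qed
    have "L-lipschitz_on (cball p r) f"
    proof (rule lipschitz_onI)
      have "0 \<le> onorm (frechet_derivative f (at p))"
        by (rule onorm_pos_le[OF has_derivative_bounded_linear[OF Cinf_on_has_derivative[OF assms(2)]]])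
           (use r in auto)
      then show "0 \<le> L" using on[of p] r(1) by simp
      fix x y assume xy: "x \<in> cball p r" "y \<in> cball p r"
      have "norm (f x - f y) \<le> L * norm (x - y)"
        by (rule differentiable_bound[OF convex_cball _ on xy])
           (use Cinf_on_has_derivative[OF assms(2)] r(2) has_derivative_at_withinI in blast)
      then show "dist (f x) (f y) \<le> L * dist x y" by (simp add: dist_norm)
    qed
    then have "\<forall>t\<in>cball t r \<inter> {0::real}. L-lipschitz_on (cball p r \<inter> K) f" for t
      using lipschitz_on_subset by blast
    then show "\<exists>u>0. \<exists>L. \<forall>t\<in>cball t u \<inter> {0::real}. L-lipschitz_on (cball p u \<inter> K) f" for t
      using r(1) by blast
  qed
  from local_lipschitz_compact_implies_lipschitz[OF this assms(3) compact_sing] obtain L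
    where "\<And>t. t \<in> {0::real} \<Longrightarrow> L-lipschitz_on K f" by auto
  then have "L-lipschitz_on K f" by auto
  then show ?thesis using that[of L] by (auto simp: lipschitz_on_def dist_norm)
qed

section \<open>Finsler metrics on the ball\<close>

text \<open>\<open>G\<close> is meaningful only over the closed ball and need not be smooth on the
  zero section. The extension \<open>g\<close> on the open set \<open>U\<close> provides two-sided
  derivatives at boundary points; all differential quantities below are formed from it.\<close>

locale Finsler_ball =
  fixes G :: metric and g :: "(real^3) \<times> (real^3) \<Rightarrow> real" and U :: "((real^3) \<times> (real^3)) set"
  assumes norm: "\<And>x. x \<in> Ball3 \<Longrightarrow> is_norm (G x)"
    and U: "open U" "slit_TB \<subseteq> U" and g: "Cinf_on U g"
    and Gg: "\<And>x v. x \<in> Ball3 \<Longrightarrow> v \<noteq> 0 \<Longrightarrow> G x v = g (x, v)"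
    and pos: "\<And>x w u. x \<in> Ball3 \<Longrightarrow> w \<noteq> 0 \<Longrightarrow> u \<noteq> 0 \<Longrightarrow> fundamental_tensor G x w u u > 0"
begin

definition "e p = (g p)\<^sup>2 / 2"
definition "De p h = frechet_derivative e (at p) h"
definition "D2e p h k = frechet_derivative (\<lambda>q. De q h) (at p) k"
text \<open>\<open>qm\<close> is the momentum (Legendre transform)
  \<open>\<partial>e/\<partial>v\<close> and \<open>rm\<close> the force
  \<open>\<partial>e/\<partial>x\<close>, both as vectors; the Euler-Lagrange equation says that the
  derivative of \<open>qm\<close> along a curve is \<open>rm\<close>.\<close>

definition "qm p = (\<Sum>b\<in>Basis. De p (0, b) *\<^sub>R b)"
definition "rm p = (\<Sum>b\<in>Basis. De p (b, 0) *\<^sub>R b)"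

lemma in_U: "x \<in> Ball3 \<Longrightarrow> v \<noteq> 0 \<Longrightarrow> (x, v) \<in> U"
  using U(2) by (auto simp: slit_TB_def)

lemma G_nonneg: "x \<in> Ball3 \<Longrightarrow> 0 \<le> G x v"
  and G_eq_0: "x \<in> Ball3 \<Longrightarrow> G x v = 0 \<longleftrightarrow> v = 0"
  and G_scale: "x \<in> Ball3 \<Longrightarrow> G x (r *\<^sub>R v) = \<bar>r\<bar> * G x v"
  and G_triangle: "x \<in> Ball3 \<Longrightarrow> G x (u + v) \<le> G x u + G x v"
  using norm by (auto simp: is_norm_def)

lemma G_minus: "x \<in> Ball3 \<Longrightarrow> G x (- v) = G x v"
  using G_scale[of x "-1" v] by simp

lemma G_zero: "x \<in> Ball3 \<Longrightarrow> G x 0 = 0"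
  using G_eq_0 by blast

lemma e_G: "x \<in> Ball3 \<Longrightarrow> v \<noteq> 0 \<Longrightarrow> e (x, v) = (G x v)\<^sup>2 / 2"
  by (simp add: e_def Gg)

lemma Cinf_e: "Cinf_on U e"
proof -
  have "Cinf_on U (\<lambda>p. (1/2) * (g p)^2)"
    by (intro Cinf_on_mult Cinf_on_power g U) auto
  then show ?thesis by (simp add: e_def[abs_def])
qed

lemma De: "p \<in> U \<Longrightarrow> (e has_derivative De p) (at p)"
  using Cinf_on_has_derivative[OF Cinf_e] by (simp add: De_def[abs_def])

lemma De_linear: "p \<in> U \<Longrightarrow> linear (De p)"
  using De has_derivative_linear by blast

lemma Cinf_De: "Cinf_on U (\<lambda>p. De p h)"
  unfolding De_def by (rule Cinf_on_frechet_derivative[OF Cinf_e])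

lemma D2e: "p \<in> U \<Longrightarrow> ((\<lambda>q. De q h) has_derivative D2e p h) (at p)"
  using Cinf_on_has_derivative[OF Cinf_De] by (simp add: D2e_def[abs_def])

lemma De_split: "p \<in> U \<Longrightarrow> De p (h, k) = De p (h, 0) + De p (0, k)"
  using linear_add[OF De_linear, of p "(h, 0)" "(0, k)"] by simp

lemma qm: "p \<in> U \<Longrightarrow> qm p \<bullet> k = De p (0, k)"
proof -
  assume p: "p \<in> U"
  have "De p (0, k) = De p (\<Sum>b\<in>Basis. (k \<bullet> b) *\<^sub>R (0, b))"
    by (subst euclidean_representation[of k, symmetric]) (simp add: sum_prod)
  also have "\<dots> = (\<Sum>b\<in>Basis. (k \<bullet> b) * De p (0, b))"
    by (simp only: linear_sum[OF De_linear[OF p]] linear_scale[OF De_linear[OF p]] real_scaleR_def)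
  finally show ?thesis by (simp add: qm_def inner_sum_right inner_commute mult.commute)
qed

lemma rm: "p \<in> U \<Longrightarrow> rm p \<bullet> k = De p (k, 0)"
proof -
  assume p: "p \<in> U"
  have "De p (k, 0) = De p (\<Sum>b\<in>Basis. (k \<bullet> b) *\<^sub>R (b, 0))"
    by (subst euclidean_representation[of k, symmetric]) (simp add: sum_prod)
  also have "\<dots> = (\<Sum>b\<in>Basis. (k \<bullet> b) * De p (b, 0))"
    by (simp only: linear_sum[OF De_linear[OF p]] linear_scale[OF De_linear[OF p]] real_scaleR_def)
  finally show ?thesis by (simp add: rm_def inner_sum_right inner_commute mult.commute)
qed

lemma De_eq: "p \<in> U \<Longrightarrow> De p (h, k) = rm p \<bullet> h + qm p \<bullet> k"
  by (simp add: De_split[of p h k] qm rm)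

lemma Cinf_qm: "Cinf_on U qm" and Cinf_rm: "Cinf_on U rm"
  unfolding qm_def[abs_def] rm_def[abs_def]
  by (intro Cinf_on_sum Cinf_on_scaleR Cinf_De U Cinf_on_const finite_Basis)+

section \<open>Fibrewise derivatives and homogeneity of the energy\<close>

lemma line_has_derivative:
  "((\<lambda>t. (x, w + t *\<^sub>R u)) has_derivative (\<lambda>a. a *\<^sub>R (0, u))) (at t)"
  by (auto intro!: derivative_eq_intros)

lemma e_line:
  assumes "x \<in> Ball3" "w + t *\<^sub>R u \<noteq> 0"
  shows "((\<lambda>t. e (x, w + t *\<^sub>R u)) has_real_derivative De (x, w + t *\<^sub>R u) (0, u)) (at t)"
proof -
  note p = in_U[OF assms]
  have "(\<lambda>a. De (x, w + t *\<^sub>R u) (a *\<^sub>R (0, u))) = times (De (x, w + t *\<^sub>R u) (0, u))"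
    using De_linear[OF p] by (intro ext) (simp add: linear_scale del: scaleR_Pair)
  from has_derivative_compose[OF line_has_derivative De[OF p], unfolded this]
  show ?thesis unfolding has_field_derivative_def .
qed

lemma De_line:
  assumes "x \<in> Ball3" "w + t *\<^sub>R u \<noteq> 0"
  shows "((\<lambda>t. De (x, w + t *\<^sub>R u) h) has_real_derivative D2e (x, w + t *\<^sub>R u) h (0, u)) (at t)"
proof -
  note p = in_U[OF assms]
  have "(\<lambda>a. D2e (x, w + t *\<^sub>R u) h (a *\<^sub>R (0, u))) = times (D2e (x, w + t *\<^sub>R u) h (0, u))"
    using has_derivative_linear[OF D2e[OF p]] by (intro ext) (simp add: linear_scale del: scaleR_Pair)
  from has_derivative_compose[OF line_has_derivative D2e[OF p, of h], unfolded this]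
  show ?thesis unfolding has_field_derivative_def .
qed

lemma eventually_line_nonzero:
  fixes w u :: "real^3"
  assumes "w \<noteq> 0"
  shows "\<forall>\<^sub>F t in nhds 0. w + t *\<^sub>R u \<noteq> 0"
proof -
  have "isCont (\<lambda>t. w + t *\<^sub>R u) 0" by (intro continuous_intros)
  then have "((\<lambda>t. w + t *\<^sub>R u) \<longlongrightarrow> w) (nhds 0)"
    using tendsto_at_iff_tendsto_nhds[of "\<lambda>t. w + t *\<^sub>R u" 0] by (simp add: isCont_def)
  then show ?thesis using assms by (rule tendsto_imp_eventually_ne)
qed

text \<open>Away from the zero section \<open>G\<^sup>2\<close> agrees with \<open>2 * e\<close>
  along short lines, so the iterated \<open>deriv\<close> is a fibrewise Hessian. The inner
  derivative is the one in direction \<open>v\<close>, hence \<open>v\<close> comes first in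
  \<open>D2e\<close>.\<close>

lemma fundamental_tensor_eq:
  assumes x: "x \<in> Ball3" and w: "w \<noteq> 0"
  shows "fundamental_tensor G x w u v = D2e (x, w) (0, v) (0, u)"
proof -
  have inner: "deriv (\<lambda>t. (G x (w' + t *\<^sub>R v))\<^sup>2) 0 = 2 * De (x, w') (0, v)" if w': "w' \<noteq> 0" for w'
  proof -
    have "deriv (\<lambda>t. (G x (w' + t *\<^sub>R v))\<^sup>2) 0 = deriv (\<lambda>t. 2 * e (x, w' + t *\<^sub>R v)) 0"
      by (rule deriv_cong_ev[OF eventually_mono[OF eventually_line_nonzero[OF w', of v]]])
         (auto simp: e_G[OF x])
    also have "((\<lambda>t. 2 * e (x, w' + t *\<^sub>R v)) has_real_derivative 2 * De (x, w') (0, v)) (at 0)"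
      using DERIV_cmult[OF e_line[OF x, of w' 0 v], of 2] w' by simp
    then have "deriv (\<lambda>t. 2 * e (x, w' + t *\<^sub>R v)) 0 = 2 * De (x, w') (0, v)"
      by (rule DERIV_imp_deriv)
    finally show ?thesis .
  qed
  have "deriv (\<lambda>s. deriv (\<lambda>t. (G x (w + s *\<^sub>R u + t *\<^sub>R v))\<^sup>2) 0) 0
      = deriv (\<lambda>s. 2 * De (x, w + s *\<^sub>R u) (0, v)) 0"
    by (rule deriv_cong_ev[OF eventually_mono[OF eventually_line_nonzero[OF w, of u]]])
       (auto simp: inner)
  also have "((\<lambda>s. 2 * De (x, w + s *\<^sub>R u) (0, v)) has_real_derivative 2 * D2e (x, w) (0, v) (0, u)) (at 0)"
    using DERIV_cmult[OF De_line[OF x, of w 0 u "(0, v)"], of 2] w by simp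
  then have "deriv (\<lambda>s. 2 * De (x, w + s *\<^sub>R u) (0, v)) 0 = 2 * D2e (x, w) (0, v) (0, u)"
    by (rule DERIV_imp_deriv)
  finally show ?thesis by (simp add: fundamental_tensor_def)
qed

text \<open>The energy is 2-homogeneous in the fibre; differentiating
  \<open>e (x, r v + t k) = r^2 e (x, v + (t/r) k)\<close> in \<open>t\<close> leaves one factor
  \<open>r\<close>. Differentiating once more, in the next lemma, removes it.\<close>

lemma De_homogeneous:
  assumes x: "x \<in> Ball3" and v: "v \<noteq> 0" and r: "r > 0"
  shows "De (x, r *\<^sub>R v) (0, k) = r * De (x, v) (0, k)"
proof -
  have rv: "r *\<^sub>R v \<noteq> 0" using v r by simp
  have 1: "((\<lambda>t. e (x, r *\<^sub>R v + t *\<^sub>R k)) has_real_derivative De (x, r *\<^sub>R v) (0, k)) (at 0)"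
    using e_line[OF x, of "r *\<^sub>R v" 0 k] rv by simp
  have "((\<lambda>t. e (x, v + t *\<^sub>R k)) has_real_derivative De (x, v) (0, k)) (at ((1/r) * 0))"
    using e_line[OF x, of v 0 k] v by simp
  then have "((\<lambda>t. e (x, v + ((1/r) * t) *\<^sub>R k)) has_real_derivative De (x, v) (0, k) * (1/r)) (at 0)"
    by (rule DERIV_chain2[OF _ DERIV_cmult_Id])
  then have "((\<lambda>t. r\<^sup>2 * e (x, v + ((1/r) * t) *\<^sub>R k)) has_real_derivative r\<^sup>2 * (De (x, v) (0, k) * (1/r))) (at 0)"
    by (rule DERIV_cmult)
  moreover have ev: "\<forall>\<^sub>F t in nhds 0. r\<^sup>2 * e (x, v + ((1/r) * t) *\<^sub>R k) = e (x, r *\<^sub>R v + t *\<^sub>R k)"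
    using eventually_line_nonzero[OF rv, of k]
  proof eventually_elim
    case (elim t)
    have eq: "r *\<^sub>R v + t *\<^sub>R k = r *\<^sub>R (v + ((1/r) * t) *\<^sub>R k)" using r by (simp add: scaleR_add_right)
    then have "v + ((1/r) * t) *\<^sub>R k \<noteq> 0" using elim by (metis scaleR_zero_right)
    then show ?case using elim r unfolding eq by (simp add: e_G[OF x] G_scale[OF x] power_mult_distrib)
  qed
  ultimately have "((\<lambda>t. e (x, r *\<^sub>R v + t *\<^sub>R k)) has_real_derivative r\<^sup>2 * (De (x, v) (0, k) * (1/r))) (at 0)"
    using DERIV_cong_ev[OF refl ev refl] by blast
  from DERIV_unique[OF 1 this] show ?thesis using r by (simp add: power2_eq_square)
qed

lemma D2e_homogeneous:
  assumes x: "x \<in> Ball3" and v: "v \<noteq> 0" and r: "r > 0"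
  shows "D2e (x, r *\<^sub>R v) (0, k) (0, u) = D2e (x, v) (0, k) (0, u)"
proof -
  have rv: "r *\<^sub>R v \<noteq> 0" using v r by simp
  have 1: "((\<lambda>t. De (x, r *\<^sub>R v + t *\<^sub>R u) (0, k)) has_real_derivative D2e (x, r *\<^sub>R v) (0, k) (0, u)) (at 0)"
    using De_line[OF x, of "r *\<^sub>R v" 0 u] rv by simp
  have "((\<lambda>t. De (x, v + t *\<^sub>R u) (0, k)) has_real_derivative D2e (x, v) (0, k) (0, u)) (at ((1/r) * 0))"
    using De_line[OF x, of v 0 u] v by simp
  then have "((\<lambda>t. De (x, v + ((1/r) * t) *\<^sub>R u) (0, k)) has_real_derivative D2e (x, v) (0, k) (0, u) * (1/r)) (at 0)"
    by (rule DERIV_chain2[OF _ DERIV_cmult_Id])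
  then have "((\<lambda>t. r * De (x, v + ((1/r) * t) *\<^sub>R u) (0, k)) has_real_derivative
      r * (D2e (x, v) (0, k) (0, u) * (1/r))) (at 0)"
    by (rule DERIV_cmult)
  moreover have ev: "\<forall>\<^sub>F t in nhds 0. r * De (x, v + ((1/r) * t) *\<^sub>R u) (0, k) = De (x, r *\<^sub>R v + t *\<^sub>R u) (0, k)"
    using eventually_line_nonzero[OF rv, of u]
  proof eventually_elim
    case (elim t)
    have eq: "r *\<^sub>R v + t *\<^sub>R u = r *\<^sub>R (v + ((1/r) * t) *\<^sub>R u)" using r by (simp add: scaleR_add_right)
    then have "v + ((1/r) * t) *\<^sub>R u \<noteq> 0" using elim by (metis scaleR_zero_right)
    from De_homogeneous[OF x this r] show ?case unfolding eq by simp
  qed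
  ultimately have "((\<lambda>t. De (x, r *\<^sub>R v + t *\<^sub>R u) (0, k)) has_real_derivative
      r * (D2e (x, v) (0, k) (0, u) * (1/r))) (at 0)"
    using DERIV_cong_ev[OF refl ev refl] by blast
  from DERIV_unique[OF 1 this] show ?thesis using r by simp
qed

text \<open>Euler's identity for a 2-homogeneous function, read off from the energy on the ray
  through \<open>v\<close>.\<close>

lemma De_self: "x \<in> Ball3 \<Longrightarrow> v \<noteq> 0 \<Longrightarrow> De (x, v) (0, v) = 2 * e (x, v)"
proof -
  assume x: "x \<in> Ball3" and v: "v \<noteq> 0"
  have 1: "((\<lambda>t. e (x, v + t *\<^sub>R v)) has_real_derivative De (x, v) (0, v)) (at 0)"
    using e_line[OF x, of v 0 v] v by simp
  have "((\<lambda>t. (1 + t)\<^sup>2 * e (x, v)) has_real_derivative 2 * e (x, v)) (at 0)"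
    by (auto intro!: derivative_eq_intros)
  moreover have ev: "\<forall>\<^sub>F t in nhds 0. (1 + t)\<^sup>2 * e (x, v) = e (x, v + t *\<^sub>R v)"
    using eventually_line_nonzero[OF v, of v]
  proof eventually_elim
    case (elim t)
    have eq: "v + t *\<^sub>R v = (1 + t) *\<^sub>R v" by (simp add: algebra_simps)
    show ?case using elim v unfolding eq by (simp add: e_G[OF x] G_scale[OF x] power_mult_distrib)
  qed
  ultimately have "((\<lambda>t. e (x, v + t *\<^sub>R v)) has_real_derivative 2 * e (x, v)) (at 0)"
    using DERIV_cong_ev[OF refl ev refl] by blast
  from DERIV_unique[OF 1 this] show ?thesis .
qed

lemma slit_compact_subset: "K \<subseteq> - {0} \<Longrightarrow> Ball3 \<times> K \<subseteq> U"
  using U(2) by (auto simp: slit_TB_def)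

text \<open>Extrema of \<open>g\<close> over the compact unit sphere bundle, spread to all vectors
  by homogeneity.\<close>

lemma G_bounds:
  obtains m M where "0 < m" "0 < M" "\<And>x v. x \<in> Ball3 \<Longrightarrow> m * norm v \<le> G x v"
    "\<And>x v. x \<in> Ball3 \<Longrightarrow> G x v \<le> M * norm v"
proof -
  let ?K = "Ball3 \<times> S2"
  have K: "compact ?K" "?K \<subseteq> U" "?K \<noteq> {}"
    using slit_compact_subset[of S2] by (auto intro!: compact_Times)
  have c: "continuous_on ?K g" using Cinf_on_continuous_on[OF g] K(2) by (rule continuous_on_subset)
  obtain p where p: "p \<in> ?K" "\<And>q. q \<in> ?K \<Longrightarrow> g p \<le> g q"
    using continuous_attains_inf[OF K(1,3) c] by blast
  obtain P where P: "P \<in> ?K" "\<And>q. q \<in> ?K \<Longrightarrow> g q \<le> g P"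
    using continuous_attains_sup[OF K(1,3) c] by blast
  have gG: "g q = G (fst q) (snd q)" if "q \<in> ?K" for q
  proof -
    have "fst q \<in> Ball3" "snd q \<noteq> 0" using that by auto
    from Gg[OF this] show ?thesis by simp
  qed
  have "g p > 0" unfolding gG[OF p(1)] using p(1) G_nonneg[of "fst p" "snd p"] G_eq_0[of "fst p" "snd p"]
    by (auto simp: mem_Times_iff less_le)
  moreover have "g P > 0" using p(2)[OF P(1)] \<open>g p > 0\<close> by simp
  moreover have "g p * norm v \<le> G x v \<and> G x v \<le> g P * norm v" if "x \<in> Ball3" for x v
  proof (cases "v = 0")
    case True
    then show ?thesis using G_zero that by simp
  next
    case False
    let ?v = "v /\<^sub>R norm v"
    have q: "(x, ?v) \<in> ?K" using that False by simp
    have "G x v = norm v * G x ?v" using G_scale[OF that, of "norm v" ?v] False by simp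
    then show ?thesis
      using p(2)[OF q] P(2)[OF q] gG[OF q] False by (simp add: mult.commute)
  qed
  ultimately show ?thesis using that by blast
qed

lemma G_lipschitz_base:
  obtains C where "0 \<le> C" "\<And>x y v. x \<in> Ball3 \<Longrightarrow> y \<in> Ball3 \<Longrightarrow> \<bar>G x v - G y v\<bar> \<le> C * norm (x - y) * norm v"
proof -
  let ?K = "Ball3 \<times> S2"
  have K: "compact ?K" "?K \<subseteq> U"
    using slit_compact_subset[of S2] by (auto intro!: compact_Times)
  obtain L where L: "L \<ge> 0" "\<And>p q. p \<in> ?K \<Longrightarrow> q \<in> ?K \<Longrightarrow> norm (g p - g q) \<le> L * norm (p - q)"
    using Cinf_on_compact_lipschitz[OF U(1) g K] by blast
  have "\<bar>G x v - G y v\<bar> \<le> L * norm (x - y) * norm v" if xy: "x \<in> Ball3" "y \<in> Ball3" for x y v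
  proof (cases "v = 0")
    case True
    then show ?thesis using G_zero xy by simp
  next
    case False
    let ?v = "v /\<^sub>R norm v"
    have q: "(x, ?v) \<in> ?K" "(y, ?v) \<in> ?K" using xy False by auto
    have s: "G z v = norm v * g (z, ?v)" if "z \<in> Ball3" for z
      using G_scale[OF that, of "norm v" ?v] Gg[OF that, of ?v] False by simp
    have "\<bar>G x v - G y v\<bar> = norm v * \<bar>g (x, ?v) - g (y, ?v)\<bar>"
      unfolding s[OF xy(1)] s[OF xy(2)] by (simp add: right_diff_distrib[symmetric] abs_mult)
    also have "\<dots> \<le> norm v * (L * norm (x - y))"
      using L(2)[OF q] by (intro mult_left_mono) (auto simp: norm_Pair)
    finally show ?thesis by (simp add: mult.commute mult.left_commute)
  qed
  then show ?thesis using that L(1) by blast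
qed

lemma G_diff:
  assumes "x \<in> Ball3" shows "\<bar>G x v - G x w\<bar> \<le> G x (v - w)"
  using G_triangle[OF assms, of "v - w" w] G_triangle[OF assms, of "w - v" v] G_minus[OF assms, of "v - w"]
  by simp

text \<open>Continuity is needed also where \<open>w\<close> vanishes, a place not covered by
  \<open>g\<close>; it therefore comes from the Lipschitz estimates in base point and vector rather
  than from smoothness.\<close>

lemma G_continuous:
  assumes "continuous_on S c" "continuous_on S w" "\<And>t. t \<in> S \<Longrightarrow> c t \<in> Ball3"
  shows "continuous_on S (\<lambda>t. G (c t) (w t))"
  unfolding continuous_on_def
proof
  fix t assume t: "t \<in> S"
  obtain m M where M: "0 < M" "\<And>x v. x \<in> Ball3 \<Longrightarrow> G x v \<le> M * norm v" using G_bounds by metis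
  obtain C where C: "0 \<le> C" "\<And>x y v. x \<in> Ball3 \<Longrightarrow> y \<in> Ball3 \<Longrightarrow> \<bar>G x v - G y v\<bar> \<le> C * norm (x - y) * norm v"
    using G_lipschitz_base by blast
  have 1: "(c \<longlongrightarrow> c t) (at t within S)" "(w \<longlongrightarrow> w t) (at t within S)"
    using assms(1,2) t by (auto simp: continuous_on_def)
  have "((\<lambda>s. C * norm (c s - c t) * norm (w t) + M * norm (w s - w t)) \<longlongrightarrow>
      C * norm (c t - c t) * norm (w t) + M * norm (w t - w t)) (at t within S)"
    by (intro tendsto_intros 1)
  then have lim: "((\<lambda>s. C * norm (c s - c t) * norm (w t) + M * norm (w s - w t)) \<longlongrightarrow> 0) (at t within S)"
    by simp
  show "((\<lambda>s. G (c s) (w s)) \<longlongrightarrow> G (c t) (w t)) (at t within S)"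
    unfolding tendsto_iff dist_real_def
  proof (intro allI impI)
    fix \<epsilon> :: real assume "\<epsilon> > 0"
    have "\<forall>\<^sub>F s in at t within S. s \<in> S" by (simp add: eventually_at_filter)
    moreover have "\<forall>\<^sub>F s in at t within S. C * norm (c s - c t) * norm (w t) + M * norm (w s - w t) < \<epsilon>"
      using order_tendstoD(2)[OF lim \<open>\<epsilon> > 0\<close>] .
    ultimately show "\<forall>\<^sub>F s in at t within S. \<bar>G (c s) (w s) - G (c t) (w t)\<bar> < \<epsilon>"
    proof eventually_elim
      case (elim s)
      have "\<bar>G (c s) (w t) - G (c t) (w t)\<bar> \<le> C * norm (c s - c t) * norm (w t)"
        using C(2) assms(3) elim(1) t by blast
      moreover have "\<bar>G (c s) (w s) - G (c s) (w t)\<bar> \<le> M * norm (w s - w t)"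
        using G_diff[of "c s" "w s" "w t"] M(2)[of "c s" "w s - w t"] assms(3)[OF elim(1)] by linarith
      ultimately show ?case using elim(2) by linarith
    qed
  qed
qed

text \<open>The Hessian is bounded below by \<open>\<mu>\<close> on the compact unit sphere bundle
  and, being 0-homogeneous in the base vector, everywhere off the zero section; Taylor's formula
  gives the estimate along segments avoiding 0. On a segment through 0, where the energy need not be
  twice differentiable, \<open>w\<close> is a nonpositive multiple of \<open>v\<close> and
  homogeneity gives the bound directly.\<close>

lemma e_strongly_convex:
  obtains \<kappa> where "\<kappa> > 0"
    "\<And>x v w. x \<in> Ball3 \<Longrightarrow> v \<noteq> 0 \<Longrightarrow>
       (G x w)\<^sup>2 / 2 \<ge> (G x v)\<^sup>2 / 2 + qm (x, v) \<bullet> (w - v) + \<kappa> * (norm (w - v))\<^sup>2"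
proof -
  obtain m M where m: "0 < m" "\<And>x v. x \<in> Ball3 \<Longrightarrow> m * norm v \<le> G x v" using G_bounds by metis
  let ?W = "U \<times> (UNIV :: (real^3) set)"
  let ?F = "\<lambda>z :: ((real^3) \<times> (real^3)) \<times> (real^3). De (fst z) (0, snd z)"
  let ?H = "\<lambda>z :: ((real^3) \<times> (real^3)) \<times> (real^3). D2e (fst z) (0, snd z) (0, snd z)"
  have W: "open ?W" by (intro open_Times U open_UNIV)
  have F: "Cinf_on ?W ?F"
    unfolding De_def
    by (rule Cinf_on_frechet_derivative_varying[OF W U(1) Cinf_e])
       (auto intro!: Cinf_on_linear W bounded_linear_fst bounded_linear_snd
         bounded_linear_Pair bounded_linear_zero)
  \<comment> \<open>Exhibits \<open>?H\<close> as a directional derivative of the jointly smooth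
    \<open>?F\<close>; this yields the joint continuity in base point, vector and direction that the
    minimum over \<open>?K\<close> requires.\<close>
  have DF: "frechet_derivative ?F (at z) ((0, snd z), 0) = ?H z" if z: "z \<in> ?W" for z
  proof -
    have 1: "(?F has_derivative frechet_derivative ?F (at z)) (at z)"
      using Cinf_on_has_derivative[OF F z] .
    have 2: "((\<lambda>t. (fst z + t *\<^sub>R (0, snd z), snd z)) has_derivative (\<lambda>a. (a *\<^sub>R (0, snd z), 0))) (at 0)"
      by (auto intro!: derivative_eq_intros)
    have 3: "((\<lambda>t. ?F (fst z + t *\<^sub>R (0, snd z), snd z)) has_derivative
        (\<lambda>a. frechet_derivative ?F (at z) (a *\<^sub>R (0, snd z), 0))) (at 0)"
      using has_derivative_compose[OF 2, of ?F "frechet_derivative ?F (at z)"] 1 by (simp add: zero_prod_def[symmetric])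
    have 4: "((\<lambda>t. fst z + t *\<^sub>R (0, snd z)) has_derivative (\<lambda>a. a *\<^sub>R (0, snd z))) (at 0)"
      by (auto intro!: derivative_eq_intros)
    have zU: "fst z \<in> U" using z by auto
    have "((\<lambda>t. De (fst z + t *\<^sub>R (0, snd z)) (0, snd z)) has_derivative
        (\<lambda>a. D2e (fst z) (0, snd z) (a *\<^sub>R (0, snd z)))) (at 0)"
      using has_derivative_compose[OF 4, of "\<lambda>q. De q (0, snd z)" "D2e (fst z) (0, snd z)"] D2e[OF zU] by (simp add: zero_prod_def[symmetric])
    with 3 have "(\<lambda>a. frechet_derivative ?F (at z) (a *\<^sub>R (0, snd z), 0)) =
        (\<lambda>a. D2e (fst z) (0, snd z) (a *\<^sub>R (0, snd z)))"
      by (intro has_derivative_unique) auto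
    from fun_cong[OF this, of 1] show ?thesis by simp
  qed
  let ?K = "(Ball3 \<times> S2) \<times> S2"
  have KW: "?K \<subseteq> ?W" using slit_compact_subset[of S2] by auto
  have "Cinf_on ?W (\<lambda>z. frechet_derivative ?F (at z) ((0, snd z), 0))"
    by (rule Cinf_on_frechet_derivative_varying[OF W W F])
       (auto intro!: Cinf_on_linear W bounded_linear_snd bounded_linear_ident
         bounded_linear_Pair bounded_linear_zero)
  from Cinf_on_continuous_on[OF Cinf_on_cong[OF W DF this]]
  have c: "continuous_on ?K ?H" using KW by (rule continuous_on_subset)
  have K: "compact ?K" "?K \<noteq> {}" by (auto intro!: compact_Times)
  obtain z where z: "z \<in> ?K" "\<And>q. q \<in> ?K \<Longrightarrow> ?H z \<le> ?H q"
    using continuous_attains_inf[OF K c] by blast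
  define \<mu> where "\<mu> = ?H z"
  have "\<mu> > 0"
  proof -
    obtain x v u where zz: "z = ((x, v), u)" by (metis prod.collapse)
    have "x \<in> Ball3" "v \<noteq> 0" "u \<noteq> 0" using z(1) zz by auto
    from pos[OF this] show ?thesis
      unfolding \<mu>_def zz by (simp add: fundamental_tensor_eq[OF \<open>x \<in> Ball3\<close> \<open>v \<noteq> 0\<close>])
  qed
  have low: "D2e (x, v) (0, u) (0, u) \<ge> \<mu> * (norm u)\<^sup>2" if x: "x \<in> Ball3" and v: "v \<noteq> 0" for x v u
  proof (cases "u = 0")
    case True
    have "D2e (x, v) (0, 0) (0, 0) = 0"
      using has_derivative_linear[OF D2e[OF in_U[OF x v]], THEN linear_0] by (simp add: zero_prod_def)
    then show ?thesis using True by simp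
  next
    case False
    let ?v = "v /\<^sub>R norm v" and ?u = "u /\<^sub>R norm u"
    have k: "((x, ?v), ?u) \<in> ?K" using x v False by simp
    have vn: "?v \<noteq> 0" using v by simp
    have "D2e (x, v) (0, u) (0, u) = D2e (x, ?v) (0, u) (0, u)"
      using D2e_homogeneous[OF x vn, of "norm v" u u] v by simp
    also have "\<dots> = norm u * D2e (x, ?v) (0, u) (0, ?u)"
    proof -
      have "(0, u) = norm u *\<^sub>R (0, ?u)" using False by simp
      then show ?thesis
        using has_derivative_linear[OF D2e[OF in_U[OF x vn]], THEN linear_scale] by (metis real_scaleR_def)
    qed
    also have "D2e (x, ?v) (0, u) (0, ?u) = norm u * D2e (x, ?v) (0, ?u) (0, ?u)"
    proof -
      have d: "((\<lambda>q. norm u * De q (0, ?u)) has_derivative (\<lambda>k. norm u * D2e (x, ?v) (0, ?u) k)) (at (x, ?v))"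
        by (rule has_derivative_mult_right[OF D2e[OF in_U[OF x vn]]])
      have "norm u * De q (0, ?u) = De q (0, u)" if "q \<in> U" for q
        using linear_scale[OF De_linear[OF that], of "norm u" "(0, ?u)"] False by simp
      note has_derivative_transform_within_open[OF d U(1) in_U[OF x vn] this]
      from has_derivative_unique[OF this D2e[OF in_U[OF x vn]]] show ?thesis by (rule fun_cong[symmetric])
    qed
    finally have "D2e (x, v) (0, u) (0, u) = (norm u)\<^sup>2 * D2e (x, ?v) (0, ?u) (0, ?u)"
      by (simp add: power2_eq_square)
    moreover have "\<mu> \<le> D2e (x, ?v) (0, ?u) (0, ?u)" using z(2)[OF k] by (simp add: \<mu>_def)
    ultimately show ?thesis by (simp only: mult.commute[of \<mu>]) (simp add: mult_left_mono)
  qed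
  \<comment> \<open>\<open>\<mu> / 2\<close> serves the Taylor estimate and
    \<open>m\<^sup>2 / 2\<close> the segments through 0, where \<open>norm (w - v)\<close> equals
    \<open>(1 + l) * norm v\<close> and is controlled by \<open>G x v\<close> via
    \<open>m\<close>.\<close>
  define \<kappa> where "\<kappa> = min (\<mu> / 2) (m\<^sup>2 / 2)"
  have \<kappa>: "\<kappa> > 0" using \<open>\<mu> > 0\<close> m by (simp add: \<kappa>_def)
  have "(G x w)\<^sup>2 / 2 \<ge> (G x v)\<^sup>2 / 2 + qm (x, v) \<bullet> (w - v) + \<kappa> * (norm (w - v))\<^sup>2"
    if x: "x \<in> Ball3" and v: "v \<noteq> 0" for x v w
  proof (cases "\<exists>t\<in>{0..1}. v + t *\<^sub>R (w - v) = 0")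
    case True
    then obtain t where t: "0 \<le> t" "t \<le> 1" "v + t *\<^sub>R (w - v) = 0" by auto
    have "t \<noteq> 0" using t(3) v by auto
    define l where "l = (1 - t) / t"
    have l: "l \<ge> 0" using t \<open>t \<noteq> 0\<close> by (simp add: l_def)
    have "t *\<^sub>R w = (t - 1) *\<^sub>R v" using t(3) by (simp add: algebra_simps add_eq_0_iff)
    then have "(1 / t) *\<^sub>R (t *\<^sub>R w) = (1 / t) *\<^sub>R ((t - 1) *\<^sub>R v)" by simp
    then have "w = ((1 / t) * (t - 1)) *\<^sub>R v" using \<open>t \<noteq> 0\<close> by simp
    moreover have "(1 / t) * (t - 1) = - l" using \<open>t \<noteq> 0\<close> by (simp add: l_def field_simps)
    ultimately have w: "w = (- l) *\<^sub>R v" by simp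
    have wv: "w - v = - (1 + l) *\<^sub>R v" by (simp add: w algebra_simps)
    have G: "G x w = l * G x v" using l by (simp add: w G_scale[OF x] G_minus[OF x])
    have q: "qm (x, v) \<bullet> (w - v) = - (1 + l) * (G x v)\<^sup>2"
      unfolding wv using De_self[OF x v] by (simp add: qm[OF in_U[OF x v]] e_G[OF x v])
    have "\<kappa> * (norm (w - v))\<^sup>2 = \<kappa> * ((1 + l)\<^sup>2 * (norm v)\<^sup>2)"
      unfolding wv using l by (simp add: power_mult_distrib)
    also have "\<dots> \<le> (m\<^sup>2 / 2) * ((1 + l)\<^sup>2 * (norm v)\<^sup>2)"
      by (intro mult_right_mono) (auto simp: \<kappa>_def)
    also have "\<dots> = (1 + l)\<^sup>2 / 2 * (m * norm v)\<^sup>2" by (simp add: power_mult_distrib)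
    also have "\<dots> \<le> (1 + l)\<^sup>2 / 2 * (G x v)\<^sup>2"
      using m(1) m(2)[OF x] by (intro mult_left_mono power_mono) auto
    finally have "\<kappa> * (norm (w - v))\<^sup>2 \<le> (1 + l)\<^sup>2 / 2 * (G x v)\<^sup>2" .
    then show ?thesis unfolding q G by (simp add: power2_eq_square algebra_simps)
  next
    case False
    let ?u = "w - v"
    define f where "f t = e (x, v + t *\<^sub>R ?u)" for t
    define f' where "f' t = De (x, v + t *\<^sub>R ?u) (0, ?u)" for t
    have nz: "v + t *\<^sub>R ?u \<noteq> 0" if "0 \<le> t" "t \<le> 1" for t using False that by auto
    have f: "(f has_real_derivative f' t) (at t)" if "0 \<le> t" "t \<le> 1" for t
      unfolding f_def f'_def using e_line[OF x nz[OF that]] .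
    have f': "(f' has_real_derivative D2e (x, v + t *\<^sub>R ?u) (0, ?u) (0, ?u)) (at t)" if "0 \<le> t" "t \<le> 1" for t
      unfolding f'_def using De_line[OF x nz[OF that]] .
    have f'_low: "f' t - f' 0 \<ge> \<mu> * (norm ?u)\<^sup>2 * t" if t: "0 \<le> t" "t \<le> 1" for t
    proof -
      have "f' 0 - \<mu> * (norm ?u)\<^sup>2 * 0 \<le> f' t - \<mu> * (norm ?u)\<^sup>2 * t"
      proof (rule DERIV_nonneg_imp_nondecreasing[OF t(1)])
        fix s assume s: "0 \<le> s" "s \<le> t"
        then have s1: "0 \<le> s" "s \<le> 1" using t by auto
        have "((\<lambda>s. f' s - \<mu> * (norm ?u)\<^sup>2 * s) has_real_derivative
            D2e (x, v + s *\<^sub>R ?u) (0, ?u) (0, ?u) - \<mu> * (norm ?u)\<^sup>2) (at s)"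
          using DERIV_diff[OF f'[OF s1] DERIV_cmult[OF DERIV_ident, of "\<mu> * (norm ?u)\<^sup>2"]] by simp
        then show "\<exists>y. ((\<lambda>s. f' s - \<mu> * (norm ?u)\<^sup>2 * s) has_real_derivative y) (at s) \<and> 0 \<le> y"
          using low[OF x nz[OF s1], of ?u] by (intro exI conjI) auto
      qed
      then show ?thesis by simp
    qed
    have "f 0 - f' 0 * 0 - \<mu> * (norm ?u)\<^sup>2 * 0\<^sup>2 / 2 \<le> f 1 - f' 0 * 1 - \<mu> * (norm ?u)\<^sup>2 * 1\<^sup>2 / 2"
    proof (rule DERIV_nonneg_imp_nondecreasing[of 0 1 "\<lambda>s. f s - f' 0 * s - \<mu> * (norm ?u)\<^sup>2 * s\<^sup>2 / 2"])
      fix s :: real assume s: "0 \<le> s" "s \<le> 1"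
      have "((\<lambda>s. f s - f' 0 * s - \<mu> * (norm ?u)\<^sup>2 * s\<^sup>2 / 2) has_real_derivative
          f' s - f' 0 - \<mu> * (norm ?u)\<^sup>2 * s) (at s)"
        by (rule derivative_eq_intros f[OF s] refl | simp)+
      then show "\<exists>y. ((\<lambda>s. f s - f' 0 * s - \<mu> * (norm ?u)\<^sup>2 * s\<^sup>2 / 2) has_real_derivative y) (at s) \<and> 0 \<le> y"
        using f'_low[OF s] by (intro exI conjI) auto
    qed simp
    then have "f 1 \<ge> f 0 + f' 0 + \<mu> / 2 * (norm ?u)\<^sup>2" by simp
    moreover have "w \<noteq> 0" using nz[of 1] by simp
    moreover have "\<kappa> * (norm ?u)\<^sup>2 \<le> \<mu> / 2 * (norm ?u)\<^sup>2" by (intro mult_right_mono) (auto simp: \<kappa>_def)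
    ultimately show ?thesis
      using v by (simp add: f_def f'_def e_G[OF x] qm[OF in_U[OF x v]])
  qed
  then show ?thesis using that \<kappa> by blast
qed

end

section \<open>Curves\<close>

lemma has_vector_derivative_quotient:
  assumes "(f has_vector_derivative D) (at x within S)"
  shows "((\<lambda>y. (f y - f x) /\<^sub>R (y - x)) \<longlongrightarrow> D) (at x within S)"
proof -
  have "((\<lambda>y. (f y - f x - (y - x) *\<^sub>R D) /\<^sub>R norm (y - x)) \<longlongrightarrow> 0) (at x within S)"
    using assms unfolding has_vector_derivative_def has_derivative_within
    by (simp add: divide_inverse algebra_simps)
  then have "((\<lambda>y. norm ((f y - f x - (y - x) *\<^sub>R D) /\<^sub>R norm (y - x))) \<longlongrightarrow> 0) (at x within S)"
    by (rule tendsto_norm_zero)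
  then have "((\<lambda>y. norm ((f y - f x) /\<^sub>R (y - x) - D)) \<longlongrightarrow> 0) (at x within S)"
  proof (rule Lim_transform_eventually)
    show "\<forall>\<^sub>F y in at x within S. norm ((f y - f x - (y - x) *\<^sub>R D) /\<^sub>R norm (y - x))
        = norm ((f y - f x) /\<^sub>R (y - x) - D)"
      unfolding eventually_at_filter
    proof (rule always_eventually, intro allI impI)
      fix y assume "y \<noteq> x" "y \<in> S"
      then have "(f y - f x) /\<^sub>R (y - x) - D = (f y - f x - (y - x) *\<^sub>R D) /\<^sub>R (y - x)"
        by (simp add: scaleR_diff_right)
      then show "norm ((f y - f x - (y - x) *\<^sub>R D) /\<^sub>R norm (y - x)) = norm ((f y - f x) /\<^sub>R (y - x) - D)"
        by simp
    qed
  qed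
  then show ?thesis by (simp only: tendsto_norm_zero_iff LIM_zero_iff)
qed

text \<open>The derivative is named explicitly and the interval is arbitrary, with one-sided
  derivatives at its ends, in contrast to \<open>velocity\<close>, which is tied to
  \<open>{0..1}\<close>. Minimizers will be handled as curves of this kind.\<close>

definition C1_curve :: "real \<Rightarrow> real \<Rightarrow> (real \<Rightarrow> 'a::euclidean_space) \<Rightarrow> (real \<Rightarrow> 'a) \<Rightarrow> bool" where
  "C1_curve a b c c' \<longleftrightarrow> continuous_on {a..b} c' \<and>
     (\<forall>t\<in>{a..b}. (c has_vector_derivative c' t) (at t within {a..b}))"

lemma C1_curve_continuous: "C1_curve a b c c' \<Longrightarrow> continuous_on {a..b} c"
  unfolding C1_curve_def continuous_on_eq_continuous_within
  using has_vector_derivative_continuous by blast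

lemma C1_curve_subset: "C1_curve a b c c' \<Longrightarrow> a \<le> a' \<Longrightarrow> b' \<le> b \<Longrightarrow> C1_curve a' b' c c'"
  unfolding C1_curve_def
  by (auto intro: continuous_on_subset has_vector_derivative_within_subset[of _ _ _ "{a..b}"])

lemma C1_curve_integral:
  assumes "C1_curve a b c c'" "a \<le> b"
  shows "(c' has_integral (c b - c a)) {a..b}"
  using assms by (auto simp: C1_curve_def intro: fundamental_theorem_of_calculus)

lemma Cinf_on_C1_curve:
  assumes "open V" "{a..b} \<subseteq> V" "Cinf_on V c"
  shows "C1_curve a b c (\<lambda>t. vector_derivative c (at t))"
  using Cinf_on_vector_derivative[OF assms(1,3)] Cinf_on_continuous_on assms(2)
  unfolding C1_curve_def
  by (meson continuous_on_subset has_vector_derivative_at_within subsetD)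

lemma smooth_map_on_C1_curve:
  assumes "smooth_map_on {0..1} c"
  shows "C1_curve 0 1 c (velocity c)"
proof -
  obtain V k where V: "open V" "{0..1} \<subseteq> V" "Cinf_on V k" "\<And>t. t \<in> {0..1} \<Longrightarrow> c t = k t"
    using assms unfolding smooth_map_on_iff_Cinf by blast
  let ?k' = "\<lambda>t. vector_derivative k (at t)"
  have k: "C1_curve 0 1 k ?k'" by (rule Cinf_on_C1_curve[OF V(1-3)])
  have c: "(c has_vector_derivative ?k' t) (at t within {0..1})" if "t \<in> {0..1}" for t
    by (rule has_vector_derivative_transform[OF that V(4)])
       (use k that in \<open>auto simp: C1_curve_def\<close>)
  then have v: "velocity c t = ?k' t" if "t \<in> {0..1}" for t
    using that by (intro vector_derivative_within_closed_interval) auto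
  have "continuous_on {0..1} (velocity c)"
    by (rule continuous_on_eq[of _ ?k']) (use k v in \<open>auto simp: C1_curve_def\<close>)
  then show ?thesis
    using v c unfolding C1_curve_def by simp
qed

text \<open>The primitive of \<open>L\<close> composed with \<open>\<phi>\<close> has the integrand
  as its derivative. The signed form covers both the reversal of a curve and its slowing
  down.\<close>

lemma reparametrized_integral:
  fixes L :: "real \<Rightarrow> real"
  assumes "a \<le> b" "continuous_on {0..1} L"
    and "\<And>t. t \<in> {a..b} \<Longrightarrow> (\<phi> has_real_derivative \<phi>' t) (at t within {a..b})"
    and "\<And>t. t \<in> {a..b} \<Longrightarrow> \<phi> t \<in> {0..1}"
  shows "((\<lambda>t. \<phi>' t * L (\<phi> t)) has_integral (integral {0..\<phi> b} L - integral {0..\<phi> a} L)) {a..b}"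
proof -
  have "((\<lambda>t. integral {0..\<phi> t} L) has_vector_derivative \<phi>' t * L (\<phi> t)) (at t within {a..b})"
    if t: "t \<in> {a..b}" for t
  proof -
    have 1: "(\<phi> has_vector_derivative \<phi>' t) (at t within {a..b})"
      using assms(3)[OF t] by (simp add: has_real_derivative_iff_has_vector_derivative)
    have "((\<lambda>u. integral {0..u} L) has_vector_derivative L (\<phi> t)) (at (\<phi> t) within {0..1})"
      by (rule integral_has_vector_derivative[OF assms(2)]) (use assms(4)[OF t] in auto)
    then have 2: "((\<lambda>u. integral {0..u} L) has_vector_derivative L (\<phi> t)) (at (\<phi> t) within \<phi> ` {a..b})"
      by (rule has_vector_derivative_within_subset) (use assms(4) in auto)
    from vector_diff_chain_within[OF 1 2] show ?thesis by (simp add: o_def)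
  qed
  from fundamental_theorem_of_calculus[OF assms(1) this] show ?thesis by simp
qed

text \<open>A substitute for the derivative test, meant for distance functions, which need not be
  differentiable. After allowing a slope \<open>\<epsilon>\<close>, the largest \<open>t\<close>
  satisfying \<open>f t \<le> f a + \<epsilon> * (t - a)\<close> cannot be smaller than
  \<open>b\<close>.\<close>

lemma nonincreasing_if_right_slopes_nonpos:
  fixes f :: "real \<Rightarrow> real"
  assumes "a \<le> b" "continuous_on {a..b} f"
    and "\<And>t \<epsilon>. a \<le> t \<Longrightarrow> t < b \<Longrightarrow> \<epsilon> > 0 \<Longrightarrow>
      \<forall>\<^sub>F s in at_right t. f s - f t \<le> \<epsilon> * (s - t)"
  shows "f b \<le> f a"
proof (rule field_le_epsilon)
  fix \<epsilon>0 :: real assume "\<epsilon>0 > 0"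
  define \<epsilon> where "\<epsilon> = \<epsilon>0 / (b - a + 1)"
  have \<epsilon>: "\<epsilon> > 0" using \<open>\<epsilon>0 > 0\<close> assms(1) by (simp add: \<epsilon>_def)
  define S where "S = {t \<in> {a..b}. f t - \<epsilon> * (t - a) \<le> f a}"
  have S_sub: "S \<subseteq> {a..b}" by (auto simp: S_def)
  have "compact S"
  proof -
    have "closed S"
      unfolding S_def by (intro continuous_on_closed_Collect_le continuous_intros assms(2))
    then show ?thesis
      using compact_Int_closed[OF compact_Icc[of a b], of S] by (simp add: Int_absorb1 S_sub)
  qed
  moreover have "a \<in> S" using assms(1) by (simp add: S_def)
  ultimately obtain t where t: "t \<in> S" "\<And>s. s \<in> S \<Longrightarrow> s \<le> t"
    using compact_attains_sup by (metis empty_iff)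
  have "t = b"
  proof (rule ccontr)
    assume "t \<noteq> b"
    then have tb: "a \<le> t" "t < b" using t(1) by (auto simp: S_def)
    have "\<forall>\<^sub>F s in at_right t. f s - f t \<le> \<epsilon> * (s - t)" using assms(3)[OF tb \<epsilon>] .
    moreover have "\<forall>\<^sub>F s in at_right t. s \<in> {t<..<b}" using eventually_at_right_real[OF tb(2)] .
    ultimately have "\<forall>\<^sub>F s in at_right t. f s - f t \<le> \<epsilon> * (s - t) \<and> s \<in> {t<..<b}"
      by eventually_elim auto
    then obtain s where s: "f s - f t \<le> \<epsilon> * (s - t)" "t < s" "s < b"
      using eventually_happens[of _ "at_right t"] by (auto simp: trivial_limit_at_right_real)
    then have "s \<in> S" using t(1) tb by (auto simp: S_def algebra_simps)
    then show False using t(2) s(2) by fastforce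
  qed
  then have "f b \<le> f a + \<epsilon> * (b - a)" using t(1) by (simp add: S_def)
  also have "\<epsilon> * (b - a) \<le> \<epsilon> * (b - a + 1)" using \<epsilon> by (intro mult_left_mono) auto
  also have "\<dots> = \<epsilon>0" using assms(1) by (simp add: \<epsilon>_def)
  finally show "f b \<le> f a + \<epsilon>0" by simp
qed

section \<open>The distance of a Finsler metric\<close>

context Finsler_ball
begin

definition "d = induced_dist G"

definition "lengths x y = {integral {0..1} (\<lambda>t. G (c t) (velocity c t)) | c.
            smooth_map_on {0..1} c \<and> c ` {0..1} \<subseteq> Ball3 \<and> c 0 = x \<and> c 1 = y}"

lemma d_lengths: "d x y = Inf (lengths x y)"
  by (simp add: d_def induced_dist_def lengths_def)

lemma integrable_G:
  assumes "C1_curve a b c c'" "c ` {a..b} \<subseteq> Ball3"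
  shows "continuous_on {a..b} (\<lambda>t. G (c t) (c' t))" "(\<lambda>t. G (c t) (c' t)) integrable_on {a..b}"
proof -
  show "continuous_on {a..b} (\<lambda>t. G (c t) (c' t))"
    using assms C1_curve_continuous[OF assms(1)] by (intro G_continuous) (unfold C1_curve_def, blast+)
  then show "(\<lambda>t. G (c t) (c' t)) integrable_on {a..b}" by (rule integrable_continuous_real)
qed

lemma lengths_nonneg: "l \<in> lengths x y \<Longrightarrow> l \<ge> 0"
proof -
  assume "l \<in> lengths x y"
  then obtain c where c: "l = integral {0..1} (\<lambda>t. G (c t) (velocity c t))"
    "smooth_map_on {0..1} c" "c ` {0..1} \<subseteq> Ball3" unfolding lengths_def by blast
  show ?thesis unfolding c(1)
    by (rule integral_nonneg[OF integrable_G(2)[OF smooth_map_on_C1_curve[OF c(2)] c(3)]])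
       (use c(3) G_nonneg in blast)
qed

lemma d_le_length:
  assumes "smooth_map_on {0..1} c" "c ` {0..1} \<subseteq> Ball3" "c 0 = x" "c 1 = y"
  shows "d x y \<le> integral {0..1} (\<lambda>t. G (c t) (velocity c t))"
  unfolding d_lengths
proof (rule cInf_lower)
  show "integral {0..1} (\<lambda>t. G (c t) (velocity c t)) \<in> lengths x y"
    unfolding lengths_def using assms by blast
  show "bdd_below (lengths x y)" by (rule bdd_belowI[of _ 0]) (rule lengths_nonneg)
qed

lemma segment_in_Ball3: "x \<in> Ball3 \<Longrightarrow> y \<in> Ball3 \<Longrightarrow> t \<in> {0..1} \<Longrightarrow> x + t *\<^sub>R (y - x) \<in> Ball3"
  using convexD_alt[OF convex_cball, of x "0 :: real^3" 1 y t] by (simp add: algebra_simps)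

lemma smooth_segment: "smooth_map_on {0..1} (\<lambda>t. x + t *\<^sub>R v)"
  for x v :: "real^3"
  by (rule smooth_map_onI[where U = UNIV])
     (auto intro!: Cinf_on_add[OF _ Cinf_on_const Cinf_on_linear] bounded_linear_scaleR_left)

lemma velocity_segment: "t \<in> {0..1} \<Longrightarrow> velocity (\<lambda>t. x + t *\<^sub>R v) t = v"
  by (rule vector_derivative_within_closed_interval) (auto intro!: derivative_eq_intros)

lemma lengths_nonempty:
  assumes "x \<in> Ball3" "y \<in> Ball3" shows "lengths x y \<noteq> {}"
proof -
  have "integral {0..1} (\<lambda>t. G (x + t *\<^sub>R (y - x)) (velocity (\<lambda>t. x + t *\<^sub>R (y - x)) t)) \<in> lengths x y"
    unfolding lengths_def
    by (intro CollectI exI[of _ "\<lambda>t. x + t *\<^sub>R (y - x)"] conjI smooth_segment refl)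
       (use segment_in_Ball3[OF assms] in auto)
  then show ?thesis by auto
qed

lemma d_near:
  assumes "x \<in> Ball3" "y \<in> Ball3" "\<epsilon> > 0"
  obtains c where "smooth_map_on {0..1} c" "c ` {0..1} \<subseteq> Ball3" "c 0 = x" "c 1 = y"
    "integral {0..1} (\<lambda>t. G (c t) (velocity c t)) < d x y + \<epsilon>"
proof -
  have "Inf (lengths x y) < d x y + \<epsilon>" using assms(3) by (simp add: d_lengths)
  then obtain l where "l \<in> lengths x y" "l < d x y + \<epsilon>"
    using cInf_lessD[OF lengths_nonempty[OF assms(1,2)]] by blast
  then show ?thesis using that unfolding lengths_def by blast
qed

lemma d_nonneg: "x \<in> Ball3 \<Longrightarrow> y \<in> Ball3 \<Longrightarrow> 0 \<le> d x y"
  unfolding d_lengths by (rule cInf_greatest[OF lengths_nonempty lengths_nonneg])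

text \<open>Tests the infimum with the straight segment, which stays in the convex ball; freezing
  the base point at \<open>x\<close> costs a quadratic term.\<close>

lemma d_upper:
  obtains C where "0 \<le> C" "\<And>x y. x \<in> Ball3 \<Longrightarrow> y \<in> Ball3 \<Longrightarrow> d x y \<le> G x (y - x) + C * (norm (y - x))\<^sup>2"
proof -
  obtain C where C: "0 \<le> C" "\<And>x y v. x \<in> Ball3 \<Longrightarrow> y \<in> Ball3 \<Longrightarrow> \<bar>G x v - G y v\<bar> \<le> C * norm (x - y) * norm v"
    using G_lipschitz_base by blast
  have "d x y \<le> G x (y - x) + C * (norm (y - x))\<^sup>2" if xy: "x \<in> Ball3" "y \<in> Ball3" for x y
  proof -
    let ?c = "\<lambda>t. x + t *\<^sub>R (y - x)"
    have im: "?c ` {0..1} \<subseteq> Ball3" using segment_in_Ball3[OF xy] by auto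
    have "d x y \<le> integral {0..1} (\<lambda>t. G (?c t) (velocity ?c t))"
      by (rule d_le_length[OF smooth_segment im]) auto
    also have "\<dots> \<le> integral {0..1} (\<lambda>t::real. G x (y - x) + C * (norm (y - x))\<^sup>2)"
    proof (rule integral_le[OF integrable_G(2)[OF smooth_map_on_C1_curve[OF smooth_segment] im] integrable_const_ivl])
      fix t :: real assume t: "t \<in> {0..1}"
      have "\<bar>G (?c t) (y - x) - G x (y - x)\<bar> \<le> C * norm (?c t - x) * norm (y - x)"
        by (rule C(2)[OF segment_in_Ball3[OF xy t] xy(1)])
      also have "\<dots> \<le> C * norm (y - x) * norm (y - x)"
        using t C(1) by (intro mult_right_mono mult_left_mono) (auto intro: mult_left_le_one_le)
      also have "\<dots> = C * (norm (y - x))\<^sup>2" by (simp add: power2_eq_square)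
      finally have "G (?c t) (y - x) \<le> G x (y - x) + C * (norm (y - x))\<^sup>2" by linarith
      then show "G (?c t) (velocity ?c t) \<le> G x (y - x) + C * (norm (y - x))\<^sup>2"
        by (subst velocity_segment[OF t, of x "y - x"])
    qed
    also have "\<dots> = G x (y - x) + C * (norm (y - x))\<^sup>2"
      by (subst integral_const_real) simp
    finally show ?thesis .
  qed
  then show ?thesis using that C(1) by blast
qed

text \<open>The bound for every \<open>t\<close>, not only for the end point, confines a short curve
  to a small neighbourhood of its start, where the base point may be frozen.\<close>

lemma length_lower:
  obtains m where "m > 0" "\<And>x v. x \<in> Ball3 \<Longrightarrow> m * norm v \<le> G x v"
    "\<And>c t. smooth_map_on {0..1} c \<Longrightarrow> c ` {0..1} \<subseteq> Ball3 \<Longrightarrow> t \<in> {0..1} \<Longrightarrow>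
       m * norm (c t - c 0) \<le> integral {0..1} (\<lambda>t. G (c t) (velocity c t))"
proof -
  obtain m M where m: "0 < m" "\<And>x v. x \<in> Ball3 \<Longrightarrow> m * norm v \<le> G x v" using G_bounds by metis
  have len: "m * norm (c t - c 0) \<le> integral {0..1} (\<lambda>t. G (c t) (velocity c t))"
    if c: "smooth_map_on {0..1} c" "c ` {0..1} \<subseteq> Ball3" "t \<in> {0..1}" for c t
  proof -
    note C1 = smooth_map_on_C1_curve[OF c(1)]
    note G = integrable_G[OF C1 c(2)]
    have C1t: "C1_curve 0 t c (velocity c)" by (rule C1_curve_subset[OF C1]) (use c(3) in auto)
    have st: "{0..t} \<subseteq> {0..1}" using c(3) by auto
    have "norm (integral {0..t} (velocity c)) \<le> integral {0..t} (\<lambda>t. G (c t) (velocity c t) / m)"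
    proof (rule integral_norm_bound_integral)
      show "velocity c integrable_on {0..t}"
        using C1t unfolding C1_curve_def by (intro integrable_continuous_real) auto
      show "(\<lambda>t. G (c t) (velocity c t) / m) integrable_on {0..t}"
        using G(1) c(3) m(1) by (intro integrable_continuous_real continuous_intros)
          (auto intro: continuous_on_subset)
      show "norm (velocity c s) \<le> G (c s) (velocity c s) / m" if "s \<in> {0..t}" for s
      proof -
        have "c s \<in> Ball3" using c(2,3) that by force
        from m(2)[OF this, of "velocity c s"] m(1) show ?thesis by (simp add: field_simps)
      qed
    qed
    moreover have "integral {0..t} (velocity c) = c t - c 0"
      using C1_curve_integral[OF C1t] c(3) by (simp add: integral_unique)
    ultimately have "m * norm (c t - c 0) \<le> integral {0..t} (\<lambda>t. G (c t) (velocity c t))"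
      using m(1) by (simp add: field_simps)
    also have "\<dots> \<le> integral {0..1} (\<lambda>t. G (c t) (velocity c t))"
    proof (rule integral_subset_le[OF st integrable_on_subinterval[OF G(2) st] G(2)])
      show "\<forall>s\<in>{0..1}. 0 \<le> G (c s) (velocity c s)" using c(2) G_nonneg by blast
    qed
    finally show ?thesis .
  qed
  with m show ?thesis by (rule that)
qed

lemma d_lower_norm:
  obtains m where "m > 0" "\<And>x y. x \<in> Ball3 \<Longrightarrow> y \<in> Ball3 \<Longrightarrow> m * norm (x - y) \<le> d x y"
proof -
  obtain m where m: "m > 0" "\<And>x v. x \<in> Ball3 \<Longrightarrow> m * norm v \<le> G x v"
    "\<And>c t. smooth_map_on {0..1} c \<Longrightarrow> c ` {0..1} \<subseteq> Ball3 \<Longrightarrow> t \<in> {0..1} \<Longrightarrow>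
       m * norm (c t - c 0) \<le> integral {0..1} (\<lambda>t. G (c t) (velocity c t))"
    using length_lower by blast
  have "m * norm (x - y) \<le> d x y" if xy: "x \<in> Ball3" "y \<in> Ball3" for x y
  proof (rule field_le_epsilon)
    fix \<epsilon> :: real assume "\<epsilon> > 0"
    then obtain c where c: "smooth_map_on {0..1} c" "c ` {0..1} \<subseteq> Ball3" "c 0 = x" "c 1 = y"
      "integral {0..1} (\<lambda>t. G (c t) (velocity c t)) < d x y + \<epsilon>" using d_near[OF xy] by blast
    show "m * norm (x - y) \<le> d x y + \<epsilon>"
      using m(3)[OF c(1,2), of 1] c(3-5) by (simp add: norm_minus_commute)
  qed
  then show ?thesis using that m(1) by blast
qed

lemma d_refl: "x \<in> Ball3 \<Longrightarrow> d x x = 0"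
proof -
  assume x: "x \<in> Ball3"
  obtain C where "0 \<le> C" and C: "\<And>x y. x \<in> Ball3 \<Longrightarrow> y \<in> Ball3 \<Longrightarrow> d x y \<le> G x (y - x) + C * (norm (y - x))\<^sup>2"
    using d_upper by blast
  from C[OF x x] d_nonneg[OF x x] G_zero[OF x] show ?thesis by simp
qed

lemma d_eq_0: "x \<in> Ball3 \<Longrightarrow> y \<in> Ball3 \<Longrightarrow> d x y = 0 \<Longrightarrow> x = y"
proof -
  assume x: "x \<in> Ball3" "y \<in> Ball3" "d x y = 0"
  obtain m where m: "m > 0" "\<And>x y. x \<in> Ball3 \<Longrightarrow> y \<in> Ball3 \<Longrightarrow> m * norm (x - y) \<le> d x y"
    using d_lower_norm by blast
  have "m * norm (x - y) \<le> 0" using m(2)[OF x(1,2)] x(3) by simp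
  then have "norm (x - y) \<le> 0" using m(1) by (simp add: mult_le_0_iff)
  then show ?thesis by simp
qed

text \<open>The Finsler form of the Cauchy-Schwarz inequality: the convexity estimate compares
  \<open>w\<close> with the multiple of \<open>v\<close> of equal length, so that the energies
  cancel.\<close>

lemma qm_le:
  assumes x: "x \<in> Ball3" and w: "w \<noteq> 0"
  shows "qm (x, w) \<bullet> v \<le> G x w * G x v"
proof (cases "v = 0")
  case True then show ?thesis using G_zero[OF x] by simp
next
  case False
  obtain \<kappa> where \<kappa>: "\<kappa> > 0"
    "\<And>x v w. x \<in> Ball3 \<Longrightarrow> v \<noteq> 0 \<Longrightarrow>
       (G x w)\<^sup>2 / 2 \<ge> (G x v)\<^sup>2 / 2 + qm (x, v) \<bullet> (w - v) + \<kappa> * (norm (w - v))\<^sup>2"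
    using e_strongly_convex by blast
  have pos: "G x w > 0" "G x v > 0" using G_nonneg[OF x] G_eq_0[OF x] w False by (auto simp: less_le)
  define s where "s = G x w / G x v"
  have s: "s > 0" "s * G x v = G x w" using pos by (auto simp: s_def)
  have "(G x w)\<^sup>2 / 2 + qm (x, w) \<bullet> (s *\<^sub>R v - w) \<le> (G x (s *\<^sub>R v))\<^sup>2 / 2"
    using \<kappa>(2)[OF x w, of "s *\<^sub>R v"] \<kappa>(1) by (smt (verit) mult_nonneg_nonneg zero_le_power2)
  moreover have "qm (x, w) \<bullet> w = (G x w)\<^sup>2"
    by (simp add: qm[OF in_U[OF x w]] De_self[OF x w] e_G[OF x w])
  moreover have "G x (s *\<^sub>R v) = G x w" using s by (simp add: G_scale[OF x])
  ultimately have "s * (qm (x, w) \<bullet> v) \<le> (G x w)\<^sup>2" by (simp add: inner_diff_right)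
  also have "\<dots> = s * (G x w * G x v)" using s by (simp add: power2_eq_square mult.commute mult.left_commute)
  finally show ?thesis using s(1) by simp
qed

text \<open>A calibration argument: the covector \<open>p\<close> is dominated by
  \<open>G x\<close>, with equality on \<open>y - x\<close>, and its integral over any curve from
  \<open>x\<close> to \<open>y\<close> is \<open>G x (y - x)\<close>. A nearly minimal curve remains
  within a multiple of \<open>norm (y - x)\<close> from \<open>x\<close>, so replacing
  \<open>G x\<close> by \<open>G (c t)\<close> changes the length only to second order.\<close>

lemma d_lower:
  obtains C where "0 \<le> C" "\<And>x y. x \<in> Ball3 \<Longrightarrow> y \<in> Ball3 \<Longrightarrow> d x y \<ge> G x (y - x) - C * (norm (y - x))\<^sup>2"
proof -
  obtain C where C: "0 \<le> C" "\<And>x y v. x \<in> Ball3 \<Longrightarrow> y \<in> Ball3 \<Longrightarrow> \<bar>G x v - G y v\<bar> \<le> C * norm (x - y) * norm v"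
    using G_lipschitz_base by blast
  obtain m where m: "m > 0" "\<And>x v. x \<in> Ball3 \<Longrightarrow> m * norm v \<le> G x v"
    "\<And>c t. smooth_map_on {0..1} c \<Longrightarrow> c ` {0..1} \<subseteq> Ball3 \<Longrightarrow> t \<in> {0..1} \<Longrightarrow>
       m * norm (c t - c 0) \<le> integral {0..1} (\<lambda>t. G (c t) (velocity c t))"
    using length_lower by blast
  obtain m' M where M: "0 < M" "\<And>x v. x \<in> Ball3 \<Longrightarrow> G x v \<le> M * norm v" using G_bounds by metis
  obtain C1 where C1: "0 \<le> C1" "\<And>x y. x \<in> Ball3 \<Longrightarrow> y \<in> Ball3 \<Longrightarrow> d x y \<le> G x (y - x) + C1 * (norm (y - x))\<^sup>2"
    using d_upper by blast
  \<comment> \<open>\<open>B * norm (y - x)\<close> will bound the length of the test curve: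
    \<open>M + 2 * C1\<close> comes from \<open>d_upper\<close> and
    \<open>norm (y - x) \<le> 2\<close>, the additional 1 from the slack
    \<open>\<delta> \<le> norm (y - x)\<close>.\<close>
  define B where "B = M + 2 * C1 + 1"
  have B: "B > 0" using M(1) C1(1) by (simp add: B_def)
  define K where "K = C / m\<^sup>2 * B\<^sup>2"
  have "d x y \<ge> G x (y - x) - K * (norm (y - x))\<^sup>2" if xy: "x \<in> Ball3" "y \<in> Ball3" for x y
  proof (cases "x = y")
    case True then show ?thesis using d_refl xy G_zero by simp
  next
    case False
    let ?w = "y - x"
    have w: "?w \<noteq> 0" using False by simp
    have n2: "norm ?w \<le> 2" using xy norm_triangle_ineq4[of y x] by simp
    have dB: "d x y \<le> (M + 2 * C1) * norm ?w"
    proof -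
      have "C1 * (norm ?w)\<^sup>2 \<le> C1 * (2 * norm ?w)"
        unfolding power2_eq_square using n2 C1(1) by (intro mult_left_mono mult_right_mono) auto
      then show ?thesis using C1(2)[OF xy] M(2)[OF xy(1), of ?w] by (simp add: algebra_simps)
    qed
    have GP: "G x ?w > 0" using G_nonneg[OF xy(1)] G_eq_0[OF xy(1)] w by (auto simp: less_le)
    define p where "p = qm (x, ?w) /\<^sub>R G x ?w"
    have p: "p \<bullet> v \<le> G x v" for v
      using qm_le[OF xy(1) w, of v] GP by (simp add: p_def field_simps)
    have pw: "p \<bullet> ?w = G x ?w"
      using GP by (simp add: p_def qm[OF in_U[OF xy(1) w]] De_self[OF xy(1) w] e_G[OF xy(1) w] power2_eq_square)
    have "G x ?w - K * (norm ?w)\<^sup>2 \<le> d x y + \<epsilon>" if \<epsilon>: "\<epsilon> > 0" for \<epsilon>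
    proof -
      define \<delta> where "\<delta> = min \<epsilon> (norm ?w)"
      have "\<delta> > 0" using \<epsilon> w by (simp add: \<delta>_def)
      then obtain c where c: "smooth_map_on {0..1} c" "c ` {0..1} \<subseteq> Ball3" "c 0 = x" "c 1 = y"
        "integral {0..1} (\<lambda>t. G (c t) (velocity c t)) < d x y + \<delta>" using d_near[OF xy] by blast
      define len where "len = integral {0..1} (\<lambda>t. G (c t) (velocity c t))"
      note cc = smooth_map_on_C1_curve[OF c(1)]
      have len: "len \<le> B * norm ?w" using c(5) dB by (simp add: len_def \<delta>_def B_def algebra_simps)
      have len0: "len \<ge> 0" using d_le_length[OF c(1-4)] d_nonneg[OF xy] by (simp add: len_def)
      have "((\<lambda>t. p \<bullet> velocity c t) has_integral p \<bullet> (c 1 - c 0)) {0..1}"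
        using has_integral_linear[OF C1_curve_integral[OF cc] bounded_linear_inner_right[of p]]
        by (simp add: o_def)
      then have "((\<lambda>t. p \<bullet> velocity c t) has_integral p \<bullet> ?w) {0..1}" by (simp only: c(3,4))
      then have "p \<bullet> ?w \<le> len * (1 + C * len / m\<^sup>2)"
      proof (rule has_integral_le)
        show "((\<lambda>t. G (c t) (velocity c t) * (1 + C * len / m\<^sup>2)) has_integral len * (1 + C * len / m\<^sup>2)) {0..1}"
          unfolding len_def by (intro has_integral_mult_left integrable_integral integrable_G(2)[OF cc c(2)])
        fix t :: real assume t: "t \<in> {0..1}"
        let ?v = "velocity c t"
        have ct: "c t \<in> Ball3" using c(2) t by blast
        have "norm (c t - x) \<le> len / m" using m(3)[OF c(1,2) t] m(1) c(3) by (simp add: len_def field_simps)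
        moreover have "norm ?v \<le> G (c t) ?v / m" using m(2)[OF ct, of ?v] m(1) by (simp add: field_simps)
        ultimately have "C * norm (c t - x) * norm ?v \<le> C * (len / m) * (G (c t) ?v / m)"
          using C(1) len0 m(1) by (intro mult_mono mult_left_mono) auto
        then have "G x ?v \<le> G (c t) ?v + C * (len / m) * (G (c t) ?v / m)"
          using C(2)[OF ct xy(1), of ?v] by linarith
        then show "p \<bullet> ?v \<le> G (c t) ?v * (1 + C * len / m\<^sup>2)"
          using p[of ?v] by (simp add: algebra_simps power2_eq_square)
      qed
      also have "\<dots> = len + C / m\<^sup>2 * len\<^sup>2" by (simp add: algebra_simps power2_eq_square)
      also have "C / m\<^sup>2 * len\<^sup>2 \<le> C / m\<^sup>2 * (B * norm ?w)\<^sup>2"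
        using len len0 C(1) by (intro mult_left_mono power_mono) auto
      also have "\<dots> = K * (norm ?w)\<^sup>2" by (simp add: K_def power_mult_distrib)
      finally show ?thesis using c(5) pw by (simp add: len_def \<delta>_def)
    qed
    from field_le_epsilon[OF this] show ?thesis by simp
  qed
  moreover have "K \<ge> 0" using C(1) by (simp add: K_def)
  ultimately show ?thesis using that by blast
qed

end

lemma derivative_zero_at_extremum:
  fixes f :: "real \<Rightarrow> real"
  assumes "(f has_real_derivative D) (at x)" "(\<forall>y. f x \<le> f y) \<or> (\<forall>y. f y \<le> f x)"
  shows "D = 0"
  using assms DERIV_local_min[of f D x 1] DERIV_local_max[of f D x 1] by auto

section \<open>The induced distance as a metric with minimizers\<close>

context Finsler_ball
begin

lemma d_sym_le:
  assumes "x \<in> Ball3" "y \<in> Ball3" shows "d y x \<le> d x y"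
proof (rule field_le_epsilon)
  fix \<epsilon> :: real assume "\<epsilon> > 0"
  then obtain c where c: "smooth_map_on {0..1} c" "c ` {0..1} \<subseteq> Ball3" "c 0 = x" "c 1 = y"
    "integral {0..1} (\<lambda>t. G (c t) (velocity c t)) < d x y + \<epsilon>" using d_near[OF assms] by blast
  obtain V k where V: "open V" "{0..1} \<subseteq> V" "Cinf_on V k" "\<And>t. t \<in> {0..1} \<Longrightarrow> c t = k t"
    using c(1) unfolding smooth_map_on_iff_Cinf by blast
  define W where "W = (\<lambda>t. 1 - t) -` V"
  have W: "open W" unfolding W_def by (intro open_vimage V continuous_intros)
  have W01: "{0..1} \<subseteq> W"
  proof
    fix t :: real assume "t \<in> {0..1}"
    then have "1 - t \<in> {0..1}" by auto
    then show "t \<in> W" using V(2) unfolding W_def by blast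
  qed
  have "Cinf_on W (\<lambda>t. k (1 - t))"
    by (rule Cinf_on_compose[OF W V(1,3) Cinf_on_diff[OF W Cinf_on_const Cinf_on_id[OF W]]])
       (simp add: W_def)
  then have s: "smooth_map_on {0..1} (\<lambda>t. c (1 - t))"
    by (rule smooth_map_onI[OF W W01]) (use V(4) in auto)
  note cc = smooth_map_on_C1_curve[OF c(1)]
  have v: "velocity (\<lambda>t. c (1 - t)) t = - velocity c (1 - t)" if t: "t \<in> {0..1}" for t
  proof (rule vector_derivative_within_closed_interval)
    have 1: "((\<lambda>t::real. 1 - t) has_vector_derivative - 1) (at t within {0..1})"
      by (auto intro!: derivative_eq_intros)
    have 2: "(c has_vector_derivative velocity c (1 - t)) (at (1 - t) within (\<lambda>t. 1 - t) ` {0..1})"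
      using cc t unfolding C1_curve_def by (auto intro: has_vector_derivative_within_subset)
    from vector_diff_chain_within[OF 1 2]
    show "((\<lambda>t. c (1 - t)) has_vector_derivative - velocity c (1 - t)) (at t within {0..1})"
      by (simp add: o_def)
  qed (use t in auto)
  have im: "(\<lambda>t. c (1 - t)) ` {0..1} \<subseteq> Ball3"
  proof (rule image_subsetI)
    fix t :: real assume "t \<in> {0..1}"
    then have "1 - t \<in> {0..1}" by auto
    then show "c (1 - t) \<in> Ball3" using c(2) by blast
  qed
  let ?L = "\<lambda>t. G (c t) (velocity c t)"
  have "((\<lambda>t. (- 1) * ?L (1 - t)) has_integral (integral {0..1 - 1} ?L - integral {0..1 - 0} ?L)) {0..1::real}"
    by (rule reparametrized_integral[OF _ integrable_G(1)[OF cc c(2)]]) (auto intro!: derivative_eq_intros)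
  then have "((\<lambda>t. - ((- 1) * ?L (1 - t))) has_integral - (0 - integral {0..1} ?L)) {0..1::real}"
    by (intro has_integral_neg) simp
  then have int: "((\<lambda>t. ?L (1 - t)) has_integral integral {0..1} ?L) {0..1::real}" by simp
  have "?L (1 - t) = G (c (1 - t)) (velocity (\<lambda>t. c (1 - t)) t)" if t: "t \<in> {0..1}" for t
  proof -
    have "c (1 - t) \<in> Ball3" using im t by blast
    then show ?thesis unfolding v[OF t] by (simp only: G_minus)
  qed
  from has_integral_eq[OF this int] have "integral {0..1} (\<lambda>t. G (c (1 - t)) (velocity (\<lambda>t. c (1 - t)) t)) = integral {0..1} ?L"
    by (rule integral_unique)
  moreover have "d y x \<le> integral {0..1} (\<lambda>t. G (c (1 - t)) (velocity (\<lambda>t. c (1 - t)) t))"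
    by (rule d_le_length[OF s im]) (use c in auto)
  ultimately show "d y x \<le> d x y + \<epsilon>" using c(5) by simp
qed

lemma d_sym: "x \<in> Ball3 \<Longrightarrow> y \<in> Ball3 \<Longrightarrow> d x y = d y x"
  using d_sym_le by (metis antisym)

text \<open>The smooth step slows the two curves down near the common point so that their
  concatenation is smooth.\<close>

lemma d_triangle:
  assumes xyz: "x \<in> Ball3" "y \<in> Ball3" "z \<in> Ball3"
  shows "d x z \<le> d x y + d y z"
proof (rule field_le_epsilon)
  fix \<epsilon> :: real assume "\<epsilon> > 0"
  then have e2: "\<epsilon> / 2 > 0" by simp
  obtain c1 where c1: "smooth_map_on {0..1} c1" "c1 ` {0..1} \<subseteq> Ball3" "c1 0 = x" "c1 1 = y"
    "integral {0..1} (\<lambda>t. G (c1 t) (velocity c1 t)) < d x y + \<epsilon> / 2" using d_near[OF xyz(1,2) e2] by blast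
  obtain c2 where c2: "smooth_map_on {0..1} c2" "c2 ` {0..1} \<subseteq> Ball3" "c2 0 = y" "c2 1 = z"
    "integral {0..1} (\<lambda>t. G (c2 t) (velocity c2 t)) < d y z + \<epsilon> / 2" using d_near[OF xyz(2,3) e2] by blast
  obtain \<theta> \<theta>' where \<theta>: "Cinf_on UNIV \<theta>" "\<And>t. (\<theta> has_real_derivative \<theta>' t) (at t)" "\<And>t. \<theta>' t \<ge> 0"
    "continuous_on UNIV \<theta>'" "\<And>t. t \<le> 0 \<Longrightarrow> \<theta> t = 0" "\<And>t. t \<ge> 1 \<Longrightarrow> \<theta> t = 1" "\<And>t. 0 \<le> \<theta> t" "\<And>t. \<theta> t \<le> 1"
    using smooth_step by blast
  \<comment> \<open>At these points \<open>\<theta>\<close> attains its minimum 0 or its maximum 1;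
    hence the resting piece contributes no velocity, including at the junction.\<close>
  have \<theta>0: "\<theta>' t = 0" if "t \<le> 0 \<or> t \<ge> 1" for t
    by (rule derivative_zero_at_extremum[OF \<theta>(2)]) (use that \<theta>(5-8) in auto)
  have smooth_piece: "Cinf_on UNIV (\<lambda>t. k (\<theta> (2 * t - j)))"
    if V: "open V" "{0..1} \<subseteq> V" "Cinf_on V k" for V and k :: "real \<Rightarrow> real^3" and j
  proof (rule Cinf_on_compose[OF open_UNIV V(1,3)])
    show "Cinf_on UNIV (\<lambda>t. \<theta> (2 * t - j))"
      by (rule Cinf_on_compose[OF open_UNIV open_UNIV \<theta>(1) Cinf_on_diff[OF open_UNIV
            Cinf_on_linear[OF open_UNIV bounded_linear_mult_right] Cinf_on_const]]) simp
    show "\<theta> (2 * t - j) \<in> V" for t using V(2) \<theta>(7,8) by (simp add: subset_eq)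
  qed
  obtain V1 k1 where V1: "open V1" "{0..1} \<subseteq> V1" "Cinf_on V1 k1" "\<And>t. t \<in> {0..1} \<Longrightarrow> c1 t = k1 t"
    using c1(1) unfolding smooth_map_on_iff_Cinf by blast
  obtain V2 k2 where V2: "open V2" "{0..1} \<subseteq> V2" "Cinf_on V2 k2" "\<And>t. t \<in> {0..1} \<Longrightarrow> c2 t = k2 t"
    using c2(1) unfolding smooth_map_on_iff_Cinf by blast
  \<comment> \<open>On each half one of the two summands rests at the common point \<open>y\<close>,
    so subtracting \<open>y\<close> leaves the other one; as a sum of smooth curves,
    \<open>c\<close> is smooth without any matching at 1/2.\<close>
  define c where "c t = c1 (\<theta> (2 * t - 0)) + c2 (\<theta> (2 * t - 1)) - y" for t
  have \<theta>01: "\<theta> t \<in> {0..1}" for t using \<theta>(7,8) by simp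
  have c_eq: "c = (\<lambda>t. k1 (\<theta> (2 * t - 0)) + k2 (\<theta> (2 * t - 1)) - y)"
    unfolding c_def by (intro ext) (simp only: V1(4)[OF \<theta>01] V2(4)[OF \<theta>01])
  have smooth: "smooth_map_on {0..1} c"
  proof (rule smooth_map_onI[OF open_UNIV subset_UNIV])
    show "Cinf_on UNIV c" unfolding c_eq
      by (intro Cinf_on_diff Cinf_on_add smooth_piece[OF V1(1-3)] smooth_piece[OF V2(1-3)] open_UNIV Cinf_on_const)
  qed simp
  have left: "c t = c1 (\<theta> (2 * t))" if "t \<le> 1/2" for t
    unfolding c_def using \<theta>(5)[of "2 * t - 1"] that by (simp add: c2(3))
  have right: "c t = c2 (\<theta> (2 * t - 1))" if "t \<ge> 1/2" for t
    unfolding c_def using \<theta>(6)[of "2 * t"] that by (simp add: c1(4))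
  have im: "c ` {0..1} \<subseteq> Ball3"
  proof (rule image_subsetI)
    fix t :: real
    show "c t \<in> Ball3"
      using left[of t] right[of t] c1(2) c2(2) \<theta>01 by (metis image_subset_iff linear)
  qed
  have piece: "((\<lambda>t. p (\<theta> (2 * t - j))) has_vector_derivative (2 * \<theta>' (2 * t - j)) *\<^sub>R velocity p (\<theta> (2 * t - j))) (at t)"
    if p: "smooth_map_on {0..1} p" for p j t
  proof -
    have "((\<lambda>t. \<theta> (2 * t - j)) has_real_derivative \<theta>' (2 * t - j) * 2) (at t)"
      by (rule DERIV_chain2[OF \<theta>(2)]) (auto intro!: derivative_eq_intros)
    then have 1: "((\<lambda>t. \<theta> (2 * t - j)) has_vector_derivative \<theta>' (2 * t - j) * 2) (at t)"
      by (simp add: has_real_derivative_iff_has_vector_derivative)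
    have "(p has_vector_derivative velocity p (\<theta> (2 * t - j))) (at (\<theta> (2 * t - j)) within {0..1})"
      using smooth_map_on_C1_curve[OF p] \<theta>01 unfolding C1_curve_def by blast
    then have 2: "(p has_vector_derivative velocity p (\<theta> (2 * t - j))) (at (\<theta> (2 * t - j)) within range (\<lambda>t. \<theta> (2 * t - j)))"
      by (rule has_vector_derivative_within_subset) (use \<theta>01 in blast)
    from vector_diff_chain_within[OF 1 2] show ?thesis by (simp add: o_def mult.commute)
  qed
  let ?v = "\<lambda>t. (2 * \<theta>' (2 * t - 0)) *\<^sub>R velocity c1 (\<theta> (2 * t - 0)) + (2 * \<theta>' (2 * t - 1)) *\<^sub>R velocity c2 (\<theta> (2 * t - 1)) - 0"
  have vel: "velocity c t = ?v t" if t: "t \<in> {0..1}" for t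
  proof (rule vector_derivative_within_closed_interval)
    have "(c has_vector_derivative ?v t) (at t)" unfolding c_def[abs_def]
      by (intro has_vector_derivative_diff has_vector_derivative_add piece c1(1) c2(1) has_vector_derivative_const)
    then show "(c has_vector_derivative ?v t) (at t within {0..1})" by (rule has_vector_derivative_at_within)
  qed (use t in auto)
  let ?L1 = "\<lambda>t. G (c1 t) (velocity c1 t)" and ?L2 = "\<lambda>t. G (c2 t) (velocity c2 t)"
  let ?L = "\<lambda>t. G (c t) (velocity c t)"
  have int: "((\<lambda>t. (\<theta>' (2 * t - j) * 2) * K (\<theta> (2 * t - j))) has_integral
      integral {0..\<theta> (2 * b - j)} K - integral {0..\<theta> (2 * a - j)} K) {a..b}"
    if "a \<le> b" "continuous_on {0..1} K" for a b j and K :: "real \<Rightarrow> real"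
  proof (rule reparametrized_integral[OF that])
    show "((\<lambda>t. \<theta> (2 * t - j)) has_real_derivative \<theta>' (2 * t - j) * 2) (at t within {a..b})" for t
      by (rule has_field_derivative_at_within, rule DERIV_chain2[OF \<theta>(2)]) (auto intro!: derivative_eq_intros)
  qed (rule \<theta>01)
  have I1: "(?L has_integral integral {0..1} ?L1) {0..1/2}"
  proof (rule has_integral_eq)
    show "((\<lambda>t. (\<theta>' (2 * t - 0) * 2) * ?L1 (\<theta> (2 * t - 0))) has_integral integral {0..1} ?L1) {0..1/2}"
      using int[of 0 "1/2" ?L1 0] integrable_G(1)[OF smooth_map_on_C1_curve[OF c1(1)] c1(2)]
      by (simp add: \<theta>(5)[of 0] \<theta>(6)[of 1])
    fix t :: real assume t: "t \<in> {0..1/2}"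
    have b: "c1 (\<theta> (2 * t)) \<in> Ball3" using c1(2) \<theta>01 by blast
    have "velocity c t = (2 * \<theta>' (2 * t)) *\<^sub>R velocity c1 (\<theta> (2 * t))"
      using vel[of t] \<theta>0[of "2 * t - 1"] t by simp
    then show "(\<theta>' (2 * t - 0) * 2) * ?L1 (\<theta> (2 * t - 0)) = ?L t"
      using left[of t] t \<theta>(3)[of "2 * t"] G_scale[OF b] by simp
  qed
  have I2: "(?L has_integral integral {0..1} ?L2) {1/2..1}"
  proof (rule has_integral_eq)
    show "((\<lambda>t. (\<theta>' (2 * t - 1) * 2) * ?L2 (\<theta> (2 * t - 1))) has_integral integral {0..1} ?L2) {1/2..1}"
      using int[of "1/2" 1 ?L2 1] integrable_G(1)[OF smooth_map_on_C1_curve[OF c2(1)] c2(2)]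
      by (simp add: \<theta>(5)[of 0] \<theta>(6)[of 1])
    fix t :: real assume t: "t \<in> {1/2..1}"
    have b: "c2 (\<theta> (2 * t - 1)) \<in> Ball3" using c2(2) \<theta>01 by blast
    have "velocity c t = (2 * \<theta>' (2 * t - 1)) *\<^sub>R velocity c2 (\<theta> (2 * t - 1))"
      using vel[of t] \<theta>0[of "2 * t"] t by simp
    then show "(\<theta>' (2 * t - 1) * 2) * ?L2 (\<theta> (2 * t - 1)) = ?L t"
      using right[of t] t \<theta>(3)[of "2 * t - 1"] G_scale[OF b] by simp
  qed
  have "(?L has_integral integral {0..1} ?L1 + integral {0..1} ?L2) {0..1}"
    by (rule has_integral_combine[OF _ _ I1 I2]) auto
  then have "integral {0..1} ?L = integral {0..1} ?L1 + integral {0..1} ?L2" by (rule integral_unique)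
  moreover have "d x z \<le> integral {0..1} ?L"
    by (rule d_le_length[OF smooth im])
       (use left[of 0] right[of 1] \<theta>(5)[of 0] \<theta>(6)[of 1] c1(3) c2(4) in auto)
  ultimately show "d x z \<le> d x y + d y z + \<epsilon>" using c1(5) c2(5) by simp
qed

lemma d_lipschitz:
  obtains K where "0 \<le> K" "\<And>x y. x \<in> Ball3 \<Longrightarrow> y \<in> Ball3 \<Longrightarrow> d x y \<le> K * norm (x - y)"
proof -
  obtain m M where M: "0 < M" "\<And>x v. x \<in> Ball3 \<Longrightarrow> G x v \<le> M * norm v" using G_bounds by metis
  obtain C where C: "0 \<le> C" "\<And>x y. x \<in> Ball3 \<Longrightarrow> y \<in> Ball3 \<Longrightarrow> d x y \<le> G x (y - x) + C * (norm (y - x))\<^sup>2"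
    using d_upper by blast
  have "d x y \<le> (M + 2 * C) * norm (x - y)" if xy: "x \<in> Ball3" "y \<in> Ball3" for x y
  proof -
    have n2: "norm (y - x) \<le> 2" using xy norm_triangle_ineq4[of y x] by simp
    have "C * (norm (y - x))\<^sup>2 \<le> C * (2 * norm (y - x))"
      unfolding power2_eq_square using n2 C(1) by (intro mult_left_mono mult_right_mono) auto
    then show ?thesis using C(2)[OF xy] M(2)[OF xy(1), of "y - x"] by (simp add: algebra_simps norm_minus_commute)
  qed
  moreover have "M + 2 * C \<ge> 0" using M C by simp
  ultimately show ?thesis using that by blast
qed

lemma d_continuous:
  assumes "x \<in> Ball3" "continuous_on S c" "c ` S \<subseteq> Ball3"
  shows "continuous_on S (\<lambda>t. d x (c t))"
proof -
  obtain K where K: "0 \<le> K" "\<And>x y. x \<in> Ball3 \<Longrightarrow> y \<in> Ball3 \<Longrightarrow> d x y \<le> K * norm (x - y)"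
    using d_lipschitz by blast
  have "K-lipschitz_on Ball3 (d x)"
  proof (rule lipschitz_onI[OF _ K(1)])
    fix y z :: "real^3" assume yz: "y \<in> Ball3" "z \<in> Ball3"
    show "dist (d x y) (d x z) \<le> K * dist y z"
      using d_triangle[OF assms(1) yz] d_triangle[OF assms(1) yz(2,1)] K(2)[OF yz] d_sym[OF yz]
      unfolding dist_real_def dist_norm by linarith
  qed
  from lipschitz_on_continuous_on[OF this] show ?thesis
    using assms(2,3) by (rule continuous_on_compose2)
qed

text \<open>The infimum defining \<open>d\<close> runs over smooth curves only. Instead of smoothing
  \<open>c\<close>, one shows that distance minus length has nonpositive right slopes: by
  \<open>d_upper\<close>, the distance grows at most at the rate
  \<open>G (c t) (c' t)\<close>.\<close>

lemma d_le_C1_length: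
  assumes ab: "a \<le> b" and c: "C1_curve a b c c'" "c ` {a..b} \<subseteq> Ball3"
  shows "d (c a) (c b) \<le> integral {a..b} (\<lambda>t. G (c t) (c' t))"
proof -
  let ?L = "\<lambda>t. G (c t) (c' t)"
  define f where "f t = d (c a) (c t) - integral {a..t} ?L" for t
  note L = integrable_G[OF c]
  have B: "c t \<in> Ball3" if "t \<in> {a..b}" for t using c(2) that by blast
  obtain C where C: "0 \<le> C" "\<And>x y. x \<in> Ball3 \<Longrightarrow> y \<in> Ball3 \<Longrightarrow> d x y \<le> G x (y - x) + C * (norm (y - x))\<^sup>2"
    using d_upper by blast
  have "f b \<le> f a"
  proof (rule nonincreasing_if_right_slopes_nonpos[OF ab])
    show "continuous_on {a..b} f" unfolding f_def
      using ab by (intro continuous_intros d_continuous B C1_curve_continuous[OF c(1)] c(2)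
          indefinite_integral_continuous_1 L(2)) auto
    fix t \<epsilon> :: real assume t: "a \<le> t" "t < b" and \<epsilon>: "\<epsilon> > 0"
    then have tab: "t \<in> {a..b}" by auto
    let ?u = "\<lambda>s. (c s - c t) /\<^sub>R (s - t)"
    let ?I = "\<lambda>s. integral {a..s} ?L"
    have sub: "{t<..b} \<subseteq> {a..b}" using t by auto
    have u: "(?u \<longlongrightarrow> c' t) (at t within {t<..b})"
      using has_vector_derivative_quotient[OF has_vector_derivative_within_subset[OF _ sub]]
        c(1) tab unfolding C1_curve_def by blast
    have I: "((\<lambda>s. (?I s - ?I t) /\<^sub>R (s - t)) \<longlongrightarrow> ?L t) (at t within {t<..b})"
      by (rule has_vector_derivative_quotient[OF has_vector_derivative_within_subset[OF _ sub]])
         (rule integral_has_vector_derivative[OF L(1) tab])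
    have "continuous_on UNIV (G (c t))"
      using G_continuous[of UNIV "\<lambda>_. c t" "\<lambda>v. v"] B[OF tab] by auto
    then have "isCont (G (c t)) (c' t)" by (simp add: continuous_on_eq_continuous_at)
    then have Gu: "((\<lambda>s. G (c t) (?u s)) \<longlongrightarrow> ?L t) (at t within {t<..b})"
      by (rule isCont_tendsto_compose[OF _ u])
    have "((\<lambda>s. G (c t) (?u s) + C * (s - t) * (norm (?u s))\<^sup>2 - (?I s - ?I t) /\<^sub>R (s - t)) \<longlongrightarrow>
        ?L t + C * (t - t) * (norm (c' t))\<^sup>2 - ?L t) (at t within {t<..b})"
      by (intro tendsto_intros Gu I u)
    then have lim: "((\<lambda>s. G (c t) (?u s) + C * (s - t) * (norm (?u s))\<^sup>2 - (?I s - ?I t) /\<^sub>R (s - t)) \<longlongrightarrow> 0)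
        (at t within {t<..b})" by simp
    have "\<forall>\<^sub>F s in at t within {t<..b}.
        G (c t) (?u s) + C * (s - t) * (norm (?u s))\<^sup>2 - (?I s - ?I t) /\<^sub>R (s - t) < \<epsilon>"
      using order_tendstoD(2)[OF lim \<epsilon>] .
    then have "\<forall>\<^sub>F s in at t within {t<..b}. f s - f t \<le> \<epsilon> * (s - t)"
      unfolding eventually_at_filter
    proof eventually_elim
      case (elim s)
      show ?case
      proof (intro impI)
        assume "s \<noteq> t" "s \<in> {t<..b}"
        then have s: "s > t" "s \<in> {a..b}" using t by auto
        have lt: "G (c t) (?u s) + C * (s - t) * (norm (?u s))\<^sup>2 - (?I s - ?I t) /\<^sub>R (s - t) < \<epsilon>"
          using elim \<open>s \<noteq> t\<close> \<open>s \<in> {t<..b}\<close> by blast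
        define u where "u = ?u s"
        have cs: "c s - c t = (s - t) *\<^sub>R u" using s by (simp add: u_def)
        have "d (c t) (c s) \<le> G (c t) ((s - t) *\<^sub>R u) + C * (norm ((s - t) *\<^sub>R u))\<^sup>2"
          using C(2)[OF B[OF tab] B[OF s(2)]] unfolding cs .
        also have "G (c t) ((s - t) *\<^sub>R u) = (s - t) * G (c t) u"
          using G_scale[OF B[OF tab], of "s - t" u] s(1) by simp
        also have "(s - t) * G (c t) u + C * (norm ((s - t) *\<^sub>R u))\<^sup>2
            = (s - t) * (G (c t) u + C * (s - t) * (norm u)\<^sup>2)"
          by (simp add: power_mult_distrib) (simp add: power2_eq_square algebra_simps)
        also have "\<dots> \<le> (s - t) * (\<epsilon> + (?I s - ?I t) /\<^sub>R (s - t))"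
          using lt s(1) unfolding u_def by (intro mult_left_mono) auto
        also have "\<dots> = \<epsilon> * (s - t) + (?I s - ?I t)" using s(1) by (simp add: field_simps)
        finally have "d (c t) (c s) \<le> \<epsilon> * (s - t) + (?I s - ?I t)" .
        moreover have "d (c a) (c s) \<le> d (c a) (c t) + d (c t) (c s)"
          by (rule d_triangle) (use B s tab ab in auto)
        ultimately show "f s - f t \<le> \<epsilon> * (s - t)" by (simp add: f_def)
      qed
    qed
    moreover have "at t within {t<..b} = at_right t"
      by (rule at_within_nhd[of t "{..<b}"]) (use t in auto)
    ultimately show "\<forall>\<^sub>F s in at_right t. f s - f t \<le> \<epsilon> * (s - t)" by simp
  qed
  moreover have "c a \<in> Ball3" using B ab by simp
  ultimately show ?thesis using ab by (simp add: f_def d_refl)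
qed

text \<open>The larger of the two distances attains a minimum on the compact ball. Cutting nearly
  minimal curves at half their length shows that it is at most half of \<open>d x y\<close>, and the
  triangle inequality then forces both equalities.\<close>

lemma d_midpoint:
  assumes xy: "x \<in> Ball3" "y \<in> Ball3"
  obtains m where "m \<in> Ball3" "d x m = d x y / 2" "d m y = d x y / 2"
proof -
  let ?h = "\<lambda>m. max (d x m) (d m y)"
  have cont: "continuous_on Ball3 ?h"
  proof -
    have 1: "continuous_on Ball3 (d x)" by (rule d_continuous[OF xy(1) continuous_on_id]) auto
    have "continuous_on Ball3 (\<lambda>m. d y m)" by (rule d_continuous[OF xy(2) continuous_on_id]) auto
    then have "continuous_on Ball3 (\<lambda>m. d m y)"
      by (rule continuous_on_eq) (use d_sym xy in blast)
    with 1 show ?thesis by (intro continuous_on_max)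
  qed
  obtain m where m: "m \<in> Ball3" "\<And>p. p \<in> Ball3 \<Longrightarrow> ?h m \<le> ?h p"
    using continuous_attains_inf[OF compact_cball _ cont] by auto
  have "?h m \<le> d x y / 2"
  proof (rule field_le_epsilon)
    fix \<epsilon> :: real assume "\<epsilon> > 0"
    then obtain c where c: "smooth_map_on {0..1} c" "c ` {0..1} \<subseteq> Ball3" "c 0 = x" "c 1 = y"
      "integral {0..1} (\<lambda>t. G (c t) (velocity c t)) < d x y + \<epsilon>" using d_near[OF xy] by blast
    let ?L = "\<lambda>t. G (c t) (velocity c t)"
    note cc = smooth_map_on_C1_curve[OF c(1)]
    note L = integrable_G[OF cc c(2)]
    have "continuous_on {0..1} (\<lambda>s. integral {0..s} ?L)" by (rule indefinite_integral_continuous_1[OF L(2)])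
    moreover have "integral {0..0} ?L \<le> integral {0..1} ?L / 2" "integral {0..1} ?L / 2 \<le> integral {0..1} ?L"
      using d_le_length[OF c(1-4)] d_nonneg[OF xy] by auto
    ultimately obtain s where s: "0 \<le> s" "s \<le> 1" "integral {0..s} ?L = integral {0..1} ?L / 2"
      using IVT'[of "\<lambda>s. integral {0..s} ?L" 0 "integral {0..1} ?L / 2" 1] by auto
    have "integral {0..s} ?L + integral {s..1} ?L = integral {0..1} ?L"
      by (rule Henstock_Kurzweil_Integration.integral_combine[OF s(1,2) L(2)])
    moreover have "d (c 0) (c s) \<le> integral {0..s} ?L"
      by (rule d_le_C1_length[OF s(1) C1_curve_subset[OF cc] order_trans[OF image_mono c(2)]]) (use s in auto)
    moreover have "d (c s) (c 1) \<le> integral {s..1} ?L"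
      by (rule d_le_C1_length[OF s(2) C1_curve_subset[OF cc] order_trans[OF image_mono c(2)]]) (use s in auto)
    moreover have "c s \<in> Ball3" using c(2) s(1,2) by force
    ultimately have "c s \<in> Ball3" "?h (c s) \<le> integral {0..1} ?L / 2" using s(3) c(3,4) by simp_all
    with m(2)[of "c s"] have "?h m \<le> integral {0..1} ?L / 2" by linarith
    then show "?h m \<le> d x y / 2 + \<epsilon>" using c(5) \<open>\<epsilon> > 0\<close> by linarith
  qed
  then have "d x m \<le> d x y / 2" "d m y \<le> d x y / 2" by simp_all
  then have "d x m = d x y / 2" "d m y = d x y / 2" using d_triangle[OF xy(1) m(1) xy(2)] by linarith+
  then show ?thesis using that m(1) by blast
qed

text \<open>A maximal subset of the ball on which the distance from \<open>x\<close> is an isometry into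
  \<open>{0..d x y}\<close> is closed and, by the existence of midpoints, has no gaps.\<close>

lemma minimal_geodesic:
  assumes xy: "x \<in> Ball3" "y \<in> Ball3"
  obtains c where "c 0 = x" "c (d x y) = y" "\<And>t. t \<in> {0..d x y} \<Longrightarrow> c t \<in> Ball3"
    "\<And>s t. s \<in> {0..d x y} \<Longrightarrow> t \<in> {0..d x y} \<Longrightarrow> d (c s) (c t) = \<bar>s - t\<bar>"
proof -
  let ?l = "d x y"
  define P where "P A \<longleftrightarrow> A \<subseteq> Ball3 \<and> x \<in> A \<and> y \<in> A \<and> (\<forall>p\<in>A. d x p \<le> ?l) \<and>
     (\<forall>p\<in>A. \<forall>q\<in>A. d p q = \<bar>d x p - d x q\<bar>)" for A
  have P0: "P {x, y}"
    using xy d_refl[OF xy(1)] d_refl[OF xy(2)] d_nonneg[OF xy] d_sym[OF xy] unfolding P_def by auto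
  have "\<exists>M\<in>Collect P. \<forall>X\<in>Collect P. M \<subseteq> X \<longrightarrow> X = M"
  proof (rule subset_Zorn_nonempty)
    show "Collect P \<noteq> {}" using P0 by auto
    fix \<C> assume C: "\<C> \<noteq> {}" "subset.chain (Collect P) \<C>"
    have CP: "\<And>A. A \<in> \<C> \<Longrightarrow> P A" using C(2) unfolding subset_chain_def by auto
    have two: "\<exists>A\<in>\<C>. p \<in> A \<and> q \<in> A" if "p \<in> \<Union>\<C>" "q \<in> \<Union>\<C>" for p q
      using that C(2) unfolding subset_chain_def by blast
    have "P (\<Union>\<C>)"
      unfolding P_def
    proof (intro conjI ballI)
      show "\<Union>\<C> \<subseteq> Ball3" using CP unfolding P_def by blast
      show "x \<in> \<Union>\<C>" "y \<in> \<Union>\<C>" using CP C(1) unfolding P_def by blast+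
      show "d x p \<le> ?l" if "p \<in> \<Union>\<C>" for p using CP that unfolding P_def by blast
      show "d p q = \<bar>d x p - d x q\<bar>" if "p \<in> \<Union>\<C>" "q \<in> \<Union>\<C>" for p q
        using two[OF that] CP unfolding P_def by blast
    qed
    then show "\<Union>\<C> \<in> Collect P" by simp
  qed
  then obtain A where A: "P A" "\<And>X. P X \<Longrightarrow> A \<subseteq> X \<Longrightarrow> X = A" by auto
  have AB: "A \<subseteq> Ball3" "x \<in> A" "y \<in> A" and Al: "\<And>p. p \<in> A \<Longrightarrow> d x p \<le> ?l"
    and Aiso: "\<And>p q. p \<in> A \<Longrightarrow> q \<in> A \<Longrightarrow> d p q = \<bar>d x p - d x q\<bar>"
    using A(1) unfolding P_def by blast+
  have cx: "continuous_on Ball3 (d p)" if "p \<in> Ball3" for p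
    by (rule d_continuous[OF that continuous_on_id]) auto
  \<comment> \<open>By maximality a point compatible with all of \<open>A\<close> already belongs to
    \<open>A\<close>; both the topological closedness of \<open>A\<close> and the filling of gaps
    rest on this.\<close>
  have closed: "q \<in> A" if q: "q \<in> Ball3" "\<And>p. p \<in> A \<Longrightarrow> d p q = \<bar>d x p - d x q\<bar>" "d x q \<le> ?l" for q
  proof -
    have "P (insert q A)"
      unfolding P_def
    proof (intro conjI ballI)
      show "d a b = \<bar>d x a - d x b\<bar>" if "a \<in> insert q A" "b \<in> insert q A" for a b
      proof -
        have qq: "d q q = \<bar>d x q - d x q\<bar>" using d_refl[OF q(1)] by simp
        have qp: "d q p = \<bar>d x q - d x p\<bar>" if "p \<in> A" for p
          using q(2)[OF that] d_sym[OF q(1), of p] AB(1) that by (auto simp: abs_minus_commute)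
        show ?thesis using that Aiso q(2) qq qp by blast
      qed
    next
      show "insert q A \<subseteq> Ball3" "x \<in> insert q A" "y \<in> insert q A" using AB q(1) by blast+
      show "d x p \<le> ?l" if "p \<in> insert q A" for p using that Al q(3) by blast
    qed
    from A(2)[OF this] show ?thesis by blast
  qed
  have "compact A"
  proof -
    have c1: "closed {q \<in> Ball3. d p q = \<bar>d x p - d x q\<bar>}" if "p \<in> A" for p
    proof -
      have "p \<in> Ball3" using that AB(1) by blast
      then have "continuous_on Ball3 (\<lambda>q. d p q - \<bar>d x p - d x q\<bar>)"
        by (intro continuous_intros cx xy(1))
      from continuous_closed_preimage_constant[OF this closed_cball, of 0]
      show ?thesis by (simp only: eq_iff_diff_eq_0[of "d p _"])
    qed
    have c2: "closed {q \<in> Ball3. d x q \<le> ?l}"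
      by (intro continuous_on_closed_Collect_le cx[OF xy(1)] continuous_on_const closed_cball)
    have "A = (\<Inter>p\<in>A. {q \<in> Ball3. d p q = \<bar>d x p - d x q\<bar>}) \<inter> {q \<in> Ball3. d x q \<le> ?l}" (is "_ = ?S")
    proof (rule set_eqI)
      fix q
      show "q \<in> A \<longleftrightarrow> q \<in> ?S"
      proof
        assume "q \<in> A"
        then have "q \<in> Ball3" "d x q \<le> ?l" "\<And>p. p \<in> A \<Longrightarrow> d p q = \<bar>d x p - d x q\<bar>"
          using AB(1) Al Aiso by blast+
        then show "q \<in> ?S" by blast
      next
        assume "q \<in> ?S"
        then show "q \<in> A" by (intro closed) blast+
      qed
    qed
    moreover have "closed ?S" by (intro closed_Int closed_INT ballI c1 c2)
    ultimately have "closed A" by metis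
    then show ?thesis using AB(1) compact_Int_closed[OF compact_cball, of A 0 1] by (simp add: Int_absorb1)
  qed
  define R where "R = d x ` A"
  have "compact R" unfolding R_def
    by (rule compact_continuous_image[OF continuous_on_subset[OF cx] \<open>compact A\<close>]) (use xy AB in auto)
  have surj: "s \<in> R" if s: "s \<in> {0..?l}" for s
  proof (rule ccontr)
    assume sR: "s \<notin> R"
    \<comment> \<open>\<open>a\<close> and \<open>b\<close> are the ends of the gap of
      \<open>R\<close> around \<open>s\<close>. The midpoint of the corresponding points
      \<open>p\<close> and \<open>q\<close> is compatible with \<open>A\<close>, because every point
      of \<open>A\<close> lies at or beyond one end of the gap and is compared through
      \<open>p\<close> or \<open>q\<close>.\<close>
    have "compact (R \<inter> {..s})" "compact (R \<inter> {s..})"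
      by (intro compact_Int_closed \<open>compact R\<close> closed_atMost closed_atLeast)+
    moreover have "0 \<in> R \<inter> {..s}" "?l \<in> R \<inter> {s..}"
      using s AB(2,3) d_refl[OF xy(1)] unfolding R_def by (auto intro: rev_image_eqI)
    ultimately obtain a b where a: "a \<in> R \<inter> {..s}" "\<And>r. r \<in> R \<inter> {..s} \<Longrightarrow> r \<le> a"
      and b: "b \<in> R \<inter> {s..}" "\<And>r. r \<in> R \<inter> {s..} \<Longrightarrow> b \<le> r"
      using compact_attains_sup[of "R \<inter> {..s}"] compact_attains_inf[of "R \<inter> {s..}"] by blast
    have ab: "a < s" "s < b" using a(1) b(1) sR by (auto simp: less_le)
    obtain p q where p: "p \<in> A" "d x p = a" and q: "q \<in> A" "d x q = b" using a(1) b(1) unfolding R_def by blast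
    have pq: "p \<in> Ball3" "q \<in> Ball3" using p q AB by auto
    have dpq: "d p q = b - a" using Aiso[OF p(1) q(1)] p q ab by simp
    obtain m where m: "m \<in> Ball3" "d p m = (b - a) / 2" "d m q = (b - a) / 2"
      using d_midpoint[OF pq] unfolding dpq by blast
    have dxm: "d x m = (a + b) / 2"
      using d_triangle[OF xy(1) pq(1) m(1)] d_triangle[OF xy(1) m(1) pq(2)] p q m by (simp add: field_simps)
    have "m \<in> A"
    proof (rule closed[OF m(1)])
      show "d x m \<le> ?l" using dxm ab s Al[OF q(1)] q(2) by simp
      fix r assume r: "r \<in> A"
      have rB: "r \<in> Ball3" using r AB by auto
      have "d x r \<in> R" using r by (simp add: R_def)
      have low: "\<bar>d x r - d x m\<bar> \<le> d r m"
        using d_triangle[OF xy(1) rB m(1)] d_triangle[OF xy(1) m(1) rB] d_sym[OF rB m(1)] by linarith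
      have "d r m \<le> \<bar>d x r - d x m\<bar>"
      proof (cases "d x r \<le> s")
        case True
        then have "d x r \<le> a" using a(2) \<open>d x r \<in> R\<close> by auto
        then show ?thesis
          using d_triangle[OF rB pq(1) m(1)] Aiso[OF r p(1)] p m(2) dxm ab by (simp add: field_simps)
      next
        case False
        then have "b \<le> d x r" using b(2) \<open>d x r \<in> R\<close> by auto
        then show ?thesis
          using d_triangle[OF m(1) pq(2) rB] Aiso[OF q(1) r] q m(3) dxm ab d_sym[OF rB m(1)]
          by (simp add: field_simps)
      qed
      with low show "d r m = \<bar>d x r - d x m\<bar>" by simp
    qed
    then have "(a + b) / 2 \<in> R" using dxm by (auto simp: R_def intro: rev_image_eqI)
    then show False using a(2)[of "(a + b) / 2"] b(2)[of "(a + b) / 2"] ab by (cases "(a + b) / 2 \<le> s") auto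
  qed
  define c where "c t = (SOME p. p \<in> A \<and> d x p = t)" for t
  have c: "c t \<in> A" "d x (c t) = t" if "t \<in> {0..?l}" for t
    using someI_ex[of "\<lambda>p. p \<in> A \<and> d x p = t"] surj[OF that] unfolding c_def R_def by auto
  show ?thesis
  proof (rule that[of c])
    have l0: "0 \<le> ?l" by (rule d_nonneg[OF xy])
    show "c 0 = x" using c[of 0] l0 AB(1) d_eq_0[OF xy(1), of "c 0"] by auto
    show "c ?l = y"
      using c[of ?l] l0 Aiso[OF c(1)[of ?l] AB(3)] d_eq_0[of "c ?l" y] AB(1) xy by auto
    show "c t \<in> Ball3" if "t \<in> {0..?l}" for t using c(1)[OF that] AB(1) by blast
    show "d (c s) (c t) = \<bar>s - t\<bar>" if "s \<in> {0..?l}" "t \<in> {0..?l}" for s t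
      using Aiso[OF c(1)[OF that(1)] c(1)[OF that(2)]] c(2)[OF that(1)] c(2)[OF that(2)] by simp
  qed
qed

end

section \<open>Regularity of minimal curves\<close>

lemma half_differences:
  fixes x y :: "real^3"
  shows "x - (1/2) *\<^sub>R (x + y) = (1/2) *\<^sub>R (x - y)" "y - (1/2) *\<^sub>R (x + y) = - ((1/2) *\<^sub>R (x - y))"
  by (simp_all add: vec_eq_iff field_simps)

lemma uniform_limit_geometric:
  fixes f :: "nat \<Rightarrow> 'a \<Rightarrow> 'b::banach"
  assumes "0 \<le> r" "r < 1" "\<And>n x. x \<in> S \<Longrightarrow> norm (f (Suc n) x - f n x) \<le> A * r ^ n"
  obtains g where "uniform_limit S f g sequentially"
proof -
  have "uniform_limit S (\<lambda>n x. \<Sum>i<n. f (Suc i) x - f i x) (\<lambda>x. \<Sum>i. f (Suc i) x - f i x) sequentially"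
    by (rule Weierstrass_m_test[OF assms(3)]) (use assms(1,2) in \<open>auto intro!: summable_mult summable_geometric\<close>)
  moreover have tele: "(\<Sum>i<n. f (Suc i) x - f i x) = f n x - f 0 x" for n x
    by (rule sum_lessThan_telescope)
  ultimately have "uniform_limit S (\<lambda>n x. f n x - f 0 x) (\<lambda>x. \<Sum>i. f (Suc i) x - f i x) sequentially"
    by (simp only: tele)
  moreover have "uniform_limit S (\<lambda>n. f 0) (f 0) sequentially" by (rule uniform_limit_const)
  ultimately have "uniform_limit S (\<lambda>n x. (f n x - f 0 x) + f 0 x) (\<lambda>x. (\<Sum>i. f (Suc i) x - f i x) + f 0 x) sequentially"
    by (rule uniform_limit_add)
  then have "uniform_limit S f (\<lambda>x. (\<Sum>i. f (Suc i) x - f i x) + f 0 x) sequentially" by simp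
  then show ?thesis by (rule that)
qed

text \<open>The curve is the pointwise limit of the mean values \<open>(\<integral>\<^sub>t\<^sup>t\<^sup>+\<^sup>h c) / h\<close> along \<open>h = H / 2\<^sup>n\<close>,
  whose derivatives are the difference quotients of \<open>c\<close>.\<close>

lemma C1_curve_if_second_differences_small:
  fixes c :: "real \<Rightarrow> real^3"
  assumes H: "0 < H" "0 \<le> b" and cont: "continuous_on {0..b + H} c"
    and K: "\<And>t h. 0 \<le> t \<Longrightarrow> 0 < h \<Longrightarrow> t + 2 * h \<le> b + H \<Longrightarrow>
      norm ((c (t + h) - c t) /\<^sub>R h - (c (t + 2 * h) - c (t + h)) /\<^sub>R h) \<le> sqrt (K * h)"
  obtains V where "C1_curve 0 b c V"
proof -
  define h where "h n = H / 2 ^ n" for n :: nat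
  define D where "D n t = (c (t + h n) - c t) /\<^sub>R h n" for n t
  define \<Phi> where "\<Phi> t = integral {0..t} c" for t
  have h: "h n > 0" "h n \<le> H" "h n = 2 * h (Suc n)" for n using H by (auto simp: h_def field_simps)
  have h0: "h \<longlonglongrightarrow> 0"
  proof -
    have "(\<lambda>n. H * (1/2) ^ n) \<longlonglongrightarrow> H * 0" by (intro tendsto_intros LIMSEQ_realpow_zero) auto
    then show ?thesis by (simp add: h_def[abs_def] power_divide)
  qed
  \<comment> \<open>Halving the step multiplies the bound \<open>sqrt (K * h)\<close> by
    \<open>sqrt (1/2)\<close>, so the quotients along \<open>h n\<close> converge
    geometrically.\<close>
  define r where "r = sqrt (1/2)"
  have r: "0 \<le> r" "r < 1" by (auto simp: r_def real_sqrt_lt_1_iff)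
  have step: "norm (D (Suc n) t - D n t) \<le> sqrt \<bar>K * H\<bar> * r ^ n" if t: "t \<in> {0..b}" for n t
  proof -
    let ?k = "h (Suc n)"
    \<comment> \<open>The quotient with step \<open>h n\<close> is the mean of two adjacent
      quotients with half the step, whose difference is the quantity bounded in
      \<open>K\<close>.\<close>
    have "D n t = (1/2) *\<^sub>R ((c (t + ?k) - c t) /\<^sub>R ?k + (c (t + 2 * ?k) - c (t + ?k)) /\<^sub>R ?k)"
      using h(1)[of "Suc n"] unfolding D_def h(3)[of n] by (simp add: scaleR_add_right[symmetric])
    moreover have "D (Suc n) t = (c (t + ?k) - c t) /\<^sub>R ?k" by (simp add: D_def)
    ultimately have "D (Suc n) t - D n t = (1/2) *\<^sub>R ((c (t + ?k) - c t) /\<^sub>R ?k - (c (t + 2 * ?k) - c (t + ?k)) /\<^sub>R ?k)"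
      by (simp only: half_differences)
    then have "norm (D (Suc n) t - D n t) \<le> norm ((c (t + ?k) - c t) /\<^sub>R ?k - (c (t + 2 * ?k) - c (t + ?k)) /\<^sub>R ?k)"
      by simp
    also have "\<dots> \<le> sqrt (K * ?k)"
      by (rule K) (use t h[of n] h(1)[of "Suc n"] in auto)
    also have "\<dots> \<le> sqrt (\<bar>K * H\<bar> * (1/2) ^ n)"
    proof (rule real_sqrt_le_mono)
      have "K * ?k \<le> \<bar>K\<bar> * h n" using h(1)[of "Suc n"] h(3)[of n]
        by (intro mult_mono) auto
      also have "\<dots> = \<bar>K * H\<bar> * (1/2) ^ n" using H by (simp add: h_def abs_mult power_divide)
      finally show "K * ?k \<le> \<bar>K * H\<bar> * (1/2) ^ n" .
    qed
    also have "\<dots> = sqrt \<bar>K * H\<bar> * r ^ n" by (simp add: real_sqrt_mult real_sqrt_power r_def)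
    finally show ?thesis .
  qed
  obtain V where V: "uniform_limit {0..b} D V sequentially"
    by (rule uniform_limit_geometric[of r "{0..b}" D "sqrt \<bar>K * H\<bar>"]) (use r step in auto)
  have Dcont: "continuous_on {0..b} (D n)" for n unfolding D_def
    using h[of n] H by (intro continuous_intros continuous_on_compose2[OF cont]) auto
  have Vcont: "continuous_on {0..b} V"
    by (rule uniform_limit_theorem[OF _ V]) (simp_all add: Dcont)
  have \<Phi>: "(\<Phi> has_vector_derivative c t) (at t within {0..b + H})" if "t \<in> {0..b + H}" for t
    unfolding \<Phi>_def by (rule integral_has_vector_derivative[OF cont that])
  define F where "F n t = (\<Phi> (t + h n) - \<Phi> t) /\<^sub>R h n" for n t
  have F': "(F n has_derivative (\<lambda>a. a *\<^sub>R D n t)) (at t within {0..b})" if t: "t \<in> {0..b}" for n t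
  proof -
    have 1: "(\<Phi> has_vector_derivative c t) (at t within {0..b})"
      by (rule has_vector_derivative_within_subset[OF \<Phi>]) (use t H in auto)
    have 2: "((\<lambda>t. t + h n) has_vector_derivative 1) (at t within {0..b})"
      by (auto intro!: derivative_eq_intros)
    have 3: "(\<Phi> has_vector_derivative c (t + h n)) (at (t + h n) within (\<lambda>t. t + h n) ` {0..b})"
      by (rule has_vector_derivative_within_subset[OF \<Phi>]) (use t h[of n] in auto)
    have 4: "((\<lambda>t. \<Phi> (t + h n)) has_vector_derivative c (t + h n)) (at t within {0..b})"
      using vector_diff_chain_within[OF 2 3] by (simp add: o_def)
    have "((\<lambda>t. inverse (h n) *\<^sub>R (\<Phi> (t + h n) - \<Phi> t)) has_vector_derivative inverse (h n) *\<^sub>R (c (t + h n) - c t)) (at t within {0..b})"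
      by (intro bounded_linear.has_vector_derivative[OF bounded_linear_scaleR_right] has_vector_derivative_diff 4 1)
    then show ?thesis unfolding F_def D_def has_vector_derivative_def .
  qed
  have Fc: "(\<lambda>n. F n t) \<longlonglongrightarrow> c t" if t: "t \<in> {0..b}" for t
  proof -
    have tb: "t \<in> {0..b + H}" using t H by auto
    have fl: "filterlim (\<lambda>n. t + h n) (at t within {0..b + H}) sequentially"
      unfolding filterlim_at
    proof
      show "\<forall>\<^sub>F n in sequentially. t + h n \<in> {0..b + H} \<and> t + h n \<noteq> t"
      proof (rule always_eventually, intro allI conjI)
        fix n
        show "t + h n \<in> {0..b + H}" using h(1,2)[of n] t by auto
        show "t + h n \<noteq> t" using h(1)[of n] by simp
      qed
      have "(\<lambda>n. t + h n) \<longlonglongrightarrow> t + 0" by (intro tendsto_intros h0)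
      then show "(\<lambda>n. t + h n) \<longlonglongrightarrow> t" by simp
    qed
    from filterlim_compose[OF has_vector_derivative_quotient[OF \<Phi>[OF tb]] fl]
    show ?thesis by (simp add: F_def)
  qed
  have "\<exists>g. \<forall>t\<in>{0..b}. (\<lambda>n. F n t) \<longlonglongrightarrow> g t \<and> (g has_derivative (\<lambda>a. a *\<^sub>R V t)) (at t within {0..b})"
  proof (rule has_derivative_sequence[where S = "{0..b}" and f = F and f' = "\<lambda>n t a. a *\<^sub>R D n t"
        and g' = "\<lambda>t a. a *\<^sub>R V t" and ?x0.0 = 0 and l = "c 0"])
    show "convex {0..b}" by (rule convex_real_interval)
    show "(F n has_derivative (\<lambda>a. a *\<^sub>R D n t)) (at t within {0..b})" if "t \<in> {0..b}" for n t
      by (rule F'[OF that])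
    fix \<epsilon> :: real assume "\<epsilon> > 0"
    then have "\<forall>\<^sub>F n in sequentially. \<forall>t\<in>{0..b}. dist (D n t) (V t) < \<epsilon>"
      using V unfolding uniform_limit_iff by blast
    then show "\<forall>\<^sub>F n in sequentially. \<forall>t\<in>{0..b}. \<forall>a. norm (a *\<^sub>R D n t - a *\<^sub>R V t) \<le> \<epsilon> * norm a"
    proof eventually_elim
      case (elim n)
      show ?case
      proof (intro ballI allI)
        fix t a assume "t \<in> {0..b}"
        then have "norm (D n t - V t) \<le> \<epsilon>" using elim by (force simp: dist_norm)
        then show "norm (a *\<^sub>R D n t - a *\<^sub>R V t) \<le> \<epsilon> * norm a"
          unfolding scaleR_diff_right[symmetric] norm_scaleR real_norm_def
            by (subst mult.commute) (rule mult_right_mono, auto)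
      qed
    qed
  next
    show "0 \<in> {0..b}" using H by simp
    show "(\<lambda>n. F n 0) \<longlonglongrightarrow> c 0" using Fc H by simp
  qed
  then obtain g where g: "\<And>t. t \<in> {0..b} \<Longrightarrow> (\<lambda>n. F n t) \<longlonglongrightarrow> g t"
    "\<And>t. t \<in> {0..b} \<Longrightarrow> (g has_vector_derivative V t) (at t within {0..b})"
    unfolding has_vector_derivative_def by blast
  have "g t = c t" if "t \<in> {0..b}" for t using LIMSEQ_unique[OF g(1)[OF that] Fc[OF that]] .
  then have "(c has_vector_derivative V t) (at t within {0..b})" if "t \<in> {0..b}" for t
    by (metis has_vector_derivative_transform[OF that _ g(2)[OF that]])
  then show ?thesis using that Vcont unfolding C1_curve_def by blast
qed

section \<open>Minimizers are continuously differentiable\<close>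

context Finsler_ball
begin

lemma e_midpoint_convex:
  obtains \<kappa> where "\<kappa> > 0"
    "\<And>x u w. x \<in> Ball3 \<Longrightarrow>
       \<kappa> * (norm (u - w))\<^sup>2 \<le> ((G x u)\<^sup>2 + (G x w)\<^sup>2) / 2 - (G x ((1/2) *\<^sub>R (u + w)))\<^sup>2"
proof -
  obtain m M where m: "0 < m" "\<And>x v. x \<in> Ball3 \<Longrightarrow> m * norm v \<le> G x v" using G_bounds by metis
  obtain \<kappa> where \<kappa>: "\<kappa> > 0" "\<And>x v w. x \<in> Ball3 \<Longrightarrow> v \<noteq> 0 \<Longrightarrow>
       (G x w)\<^sup>2 / 2 \<ge> (G x v)\<^sup>2 / 2 + qm (x, v) \<bullet> (w - v) + \<kappa> * (norm (w - v))\<^sup>2"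
    using e_strongly_convex by blast
  define k where "k = min (\<kappa> / 2) (m\<^sup>2 / 4)"
  have k: "k > 0" using \<kappa>(1) m(1) by (simp add: k_def)
  have "k * (norm (u - w))\<^sup>2 \<le> ((G x u)\<^sup>2 + (G x w)\<^sup>2) / 2 - (G x ((1/2) *\<^sub>R (u + w)))\<^sup>2"
    if x: "x \<in> Ball3" for x u w
  proof (cases "u + w = 0")
    case True
    then have w: "w = - u" by (simp add: add_eq_0_iff)
    have "norm (u - w) = 2 * norm u" unfolding w by (simp add: scaleR_2[symmetric] del: scaleR_2)
    then have "k * (norm (u - w))\<^sup>2 = (4 * k) * (norm u)\<^sup>2" by (simp add: power_mult_distrib)
    also have "\<dots> \<le> m\<^sup>2 * (norm u)\<^sup>2" by (intro mult_right_mono) (auto simp: k_def)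
    also have "\<dots> = (m * norm u)\<^sup>2" by (simp add: power_mult_distrib)
    also have "\<dots> \<le> (G x u)\<^sup>2" using m(1) m(2)[OF x] by (intro power_mono) auto
    finally show ?thesis using G_zero[OF x] True by (simp add: w G_minus[OF x])
  next
    case False
    define v where "v = (1/2) *\<^sub>R (u + w)"
    have v: "v \<noteq> 0" using False by (simp add: v_def)
    have uv: "u - v = (1/2) *\<^sub>R (u - w)" and wv: "w - v = - ((1/2) *\<^sub>R (u - w))"
      by (simp_all only: v_def half_differences)
    have n: "\<kappa> * (norm (u - v))\<^sup>2 + \<kappa> * (norm (w - v))\<^sup>2 = (\<kappa> / 2) * (norm (u - w))\<^sup>2"
      unfolding uv wv by (simp add: power_divide)
    have "(G x u)\<^sup>2 / 2 + (G x w)\<^sup>2 / 2 \<ge> (G x v)\<^sup>2 + (qm (x, v) \<bullet> (u - v) + qm (x, v) \<bullet> (w - v)) + (\<kappa> / 2) * (norm (u - w))\<^sup>2"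
      unfolding n[symmetric] using \<kappa>(2)[OF x v, of u] \<kappa>(2)[OF x v, of w] by linarith
    moreover have "qm (x, v) \<bullet> (u - v) + qm (x, v) \<bullet> (w - v) = 0" unfolding uv wv by simp
    moreover have "k * (norm (u - w))\<^sup>2 \<le> (\<kappa> / 2) * (norm (u - w))\<^sup>2" by (intro mult_right_mono) (auto simp: k_def)
    ultimately have "k * (norm (u - w))\<^sup>2 \<le> (G x u)\<^sup>2 / 2 + (G x w)\<^sup>2 / 2 - (G x v)\<^sup>2" by linarith
    then show ?thesis unfolding v_def[symmetric] by (simp add: add_divide_distrib)
  qed
  then show ?thesis using that k by blast
qed

lemma minimal_lipschitz:
  obtains A where "A > 0" "\<And>l c s t. (\<And>t. t \<in> {0..l} \<Longrightarrow> c t \<in> Ball3) \<Longrightarrow>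
     (\<And>s t. s \<in> {0..l} \<Longrightarrow> t \<in> {0..l} \<Longrightarrow> d (c s) (c t) = \<bar>s - t\<bar>) \<Longrightarrow>
     s \<in> {0..l} \<Longrightarrow> t \<in> {0..l} \<Longrightarrow> norm (c s - c t) \<le> A * \<bar>s - t\<bar>"
proof -
  obtain m where m: "m > 0" "\<And>x y. x \<in> Ball3 \<Longrightarrow> y \<in> Ball3 \<Longrightarrow> m * norm (x - y) \<le> d x y"
    using d_lower_norm by blast
  show ?thesis
  proof (rule that[of "1 / m"])
    show "1 / m > 0" using m by simp
    fix l s t and c :: "real \<Rightarrow> real^3"
    assume c: "\<And>t. t \<in> {0..l} \<Longrightarrow> c t \<in> Ball3"
      "\<And>s t. s \<in> {0..l} \<Longrightarrow> t \<in> {0..l} \<Longrightarrow> d (c s) (c t) = \<bar>s - t\<bar>" and st: "s \<in> {0..l}" "t \<in> {0..l}"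
    from m(2)[OF c(1)[OF st(1)] c(1)[OF st(2)]] c(2)[OF st] m(1)
    show "norm (c s - c t) \<le> 1 / m * \<bar>s - t\<bar>" by (simp add: field_simps)
  qed
qed

text \<open>The second difference \<open>c (t + 2h) - 2 c (t + h) + c t\<close> is small because by strong convexity
  the broken line through these points would otherwise be shortened considerably by its chord.\<close>

lemma minimal_second_differences:
  assumes c: "\<And>t. t \<in> {0..l} \<Longrightarrow> c t \<in> Ball3"
    "\<And>s t. s \<in> {0..l} \<Longrightarrow> t \<in> {0..l} \<Longrightarrow> d (c s) (c t) = \<bar>s - t\<bar>"
  obtains K where "\<And>t h. 0 \<le> t \<Longrightarrow> 0 < h \<Longrightarrow> t + 2 * h \<le> l \<Longrightarrow>
      norm ((c (t + h) - c t) /\<^sub>R h - (c (t + 2 * h) - c (t + h)) /\<^sub>R h) \<le> sqrt (K * h)"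
proof -
  obtain A where "A > 0" and A0: "\<And>l c s t. (\<And>t. t \<in> {0..l} \<Longrightarrow> c t \<in> Ball3) \<Longrightarrow>
     (\<And>s t. s \<in> {0..l} \<Longrightarrow> t \<in> {0..l} \<Longrightarrow> d (c s) (c t) = \<bar>s - t\<bar>) \<Longrightarrow>
     s \<in> {0..l} \<Longrightarrow> t \<in> {0..l} \<Longrightarrow> norm (c s - c t) \<le> A * \<bar>s - t\<bar>"
    using minimal_lipschitz by blast
  have A: "norm (c s - c t) \<le> A * \<bar>s - t\<bar>" if "s \<in> {0..l}" "t \<in> {0..l}" for s t
    by (rule A0[OF c that])
  obtain C1 where C1: "0 \<le> C1" "\<And>x y. x \<in> Ball3 \<Longrightarrow> y \<in> Ball3 \<Longrightarrow> d x y \<le> G x (y - x) + C1 * (norm (y - x))\<^sup>2"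
    using d_upper by blast
  obtain C2 where C2: "0 \<le> C2" "\<And>x y. x \<in> Ball3 \<Longrightarrow> y \<in> Ball3 \<Longrightarrow> d x y \<ge> G x (y - x) - C2 * (norm (y - x))\<^sup>2"
    using d_lower by blast
  obtain C3 where C3: "0 \<le> C3" "\<And>x y v. x \<in> Ball3 \<Longrightarrow> y \<in> Ball3 \<Longrightarrow> \<bar>G x v - G y v\<bar> \<le> C3 * norm (x - y) * norm v"
    using G_lipschitz_base by blast
  obtain m M where M: "0 < M" "\<And>x v. x \<in> Ball3 \<Longrightarrow> G x v \<le> M * norm v" using G_bounds by metis
  obtain \<kappa> where \<kappa>: "\<kappa> > 0" "\<And>x u w. x \<in> Ball3 \<Longrightarrow>
       \<kappa> * (norm (u - w))\<^sup>2 \<le> ((G x u)\<^sup>2 + (G x w)\<^sup>2) / 2 - (G x ((1/2) *\<^sub>R (u + w)))\<^sup>2"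
    using e_midpoint_convex by blast
  \<comment> \<open>\<open>P\<close> is the error of \<open>d_lower\<close> on the two legs;
    \<open>Q\<close> collects the error of \<open>d_upper\<close> on the chord and the cost of
    moving its base point from \<open>c t\<close> to the middle point. The factor
    \<open>2 * M * A\<close> bounds the sum in the factored difference of squares.\<close>
  define P where "P = C2 * A\<^sup>2"
  define Q where "Q = C3 * A\<^sup>2 + 2 * C1 * A\<^sup>2"
  define K where "K = (P + Q) * (2 * M * A) / \<kappa>"
  have "norm ((c (t + h) - c t) /\<^sub>R h - (c (t + 2 * h) - c (t + h)) /\<^sub>R h) \<le> sqrt (K * h)"
    if t: "0 \<le> t" "0 < h" "t + 2 * h \<le> l" for t h
  proof -
    let ?x = "c (t + h)" and ?p = "c t" and ?q = "c (t + 2 * h)"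
    have i: "t \<in> {0..l}" "t + h \<in> {0..l}" "t + 2 * h \<in> {0..l}" using t by auto
    note x = c(1)[OF i(2)] and p = c(1)[OF i(1)] and q = c(1)[OF i(3)]
    define w where "w = (?x - ?p) /\<^sub>R h"
    define u where "u = (?q - ?x) /\<^sub>R h"
    have hw: "?x - ?p = h *\<^sub>R w" and hu: "?q - ?x = h *\<^sub>R u" using t by (auto simp: w_def u_def)
    define v where "v = (1/2) *\<^sub>R (w + u)"
    have hv: "?q - ?p = (2 * h) *\<^sub>R v"
    proof -
      have "?q - ?p = h *\<^sub>R w + h *\<^sub>R u" unfolding hw[symmetric] hu[symmetric] by simp
      also have "\<dots> = (2 * h) *\<^sub>R v" by (simp add: v_def vec_eq_iff algebra_simps)
      finally show ?thesis .
    qed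
    have nx: "norm (?x - ?p) \<le> A * h" "norm (?q - ?x) \<le> A * h" "norm (?q - ?p) \<le> A * (2 * h)"
      using A[OF i(2) i(1)] A[OF i(3) i(2)] A[OF i(3) i(1)] t by auto
    have nw: "norm w \<le> A" "norm u \<le> A"
      using nx(1,2) t(2) unfolding hw hu by (auto simp: mult.commute)
    have Gw: "G ?x w \<le> 1 + P * h"
    proof -
      have "G ?x (?p - ?x) \<le> d ?x ?p + C2 * (norm (?p - ?x))\<^sup>2" using C2(2)[OF x p] by linarith
      also have "?p - ?x = - (h *\<^sub>R w)" using hw by (metis minus_diff_eq)
      also have "d ?x ?p = h" using c(2)[OF i(2,1)] t by simp
      also have "C2 * (norm (- (h *\<^sub>R w)))\<^sup>2 \<le> C2 * (A * h)\<^sup>2"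
        using nx(1) C2(1) unfolding hw by (intro mult_left_mono power_mono) auto
      also have "G ?x (- (h *\<^sub>R w)) = h * G ?x w" using t(2) by (simp only: G_minus[OF x] G_scale[OF x] abs_of_pos)
      finally have "h * G ?x w \<le> h * (1 + P * h)" by (simp add: P_def power_mult_distrib power2_eq_square algebra_simps)
      then show ?thesis using t(2) by simp
    qed
    have Gu: "G ?x u \<le> 1 + P * h"
    proof -
      have "G ?x (?q - ?x) \<le> d ?x ?q + C2 * (norm (?q - ?x))\<^sup>2" using C2(2)[OF x q] by linarith
      also have "d ?x ?q = h" using c(2)[OF i(2,3)] t by simp
      also have "C2 * (norm (?q - ?x))\<^sup>2 \<le> C2 * (A * h)\<^sup>2"
        using nx(2) C2(1) by (intro mult_left_mono power_mono) auto
      also have "G ?x (?q - ?x) = h * G ?x u" unfolding hu using t(2) by (simp only: G_scale[OF x] abs_of_pos)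
      finally have "h * G ?x u \<le> h * (1 + P * h)" by (simp add: P_def power_mult_distrib power2_eq_square algebra_simps)
      then show ?thesis using t(2) by simp
    qed
    have Gv: "G ?x v \<ge> 1 - Q * h"
    proof -
      have "2 * h = d ?p ?q" using c(2)[OF i(1,3)] t by simp
      also have "\<dots> \<le> G ?p (?q - ?p) + C1 * (norm (?q - ?p))\<^sup>2" by (rule C1(2)[OF p q])
      also have "C1 * (norm (?q - ?p))\<^sup>2 \<le> C1 * (A * (2 * h))\<^sup>2"
        using nx(3) C1(1) by (intro mult_left_mono power_mono) auto
      also have "G ?p (?q - ?p) \<le> G ?x (?q - ?p) + C3 * norm (?x - ?p) * norm (?q - ?p)"
        using C3(2)[OF x p, of "?q - ?p"] by linarith
      also have "C3 * norm (?x - ?p) * norm (?q - ?p) \<le> C3 * (A * h) * (A * (2 * h))"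
        using nx C3(1) \<open>A > 0\<close> t(2) by (intro mult_mono mult_left_mono) auto
      also have "G ?x (?q - ?p) = 2 * h * G ?x v" unfolding hv using t(2) by (simp add: G_scale[OF x])
      finally have "2 * h * (1 - Q * h) \<le> 2 * h * G ?x v"
        by (simp add: Q_def power_mult_distrib power2_eq_square algebra_simps)
      then show ?thesis using t(2) by simp
    qed
    have B: "G ?x w \<le> M * A" "G ?x u \<le> M * A" "G ?x v \<le> M * A"
    proof -
      have "norm v \<le> A" using nw norm_triangle_ineq[of w u] by (simp add: v_def)
      then show "G ?x w \<le> M * A" "G ?x u \<le> M * A" "G ?x v \<le> M * A"
        using M nw x by (meson mult_left_mono order_trans less_imp_le)+
    qed
    have sq: "a\<^sup>2 - b\<^sup>2 \<le> ((P + Q) * h) * (2 * (M * A))"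
      if "a \<le> 1 + P * h" "1 - Q * h \<le> b" "0 \<le> a" "0 \<le> b" "a \<le> M * A" "b \<le> M * A" for a b :: real
    proof -
      have PQ: "(P + Q) * h \<ge> 0" using C1 C2 C3 t(2) by (simp add: P_def Q_def)
      have "a\<^sup>2 - b\<^sup>2 = (a - b) * (a + b)" by (simp add: power2_eq_square algebra_simps)
      also have "\<dots> \<le> ((P + Q) * h) * (a + b)" using that by (intro mult_right_mono) (auto simp: algebra_simps)
      also have "\<dots> \<le> ((P + Q) * h) * (2 * (M * A))" using that PQ by (intro mult_left_mono) auto
      finally show ?thesis .
    qed
    note g0 = G_nonneg[OF x]
    have av: "X \<le> T" if "X \<le> (a + b) / 2 - c" "a - c \<le> T" "b - c \<le> T" for X T a b c :: real
      using that by argo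
    have "\<kappa> * (norm (w - u))\<^sup>2 \<le> ((P + Q) * h) * (2 * (M * A))"
      by (rule av[OF \<kappa>(2)[OF x, of w u, folded v_def] sq[OF Gw Gv g0 g0 B(1,3)] sq[OF Gu Gv g0 g0 B(2,3)]])
    then have "(norm (w - u))\<^sup>2 \<le> K * h" using \<kappa>(1) by (simp add: K_def field_simps)
    then show ?thesis unfolding w_def[symmetric] u_def[symmetric] by (rule real_le_rsqrt)
  qed
  then show ?thesis using that by blast
qed

text \<open>The mean values producing the derivative look ahead by up to \<open>l - b\<close>, hence
  \<open>b < l\<close>. Unit speed follows since \<open>d_upper\<close> and \<open>d_lower\<close>
  agree to first order.\<close>

lemma minimal_C1:
  assumes c: "\<And>t. t \<in> {0..l} \<Longrightarrow> c t \<in> Ball3"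
    "\<And>s t. s \<in> {0..l} \<Longrightarrow> t \<in> {0..l} \<Longrightarrow> d (c s) (c t) = \<bar>s - t\<bar>" and b: "0 < b" "b < l"
  obtains V where "C1_curve 0 b c V" "\<And>t. t \<in> {0..b} \<Longrightarrow> G (c t) (V t) = 1"
proof -
  obtain A where "A > 0" and A0: "\<And>l c s t. (\<And>t. t \<in> {0..l} \<Longrightarrow> c t \<in> Ball3) \<Longrightarrow>
     (\<And>s t. s \<in> {0..l} \<Longrightarrow> t \<in> {0..l} \<Longrightarrow> d (c s) (c t) = \<bar>s - t\<bar>) \<Longrightarrow>
     s \<in> {0..l} \<Longrightarrow> t \<in> {0..l} \<Longrightarrow> norm (c s - c t) \<le> A * \<bar>s - t\<bar>"
    using minimal_lipschitz by blast
  have A: "norm (c s - c t) \<le> A * \<bar>s - t\<bar>" if "s \<in> {0..l}" "t \<in> {0..l}" for s t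
    by (rule A0[OF c that])
  have "A-lipschitz_on {0..l} c"
    by (rule lipschitz_onI) (use A \<open>A > 0\<close> in \<open>auto simp: dist_norm\<close>)
  then have cont: "continuous_on {0..l} c" by (rule lipschitz_on_continuous_on)
  obtain K where K: "\<And>t h. 0 \<le> t \<Longrightarrow> 0 < h \<Longrightarrow> t + 2 * h \<le> l \<Longrightarrow>
      norm ((c (t + h) - c t) /\<^sub>R h - (c (t + 2 * h) - c (t + h)) /\<^sub>R h) \<le> sqrt (K * h)"
    using minimal_second_differences[OF c] by blast
  obtain V where V: "C1_curve 0 b c V"
    by (rule C1_curve_if_second_differences_small[of "l - b" b c K]) (use b cont K in auto)
  obtain C1 where C1: "0 \<le> C1" "\<And>x y. x \<in> Ball3 \<Longrightarrow> y \<in> Ball3 \<Longrightarrow> d x y \<le> G x (y - x) + C1 * (norm (y - x))\<^sup>2"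
    using d_upper by blast
  obtain C2 where C2: "0 \<le> C2" "\<And>x y. x \<in> Ball3 \<Longrightarrow> y \<in> Ball3 \<Longrightarrow> d x y \<ge> G x (y - x) - C2 * (norm (y - x))\<^sup>2"
    using d_lower by blast
  have "G (c t) (V t) = 1" if t: "t \<in> {0..b}" for t
  proof -
    let ?F = "at t within {0..b}"
    have tl: "t \<in> {0..l}" using t b by auto
    have "(c has_vector_derivative V t) ?F" using V t unfolding C1_curve_def by blast
    from has_vector_derivative_quotient[OF this]
    have q: "((\<lambda>s. (c s - c t) /\<^sub>R (s - t)) \<longlongrightarrow> V t) ?F" .
    have "continuous_on UNIV (G (c t))"
      using G_continuous[of UNIV "\<lambda>_. c t" "\<lambda>v. v"] c(1)[OF tl] by auto
    then have "isCont (G (c t)) (V t)" by (simp add: continuous_on_eq_continuous_at)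
    then have lim: "((\<lambda>s. G (c t) ((c s - c t) /\<^sub>R (s - t))) \<longlongrightarrow> G (c t) (V t)) ?F"
      by (rule isCont_tendsto_compose[OF _ q])
    have "((\<lambda>s. (C1 + C2) * A\<^sup>2 * \<bar>s - t\<bar>) \<longlongrightarrow> (C1 + C2) * A\<^sup>2 * \<bar>t - t\<bar>) ?F"
      by (intro tendsto_intros)
    then have z: "((\<lambda>s. (C1 + C2) * A\<^sup>2 * \<bar>s - t\<bar>) \<longlongrightarrow> 0) ?F" by simp
    have "((\<lambda>s. G (c t) ((c s - c t) /\<^sub>R (s - t)) - 1) \<longlongrightarrow> 0) ?F"
    proof (rule Lim_null_comparison[OF _ z])
      show "\<forall>\<^sub>F s in ?F. norm (G (c t) ((c s - c t) /\<^sub>R (s - t)) - 1) \<le> (C1 + C2) * A\<^sup>2 * \<bar>s - t\<bar>"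
        unfolding eventually_at_filter
      proof (rule always_eventually, intro allI impI)
        fix s assume s: "s \<noteq> t" "s \<in> {0..b}"
        have sl: "s \<in> {0..l}" using s b by auto
        let ?D = "\<bar>s - t\<bar>"
        have D: "?D > 0" using s by simp
        have G1: "G (c t) ((c s - c t) /\<^sub>R (s - t)) = G (c t) (c s - c t) / ?D"
          by (simp add: G_scale[OF c(1)[OF tl]] divide_inverse mult.commute)
        have n: "(norm (c s - c t))\<^sup>2 \<le> (A * ?D)\<^sup>2" using A[OF sl tl] by (intro power_mono) auto
        have "\<bar>G (c t) (c s - c t) - ?D\<bar> \<le> (C1 + C2) * (norm (c s - c t))\<^sup>2"
          using C1(2)[OF c(1)[OF tl] c(1)[OF sl]] C2(2)[OF c(1)[OF tl] c(1)[OF sl]] c(2)[OF tl sl]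
            mult_nonneg_nonneg[OF C1(1) zero_le_power2[of "norm (c s - c t)"]]
            mult_nonneg_nonneg[OF C2(1) zero_le_power2[of "norm (c s - c t)"]]
          by (simp add: algebra_simps abs_le_iff abs_minus_commute)
        also have "\<dots> \<le> (C1 + C2) * (A * ?D)\<^sup>2" using n C1(1) C2(1) by (intro mult_left_mono) auto
        also have "\<dots> = ((C1 + C2) * A\<^sup>2 * ?D) * ?D" by (simp add: power_mult_distrib power2_eq_square)
        finally have "\<bar>G (c t) (c s - c t) - ?D\<bar> / ?D \<le> (C1 + C2) * A\<^sup>2 * ?D"
          using D by (simp add: divide_le_eq)
        moreover have "\<bar>X - D\<bar> / D = \<bar>X / D - 1\<bar>" if "D > 0" for X D :: real
        proof -
          have "X / D - 1 = (X - D) / D" using that by (simp add: field_simps)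
          then show ?thesis using that by simp
        qed
        note this[OF D, of "G (c t) (c s - c t)"]
        ultimately show "norm (G (c t) ((c s - c t) /\<^sub>R (s - t)) - 1) \<le> (C1 + C2) * A\<^sup>2 * \<bar>s - t\<bar>"
          unfolding G1 by simp
      qed
    qed
    then have "((\<lambda>s. G (c t) ((c s - c t) /\<^sub>R (s - t))) \<longlongrightarrow> 1) ?F" by (simp add: LIM_zero_iff)
    moreover have "?F \<noteq> bot"
      using islimpt_Icc[OF b(1)] t by (auto simp: trivial_limit_within)
    ultimately show ?thesis using tendsto_unique[OF _ lim] by blast
  qed
  with V show ?thesis by (rule that)
qed

end

lemma C1_curve_variation:
  assumes "C1_curve a b c V" "C1_curve a b \<phi> \<psi>"
  shows "C1_curve a b (\<lambda>t. c t + \<epsilon> *\<^sub>R \<phi> t) (\<lambda>t. V t + \<epsilon> *\<^sub>R \<psi> t)"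
  using assms unfolding C1_curve_def
  by (auto intro!: continuous_intros has_vector_derivative_add
      bounded_linear.has_vector_derivative[OF bounded_linear_scaleR_right])

section \<open>First variation and the Euler-Lagrange equation\<close>

context Finsler_ball
begin

text \<open>Lengths are compared with the energy through \<open>G \<le> G\<^sup>2 / 2 + 1 / 2\<close>, an equality for
  unit speed.\<close>

lemma first_variation:
  assumes ab: "a < b" and c: "C1_curve a b c V" "\<And>t. t \<in> {a..b} \<Longrightarrow> norm (c t) < 1"
    "\<And>t. t \<in> {a..b} \<Longrightarrow> G (c t) (V t) = 1" "d (c a) (c b) = b - a"
    and \<phi>: "C1_curve a b \<phi> \<psi>" "\<phi> a = 0" "\<phi> b = 0"
  shows "integral {a..b} (\<lambda>t. rm (c t, V t) \<bullet> \<phi> t + qm (c t, V t) \<bullet> \<psi> t) = 0"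
proof -
  obtain m M where M: "0 < M" "\<And>x v. x \<in> Ball3 \<Longrightarrow> G x v \<le> M * norm v" using G_bounds by metis
  have contc: "continuous_on {a..b} c" "continuous_on {a..b} \<phi>"
    using C1_curve_continuous c(1) \<phi>(1) by blast+
  have contV: "continuous_on {a..b} V" "continuous_on {a..b} \<psi>"
    using c(1) \<phi>(1) by (auto simp: C1_curve_def)
  have ne: "{a..b} \<noteq> {}" using ab by simp
  obtain s where s: "s \<in> {a..b}" "\<And>t. t \<in> {a..b} \<Longrightarrow> norm (c t) \<le> norm (c s)"
    using continuous_attains_sup[OF compact_Icc ne continuous_on_norm[OF contc(1)]] by blast
  obtain p where p: "\<And>t. t \<in> {a..b} \<Longrightarrow> norm (\<phi> t) \<le> norm (\<phi> p)"
    using continuous_attains_sup[OF compact_Icc ne continuous_on_norm[OF contc(2)]] by blast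
  obtain q where q: "\<And>t. t \<in> {a..b} \<Longrightarrow> norm (\<psi> t) \<le> norm (\<psi> q)"
    using continuous_attains_sup[OF compact_Icc ne continuous_on_norm[OF contV(2)]] by blast
  define N where "N = norm (\<phi> p) + norm (\<psi> q) + 1"
  have N: "N > 0" "\<And>t. t \<in> {a..b} \<Longrightarrow> norm (\<phi> t) \<le> N" "\<And>t. t \<in> {a..b} \<Longrightarrow> norm (\<psi> t) \<le> N"
  proof -
    note nn = norm_ge_zero[of "\<phi> p"] norm_ge_zero[of "\<psi> q"]
    show "N > 0" using nn unfolding N_def by linarith
    show "norm (\<phi> t) \<le> N" if "t \<in> {a..b}" for t using nn p[OF that] unfolding N_def by linarith
    show "norm (\<psi> t) \<le> N" if "t \<in> {a..b}" for t using nn q[OF that] unfolding N_def by linarith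
  qed
  \<comment> \<open>Small enough for the varied curve to stay in the ball and for its velocity not
    to vanish; the latter uses that unit speed forces \<open>norm (V t) \<ge> 1 / M\<close>.\<close>
  define \<delta> where "\<delta> = min (1 - norm (c s)) (1 / (2 * M)) / N"
  have \<delta>: "\<delta> > 0" using c(2)[OF s(1)] M N by (simp add: \<delta>_def)
  let ?U = "{-\<delta><..<\<delta>}"
  let ?c = "\<lambda>\<epsilon> t. c t + \<epsilon> *\<^sub>R \<phi> t" and ?V = "\<lambda>\<epsilon> t. V t + \<epsilon> *\<^sub>R \<psi> t"
  have small: "\<bar>\<epsilon>\<bar> * N < 1 - norm (c s)" "\<bar>\<epsilon>\<bar> * N < 1 / M" if "\<epsilon> \<in> ?U" for \<epsilon>
  proof -
    have "\<bar>\<epsilon>\<bar> < \<delta>" using that by auto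
    then have "\<bar>\<epsilon>\<bar> * N < \<delta> * N" using N(1) by simp
    also have "\<delta> * N = min (1 - norm (c s)) (1 / (2 * M))" using N(1) by (simp add: \<delta>_def)
    finally have 1: "\<bar>\<epsilon>\<bar> * N < min (1 - norm (c s)) (1 / (2 * M))" .
    have "1 / (2 * M) < 1 / M" using M(1) by (simp add: field_simps)
    with 1 show "\<bar>\<epsilon>\<bar> * N < 1 - norm (c s)" "\<bar>\<epsilon>\<bar> * N < 1 / M" by linarith+
  qed
  have ball: "?c \<epsilon> t \<in> Ball3" if \<epsilon>: "\<epsilon> \<in> ?U" and t: "t \<in> {a..b}" for \<epsilon> t
  proof -
    have "norm (?c \<epsilon> t) \<le> norm (c t) + \<bar>\<epsilon>\<bar> * norm (\<phi> t)" by (metis norm_scaleR norm_triangle_ineq)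
    also have "\<dots> \<le> norm (c s) + \<bar>\<epsilon>\<bar> * N" by (intro add_mono s(2) mult_left_mono N(2) t) auto
    finally show ?thesis using small(1)[OF \<epsilon>] by simp
  qed
  have nz: "?V \<epsilon> t \<noteq> 0" if \<epsilon>: "\<epsilon> \<in> ?U" and t: "t \<in> {a..b}" for \<epsilon> t
  proof
    assume "?V \<epsilon> t = 0"
    then have "V t = - (\<epsilon> *\<^sub>R \<psi> t)" by (simp add: add_eq_0_iff2)
    then have "norm (V t) = \<bar>\<epsilon>\<bar> * norm (\<psi> t)" by simp
    also have "\<dots> \<le> \<bar>\<epsilon>\<bar> * N" by (intro mult_left_mono N(3) t) auto
    also have "\<dots> < 1 / M" by (rule small(2)[OF \<epsilon>])
    finally have "M * norm (V t) < 1" using M(1) by (simp add: field_simps)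
    moreover have "c t \<in> Ball3" using c(2)[OF t] by simp
    ultimately show False using M(2)[of "c t" "V t"] c(3)[OF t] by simp
  qed
  define f where "f \<epsilon> t = e (?c \<epsilon> t, ?V \<epsilon> t)" for \<epsilon> t
  define f' where "f' \<epsilon> t = rm (?c \<epsilon> t, ?V \<epsilon> t) \<bullet> \<phi> t + qm (?c \<epsilon> t, ?V \<epsilon> t) \<bullet> \<psi> t" for \<epsilon> t
  have inU: "(?c \<epsilon> t, ?V \<epsilon> t) \<in> U" if "\<epsilon> \<in> ?U" "t \<in> {a..b}" for \<epsilon> t
    by (rule in_U[OF ball[OF that] nz[OF that]])
  have fd: "((\<lambda>\<epsilon>. f \<epsilon> t) has_real_derivative f' \<epsilon> t) (at \<epsilon> within ?U)"
    if \<epsilon>: "\<epsilon> \<in> ?U" and t: "t \<in> cbox a b" for \<epsilon> t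
  proof -
    have t': "t \<in> {a..b}" using t by simp
    have 1: "((\<lambda>\<epsilon>. (?c \<epsilon> t, ?V \<epsilon> t)) has_derivative (\<lambda>a. (a *\<^sub>R \<phi> t, a *\<^sub>R \<psi> t))) (at \<epsilon>)"
      by (auto intro!: derivative_eq_intros)
    have "((\<lambda>\<epsilon>. f \<epsilon> t) has_derivative (\<lambda>a. De (?c \<epsilon> t, ?V \<epsilon> t) (a *\<^sub>R \<phi> t, a *\<^sub>R \<psi> t))) (at \<epsilon>)"
      unfolding f_def by (rule has_derivative_compose[OF 1 De[OF inU[OF \<epsilon> t']]])
    moreover have "(\<lambda>a. De (?c \<epsilon> t, ?V \<epsilon> t) (a *\<^sub>R \<phi> t, a *\<^sub>R \<psi> t)) = times (f' \<epsilon> t)"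
      by (intro ext) (simp add: De_eq[OF inU[OF \<epsilon> t']] f'_def algebra_simps)
    ultimately have "((\<lambda>\<epsilon>. f \<epsilon> t) has_real_derivative f' \<epsilon> t) (at \<epsilon>)"
      unfolding has_field_derivative_def by simp
    then show ?thesis by (rule has_field_derivative_at_within)
  qed
  have pc: "continuous_on (?U \<times> {a..b}) (\<lambda>p. h (snd p))" if "continuous_on {a..b} h" for h :: "real \<Rightarrow> real^3"
    by (rule continuous_on_compose2[OF that]) (auto intro!: continuous_intros)
  have pU: "continuous_on (?U \<times> {a..b}) (\<lambda>p. (?c (fst p) (snd p), ?V (fst p) (snd p)))"
    by (intro continuous_intros pc contc contV)
  have pin: "(\<lambda>p. (?c (fst p) (snd p), ?V (fst p) (snd p))) ` (?U \<times> {a..b}) \<subseteq> U"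
    using inU by (auto simp del: greaterThanLessThan_iff)
  have f'cont: "continuous_on (?U \<times> cbox a b) (\<lambda>(\<epsilon>, t). f' \<epsilon> t)"
    unfolding f'_def split_beta cbox_interval
    by (intro continuous_intros pc contc contV
        continuous_on_compose2[OF Cinf_on_continuous_on[OF Cinf_rm] pU pin]
        continuous_on_compose2[OF Cinf_on_continuous_on[OF Cinf_qm] pU pin])
  have fcont: "continuous_on {a..b} (f \<epsilon>)" if \<epsilon>: "\<epsilon> \<in> ?U" for \<epsilon>
    unfolding f_def
    by (rule continuous_on_compose2[OF Cinf_on_continuous_on[OF Cinf_e]])
       (use inU[OF \<epsilon>] in \<open>auto intro!: continuous_intros contc contV\<close>)
  then have fint: "f \<epsilon> integrable_on cbox a b" if "\<epsilon> \<in> ?U" for \<epsilon>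
    using that by (auto intro: integrable_continuous_real)
  define J where "J \<epsilon> = integral {a..b} (f \<epsilon>)" for \<epsilon>
  have U0: "0 \<in> ?U" using \<delta> by simp
  have "(J has_real_derivative integral {a..b} (f' 0)) (at 0 within ?U)"
    using leibniz_rule_field_derivative[OF fd fint f'cont U0] unfolding J_def by auto
  then have J': "(J has_real_derivative integral {a..b} (f' 0)) (at 0)"
    using at_within_open[OF U0] by simp
  have half: "integral {a..b} (\<lambda>t::real. 1 / 2 :: real) = (b - a) / 2" using ab by simp
  have "J 0 = integral {a..b} (\<lambda>t. 1 / 2)"
    unfolding J_def
  proof (rule integral_cong)
    fix t assume t: "t \<in> {a..b}"
    have "c t \<in> Ball3" "V t \<noteq> 0" using ball[OF U0 t] nz[OF U0 t] by auto
    from e_G[OF this] show "f 0 t = 1 / 2" using c(3)[OF t] by (simp add: f_def)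
  qed
  then have J0: "J 0 = (b - a) / 2" using half by simp
  have "J 0 \<le> J \<epsilon>" if "\<bar>0 - \<epsilon>\<bar> < \<delta>" for \<epsilon>
  proof -
    have \<epsilon>: "\<epsilon> \<in> ?U" using that by auto
    note C = C1_curve_variation[OF c(1) \<phi>(1), of \<epsilon>]
    have im: "?c \<epsilon> ` {a..b} \<subseteq> Ball3" using ball[OF \<epsilon>] by blast
    have "b - a \<le> integral {a..b} (\<lambda>t. G (?c \<epsilon> t) (?V \<epsilon> t))"
      using d_le_C1_length[OF less_imp_le[OF ab] C im] c(4) \<phi>(2,3) by simp
    also have "\<dots> \<le> integral {a..b} (\<lambda>t. f \<epsilon> t + 1 / 2)"
    proof (rule integral_le[OF integrable_G(2)[OF C im]])
      show "(\<lambda>t. f \<epsilon> t + 1 / 2) integrable_on {a..b}"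
        by (intro integrable_continuous_real continuous_intros fcont \<epsilon>)
      fix t assume t: "t \<in> {a..b}"
      have "2 * x \<le> x\<^sup>2 + 1" for x :: real using zero_le_power2[of "x - 1"] by (simp add: power2_diff)
      from this[of "G (?c \<epsilon> t) (?V \<epsilon> t)"]
      show "G (?c \<epsilon> t) (?V \<epsilon> t) \<le> f \<epsilon> t + 1 / 2"
        unfolding f_def e_G[OF ball[OF \<epsilon> t] nz[OF \<epsilon> t]] by simp
    qed
    also have "\<dots> = J \<epsilon> + (b - a) / 2"
      unfolding J_def using fint[OF \<epsilon>] half by (subst integral_add) (auto intro: integrable_const_ivl)
    finally show ?thesis using J0 by (simp add: field_simps)
  qed
  then have "integral {a..b} (f' 0) = 0" by (intro DERIV_local_min[OF J' \<delta>]) auto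
  then show ?thesis by (simp add: f'_def[abs_def])
qed

lemma continuous_moments:
  assumes "continuous_on S c" "continuous_on S V" "\<And>t. t \<in> S \<Longrightarrow> c t \<in> Ball3" "\<And>t. t \<in> S \<Longrightarrow> V t \<noteq> 0"
  shows "continuous_on S (\<lambda>t. qm (c t, V t))" "continuous_on S (\<lambda>t. rm (c t, V t))"
  by (rule continuous_on_compose2[OF Cinf_on_continuous_on[OF Cinf_qm]]
           continuous_on_compose2[OF Cinf_on_continuous_on[OF Cinf_rm]],
      use assms in_U in \<open>auto intro!: continuous_intros simp del: mem_cball_0\<close>)+

text \<open>The du Bois-Reymond argument, in integrated form because \<open>V\<close> is merely
  continuous. The variation has derivative \<open>\<psi>\<close>, which is \<open>q - \<Phi>\<close>
  minus its mean so that \<open>\<phi>\<close> vanishes at both ends; integration by parts turns the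
  first variation into the integral of \<open>\<psi> \<bullet> \<psi>\<close>.\<close>

lemma Euler_Lagrange_interior:
  assumes ab: "a < b" and c: "C1_curve a b c V" "\<And>t. t \<in> {a..b} \<Longrightarrow> norm (c t) < 1"
    "\<And>t. t \<in> {a..b} \<Longrightarrow> G (c t) (V t) = 1" "d (c a) (c b) = b - a"
  shows "qm (c b, V b) - qm (c a, V a) = integral {a..b} (\<lambda>t. rm (c t, V t))"
proof -
  have B: "c t \<in> Ball3" if "t \<in> {a..b}" for t using c(2)[OF that] by simp
  have nz: "V t \<noteq> 0" if "t \<in> {a..b}" for t using c(3)[OF that] G_zero[OF B[OF that]] by auto
  have cV: "continuous_on {a..b} c" "continuous_on {a..b} V"
    using C1_curve_continuous[OF c(1)] c(1) by (auto simp: C1_curve_def)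
  define q where "q t = qm (c t, V t)" for t
  define r where "r t = rm (c t, V t)" for t
  have qc: "continuous_on {a..b} q" and rc: "continuous_on {a..b} r"
    unfolding q_def r_def using continuous_moments[OF cV B nz] by auto
  define \<Phi> where "\<Phi> t = integral {a..t} r" for t
  have \<Phi>: "(\<Phi> has_vector_derivative r t) (at t within {a..b})" if "t \<in> {a..b}" for t
    unfolding \<Phi>_def by (rule integral_has_vector_derivative[OF rc that])
  then have \<Phi>c: "continuous_on {a..b} \<Phi>"
    unfolding continuous_on_eq_continuous_within using has_vector_derivative_continuous by blast
  define k where "k = (1 / (b - a)) *\<^sub>R integral {a..b} (\<lambda>t. q t - \<Phi> t)"
  define \<psi> where "\<psi> t = q t - \<Phi> t - k" for t
  have \<psi>c: "continuous_on {a..b} \<psi>" unfolding \<psi>_def by (intro continuous_intros qc \<Phi>c)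
  define \<phi> where "\<phi> t = integral {a..t} \<psi>" for t
  have \<phi>: "(\<phi> has_vector_derivative \<psi> t) (at t within {a..b})" if "t \<in> {a..b}" for t
    unfolding \<phi>_def by (rule integral_has_vector_derivative[OF \<psi>c that])
  have \<phi>C: "C1_curve a b \<phi> \<psi>" using \<phi> \<psi>c by (simp add: C1_curve_def)
  have \<phi>a: "\<phi> a = 0" by (simp add: \<phi>_def)
  have \<phi>b: "\<phi> b = 0"
  proof -
    have "(\<lambda>t. q t - \<Phi> t) integrable_on {a..b}" by (intro integrable_continuous_real continuous_intros qc \<Phi>c)
    then have "\<phi> b = integral {a..b} (\<lambda>t. q t - \<Phi> t) - integral {a..b} (\<lambda>t::real. k)"
      unfolding \<phi>_def \<psi>_def by (intro integral_diff integrable_const_ivl)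
    also have "integral {a..b} (\<lambda>t::real. k) = (b - a) *\<^sub>R k" using ab by simp
    finally show ?thesis using ab by (simp add: k_def)
  qed
  have 0: "integral {a..b} (\<lambda>t. r t \<bullet> \<phi> t + q t \<bullet> \<psi> t) = 0"
    unfolding q_def r_def by (rule first_variation[OF ab c \<phi>C \<phi>a \<phi>b])
  have "((\<lambda>t. \<Phi> t \<bullet> \<phi> t + k \<bullet> \<phi> t) has_vector_derivative (\<Phi> t \<bullet> \<psi> t + r t \<bullet> \<phi> t) + k \<bullet> \<psi> t) (at t within {a..b})"
    if "t \<in> {a..b}" for t
    by (intro has_vector_derivative_add bounded_bilinear.has_vector_derivative[OF bounded_bilinear_inner]
        bounded_linear.has_vector_derivative[OF bounded_linear_inner_right] \<Phi> \<phi> that)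
  from fundamental_theorem_of_calculus[OF less_imp_le[OF ab] this]
  have 1: "((\<lambda>t. (\<Phi> t \<bullet> \<psi> t + r t \<bullet> \<phi> t) + k \<bullet> \<psi> t) has_integral 0) {a..b}"
    by (simp add: \<phi>a \<phi>b)
  have \<phi>c: "continuous_on {a..b} \<phi>" by (rule C1_curve_continuous[OF \<phi>C])
  have "(\<lambda>t. r t \<bullet> \<phi> t + q t \<bullet> \<psi> t) integrable_on {a..b}"
    by (intro integrable_continuous_real continuous_intros qc rc \<psi>c \<phi>c)
  then have "((\<lambda>t. r t \<bullet> \<phi> t + q t \<bullet> \<psi> t) has_integral 0) {a..b}"
    using 0 by (metis has_integral_integrable_integral)
  note D = has_integral_diff[OF this 1]
  have "(r t \<bullet> \<phi> t + q t \<bullet> \<psi> t) - ((\<Phi> t \<bullet> \<psi> t + r t \<bullet> \<phi> t) + k \<bullet> \<psi> t) = \<psi> t \<bullet> \<psi> t" for t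
  proof -
    have "\<psi> t \<bullet> \<psi> t = (q t - \<Phi> t - k) \<bullet> \<psi> t" by (simp add: \<psi>_def)
    then show ?thesis by (simp add: inner_diff_left)
  qed
  from has_integral_eq[OF this D] have "((\<lambda>t. \<psi> t \<bullet> \<psi> t) has_integral 0) {a..b}" by simp
  then have "integral {a..b} (\<lambda>t. \<psi> t \<bullet> \<psi> t) = 0" by (rule integral_unique)
  moreover have "continuous_on {a..b} (\<lambda>t. \<psi> t \<bullet> \<psi> t)" by (intro continuous_intros \<psi>c)
  ultimately have "\<forall>t\<in>{a..b}. \<psi> t \<bullet> \<psi> t = 0" using integral_eq_0_iff[OF _ ab] by auto
  then have "\<psi> a = 0" "\<psi> b = 0" using ab by auto
  then have "q b - q a = \<Phi> b" by (simp add: \<psi>_def \<Phi>_def algebra_simps)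
  then show ?thesis unfolding q_def \<Phi>_def r_def[abs_def] .
qed

text \<open>The curve may start on the sphere, where variations could leave the ball. On
  \<open>{t..b}\<close> with \<open>t > 0\<close> the integrated equation says that \<open>q\<close>
  minus the integral of the force is constant, and continuity extends this to 0.\<close>

lemma Euler_Lagrange:
  assumes b: "0 < b" and c: "C1_curve 0 b c V" "\<And>t. t \<in> {0<..b} \<Longrightarrow> norm (c t) < 1" "c 0 \<in> Ball3"
    "\<And>t. t \<in> {0..b} \<Longrightarrow> G (c t) (V t) = 1" "\<And>s t. s \<in> {0..b} \<Longrightarrow> t \<in> {0..b} \<Longrightarrow> d (c s) (c t) = \<bar>s - t\<bar>"
    and t: "t \<in> {0..b}"
  shows "((\<lambda>t. qm (c t, V t)) has_vector_derivative rm (c t, V t)) (at t within {0..b})"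
proof -
  have B: "c t \<in> Ball3" if "t \<in> {0..b}" for t
    using c(2)[of t] c(3) that by (cases "t = 0") auto
  have nz: "V t \<noteq> 0" if "t \<in> {0..b}" for t using c(4)[OF that] G_zero[OF B[OF that]] by auto
  have cV: "continuous_on {0..b} c" "continuous_on {0..b} V"
    using C1_curve_continuous[OF c(1)] c(1) by (auto simp: C1_curve_def)
  define q where "q t = qm (c t, V t)" for t
  define r where "r t = rm (c t, V t)" for t
  have qc: "continuous_on {0..b} q" and rc: "continuous_on {0..b} r"
    unfolding q_def r_def using continuous_moments[OF cV B nz] by auto
  note rint = integrable_continuous_real[OF rc]
  define k where "k t = q t - integral {0..t} r" for t
  have kc: "continuous_on {0..b} k" unfolding k_def
    by (intro continuous_intros qc indefinite_integral_continuous_1 rint)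
  have kb: "k t = k b" if "t \<in> {0<..b}" for t
  proof (cases "t = b")
    case False
    then have t: "0 < t" "t < b" using that by auto
    have "q b - q t = integral {t..b} r" unfolding q_def r_def
      by (rule Euler_Lagrange_interior[OF t(2) C1_curve_subset[OF c(1)]]) (use t c(2,4,5) in auto)
    moreover have "integral {0..t} r + integral {t..b} r = integral {0..b} r"
      by (rule Henstock_Kurzweil_Integration.integral_combine[OF _ _ rint]) (use t in auto)
    ultimately show ?thesis by (simp add: k_def algebra_simps)
  qed simp
  have "k t = k b" if "t \<in> {0..b}" for t
  proof (rule continuous_constant_on_closure[of "{0<..b}" k, OF _ kb])
    have "closure {0<..b} = {0..b}" using b by (rule closure_greaterThanAtMost)
    then show "continuous_on (closure {0<..b}) k" "t \<in> closure {0<..b}" using kc that by simp_all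
  qed
  then have qk: "q t = integral {0..t} r + k b" if "t \<in> {0..b}" for t using that by (simp add: k_def algebra_simps)
  have "((\<lambda>t. integral {0..t} r + k b) has_vector_derivative r t + 0) (at t within {0..b})"
    by (intro has_vector_derivative_add integral_has_vector_derivative rc t has_vector_derivative_const)
  then have "(q has_vector_derivative r t) (at t within {0..b})"
    using has_vector_derivative_transform[OF t qk] by simp
  then show ?thesis by (simp only: q_def[abs_def] r_def)
qed

section \<open>Uniqueness of geodesics with given initial data\<close>

lemma moment_lipschitz:
  assumes "0 < r"
  obtains L where "L \<ge> 0" "\<And>x y v w. x \<in> Ball3 \<Longrightarrow> y \<in> Ball3 \<Longrightarrow> r \<le> norm v \<Longrightarrow> norm v \<le> R \<Longrightarrow>
      r \<le> norm w \<Longrightarrow> norm w \<le> R \<Longrightarrow>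
      norm (qm (x, v) - qm (y, w)) \<le> L * (norm (x - y) + norm (v - w)) \<and>
      norm (rm (x, v) - rm (y, w)) \<le> L * (norm (x - y) + norm (v - w))"
proof -
  define S where "S = {v :: real^3. r \<le> norm v \<and> norm v \<le> R}"
  have "S = cball 0 R - ball 0 r" by (auto simp: S_def)
  then have "compact S" by (simp add: compact_diff)
  then have K: "compact (Ball3 \<times> S)" by (intro compact_Times compact_cball)
  have KU: "Ball3 \<times> S \<subseteq> U" by (rule slit_compact_subset) (use assms in \<open>auto simp: S_def\<close>)
  obtain L1 where L1: "L1 \<ge> 0" "\<And>p q. p \<in> Ball3 \<times> S \<Longrightarrow> q \<in> Ball3 \<times> S \<Longrightarrow> norm (qm p - qm q) \<le> L1 * norm (p - q)"
    using Cinf_on_compact_lipschitz[OF U(1) Cinf_qm K KU] by blast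
  obtain L2 where L2: "L2 \<ge> 0" "\<And>p q. p \<in> Ball3 \<times> S \<Longrightarrow> q \<in> Ball3 \<times> S \<Longrightarrow> norm (rm p - rm q) \<le> L2 * norm (p - q)"
    using Cinf_on_compact_lipschitz[OF U(1) Cinf_rm K KU] by blast
  show ?thesis
  proof (rule that[of "L1 + L2"])
    show "L1 + L2 \<ge> 0" using L1 L2 by simp
    fix x y v w :: "real^3"
    assume a: "x \<in> Ball3" "y \<in> Ball3" "r \<le> norm v" "norm v \<le> R" "r \<le> norm w" "norm w \<le> R"
    then have p: "(x, v) \<in> Ball3 \<times> S" "(y, w) \<in> Ball3 \<times> S" by (auto simp: S_def)
    have n: "norm ((x, v) - (y, w)) \<le> norm (x - y) + norm (v - w)"
      using norm_Pair_le[of "x - y" "v - w"] by simp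
    have "norm (qm (x, v) - qm (y, w)) \<le> (L1 + L2) * norm ((x, v) - (y, w))"
      using L1(2)[OF p] L2(1) by (smt (verit) mult_right_mono norm_ge_zero)
    moreover have "norm (rm (x, v) - rm (y, w)) \<le> (L1 + L2) * norm ((x, v) - (y, w))"
      using L2(2)[OF p] L1(1) by (smt (verit) mult_right_mono norm_ge_zero)
    moreover have "(L1 + L2) * norm ((x, v) - (y, w)) \<le> (L1 + L2) * (norm (x - y) + norm (v - w))"
      using n L1(1) L2(1) by (intro mult_left_mono) auto
    ultimately show "norm (qm (x, v) - qm (y, w)) \<le> (L1 + L2) * (norm (x - y) + norm (v - w)) \<and>
      norm (rm (x, v) - rm (y, w)) \<le> (L1 + L2) * (norm (x - y) + norm (v - w))" by linarith
  qed
qed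

text \<open>Sum of the convexity estimates based at \<open>v\<close> and at \<open>w\<close>. It
  acts as a quantitative inverse of the Legendre transform: velocities are controlled by
  momenta.\<close>

lemma qm_strongly_monotone:
  obtains \<kappa> where "\<kappa> > 0" "\<And>x v w. x \<in> Ball3 \<Longrightarrow> v \<noteq> 0 \<Longrightarrow> w \<noteq> 0 \<Longrightarrow>
     \<kappa> * (norm (v - w))\<^sup>2 \<le> (qm (x, v) - qm (x, w)) \<bullet> (v - w)"
proof -
  obtain \<kappa> where \<kappa>: "\<kappa> > 0" "\<And>x v w. x \<in> Ball3 \<Longrightarrow> v \<noteq> 0 \<Longrightarrow>
       (G x w)\<^sup>2 / 2 \<ge> (G x v)\<^sup>2 / 2 + qm (x, v) \<bullet> (w - v) + \<kappa> * (norm (w - v))\<^sup>2"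
    using e_strongly_convex by blast
  show ?thesis
  proof (rule that[OF \<kappa>(1)])
    fix x v w :: "real^3" assume a: "x \<in> Ball3" "v \<noteq> 0" "w \<noteq> 0"
    have 0: "\<kappa> * (norm (v - w))\<^sup>2 \<ge> 0" using \<kappa>(1) by simp
    have 1: "(qm (x, v) - qm (x, w)) \<bullet> (v - w) = - (qm (x, v) \<bullet> (w - v)) - qm (x, w) \<bullet> (v - w)"
      by (simp add: inner_diff_left inner_diff_right)
    show "\<kappa> * (norm (v - w))\<^sup>2 \<le> (qm (x, v) - qm (x, w)) \<bullet> (v - w)"
      unfolding 1 using \<kappa>(2)[OF a(1,2), of w] \<kappa>(2)[OF a(1,3), of v] 0
      by (simp add: norm_minus_commute)
  qed
qed

text \<open>A Gronwall estimate for the differences of positions and momenta. Velocity differences,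
  not known to be differentiable, are bounded by these through \<open>qm_strongly_monotone\<close>.
  Indexing the curves by \<open>i\<close> states the assumptions for both at once.\<close>

lemma geodesic_flow_unique:
  assumes b: "0 < b"
    and c: "\<And>i. C1_curve 0 b (c i) (V i)" "\<And>i t. t \<in> {0..b} \<Longrightarrow> c i t \<in> Ball3"
    "\<And>i t. t \<in> {0..b} \<Longrightarrow> G (c i t) (V i t) = 1"
    "\<And>i t. t \<in> {0..b} \<Longrightarrow> ((\<lambda>t. qm (c i t, V i t)) has_vector_derivative rm (c i t, V i t)) (at t within {0..b})"
    and init: "c i 0 = c j 0" "V i 0 = V j 0"
    and t: "t \<in> {0..b}"
  shows "c i t = c j t"
proof -
  obtain m M where mM: "0 < m" "0 < M" "\<And>x v. x \<in> Ball3 \<Longrightarrow> m * norm v \<le> G x v"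
    "\<And>x v. x \<in> Ball3 \<Longrightarrow> G x v \<le> M * norm v" using G_bounds by blast
  have Vn: "1 / M \<le> norm (V i t)" "norm (V i t) \<le> 1 / m" if "t \<in> {0..b}" for i t
    using mM(3,4)[OF c(2)[OF that, of i], of "V i t"] c(3)[OF that, of i] mM(1,2) by (auto simp: field_simps)
  have Mpos: "0 < 1 / M" using mM by simp
  have nz: "V i t \<noteq> 0" if "t \<in> {0..b}" for i t using Vn(1)[OF that, of i] Mpos by auto
  obtain L where L: "L \<ge> 0" "\<And>x y v w. x \<in> Ball3 \<Longrightarrow> y \<in> Ball3 \<Longrightarrow> 1 / M \<le> norm v \<Longrightarrow> norm v \<le> 1 / m \<Longrightarrow>
      1 / M \<le> norm w \<Longrightarrow> norm w \<le> 1 / m \<Longrightarrow>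
      norm (qm (x, v) - qm (y, w)) \<le> L * (norm (x - y) + norm (v - w)) \<and>
      norm (rm (x, v) - rm (y, w)) \<le> L * (norm (x - y) + norm (v - w))"
    using moment_lipschitz[OF Mpos] by blast
  obtain \<kappa> where \<kappa>: "\<kappa> > 0" "\<And>x v w. x \<in> Ball3 \<Longrightarrow> v \<noteq> 0 \<Longrightarrow> w \<noteq> 0 \<Longrightarrow>
     \<kappa> * (norm (v - w))\<^sup>2 \<le> (qm (x, v) - qm (x, w)) \<bullet> (v - w)"
    using qm_strongly_monotone by blast
  define x where "x t = c i t - c j t" for t
  define x' where "x' t = V i t - V j t" for t
  define y where "y t = qm (c i t, V i t) - qm (c j t, V j t)" for t
  define y' where "y' t = rm (c i t, V i t) - rm (c j t, V j t)" for t
  define P where "P = 1 / \<kappa>"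
  define K where "K = P + 2 * L * P + L + L\<^sup>2 * P"
  have P: "P > 0" using \<kappa>(1) by (simp add: P_def)
  have x'b: "norm (x' t) \<le> P * (norm (y t) + L * norm (x t))" if t: "t \<in> {0..b}" for t
  proof (cases "x' t = 0")
    case True then show ?thesis using P L(1) by simp
  next
    case False
    let ?q = "qm (c i t, V j t)"
    have "\<kappa> * (norm (x' t))\<^sup>2 \<le> (qm (c i t, V i t) - ?q) \<bullet> x' t"
      unfolding x'_def by (rule \<kappa>(2)[OF c(2)[OF t] nz[OF t] nz[OF t]])
    also have "\<dots> \<le> norm (qm (c i t, V i t) - ?q) * norm (x' t)" by (rule norm_cauchy_schwarz)
    finally have "(\<kappa> * norm (x' t)) * norm (x' t) \<le> norm (qm (c i t, V i t) - ?q) * norm (x' t)"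
      by (simp add: power2_eq_square)
    then have "\<kappa> * norm (x' t) \<le> norm (qm (c i t, V i t) - ?q)" using False by simp
    also have "qm (c i t, V i t) - ?q = y t + (qm (c j t, V j t) - ?q)" by (simp add: y_def)
    also have "norm \<dots> \<le> norm (y t) + norm (qm (c j t, V j t) - ?q)" by (rule norm_triangle_ineq)
    also have "norm (qm (c j t, V j t) - ?q) \<le> L * norm (x t)"
      using L(2)[OF c(2)[OF t, of j] c(2)[OF t, of i] Vn[OF t, of j] Vn[OF t, of j]] by (simp add: x_def norm_minus_commute)
    finally show ?thesis using \<kappa>(1) by (simp add: P_def field_simps)
  qed
  have y'b: "norm (y' t) \<le> L * (norm (x t) + norm (x' t))" if t: "t \<in> {0..b}" for t
    unfolding y'_def x_def x'_def using L(2)[OF c(2)[OF t] c(2)[OF t] Vn[OF t] Vn[OF t]] by blast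
  \<comment> \<open>The exponential weight absorbs the growth: \<open>K\<close> dominates all
    coefficients once mixed products are split by \<open>2 * (\<alpha> * \<beta>) \<le>
    \<alpha>\<^sup>2 + \<beta>\<^sup>2\<close>, so \<open>W\<close> does not increase from its
    initial value 0.\<close>
  define W where "W t = exp (- (K * t)) * (x t \<bullet> x t + y t \<bullet> y t)" for t
  define W' where "W' t = exp (- (K * t)) * ((2 * (x t \<bullet> x' t) + 2 * (y t \<bullet> y' t)) - K * (x t \<bullet> x t + y t \<bullet> y t))" for t
  have xd: "(x has_vector_derivative x' t) (at t within {0..b})" if "t \<in> {0..b}" for t
    unfolding x_def[abs_def] x'_def using c(1) that
    by (intro has_vector_derivative_diff) (auto simp: C1_curve_def)
  have yd: "(y has_vector_derivative y' t) (at t within {0..b})" if "t \<in> {0..b}" for t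
    unfolding y_def[abs_def] y'_def by (intro has_vector_derivative_diff c(4) that)
  have ip: "((\<lambda>t. z t \<bullet> z t) has_real_derivative 2 * (z t \<bullet> z')) (at t within {0..b})"
    if "(z has_vector_derivative z') (at t within {0..b})" for z :: "real \<Rightarrow> real^3" and z' t
    using bounded_bilinear.has_vector_derivative[OF bounded_bilinear_inner that that]
    by (simp add: has_real_derivative_iff_has_vector_derivative inner_commute)
  have Wd: "(W has_real_derivative W' t) (at t within {0..b})" if t: "t \<in> {0..b}" for t
  proof -
    have 1: "((\<lambda>t. exp (- (K * t))) has_real_derivative exp (- (K * t)) * (- K)) (at t within {0..b})"
      by (auto intro!: derivative_eq_intros)
    have 2: "((\<lambda>t. x t \<bullet> x t + y t \<bullet> y t) has_real_derivative 2 * (x t \<bullet> x' t) + 2 * (y t \<bullet> y' t)) (at t within {0..b})"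
      by (intro DERIV_add ip xd yd t)
    from DERIV_mult[OF 1 2] show ?thesis unfolding W_def[abs_def] W'_def by (simp add: algebra_simps)
  qed
  have W'le: "W' t \<le> 0" if t: "t \<in> {0..b}" for t
  proof -
    define \<alpha> where "\<alpha> = norm (x t)"
    define \<beta> where "\<beta> = norm (y t)"
    have ab0: "\<alpha> \<ge> 0" "\<beta> \<ge> 0" by (auto simp: \<alpha>_def \<beta>_def)
    have v: "norm (x' t) \<le> P * (\<beta> + L * \<alpha>)" using x'b[OF t] by (simp add: \<alpha>_def \<beta>_def)
    have "x t \<bullet> x' t \<le> \<alpha> * norm (x' t)" unfolding \<alpha>_def by (rule norm_cauchy_schwarz)
    also have "\<dots> \<le> \<alpha> * (P * (\<beta> + L * \<alpha>))" using v ab0 by (intro mult_left_mono) auto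
    finally have 1: "x t \<bullet> x' t \<le> \<alpha> * (P * (\<beta> + L * \<alpha>))" .
    have "y t \<bullet> y' t \<le> \<beta> * norm (y' t)" unfolding \<beta>_def by (rule norm_cauchy_schwarz)
    also have "\<dots> \<le> \<beta> * (L * (\<alpha> + P * (\<beta> + L * \<alpha>)))"
      using y'b[OF t] v ab0 L(1) unfolding \<alpha>_def[symmetric]
      by (intro mult_left_mono) (auto intro: order_trans mult_left_mono add_left_mono)
    finally have 2: "y t \<bullet> y' t \<le> \<beta> * (L * (\<alpha> + P * (\<beta> + L * \<alpha>)))" .
    have ab2: "2 * (\<alpha> * \<beta>) \<le> \<alpha>\<^sup>2 + \<beta>\<^sup>2" using sum_squares_bound[of \<alpha> \<beta>] by simp
    have "2 * (x t \<bullet> x' t) + 2 * (y t \<bullet> y' t) \<le> 2 * (\<alpha> * (P * (\<beta> + L * \<alpha>))) + 2 * (\<beta> * (L * (\<alpha> + P * (\<beta> + L * \<alpha>))))"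
      using 1 2 by linarith
    also have "\<dots> = (P + L + L\<^sup>2 * P) * (2 * (\<alpha> * \<beta>)) + 2 * L * P * (\<alpha>\<^sup>2 + \<beta>\<^sup>2)"
      by (simp add: power2_eq_square algebra_simps)
    also have "\<dots> \<le> (P + L + L\<^sup>2 * P) * (\<alpha>\<^sup>2 + \<beta>\<^sup>2) + 2 * L * P * (\<alpha>\<^sup>2 + \<beta>\<^sup>2)"
      using ab2 P L(1) by (intro add_right_mono mult_left_mono) auto
    also have "\<dots> = K * (\<alpha>\<^sup>2 + \<beta>\<^sup>2)" by (simp add: K_def algebra_simps)
    also have "\<alpha>\<^sup>2 + \<beta>\<^sup>2 = x t \<bullet> x t + y t \<bullet> y t" by (simp add: \<alpha>_def \<beta>_def power2_norm_eq_inner)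
    finally show ?thesis unfolding W'_def by (simp add: mult_le_0_iff)
  qed
  have "W t \<le> W 0"
  proof (rule DERIV_nonpos_imp_decreasing_open[of 0 t W])
    show "0 \<le> t" using t by simp
    show "\<exists>y. (W has_real_derivative y) (at s) \<and> y \<le> 0" if "0 < s" "s < t" for s
    proof -
      have s: "s \<in> {0..b}" "0 < s" "s < b" using that t by auto
      then show ?thesis using Wd[OF s(1)] W'le[OF s(1)] by (auto simp: at_within_Icc_at)
    qed
    have "continuous_on {0..b} W" unfolding continuous_on_eq_continuous_within
      using Wd DERIV_continuous by blast
    then show "continuous_on {0..t} W" by (rule continuous_on_subset) (use t in auto)
  qed
  also have "W 0 = 0" using init by (simp add: W_def x_def y_def)
  finally have "x t \<bullet> x t + y t \<bullet> y t \<le> 0" by (simp add: W_def mult_le_0_iff)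
  then have "x t \<bullet> x t = 0" using inner_ge_zero[of "x t"] inner_ge_zero[of "y t"] by linarith
  then show ?thesis by (simp add: x_def)
qed

end

section \<open>The differential of the boundary distance\<close>

context Finsler_ball
begin

text \<open>For small \<open>s > 0\<close> the point \<open>y\<close> moves to \<open>cos \<theta> y + sin \<theta> u\<close>, and the new point is joined to
  the minimal curve at the time \<open>\<theta> / s\<close>; the resulting bounds for the derivative are optimized by
  letting \<open>s\<close> tend to \<open>0\<close>.\<close>

lemma boundary_first_variation:
  assumes y: "norm y = 1" and u: "norm u = 1" "y \<bullet> u = 0" and z: "z \<in> Ball3"
    and c: "\<And>t. t \<in> {0..l} \<Longrightarrow> c t \<in> Ball3" "\<And>s t. s \<in> {0..l} \<Longrightarrow> t \<in> {0..l} \<Longrightarrow> d (c s) (c t) = \<bar>s - t\<bar>"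
      "c 0 = y" "c l = z"
    and b: "0 < b" "b \<le> l" and V: "C1_curve 0 b c V" "G y (V 0) = 1"
    and D: "((\<lambda>\<theta>. d (cos \<theta> *\<^sub>R y + sin \<theta> *\<^sub>R u) z) has_real_derivative D) (at 0)"
  shows "D \<le> - (qm (y, V 0) \<bullet> u)"
proof -
  let ?y = "\<lambda>\<theta>. cos \<theta> *\<^sub>R y + sin \<theta> *\<^sub>R u"
  let ?v = "V 0"
  let ?F = "at_right (0::real)"
  have yB: "y \<in> Ball3" using y by simp
  have vnz: "?v \<noteq> 0" using V(2) G_zero[OF yB] by auto
  have yn: "norm (?y \<theta>) = 1" for \<theta>
  proof -
    have "(norm (?y \<theta>))\<^sup>2 = (cos \<theta>)\<^sup>2 + (sin \<theta>)\<^sup>2"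
      unfolding power2_norm_eq_inner using y u
      by (simp add: inner_add_left inner_add_right inner_commute power2_eq_square norm_eq_1)
    then have "(norm (?y \<theta>))\<^sup>2 = 1" by simp
    then show ?thesis using norm_ge_zero[of "?y \<theta>"] by (simp add: power2_eq_1_iff)
  qed
  then have yB': "?y \<theta> \<in> Ball3" for \<theta> by simp
  obtain C where C: "0 \<le> C" "\<And>x y. x \<in> Ball3 \<Longrightarrow> y \<in> Ball3 \<Longrightarrow> d x y \<le> G x (y - x) + C * (norm (y - x))\<^sup>2"
    using d_upper by blast
  obtain C3 where C3: "0 \<le> C3" "\<And>x y v. x \<in> Ball3 \<Longrightarrow> y \<in> Ball3 \<Longrightarrow> \<bar>G x v - G y v\<bar> \<le> C3 * norm (x - y) * norm v"
    using G_lipschitz_base by blast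
  have "continuous_on UNIV (G y)" using G_continuous[of UNIV "\<lambda>_. y" "\<lambda>v. v"] yB by auto
  then have Gc: "isCont (G y) w" for w by (simp add: continuous_on_eq_continuous_at)
  have l: "l = d y z" using c(2)[of 0 l] c(3,4) b by simp
  have bound: "D \<le> (G y (?v - s *\<^sub>R u) - 1) / s" if s: "s > 0" for s
  proof -
    \<comment> \<open>The displacement from the moved boundary point to the curve at time
      \<open>\<theta> / s\<close>, rescaled by \<open>\<theta>\<close>; its limit is
      \<open>V 0 / s - u\<close>.\<close>
    define X where "X \<theta> = (c (\<theta> / s) - ?y \<theta>) /\<^sub>R \<theta>" for \<theta>
    have Y': "((\<lambda>\<theta>. (?y \<theta> - y) /\<^sub>R \<theta>) \<longlongrightarrow> u) ?F"
    proof -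
      have "(?y has_vector_derivative 0 *\<^sub>R y + 1 *\<^sub>R u) (at_right 0)"
        by (rule has_vector_derivative_at_within) (auto intro!: derivative_eq_intros)
      from has_vector_derivative_quotient[OF this] show ?thesis by simp
    qed
    have c': "((\<lambda>\<theta>. (c (\<theta> / s) - y) /\<^sub>R (\<theta> / s)) \<longlongrightarrow> ?v) ?F"
    proof -
      have fl: "filterlim (\<lambda>\<theta>. \<theta> / s) (at 0 within {0..b}) ?F"
        unfolding filterlim_at
      proof
        have "\<forall>\<^sub>F \<theta> in ?F. \<theta> \<in> {0<..<b * s}" by (rule eventually_at_right_real) (use b s in simp)
        then show "\<forall>\<^sub>F \<theta> in ?F. \<theta> / s \<in> {0..b} \<and> \<theta> / s \<noteq> 0"
          by eventually_elim (use s in \<open>auto simp: field_simps\<close>)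
        have "((\<lambda>\<theta>. \<theta> / s) \<longlongrightarrow> 0 / s) ?F" by (intro tendsto_intros) (use s in auto)
        then show "((\<lambda>\<theta>. \<theta> / s) \<longlongrightarrow> 0) ?F" by simp
      qed
      have "(c has_vector_derivative ?v) (at 0 within {0..b})"
        using V(1) b unfolding C1_curve_def by auto
      from filterlim_compose[OF has_vector_derivative_quotient[OF this] fl] show ?thesis by (simp add: c(3))
    qed
    have X: "(X \<longlongrightarrow> (1 / s) *\<^sub>R ?v - u) ?F"
    proof (rule Lim_transform_eventually)
      show "((\<lambda>\<theta>. (1 / s) *\<^sub>R ((c (\<theta> / s) - y) /\<^sub>R (\<theta> / s)) - (?y \<theta> - y) /\<^sub>R \<theta>) \<longlongrightarrow> (1 / s) *\<^sub>R ?v - u) ?F"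
        by (intro tendsto_intros c' Y')
      show "\<forall>\<^sub>F \<theta> in ?F. (1 / s) *\<^sub>R ((c (\<theta> / s) - y) /\<^sub>R (\<theta> / s)) - (?y \<theta> - y) /\<^sub>R \<theta> = X \<theta>"
        unfolding eventually_at_filter
      proof (rule always_eventually, intro allI impI)
        fix \<theta> :: real assume "\<theta> \<noteq> 0"
        then have e1: "(1 / s) *\<^sub>R ((c (\<theta> / s) - y) /\<^sub>R (\<theta> / s)) = (c (\<theta> / s) - y) /\<^sub>R \<theta>" using s by (simp add: divide_inverse)
        show "(1 / s) *\<^sub>R ((c (\<theta> / s) - y) /\<^sub>R (\<theta> / s)) - (?y \<theta> - y) /\<^sub>R \<theta> = X \<theta>"
          unfolding e1 X_def by (simp add: scaleR_diff_right[symmetric])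
      qed
    qed
    have yl: "(?y \<longlongrightarrow> y) ?F"
    proof -
      have "(?y \<longlongrightarrow> cos 0 *\<^sub>R y + sin 0 *\<^sub>R u) ?F" by (intro tendsto_intros)
      then show ?thesis by simp
    qed
    let ?R = "\<lambda>\<theta>. G y (X \<theta>) + C3 * norm (?y \<theta> - y) * norm (X \<theta>) + C * \<theta> * (norm (X \<theta>))\<^sup>2 - 1 / s"
    let ?lim = "(1 / s) *\<^sub>R ?v - u"
    have "(?R \<longlongrightarrow> G y ?lim + C3 * norm (y - y) * norm ?lim + C * 0 * (norm ?lim)\<^sup>2 - 1 / s) ?F"
      by (intro tendsto_intros X yl isCont_tendsto_compose[OF Gc X])
    then have R: "(?R \<longlongrightarrow> G y ?lim - 1 / s) ?F" by simp
    have "(((\<lambda>\<theta>. (d (?y \<theta>) z - d (?y 0) z) / (\<theta> - 0))) \<longlongrightarrow> D) (at 0)"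
      using D by (simp only: has_field_derivative_iff)
    then have Q: "((\<lambda>\<theta>. (d (?y \<theta>) z - d y z) / \<theta>) \<longlongrightarrow> D) ?F"
      using tendsto_within_subset[OF _ subset_UNIV] by simp
    have "D \<le> G y ?lim - 1 / s"
    proof (rule tendsto_le[OF trivial_limit_at_right_real R Q])
      have "\<forall>\<^sub>F \<theta> in ?F. \<theta> \<in> {0<..<l * s}" by (rule eventually_at_right_real) (use b s in auto)
      then show "\<forall>\<^sub>F \<theta> in ?F. (d (?y \<theta>) z - d y z) / \<theta> \<le> ?R \<theta>"
      proof eventually_elim
        case (elim \<theta>)
        let ?t = "\<theta> / s"
        have t: "?t \<in> {0..l}" "\<theta> > 0" using elim s by (auto simp: field_simps)
        have l0: "l \<in> {0..l}" using b by simp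
        have w: "c ?t - ?y \<theta> = \<theta> *\<^sub>R X \<theta>" using t by (simp add: X_def)
        have "d (?y \<theta>) z \<le> d (?y \<theta>) (c ?t) + d (c ?t) z" by (rule d_triangle[OF yB' c(1)[OF t(1)] z])
        also have "d (c ?t) z = l - ?t" using c(2)[OF t(1) l0] c(4) t(1) by simp
        also have "d (?y \<theta>) (c ?t) \<le> G (?y \<theta>) (\<theta> *\<^sub>R X \<theta>) + C * (norm (\<theta> *\<^sub>R X \<theta>))\<^sup>2"
          using C(2)[OF yB'[of \<theta>] c(1)[OF t(1)]] by (simp only: w)
        also have "G (?y \<theta>) (\<theta> *\<^sub>R X \<theta>) = \<theta> * G (?y \<theta>) (X \<theta>)"
          using G_scale[OF yB'[of \<theta>], of \<theta> "X \<theta>"] t(2) by simp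
        also have "\<theta> * G (?y \<theta>) (X \<theta>) \<le> \<theta> * (G y (X \<theta>) + C3 * norm (?y \<theta> - y) * norm (X \<theta>))"
          using C3(2)[OF yB'[of \<theta>] yB, of "X \<theta>"] t(2) by (intro mult_left_mono) auto
        also have "C * (norm (\<theta> *\<^sub>R X \<theta>))\<^sup>2 = \<theta> * (C * \<theta> * (norm (X \<theta>))\<^sup>2)"
          by (simp add: power_mult_distrib) (simp add: power2_eq_square)
        finally have "d (?y \<theta>) z - d y z \<le> \<theta> * ?R \<theta>" unfolding l by (simp add: algebra_simps)
        then show ?case using t(2) by (simp add: divide_le_eq mult.commute)
      qed
    qed
    also have "G y ?lim = G y (?v - s *\<^sub>R u) / s"
    proof -
      have "?v - s *\<^sub>R u = s *\<^sub>R ?lim" using s by (simp add: scaleR_diff_right)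
      then show ?thesis using s by (simp add: G_scale[OF yB])
    qed
    finally show ?thesis by (simp add: diff_divide_distrib)
  qed
  \<comment> \<open>Letting \<open>s\<close> tend to 0 differentiates \<open>G y\<close> at
    \<open>V 0\<close> in direction \<open>- u\<close>. The derivative is taken from
    \<open>e\<close>, and dividing by \<open>G + 1\<close> converts it, since
    \<open>G\<^sup>2 - 1 = (G - 1) * (G + 1)\<close>.\<close>
  have line: "((\<lambda>s. e (y, ?v + s *\<^sub>R (- u))) has_real_derivative - (qm (y, ?v) \<bullet> u)) (at 0)"
    using e_line[OF yB, of ?v 0 "- u"] vnz qm[OF in_U[OF yB vnz], of "- u"] by simp
  have e0: "e (y, ?v) = 1 / 2" using e_G[OF yB vnz] V(2) by simp
  have 1: "((\<lambda>s. (e (y, ?v - s *\<^sub>R u) - 1 / 2) / s) \<longlongrightarrow> - (qm (y, ?v) \<bullet> u)) ?F"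
    using line e0 tendsto_within_subset[OF _ subset_UNIV] by (simp add: has_field_derivative_iff)
  have vs: "((\<lambda>s. ?v - s *\<^sub>R u) \<longlongrightarrow> ?v - 0 *\<^sub>R u) ?F" by (intro tendsto_intros)
  have "((\<lambda>s. G y (?v - s *\<^sub>R u)) \<longlongrightarrow> G y ?v) ?F"
    by (rule isCont_tendsto_compose[OF Gc]) (use vs in simp)
  then have "((\<lambda>s. G y (?v - s *\<^sub>R u)) \<longlongrightarrow> 1) ?F" by (simp only: V(2))
  then have 2: "((\<lambda>s. 2 * ((e (y, ?v - s *\<^sub>R u) - 1 / 2) / s) / (G y (?v - s *\<^sub>R u) + 1)) \<longlongrightarrow>
      2 * (- (qm (y, ?v) \<bullet> u)) / (1 + 1)) ?F"
    by (intro tendsto_intros 1) auto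
  show ?thesis
  proof (rule tendsto_le[OF trivial_limit_at_right_real _ tendsto_const])
    show "((\<lambda>s. 2 * ((e (y, ?v - s *\<^sub>R u) - 1 / 2) / s) / (G y (?v - s *\<^sub>R u) + 1)) \<longlongrightarrow> - (qm (y, ?v) \<bullet> u)) ?F"
      using 2 by simp
    have "((\<lambda>s. ?v - s *\<^sub>R u) \<longlongrightarrow> ?v) ?F" using vs by simp
    then have "\<forall>\<^sub>F s in ?F. ?v - s *\<^sub>R u \<noteq> 0" by (rule tendsto_imp_eventually_ne[OF _ vnz])
    moreover have "\<forall>\<^sub>F s in ?F. s \<in> {0<..<1}" by (rule eventually_at_right_real) simp
    ultimately show "\<forall>\<^sub>F s in ?F. D \<le> 2 * ((e (y, ?v - s *\<^sub>R u) - 1 / 2) / s) / (G y (?v - s *\<^sub>R u) + 1)"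
    proof eventually_elim
      case (elim s)
      let ?g = "G y (?v - s *\<^sub>R u)"
      have g: "?g + 1 > 0" using G_nonneg[OF yB, of "?v - s *\<^sub>R u"] by simp
      have "2 * (e (y, ?v - s *\<^sub>R u) - 1 / 2) = (?g - 1) * (?g + 1)"
        by (simp add: e_G[OF yB elim(1)] power2_eq_square algebra_simps)
      then have "2 * ((e (y, ?v - s *\<^sub>R u) - 1 / 2) / s) / (?g + 1) = (?g - 1) * (?g + 1) / s / (?g + 1)"
        by simp
      also have "\<dots> = (?g - 1) / s" using g by simp
      finally show ?case using bound[of s] elim(2) by simp
    qed
  qed
qed

lemma inward_velocity:
  assumes "norm (c 0) = 1" "0 < b" "\<And>t. t \<in> {0..b} \<Longrightarrow> c t \<in> Ball3" "C1_curve 0 b c V"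
  shows "c 0 \<bullet> V 0 \<le> 0"
proof -
  have "(c has_vector_derivative V 0) (at 0 within {0..b})" using assms(2,4) by (auto simp: C1_curve_def)
  from has_vector_derivative_quotient[OF this]
  have "((\<lambda>t. c 0 \<bullet> ((c t - c 0) /\<^sub>R (t - 0))) \<longlongrightarrow> c 0 \<bullet> V 0) (at 0 within {0..b})"
    by (intro tendsto_intros)
  moreover have "\<forall>\<^sub>F t in at 0 within {0..b}. c 0 \<bullet> ((c t - c 0) /\<^sub>R (t - 0)) \<le> 0"
    unfolding eventually_at_filter
  proof (rule always_eventually, intro allI impI)
    fix t assume t: "t \<noteq> 0" "t \<in> {0..b}"
    have "c 0 \<bullet> c t \<le> norm (c 0) * norm (c t)" by (rule norm_cauchy_schwarz)
    also have "\<dots> \<le> 1" using assms(1) assms(3)[OF t(2)] by simp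
    finally have "c 0 \<bullet> (c t - c 0) \<le> 0" using assms(1) by (simp add: inner_diff_right norm_eq_1)
    then show "c 0 \<bullet> ((c t - c 0) /\<^sub>R (t - 0)) \<le> 0" using t by (simp add: divide_simps mult_le_0_iff)
  qed
  moreover have "at 0 within {0..b} \<noteq> bot"
    using islimpt_Icc[OF assms(2)] assms(2) by (auto simp: trivial_limit_within)
  ultimately show ?thesis using tendsto_upperbound by blast
qed

text \<open>Unit covectors at a boundary point are determined, among those of inward pointing vectors,
  by their tangential part.\<close>

lemma inward_unit_vector_unique:
  assumes y: "y \<in> Ball3" and v: "G y v = 1" "G y w = 1" "y \<bullet> v \<le> 0" "y \<bullet> w \<le> 0"
    and q: "qm (y, v) - qm (y, w) = r *\<^sub>R y"
  shows "v = w"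
proof (rule ccontr)
  assume ne: "v \<noteq> w"
  have nz: "v \<noteq> 0" "w \<noteq> 0" using v G_zero[OF y] by auto
  obtain \<kappa> where \<kappa>: "\<kappa> > 0" "\<And>x v w. x \<in> Ball3 \<Longrightarrow> v \<noteq> 0 \<Longrightarrow>
       (G x w)\<^sup>2 / 2 \<ge> (G x v)\<^sup>2 / 2 + qm (x, v) \<bullet> (w - v) + \<kappa> * (norm (w - v))\<^sup>2"
    using e_strongly_convex by blast
  have p: "\<kappa> * (norm (w - v))\<^sup>2 > 0" "\<kappa> * (norm (v - w))\<^sup>2 > 0" using \<kappa>(1) ne by auto
  \<comment> \<open>Both vectors lie on the strictly convex unit sphere of \<open>G y\<close>, so
    each lies strictly inside the supporting half-space at the other. Testing the difference of the
    covectors, a multiple of \<open>y\<close>, on \<open>v\<close> and on \<open>w\<close> then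
    gives contradictory signs of \<open>r\<close>.\<close>
  have 1: "qm (y, v) \<bullet> (w - v) < 0" using \<kappa>(2)[OF y nz(1), of w] p v by simp
  have 2: "qm (y, w) \<bullet> (v - w) < 0" using \<kappa>(2)[OF y nz(2), of v] p v by simp
  have s: "qm (y, v) \<bullet> v = 1" "qm (y, w) \<bullet> w = 1"
    using qm[OF in_U[OF y nz(1)]] qm[OF in_U[OF y nz(2)]] De_self[OF y nz(1)] De_self[OF y nz(2)]
      e_G[OF y nz(1)] e_G[OF y nz(2)] v by simp_all
  have "r * (y \<bullet> v) = (qm (y, v) - qm (y, w)) \<bullet> v" unfolding q by simp
  also have "\<dots> > 0" using 2 s by (simp add: inner_diff_left inner_diff_right)
  finally have "r < 0" using v(3) by (simp add: zero_less_mult_iff)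
  have "r * (y \<bullet> w) = (qm (y, v) - qm (y, w)) \<bullet> w" unfolding q by simp
  also have "\<dots> < 0" using 1 s by (simp add: inner_diff_left inner_diff_right)
  finally have "r > 0" using v(4) by (simp add: mult_less_0_iff)
  with \<open>r < 0\<close> show False by simp
qed

text \<open>Ordering the two distances allows both minimizers to be compared on the shorter
  parameter interval. They share the initial covector and hence agree there, so the nearer point
  lies on the minimizer to the farther one, against the strict triangle inequality.\<close>

lemma no_common_derivative_aux:
  assumes y: "y \<in> S2" and z: "\<forall>i. z i \<in> S2 \<and> y \<noteq> z i" "z True \<noteq> z False"
    and strict: "\<forall>p\<in>S2. \<forall>q\<in>S2. \<forall>r\<in>S2. p \<noteq> q \<longrightarrow> q \<noteq> r \<longrightarrow> p \<noteq> r \<longrightarrow> d p r < d p q + d q r"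
    and D: "\<forall>u. norm u = 1 \<longrightarrow> y \<bullet> u = 0 \<longrightarrow>
      (\<exists>D. \<forall>i. ((\<lambda>\<theta>. d (cos \<theta> *\<^sub>R y + sin \<theta> *\<^sub>R u) (z i)) has_real_derivative D) (at 0))"
    and le: "d y (z True) \<le> d y (z False)"
  shows False
proof -
  have zS: "z i \<in> S2" and yz: "y \<noteq> z i" for i using z(1) by auto
  have B: "y \<in> Ball3" "z i \<in> Ball3" for i using y zS[of i] by auto
  have ny: "norm y = 1" using y by simp
  define l where "l i = d y (z i)" for i
  have "\<exists>c. c 0 = y \<and> c (l i) = z i \<and> (\<forall>t\<in>{0..l i}. c t \<in> Ball3) \<and>
     (\<forall>s\<in>{0..l i}. \<forall>t\<in>{0..l i}. d (c s) (c t) = \<bar>s - t\<bar>)" for i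
    using minimal_geodesic[OF B(1) B(2)[of i]] unfolding l_def by metis
  then obtain c where c0: "\<And>i. c i 0 = y" and cl: "\<And>i. c i (l i) = z i"
    and cB: "\<And>i t. t \<in> {0..l i} \<Longrightarrow> c i t \<in> Ball3"
    and cd: "\<And>i s t. s \<in> {0..l i} \<Longrightarrow> t \<in> {0..l i} \<Longrightarrow> d (c i s) (c i t) = \<bar>s - t\<bar>"
    by metis
  have lpos: "l i > 0" for i using d_nonneg[OF B(1) B(2)[of i]] d_eq_0[OF B(1) B(2)[of i]] yz[of i]
    by (auto simp: l_def less_le)
  have lle: "l True \<le> l i" for i using le by (cases i) (auto simp: l_def)
  have interior: "norm (c i t) < 1" if t: "0 < t" "t < l i" for i t
  proof (rule ccontr)
    assume "\<not> norm (c i t) < 1"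
    moreover have ti: "t \<in> {0..l i}" "0 \<in> {0..l i}" "l i \<in> {0..l i}" using t by auto
    ultimately have S: "c i t \<in> S2" using cB[OF ti(1)] by simp
    have 1: "d y (c i t) = t" "d (c i t) (z i) = l i - t"
      using cd[OF ti(2,1)] cd[OF ti(1,3)] c0 cl t by auto
    have "y \<noteq> c i t" using 1(1) t d_refl[OF B(1)] by auto
    moreover have "c i t \<noteq> z i" using 1(2) t d_refl[OF B(2)] by auto
    ultimately have "d y (z i) < d y (c i t) + d (c i t) (z i)" using strict y S zS[of i] yz[of i] by blast
    then show False using 1 by (simp add: l_def)
  qed
  have coincide: "c True t = c False t" if t: "0 < t" "t < l True" for t
  proof -
    have tl: "t < l i" for i using lle[of i] t by simp
    have "\<exists>V. C1_curve 0 t (c i) V \<and> (\<forall>s\<in>{0..t}. G (c i s) (V s) = 1)" for i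
      using minimal_C1[OF cB cd t(1) tl] by metis
    then obtain V where V: "\<And>i. C1_curve 0 t (c i) (V i)" "\<And>i s. s \<in> {0..t} \<Longrightarrow> G (c i s) (V i s) = 1" by metis
    have cB': "c i s \<in> Ball3" if "s \<in> {0..t}" for i s using cB[of s i] that tl[of i] by auto
    have EL: "((\<lambda>s. qm (c i s, V i s)) has_vector_derivative rm (c i s, V i s)) (at s within {0..t})"
      if "s \<in> {0..t}" for i s
    proof (rule Euler_Lagrange[OF t(1) V(1) _ _ V(2) _ that])
      show "norm (c i s) < 1" if "s \<in> {0<..t}" for s using interior[of s i] that tl[of i] by auto
      show "c i 0 \<in> Ball3" using c0 B by simp
      show "d (c i r) (c i s) = \<bar>r - s\<bar>" if "r \<in> {0..t}" "s \<in> {0..t}" for r s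
        using cd[of r i s] that tl[of i] by auto
    qed
    have V0: "G y (V i 0) = 1" for i using V(2)[of 0 i] c0 t(1) by simp
    have inw: "y \<bullet> V i 0 \<le> 0" for i
      using inward_velocity[of "c i" t "V i"] c0 ny t(1) cB' V(1) by simp
    have le: "D \<le> - (qm (y, V i 0) \<bullet> u)"
      if "norm u = 1" "y \<bullet> u = 0" "((\<lambda>\<theta>. d (cos \<theta> *\<^sub>R y + sin \<theta> *\<^sub>R u) (z i)) has_real_derivative D) (at 0)" for D u i
      by (rule boundary_first_variation[OF ny that(1,2) B(2) cB cd c0 cl t(1) less_imp_le[OF tl] V(1) V0 that(3)])
    have eq: "qm (y, V True 0) \<bullet> u = qm (y, V False 0) \<bullet> u" if u: "norm u = 1" "y \<bullet> u = 0" for u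
    proof -
      obtain D0 where D0: "\<And>i. ((\<lambda>\<theta>. d (cos \<theta> *\<^sub>R y + sin \<theta> *\<^sub>R u) (z i)) has_real_derivative D0) (at 0)"
        using D u by blast
      have neg: "((\<lambda>\<theta>. d (cos \<theta> *\<^sub>R y + sin \<theta> *\<^sub>R (- u)) (z i)) has_real_derivative - D0) (at 0)" for i
      proof -
        have "((\<lambda>\<theta>. d (cos (- \<theta>) *\<^sub>R y + sin (- \<theta>) *\<^sub>R u) (z i)) has_real_derivative D0 * (- 1)) (at 0)"
          by (rule DERIV_chain2[of "\<lambda>\<theta>. d (cos \<theta> *\<^sub>R y + sin \<theta> *\<^sub>R u) (z i)"])
             (use D0[of i] in \<open>auto intro!: derivative_eq_intros\<close>)
        then show ?thesis by simp
      qed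
      \<comment> \<open>The one-sided bound of \<open>boundary_first_variation\<close>, used for
        \<open>u\<close> and for \<open>- u\<close>, becomes an equality.\<close>
      have "qm (y, V i 0) \<bullet> u = - D0" for i
        using le[OF u D0[of i]] le[of "- u", OF _ _ neg[of i]] u by simp
      then show ?thesis by simp
    qed
    define w where "w = qm (y, V True 0) - qm (y, V False 0)"
    have "w = (w \<bullet> y) *\<^sub>R y"
    proof (rule ccontr)
      assume ne: "w \<noteq> (w \<bullet> y) *\<^sub>R y"
      define p where "p = w - (w \<bullet> y) *\<^sub>R y"
      have p: "p \<noteq> 0" "y \<bullet> p = 0" using ne ny by (auto simp: p_def inner_diff_right inner_commute norm_eq_1)
      have "w \<bullet> (p /\<^sub>R norm p) = 0"
        using eq[of "p /\<^sub>R norm p"] p by (simp add: w_def inner_diff_left)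
      then have "w \<bullet> p = 0" using p by simp
      moreover have "w \<bullet> p = p \<bullet> p"
        using p(2) by (simp add: p_def inner_diff_left inner_diff_right inner_commute)
      ultimately show False using p by simp
    qed
    then have v: "V True 0 = V False 0"
      using inward_unit_vector_unique[OF B(1) V0 V0 inw inw] unfolding w_def by blast
    have tt: "t \<in> {0..t}" and c00: "c True 0 = c False 0" using t by (simp_all add: c0)
    show ?thesis
      by (rule geodesic_flow_unique[where i = True and j = False and c = c and V = V and b = t];
          (rule t(1) V(1) v tt c00 | erule cB' V(2) EL))
  qed
  let ?l = "l True"
  have cont: "continuous_on {0..?l} (c i)" for i
  proof -
    obtain m where m: "m > 0" "\<And>x y. x \<in> Ball3 \<Longrightarrow> y \<in> Ball3 \<Longrightarrow> m * norm (x - y) \<le> d x y"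
      using d_lower_norm by blast
    have "(1 / m)-lipschitz_on {0..?l} (c i)"
    proof (rule lipschitz_onI)
      fix s t assume "s \<in> {0..?l}" "t \<in> {0..?l}"
      then have st: "s \<in> {0..l i}" "t \<in> {0..l i}" using lle[of i] by auto
      show "dist (c i s) (c i t) \<le> 1 / m * dist s t"
        using m(2)[OF cB[OF st(1)] cB[OF st(2)]] cd[OF st] m(1) by (simp add: dist_norm field_simps)
    qed (use m in simp)
    then show ?thesis by (rule lipschitz_on_continuous_on)
  qed
  have cl01: "closure {0<..<?l} = {0..?l}" using lpos by (rule closure_greaterThanLessThan)
  have "c True ?l - c False ?l = 0"
    by (rule continuous_constant_on_closure[of "{0<..<?l}" "\<lambda>t. c True t - c False t"])
       (use cl01 cont coincide lpos[of True] in \<open>auto intro!: continuous_intros\<close>)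
  then have zc: "c False ?l = z True" using cl[of True] by simp
  have il: "0 \<in> {0..l False}" "?l \<in> {0..l False}" "l False \<in> {0..l False}" using lle[of False] lpos[of True] by auto
  have "d y (z True) + d (z True) (z False) = d y (z False)"
    using cd[OF il(1,2)] cd[OF il(2,3)] zc c0[of False] cl[of False] lle[of False] lpos[of True] by (simp add: l_def)
  moreover have "d y (z False) < d y (z True) + d (z True) (z False)"
    using strict y zS yz z(2) by blast
  ultimately show False by simp
qed

text \<open>A geodesic is determined by its initial covector, which for a minimal geodesic starting at a
  boundary point \<open>y\<close> is determined by the differential of the boundary distance at \<open>y\<close>.\<close>

theorem no_common_derivative:
  assumes y: "y \<in> S2" and z: "\<forall>i. z i \<in> S2 \<and> y \<noteq> z i" "z True \<noteq> z False"
    and strict: "\<forall>p\<in>S2. \<forall>q\<in>S2. \<forall>r\<in>S2. p \<noteq> q \<longrightarrow> q \<noteq> r \<longrightarrow> p \<noteq> r \<longrightarrow> d p r < d p q + d q r"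
    and D: "\<forall>u. norm u = 1 \<longrightarrow> y \<bullet> u = 0 \<longrightarrow>
      (\<exists>D. \<forall>i. ((\<lambda>\<theta>. d (cos \<theta> *\<^sub>R y + sin \<theta> *\<^sub>R u) (z i)) has_real_derivative D) (at 0))"
  shows False
proof (cases "d y (z True) \<le> d y (z False)")
  case True
  show False by (rule no_common_derivative_aux[OF y z strict D True])
next
  case False
  show False
  proof (rule no_common_derivative_aux[OF y, where z = "\<lambda>i. z (\<not> i)"])
    show "\<forall>i. z (\<not> i) \<in> S2 \<and> y \<noteq> z (\<not> i)" using z(1) by blast
    show "z (\<not> True) \<noteq> z (\<not> False)" using z(2) by simp
    show "\<forall>u. norm u = 1 \<longrightarrow> y \<bullet> u = 0 \<longrightarrow> (\<exists>D. \<forall>i.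
        ((\<lambda>\<theta>. d (cos \<theta> *\<^sub>R y + sin \<theta> *\<^sub>R u) (z (\<not> i))) has_real_derivative D) (at 0))"
      using D by blast
    show "d y (z (\<not> True)) \<le> d y (z (\<not> False))" using False by simp
  qed (rule strict)
qed

end

lemma reversible_Finsler_imp_Finsler_ball:
  assumes "reversible_Finsler G"
  obtains g U where "Finsler_ball G g U"
proof -
  have 1: "\<forall>x\<in>Ball3. is_norm (G x)" and 2: "smooth_map_on slit_TB (\<lambda>(x, v). G x v)"
    and 3: "\<forall>x\<in>Ball3. \<forall>w. w \<noteq> 0 \<longrightarrow> (\<forall>u. u \<noteq> 0 \<longrightarrow> fundamental_tensor G x w u u > 0)"
    using assms unfolding reversible_Finsler_def by blast+
  obtain U g where U: "open U" "slit_TB \<subseteq> U" "Cinf_on U g" "\<forall>p\<in>slit_TB. (\<lambda>(x, v). G x v) p = g p"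
    using 2 unfolding smooth_map_on_iff_Cinf by blast
  have "Finsler_ball G g U"
  proof
    show "is_norm (G x)" if "x \<in> Ball3" for x using 1 that by blast
    show "G x v = g (x, v)" if "x \<in> Ball3" "v \<noteq> 0" for x v
    proof -
      have "(x, v) \<in> slit_TB" using that by (simp add: slit_TB_def)
      then show ?thesis using U(4) by fastforce
    qed
    show "fundamental_tensor G x w u u > 0" if "x \<in> Ball3" "w \<noteq> 0" "u \<noteq> 0" for x w u
      using 3 that by blast
  qed (rule U)+
  then show ?thesis by (rule that)
qed

section \<open>Pullbacks of the Euclidean metric\<close>

lemma has_derivative_zero_direction:
  fixes L :: "'a::real_normed_vector \<Rightarrow> real"
  assumes "((\<lambda>_. 0) has_derivative L) (at p within S)" "\<delta> > 0" "\<And>t. 0 \<le> t \<Longrightarrow> t \<le> \<delta> \<Longrightarrow> p + t *\<^sub>R w \<in> S"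
  shows "L w = 0"
proof -
  have 1: "((\<lambda>t. p + t *\<^sub>R w) has_derivative (\<lambda>t. t *\<^sub>R w)) (at 0 within {0..\<delta>})"
    by (auto intro!: derivative_eq_intros)
  have im: "(\<lambda>t. p + t *\<^sub>R w) ` {0..\<delta>} \<subseteq> S" using assms(3) by auto
  have "((\<lambda>_. 0) has_derivative L) (at (p + 0 *\<^sub>R w) within (\<lambda>t. p + t *\<^sub>R w) ` {0..\<delta>})"
    using has_derivative_subset[OF assms(1) im] by simp
  from has_derivative_in_compose[OF 1 this]
  have "((\<lambda>_. 0) has_derivative (\<lambda>t. L (t *\<^sub>R w))) (at 0 within {0..\<delta>})" .
  then have 2: "((\<lambda>_. 0) has_vector_derivative L w) (at 0 within {0..\<delta>})"
    using has_derivative_linear[OF assms(1)] by (simp add: has_vector_derivative_def linear_scale)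
  have "vector_derivative (\<lambda>_. 0 :: real) (at 0 within {0..\<delta>}) = L w"
    by (rule vector_derivative_within_closed_interval[OF assms(2) _ 2]) (use assms(2) in auto)
  moreover have "vector_derivative (\<lambda>_. 0 :: real) (at 0 within {0..\<delta>}) = 0"
    by (rule vector_derivative_within_closed_interval[OF assms(2)]) (use assms(2) in auto)
  ultimately show ?thesis by simp
qed

text \<open>\<open>denergy\<close> is a derivative within \<open>slit_TB\<close>, which is not open
  over the boundary sphere, so uniqueness needs an argument: directions from \<open>x\<close> to
  points of the ball are admissible, and their differences span the space because the ball is a
  neighbourhood of 0.\<close>

lemma slit_TB_has_derivative_unique:
  fixes f :: "(real^3) \<times> (real^3) \<Rightarrow> real"
  assumes p: "p \<in> slit_TB" and f: "(f has_derivative f') (at p within slit_TB)" "(f has_derivative f'') (at p within slit_TB)"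
  shows "f' = f''"
proof -
  define x where "x = fst p"
  define v where "v = snd p"
  have xv: "p = (x, v)" "x \<in> Ball3" "v \<noteq> 0" using p by (auto simp: slit_TB_def x_def v_def)
  define L where "L h = f' h - f'' h" for h
  have L0: "((\<lambda>_. 0) has_derivative L) (at p within slit_TB)"
    using has_derivative_diff[OF f] by (simp add: L_def[abs_def])
  have lin: "linear L" using has_derivative_linear[OF L0] .
  have dir: "L (q - x, k) = 0" if q: "q \<in> Ball3" for q k
  proof -
    define \<delta> where "\<delta> = min 1 (norm v / (2 * (norm k + 1)))"
    have \<delta>: "\<delta> > 0" using xv(3) by (simp add: \<delta>_def add_nonneg_pos)
    show ?thesis
    proof (rule has_derivative_zero_direction[OF L0 \<delta>])
      fix t assume t: "0 \<le> t" "t \<le> \<delta>"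
      have "x + t *\<^sub>R (q - x) \<in> Ball3"
        using convexD_alt[OF convex_cball xv(2) q, of t] t by (simp add: \<delta>_def algebra_simps)
      moreover have "v + t *\<^sub>R k \<noteq> 0"
      proof
        assume "v + t *\<^sub>R k = 0"
        then have "norm v = t * norm k" using t(1) by (metis add_eq_0_iff norm_minus_cancel norm_scaleR abs_of_nonneg)
        also have "\<dots> \<le> norm v / (2 * (norm k + 1)) * norm k"
          using t(2) by (intro mult_right_mono) (auto simp: \<delta>_def)
        also have "\<dots> \<le> norm v / 2"
        proof -
          have "norm k / (norm k + 1) \<le> 1" by (simp add: divide_le_eq_1 add_nonneg_pos)
          then have "norm v / 2 * (norm k / (norm k + 1)) \<le> norm v / 2 * 1" by (intro mult_left_mono) auto
          then show ?thesis by simp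
        qed
        finally show False using xv(3) by simp
      qed
      ultimately show "p + t *\<^sub>R (q - x, k) \<in> slit_TB" by (simp add: xv(1) slit_TB_def)
    qed
  qed
  have "L (h, k) = 0" for h k
  proof -
    define \<epsilon> where "\<epsilon> = 1 / (norm h + 1)"
    have \<epsilon>: "\<epsilon> > 0" by (simp add: \<epsilon>_def add_nonneg_pos)
    have "\<epsilon> * norm h \<le> 1" by (simp add: \<epsilon>_def divide_le_eq_1 add_nonneg_pos)
    then have "\<epsilon> *\<^sub>R h \<in> Ball3" using \<epsilon> by simp
    from dir[OF this, of "\<epsilon> *\<^sub>R k"] dir[of 0 0] have "L (\<epsilon> *\<^sub>R h - x, \<epsilon> *\<^sub>R k) - L (0 - x, 0) = 0" by simp
    then have "L ((\<epsilon> *\<^sub>R h - x, \<epsilon> *\<^sub>R k) - (0 - x, 0)) = 0" by (simp only: linear_diff[OF lin])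
    then have "L (\<epsilon> *\<^sub>R (h, k)) = 0" by simp
    then show ?thesis using \<epsilon> by (simp add: linear_scale[OF lin] del: scaleR_Pair)
  qed
  then show ?thesis by (intro ext) (simp add: L_def split_paired_all)
qed

text \<open>Linearity in the second argument reduces joint differentiability to the functions
  \<open>\<lambda>x. A x b\<close> for the finitely many basis vectors \<open>b\<close>.\<close>

lemma linear_family_has_derivative:
  fixes A :: "real^3 \<Rightarrow> real^3 \<Rightarrow> real^3"
  assumes lin: "\<And>x. linear (A x)" and A: "\<And>v. ((\<lambda>x. A x v) has_derivative (\<lambda>h. A' h v)) (at x)"
  shows "((\<lambda>p. A (fst p) (snd p)) has_derivative (\<lambda>p. A' (fst p) v + A x (snd p))) (at (x, v))"
proof -
  have rep: "A x v = (\<Sum>b\<in>Basis. (v \<bullet> b) *\<^sub>R A x b)" for x v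
    by (subst euclidean_representation[of v, symmetric]) (simp only: linear_sum[OF lin] linear_scale[OF lin])
  have A'rep: "A' h v = (\<Sum>b\<in>Basis. (v \<bullet> b) *\<^sub>R A' h b)" for h v
  proof -
    have "((\<lambda>x. \<Sum>b\<in>Basis. (v \<bullet> b) *\<^sub>R A x b) has_derivative (\<lambda>h. \<Sum>b\<in>Basis. (v \<bullet> b) *\<^sub>R A' h b)) (at x)"
      by (intro has_derivative_sum has_derivative_scaleR_right A)
    then have "((\<lambda>x. A x v) has_derivative (\<lambda>h. \<Sum>b\<in>Basis. (v \<bullet> b) *\<^sub>R A' h b)) (at x)"
      by (simp only: rep[symmetric])
    from has_derivative_unique[OF A this] show ?thesis by metis
  qed
  have f: "((\<lambda>p. A (fst p) b) has_derivative (\<lambda>p. A' (fst p) b)) (at (x, v))" for b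
    using has_derivative_compose[OF has_derivative_fst[OF has_derivative_ident], of "\<lambda>x. A x b" "\<lambda>h. A' h b" "(x, v)" UNIV] A[of b]
    by simp
  have s: "((\<lambda>p. snd p \<bullet> b) has_derivative (\<lambda>p. snd p \<bullet> b)) (at (x, v))" for b :: "real^3"
    by (intro has_derivative_inner_left has_derivative_snd has_derivative_ident)
  have "((\<lambda>p. \<Sum>b\<in>Basis. (snd p \<bullet> b) *\<^sub>R A (fst p) b) has_derivative
      (\<lambda>p. \<Sum>b\<in>Basis. (snd (x, v) \<bullet> b) *\<^sub>R A' (fst p) b + (snd p \<bullet> b) *\<^sub>R A (fst (x, v)) b)) (at (x, v))"
    by (intro has_derivative_sum has_derivative_scaleR f s)
  then show ?thesis
    by (simp only: rep[symmetric] sum.distrib A'rep[symmetric] fst_conv snd_conv)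
qed

lemma Cinf_on_vec_lambda:
  fixes f :: "'n::finite \<Rightarrow> 'a::euclidean_space \<Rightarrow> 'b::euclidean_space"
  assumes "open U" "\<And>i. Cinf_on U (f i)"
  shows "Cinf_on U (\<lambda>x. \<chi> i. f i x)"
proof -
  have 1: "(\<chi> i. f i x) = (\<Sum>i\<in>UNIV. axis i (f i x))" for x
    by (simp add: vec_eq_iff axis_def if_distrib[of "\<lambda>v. v $ _"] sum.delta cong: if_cong)
  have 2: "bounded_linear (axis i :: 'b \<Rightarrow> 'b ^ 'n)" for i
    by (simp add: linear_conv_bounded_linear[symmetric] linear_iff axis_def vec_eq_iff)
  show ?thesis unfolding 1
    by (intro Cinf_on_sum Cinf_on_bounded_linear[OF assms(1) 2] assms finite)
qed

lemma smooth_map_on_velocity: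
  assumes "smooth_map_on {0..1} c" shows "smooth_map_on {0..1} (velocity c)"
proof -
  obtain V k where V: "open V" "{0..1} \<subseteq> V" "Cinf_on V k" "\<And>t. t \<in> {0..1} \<Longrightarrow> c t = k t"
    using assms unfolding smooth_map_on_iff_Cinf by blast
  show ?thesis
  proof (rule smooth_map_onI[OF V(1,2) Cinf_on_vector_derivative(1)[OF V(1,3)]])
    fix t :: real assume t: "t \<in> {0..1}"
    show "velocity c t = vector_derivative k (at t)"
    proof (rule vector_derivative_within_closed_interval)
      have "(k has_vector_derivative vector_derivative k (at t)) (at t within {0..1})"
        by (rule has_vector_derivative_at_within[OF Cinf_on_vector_derivative(2)[OF V(1,3)]]) (use t V(2) in blast)
      then show "(c has_vector_derivative vector_derivative k (at t)) (at t within {0..1})"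
        by (rule has_vector_derivative_transform[OF t V(4), rotated])
    qed (use t in auto)
  qed
qed

lemma smooth_map_on_compose2:
  fixes f :: "(real^3) \<times> (real^3) \<Rightarrow> real^3" and c J :: "real \<Rightarrow> real^3"
  assumes "Cinf_on UNIV f" "smooth_map_on {0..1} c" "smooth_map_on {0..1} J"
  shows "smooth_map_on {0..1} (\<lambda>t. f (c t, J t))"
proof -
  obtain V k where V: "open V" "{0..1} \<subseteq> V" "Cinf_on V k" "\<And>t. t \<in> {0..1} \<Longrightarrow> c t = k t"
    using assms(2) unfolding smooth_map_on_iff_Cinf by blast
  obtain W j where W: "open W" "{0..1} \<subseteq> W" "Cinf_on W j" "\<And>t. t \<in> {0..1} \<Longrightarrow> J t = j t"
    using assms(3) unfolding smooth_map_on_iff_Cinf by blast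
  have o: "open (V \<inter> W)" using V W by blast
  have bl: "bounded_linear (\<lambda>v :: real^3. (v, 0 :: real^3))" "bounded_linear (\<lambda>v :: real^3. (0 :: real^3, v))"
    by (auto intro!: bounded_linear_Pair bounded_linear_ident bounded_linear_zero)
  have "Cinf_on (V \<inter> W) (\<lambda>t. (k t, 0) + (0, j t))"
    by (intro Cinf_on_add o Cinf_on_bounded_linear[OF o bl(1)] Cinf_on_bounded_linear[OF o bl(2)]
        Cinf_on_subset[OF V(3)] Cinf_on_subset[OF W(3)]) auto
  then have "Cinf_on (V \<inter> W) (\<lambda>t. (k t, j t))" by simp
  then have "Cinf_on (V \<inter> W) (\<lambda>t. f (k t, j t))"
    by (rule Cinf_on_compose[OF o open_UNIV assms(1)]) simp
  then show ?thesis by (rule smooth_map_onI[OF o, rotated]) (use V W in auto)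
qed

text \<open>Both maps are globally defined, so smoothness up to the boundary is immediate. The
  condition on norms makes the image of the unit ball a round, hence convex, ball and carries
  boundary defining functions into each other.\<close>

locale radial_diffeomorphism =
  fixes \<phi> \<psi> :: "real^3 \<Rightarrow> real^3" and R :: real
  assumes smooth: "Cinf_on UNIV \<phi>" "Cinf_on UNIV \<psi>"
    and inv: "\<And>x. \<phi> (\<psi> x) = x" "\<And>x. \<psi> (\<phi> x) = x"
    and norm_\<phi>: "\<And>x. norm (\<phi> x) = R * norm x" and R: "R > 0"
begin

definition "D x v = frechet_derivative \<phi> (at x) v"
text \<open>In \<open>D2 x h v\<close> and \<open>D3 x h w v\<close> the last argument is the vector
  fed to \<open>D\<close>; the preceding ones are directions of differentiation, the outermost
  first.\<close>

definition "D2 x h v = frechet_derivative (\<lambda>x. D x v) (at x) h"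
definition "D3 x h w v = frechet_derivative (\<lambda>x. D2 x w v) (at x) h"
definition pullback :: metric where "pullback x v = norm (D x v)"

lemma D: "(\<phi> has_derivative D x) (at x)"
  using Cinf_on_has_derivative[OF smooth(1)] by (simp add: D_def[abs_def])

lemma linear_D: "linear (D x)" using D has_derivative_linear by blast

lemma Cinf_D: "Cinf_on UNIV (\<lambda>x. D x v)"
  unfolding D_def by (rule Cinf_on_frechet_derivative[OF smooth(1)])

lemma D2: "((\<lambda>x. D x v) has_derivative (\<lambda>h. D2 x h v)) (at x)"
  using Cinf_on_has_derivative[OF Cinf_D] by (simp add: D2_def)

lemma Cinf_D2: "Cinf_on UNIV (\<lambda>x. D2 x h v)"
  unfolding D2_def by (rule Cinf_on_frechet_derivative[OF Cinf_D])

lemma D3: "((\<lambda>x. D2 x w v) has_derivative (\<lambda>h. D3 x h w v)) (at x)"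
  using Cinf_on_has_derivative[OF Cinf_D2] by (simp add: D3_def)

lemma D2_sym: "D2 x h v = D2 x v h"
  unfolding D2_def D_def by (rule Cinf_on_second_derivative_symmetric[OF open_UNIV smooth(1)]) simp

lemma D3_swap: "D3 x h w v = D3 x w h v"
  unfolding D3_def D2_def by (rule Cinf_on_second_derivative_symmetric[OF open_UNIV Cinf_D]) simp

lemma D3_sym: "D3 x h w v = D3 x w v h"
proof -
  have "D3 x h w v = D3 x w h v" by (rule D3_swap)
  also have "\<dots> = D3 x w v h" unfolding D3_def by (simp only: D2_sym[of _ h v])
  finally show ?thesis .
qed

lemma linear_D2: "linear (\<lambda>h. D2 x h v)" "linear (D2 x h)"
proof -
  show 1: "linear (\<lambda>h. D2 x h v)" for x v using D2 has_derivative_linear by blast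
  have "D2 x h = (\<lambda>v. D2 x v h)" by (intro ext) (rule D2_sym)
  then show "linear (D2 x h)" using 1 by simp
qed

lemma D_inverse: "frechet_derivative \<psi> (at (\<phi> x)) (D x v) = v" "D x (frechet_derivative \<psi> (at (\<phi> x)) w) = w"
proof -
  have \<psi>: "(\<psi> has_derivative frechet_derivative \<psi> (at y)) (at y)" for y
    by (rule Cinf_on_has_derivative[OF smooth(2)]) simp
  have "((\<lambda>x. \<psi> (\<phi> x)) has_derivative (\<lambda>v. frechet_derivative \<psi> (at (\<phi> x)) (D x v))) (at x)"
    by (rule has_derivative_compose[OF D \<psi>])
  then have "((\<lambda>x. x) has_derivative (\<lambda>v. frechet_derivative \<psi> (at (\<phi> x)) (D x v))) (at x)" by (simp only: inv)
  from has_derivative_unique[OF this has_derivative_ident]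
  show "frechet_derivative \<psi> (at (\<phi> x)) (D x v) = v" by metis
  have "((\<lambda>y. \<phi> (\<psi> y)) has_derivative (\<lambda>w. D (\<psi> (\<phi> x)) (frechet_derivative \<psi> (at (\<phi> x)) w))) (at (\<phi> x))"
    by (rule has_derivative_compose[OF \<psi> D])
  then have "((\<lambda>y. y) has_derivative (\<lambda>w. D x (frechet_derivative \<psi> (at (\<phi> x)) w))) (at (\<phi> x))" by (simp only: inv)
  from has_derivative_unique[OF this has_derivative_ident]
  show "D x (frechet_derivative \<psi> (at (\<phi> x)) w) = w" by metis
qed

lemma D_eq_0: "D x v = 0 \<longleftrightarrow> v = 0"
proof
  assume "D x v = 0"
  then have "D x v = D x 0" by (simp add: linear_0[OF linear_D])
  then show "v = 0" by (metis D_inverse(1))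
qed (simp add: linear_0[OF linear_D])

text \<open>Surjectivity of \<open>D x\<close> in weak form; it removes the test vector
  \<open>w\<close> from the Euler-Lagrange and Jacobi equations.\<close>

lemma D_orthogonal_zero:
  assumes "\<And>w. p \<bullet> D x w = 0" shows "p = 0"
  using assms[of "frechet_derivative \<psi> (at (\<phi> x)) p"] by (simp add: D_inverse)

lemma Cinf_D_joint: "Cinf_on UNIV (\<lambda>p :: (real^3) \<times> (real^3). D (fst p) (snd p))"
  unfolding D_def
  by (rule Cinf_on_frechet_derivative_varying[OF open_UNIV open_UNIV smooth(1)])
     (auto intro!: Cinf_on_linear bounded_linear_fst bounded_linear_snd)

lemma D_joint: "((\<lambda>p. D (fst p) (snd p)) has_derivative (\<lambda>p. D2 x (fst p) v + D x (snd p))) (at (x, v))"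
  by (rule linear_family_has_derivative[OF linear_D D2])

lemma D2_joint: "((\<lambda>p. D2 (fst p) w (snd p)) has_derivative (\<lambda>p. D3 x (fst p) w v + D2 x w (snd p))) (at (x, v))"
  by (rule linear_family_has_derivative[OF linear_D2(2) D3])

lemma D_fst: "((\<lambda>p. D (fst p) w) has_derivative (\<lambda>p. D2 x (fst p) w)) (at (x, v :: real^3))"
  using has_derivative_compose[OF has_derivative_fst[OF has_derivative_ident], of "\<lambda>x. D x w" "\<lambda>h. D2 x h w" "(x, v)" UNIV] D2[of w x]
  by simp

lemma pullback_norm: "is_norm (pullback x)"
  unfolding is_norm_def pullback_def
  using linear_add[OF linear_D] linear_scale[OF linear_D] by (auto simp: D_eq_0 norm_triangle_ineq)

lemma energy_pullback: "energy pullback p = (D (fst p) (snd p) \<bullet> D (fst p) (snd p)) / 2"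
  by (simp add: energy_def pullback_def split_beta power2_norm_eq_inner)

lemma denergy_pullback:
  assumes "x \<in> Ball3" "v \<noteq> 0"
  shows "denergy pullback (x, v) (h, k) = D x v \<bullet> (D2 x h v + D x k)"
proof -
  have p: "(x, v) \<in> slit_TB" using assms by (simp add: slit_TB_def)
  have "((\<lambda>p. (D (fst p) (snd p) \<bullet> D (fst p) (snd p)) / 2) has_derivative
      (\<lambda>p. (D (fst (x, v)) (snd (x, v)) \<bullet> (D2 x (fst p) v + D x (snd p))
        + (D2 x (fst p) v + D x (snd p)) \<bullet> D (fst (x, v)) (snd (x, v))) / 2)) (at (x, v))"
    by (intro bounded_linear.has_derivative[OF bounded_linear_divide] has_derivative_inner D_joint)
  then have "(energy pullback has_derivative (\<lambda>p. D x v \<bullet> (D2 x (fst p) v + D x (snd p)))) (at (x, v))"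
    by (simp add: energy_pullback[abs_def] inner_commute)
  then have 1: "(energy pullback has_derivative (\<lambda>p. D x v \<bullet> (D2 x (fst p) v + D x (snd p)))) (at (x, v) within slit_TB)"
    by (rule has_derivative_at_withinI)
  then have "(energy pullback has_derivative frechet_derivative (energy pullback) (at (x, v) within slit_TB)) (at (x, v) within slit_TB)"
    using frechet_derivative_works differentiableI by blast
  from slit_TB_has_derivative_unique[OF p this 1] show ?thesis by (simp add: denergy_def)
qed

lemma ddenergy_unique:
  assumes "x \<in> Ball3" "v \<noteq> 0" "\<And>x v. x \<in> Ball3 \<Longrightarrow> v \<noteq> 0 \<Longrightarrow> denergy pullback (x, v) w = f (x, v)"
    "(f has_derivative f') (at (x, v))"
  shows "ddenergy pullback (x, v) w h = f' h"
proof -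
  have p: "(x, v) \<in> slit_TB" using assms by (simp add: slit_TB_def)
  have "(f has_derivative f') (at (x, v) within slit_TB)" by (rule has_derivative_at_withinI[OF assms(4)])
  then have 1: "((\<lambda>q. denergy pullback q w) has_derivative f') (at (x, v) within slit_TB)"
  proof (rule has_derivative_transform[OF p, rotated])
    fix q assume "q \<in> slit_TB"
    then have "fst q \<in> Ball3" "snd q \<noteq> 0" by (auto simp: slit_TB_def)
    from assms(3)[OF this] show "denergy pullback q w = f q" by simp
  qed
  then have "((\<lambda>q. denergy pullback q w) has_derivative frechet_derivative (\<lambda>q. denergy pullback q w) (at (x, v) within slit_TB)) (at (x, v) within slit_TB)"
    using frechet_derivative_works differentiableI by blast
  from slit_TB_has_derivative_unique[OF p this 1] show ?thesis by (simp add: ddenergy_def)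
qed

lemma ddenergy_vertical:
  assumes "x \<in> Ball3" "v \<noteq> 0"
  shows "ddenergy pullback (x, v) (0, w) (h, k) = D x v \<bullet> D2 x h w + (D2 x h v + D x k) \<bullet> D x w"
proof -
  have "((\<lambda>p. D (fst p) (snd p) \<bullet> D (fst p) w) has_derivative
      (\<lambda>p. D (fst (x, v)) (snd (x, v)) \<bullet> D2 x (fst p) w + (D2 x (fst p) v + D x (snd p)) \<bullet> D (fst (x, v)) w)) (at (x, v))"
    by (intro has_derivative_inner D_joint D_fst)
  from ddenergy_unique[OF assms _ this, of "(0, w)" "(h, k)"] show ?thesis
    by (simp add: denergy_pullback linear_0[OF linear_D2(1)] del: mem_cball_0)
qed

lemma ddenergy_horizontal:
  assumes "x \<in> Ball3" "v \<noteq> 0"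
  shows "ddenergy pullback (x, v) (w, 0) (h, k) = D x v \<bullet> (D3 x h w v + D2 x w k) + (D2 x h v + D x k) \<bullet> D2 x w v"
proof -
  have "((\<lambda>p. D (fst p) (snd p) \<bullet> D2 (fst p) w (snd p)) has_derivative
      (\<lambda>p. D (fst (x, v)) (snd (x, v)) \<bullet> (D3 x (fst p) w v + D2 x w (snd p)) + (D2 x (fst p) v + D x (snd p)) \<bullet> D2 (fst (x, v)) w (snd (x, v)))) (at (x, v))"
    by (intro has_derivative_inner D_joint D2_joint)
  from ddenergy_unique[OF assms _ this, of "(w, 0)" "(h, k)"] show ?thesis
    by (simp add: denergy_pullback linear_0[OF linear_D] del: mem_cball_0)
qed

lemma fundamental_tensor_pullback: "fundamental_tensor pullback x w u v = D x u \<bullet> D x v"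
proof -
  have 1: "deriv (\<lambda>t. (pullback x (a + t *\<^sub>R v))\<^sup>2) 0 = 2 * (D x a \<bullet> D x v)" for a
  proof (rule DERIV_imp_deriv)
    have e: "(pullback x (a + t *\<^sub>R v))\<^sup>2 = D x a \<bullet> D x a + t * (2 * (D x a \<bullet> D x v)) + t\<^sup>2 * (D x v \<bullet> D x v)" for t
      unfolding pullback_def power2_norm_eq_inner linear_add[OF linear_D] linear_scale[OF linear_D]
      by (simp add: inner_add_left inner_add_right inner_commute power2_eq_square algebra_simps)
    show "((\<lambda>t. (pullback x (a + t *\<^sub>R v))\<^sup>2) has_real_derivative 2 * (D x a \<bullet> D x v)) (at 0)"
      unfolding e by (auto intro!: derivative_eq_intros)
  qed
  have "deriv (\<lambda>s. 2 * (D x (w + s *\<^sub>R u) \<bullet> D x v)) 0 = 2 * (D x u \<bullet> D x v)"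
  proof (rule DERIV_imp_deriv)
    have e: "2 * (D x (w + s *\<^sub>R u) \<bullet> D x v) = 2 * (D x w \<bullet> D x v) + s * (2 * (D x u \<bullet> D x v))" for s
      by (simp add: linear_add[OF linear_D] linear_scale[OF linear_D] inner_add_left algebra_simps)
    show "((\<lambda>s. 2 * (D x (w + s *\<^sub>R u) \<bullet> D x v)) has_real_derivative 2 * (D x u \<bullet> D x v)) (at 0)"
      unfolding e by (auto intro!: derivative_eq_intros)
  qed
  then show ?thesis unfolding fundamental_tensor_def 1 by simp
qed

lemma reversible_Finsler_pullback: "reversible_Finsler pullback"
proof -
  let ?U = "UNIV \<times> (- {0}) :: ((real^3) \<times> (real^3)) set"
  have U: "open ?U" by (intro open_Times) auto
  have "Cinf_on ?U (\<lambda>p. D (fst p) (snd p) \<bullet> D (fst p) (snd p))"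
    by (intro Cinf_on_inner U Cinf_on_subset[OF Cinf_D_joint]) auto
  then have "Cinf_on ?U (\<lambda>p. sqrt (D (fst p) (snd p) \<bullet> D (fst p) (snd p)))"
    by (rule Cinf_on_compose[OF U open_greaterThan Cinf_on_sqrt]) (auto simp: D_eq_0)
  then have "smooth_map_on slit_TB (\<lambda>(x, v). pullback x v)"
    by (rule smooth_map_onI[OF U, rotated]) (auto simp: slit_TB_def pullback_def norm_eq_sqrt_inner)
  moreover have "pullback x (- v) = pullback x v" for x v
    by (simp add: pullback_def linear_neg[OF linear_D])
  ultimately show ?thesis
    unfolding reversible_Finsler_def
    by (auto simp: pullback_norm fundamental_tensor_pullback D_eq_0)
qed

lemma Riemannian_pullback: "Riemannian pullback"
  unfolding Riemannian_def
proof (intro exI conjI ballI allI impI)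
  let ?g = "\<lambda>x. \<chi> i j. D x (axis i 1) \<bullet> D x (axis j 1)"
  have "Cinf_on UNIV ?g"
    by (intro Cinf_on_vec_lambda Cinf_on_inner Cinf_D open_UNIV)
  then show "smooth_map_on Ball3 ?g" by (rule smooth_map_onI[OF open_UNIV, rotated]) auto
  show "transpose (?g x) = ?g x" for x by (simp add: transpose_def vec_eq_iff inner_commute)
  have q: "v \<bullet> (?g x *v v) = D x v \<bullet> D x v" for x v
  proof -
    have "(\<Sum>i\<in>UNIV. v $ i *\<^sub>R axis i 1) = v"
      using basis_expansion[of v] unfolding scalar_mult_eq_scaleR .
    then have "D x v = D x (\<Sum>i\<in>UNIV. v $ i *\<^sub>R axis i 1)" by simp
    then have "D x v = (\<Sum>i\<in>UNIV. v $ i *\<^sub>R D x (axis i 1))"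
      by (simp only: linear_sum[OF linear_D] linear_scale[OF linear_D])
    note dv = this
    have "D x (axis i 1) \<bullet> D x v = (\<Sum>j\<in>UNIV. (D x (axis i 1) \<bullet> D x (axis j 1)) * v $ j)" for i
      by (subst dv) (simp add: inner_sum_right mult.commute)
    then have "(?g x *v v) $ i = D x (axis i 1) \<bullet> D x v" for i
      by (simp add: matrix_vector_mult_def)
    then have "v \<bullet> (?g x *v v) = (\<Sum>i\<in>UNIV. v $ i * (D x (axis i 1) \<bullet> D x v))"
      by (simp add: inner_vec_def[of v])
    also have "\<dots> = (\<Sum>i\<in>UNIV. v $ i *\<^sub>R D x (axis i 1)) \<bullet> D x v"
      by (simp add: inner_sum_left)
    finally show ?thesis by (simp only: dv[symmetric])
  qed
  show "v \<bullet> (?g x *v v) > 0" if "v \<noteq> 0" for x v unfolding q using that by (simp add: D_eq_0)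
  show "pullback x v = sqrt (v \<bullet> (?g x *v v))" for x v unfolding q by (simp add: pullback_def norm_eq_sqrt_inner)
qed

text \<open>The first and second derivatives of
  \<open>\<phi> x \<bullet> \<phi> x = R\<^sup>2 * (x \<bullet> x)\<close>; the second one transfers
  the convexity of the boundary.\<close>

lemma radial_identity:
  shows "\<phi> x \<bullet> D x v = R\<^sup>2 * (x \<bullet> v)" "D x v \<bullet> D x v + \<phi> x \<bullet> D2 x v v = R\<^sup>2 * (v \<bullet> v)"
proof -
  have e: "\<phi> x \<bullet> \<phi> x = R\<^sup>2 * (x \<bullet> x)" for x
    using norm_\<phi>[of x] by (simp add: power2_norm_eq_inner[symmetric] power_mult_distrib)
  show 1: "\<phi> x \<bullet> D x v = R\<^sup>2 * (x \<bullet> v)" for x v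
  proof -
    have d1: "((\<lambda>x. \<phi> x \<bullet> \<phi> x) has_derivative (\<lambda>v. \<phi> x \<bullet> D x v + D x v \<bullet> \<phi> x)) (at x)"
      by (intro has_derivative_inner D)
    have d2: "((\<lambda>x. R\<^sup>2 * (x \<bullet> x)) has_derivative (\<lambda>v. R\<^sup>2 * (x \<bullet> v + v \<bullet> x))) (at x)"
      by (intro has_derivative_mult_right has_derivative_inner has_derivative_ident)
    from fun_cong[OF has_derivative_unique[OF d1[unfolded e] d2], of v]
    show ?thesis by (simp add: inner_commute)
  qed
  have d1: "((\<lambda>x. \<phi> x \<bullet> D x v) has_derivative (\<lambda>h. \<phi> x \<bullet> D2 x h v + D x h \<bullet> D x v)) (at x)"
    by (intro has_derivative_inner D D2)
  have d2: "((\<lambda>x. R\<^sup>2 * (x \<bullet> v)) has_derivative (\<lambda>h. R\<^sup>2 * (h \<bullet> v))) (at x)"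
    by (intro has_derivative_mult_right has_derivative_inner_left has_derivative_ident)
  from fun_cong[OF has_derivative_unique[OF d1[unfolded 1] d2], of v]
  have "\<phi> x \<bullet> D2 x v v + D x v \<bullet> D x v = R\<^sup>2 * (v \<bullet> v)" .
  then show "D x v \<bullet> D x v + \<phi> x \<bullet> D2 x v v = R\<^sup>2 * (v \<bullet> v)" by simp
qed

text \<open>The equation for \<open>a\<close> amounts to \<open>D2 x v v + D x a = 0\<close>: the
  image curve has no acceleration. Then \<open>radial_identity\<close> shows that
  \<open>R\<^sup>2\<close> times the quantity in question is
  \<open>D x v \<bullet> D x v\<close>.\<close>

lemma convex_pullback: "convex_metric pullback"
  unfolding convex_metric_def
proof (intro ballI allI impI)
  fix x v a assume x: "x \<in> S2" and a: "v \<noteq> 0 \<and> x \<bullet> v = 0 \<and> geodesic_acceleration pullback x v a"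
  have xB: "x \<in> Ball3" using x by simp
  have "(D2 x v v + D x a) \<bullet> D x w = 0" for w
  proof -
    have v: "v \<noteq> 0" using a by simp
    have "ddenergy pullback (x, v) (0, w) (v, a) = denergy pullback (x, v) (w, 0)"
      using a unfolding geodesic_acceleration_def by blast
    then show ?thesis
      unfolding ddenergy_vertical[OF xB v] denergy_pullback[OF xB v] D2_sym[of x w v]
      by (simp add: linear_0[OF linear_D])
  qed
  then have "D2 x v v + D x a = 0" by (rule D_orthogonal_zero)
  then have "D2 x v v = - D x a" by (simp add: add_eq_0_iff2)
  then have "R\<^sup>2 * (v \<bullet> v + x \<bullet> a) = D x v \<bullet> D x v"
    using radial_identity(2)[of x v] radial_identity(1)[of x a] by (simp add: algebra_simps)
  then have "R\<^sup>2 * (v \<bullet> v + x \<bullet> a) \<ge> 0" by simp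
  then show "v \<bullet> v + x \<bullet> a \<ge> 0" using R by (simp add: zero_le_mult_iff)
qed

lemma smooth_D_curve:
  fixes c J :: "real \<Rightarrow> real^3"
  assumes "smooth_map_on {0..1} c" "smooth_map_on {0..1} J"
  shows "smooth_map_on {0..1} (\<lambda>t. D (c t) (J t))"
  using smooth_map_on_compose2[OF Cinf_D_joint assms] by simp

lemma smooth_velocity:
  fixes c :: "real \<Rightarrow> real^3"
  assumes "smooth_map_on {0..1} c" "t \<in> {0..1}"
  shows "(c has_vector_derivative velocity c t) (at t within {0..1})"
  using smooth_map_on_C1_curve[OF assms(1)] assms(2) by (simp add: C1_curve_def)

lemma curve_derivatives:
  fixes c J :: "real \<Rightarrow> real^3"
  assumes c: "smooth_map_on {0..1} c" and J: "smooth_map_on {0..1} J" and t: "t \<in> {0..1}"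
  shows "((\<lambda>t. \<phi> (c t)) has_vector_derivative D (c t) (velocity c t)) (at t within {0..1})"
    and "((\<lambda>t. D (c t) (J t)) has_vector_derivative D2 (c t) (velocity c t) (J t) + D (c t) (velocity J t)) (at t within {0..1})"
    and "((\<lambda>t. D2 (c t) w (J t)) has_vector_derivative D3 (c t) (velocity c t) w (J t) + D2 (c t) w (velocity J t)) (at t within {0..1})"
proof -
  have c': "(c has_derivative (\<lambda>a. a *\<^sub>R velocity c t)) (at t within {0..1})"
    and J': "(J has_derivative (\<lambda>a. a *\<^sub>R velocity J t)) (at t within {0..1})"
    using smooth_velocity[OF c t] smooth_velocity[OF J t] by (simp_all add: has_vector_derivative_def)
  show "((\<lambda>t. \<phi> (c t)) has_vector_derivative D (c t) (velocity c t)) (at t within {0..1})"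
    using has_derivative_compose[OF c' D] by (simp add: has_vector_derivative_def linear_scale[OF linear_D])
  note cJ = has_derivative_Pair[OF c' J']
  show "((\<lambda>t. D (c t) (J t)) has_vector_derivative D2 (c t) (velocity c t) (J t) + D (c t) (velocity J t)) (at t within {0..1})"
    using has_derivative_compose[OF cJ D_joint]
    by (simp add: has_vector_derivative_def linear_scale[OF linear_D] linear_scale[OF linear_D2(1)] scaleR_add_right)
  have lin3: "linear (\<lambda>h. D3 x h w v)" for x v using D3 has_derivative_linear by blast
  show "((\<lambda>t. D2 (c t) w (J t)) has_vector_derivative D3 (c t) (velocity c t) w (J t) + D2 (c t) w (velocity J t)) (at t within {0..1})"
    using has_derivative_compose[OF cJ D2_joint[of w]]
    by (simp add: has_vector_derivative_def linear_scale[OF lin3] linear_scale[OF linear_D2(2)] scaleR_add_right)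
qed

lemma curve_D_derivative:
  fixes c :: "real \<Rightarrow> real^3"
  assumes c: "smooth_map_on {0..1} c" and t: "t \<in> {0..1}"
  shows "((\<lambda>t. D (c t) w) has_vector_derivative D2 (c t) (velocity c t) w) (at t within {0..1})"
proof -
  have c': "(c has_derivative (\<lambda>a. a *\<^sub>R velocity c t)) (at t within {0..1})"
    using smooth_velocity[OF c t] by (simp add: has_vector_derivative_def)
  show ?thesis
    using has_derivative_compose[OF c' D2[of w]] by (simp add: has_vector_derivative_def linear_scale[OF linear_D2(1)])
qed

lemma constant_if_vector_derivative_zero:
  fixes f :: "real \<Rightarrow> real^3"
  assumes "\<And>t. t \<in> {0..1} \<Longrightarrow> (f has_vector_derivative 0) (at t within {0..1})" "t \<in> {0..1}"
  shows "f t = f 0"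
  using has_derivative_zero_unique[of "{0..1}" f 0 t] assms by (auto simp: has_vector_derivative_def)

lemma affine_if_vector_derivative_constant:
  fixes f :: "real \<Rightarrow> real^3"
  assumes "\<And>t. t \<in> {0..1} \<Longrightarrow> (f has_vector_derivative p) (at t within {0..1})" "t \<in> {0..1}"
  shows "f t = f 0 + t *\<^sub>R p"
proof -
  have "((\<lambda>t. f t - t *\<^sub>R p) has_vector_derivative p - 1 *\<^sub>R p) (at t within {0..1})" if "t \<in> {0..1}" for t
    by (intro has_vector_derivative_diff assms that) (auto intro!: derivative_eq_intros)
  then have "((\<lambda>t. f t - t *\<^sub>R p) has_vector_derivative 0) (at t within {0..1})" if "t \<in> {0..1}" for t
    using that by simp
  from constant_if_vector_derivative_zero[OF this assms(2)] show ?thesis by (simp add: algebra_simps)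
qed

text \<open>For the velocity \<open>p\<close> of the image curve, the Euler-Lagrange equation is the
  product rule for \<open>p s \<bullet> D (c s) w\<close> without the term containing the derivative
  of \<open>p\<close>, up to the symmetry of \<open>D2\<close>. Hence \<open>p\<close> is constant
  and the image is a straight segment.\<close>

lemma geodesic_pullback:
  assumes "geodesic pullback c"
  obtains p where "\<And>t. t \<in> {0..1} \<Longrightarrow> D (c t) (velocity c t) = p" "\<And>t. t \<in> {0..1} \<Longrightarrow> \<phi> (c t) = \<phi> (c 0) + t *\<^sub>R p"
proof -
  have c: "smooth_map_on {0..1} c" "\<And>t. t \<in> {0..1} \<Longrightarrow> c t \<in> Ball3" "\<And>t. t \<in> {0..1} \<Longrightarrow> velocity c t \<noteq> 0"
    and EL: "\<And>t w. t \<in> {0..1} \<Longrightarrow> ((\<lambda>s. denergy pullback (c s, velocity c s) (0, w)) has_real_derivative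
           denergy pullback (c t, velocity c t) (w, 0)) (at t within {0..1})"
    using assms unfolding geodesic_def by blast+
  define p where "p t = D (c t) (velocity c t)" for t
  have ps: "smooth_map_on {0..1} p" unfolding p_def by (rule smooth_D_curve[OF c(1) smooth_map_on_velocity[OF c(1)]])
  have "velocity p t = 0" if t: "t \<in> {0..1}" for t
  proof (rule D_orthogonal_zero)
    fix w
    have 1: "((\<lambda>s. p s \<bullet> D (c s) w) has_vector_derivative p t \<bullet> D2 (c t) (velocity c t) w + velocity p t \<bullet> D (c t) w) (at t within {0..1})"
      by (intro bounded_bilinear.has_vector_derivative[OF bounded_bilinear_inner] smooth_velocity[OF ps t] curve_D_derivative[OF c(1) t])
    have "((\<lambda>s. denergy pullback (c s, velocity c s) (0, w)) has_vector_derivative p t \<bullet> D2 (c t) w (velocity c t)) (at t within {0..1})"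
      using EL[OF t, of w] denergy_pullback[OF c(2)[OF t] c(3)[OF t], of w 0]
      by (simp add: has_real_derivative_iff_has_vector_derivative p_def linear_0[OF linear_D])
    then have 2: "((\<lambda>s. p s \<bullet> D (c s) w) has_vector_derivative p t \<bullet> D2 (c t) w (velocity c t)) (at t within {0..1})"
      by (rule has_vector_derivative_transform[OF t, rotated])
         (use denergy_pullback[OF c(2) c(3)] in \<open>simp add: p_def linear_0[OF linear_D2(1)]\<close>)
    from vector_derivative_within_closed_interval[OF zero_less_one t 1]
      vector_derivative_within_closed_interval[OF zero_less_one t 2]
    show "velocity p t \<bullet> D (c t) w = 0" by (simp add: D2_sym[of "c t" w])
  qed
  then have "(p has_vector_derivative 0) (at t within {0..1})" if "t \<in> {0..1}" for t
    using smooth_velocity[OF ps that] that by simp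
  from constant_if_vector_derivative_zero[OF this] have pc: "p t = p 0" if "t \<in> {0..1}" for t using that by blast
  have "((\<lambda>t. \<phi> (c t)) has_vector_derivative p 0) (at t within {0..1})" if "t \<in> {0..1}" for t
    using curve_derivatives(1)[OF c(1) c(1) that] pc[OF that] by (simp add: p_def)
  from affine_if_vector_derivative_constant[OF this] have "\<phi> (c t) = \<phi> (c 0) + t *\<^sub>R p 0" if "t \<in> {0..1}" for t
    using that by blast
  note aff = this
  show ?thesis
  proof (rule that[of "p 0"])
    show "D (c t) (velocity c t) = p 0" if "t \<in> {0..1}" for t using pc[OF that] unfolding p_def .
  qed (rule aff)
qed

text \<open>By linearization the image \<open>K\<close> of a Jacobi field is affine in
  \<open>t\<close>, so zeros at both ends make it vanish. The third derivatives cancel by the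
  symmetry of \<open>D3\<close>.\<close>

lemma no_conjugate_points_pullback: "no_conjugate_points pullback"
  unfolding no_conjugate_points_def
proof (intro allI impI ballI)
  fix c J t
  assume g: "geodesic pullback c" and Ja: "Jacobi_field pullback c J" and J01: "J 0 = 0" "J 1 = 0" and t: "t \<in> {0..1::real}"
  have c: "smooth_map_on {0..1} c" "\<And>t. t \<in> {0..1} \<Longrightarrow> c t \<in> Ball3" "\<And>t. t \<in> {0..1} \<Longrightarrow> velocity c t \<noteq> 0"
    using g unfolding geodesic_def by blast+
  have J: "smooth_map_on {0..1} J"
    and JE: "\<And>t w. t \<in> {0..1} \<Longrightarrow> ((\<lambda>s. ddenergy pullback (c s, velocity c s) (0, w) (J s, velocity J s)) has_real_derivative
           ddenergy pullback (c t, velocity c t) (w, 0) (J t, velocity J t)) (at t within {0..1})"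
    using Ja unfolding Jacobi_field_def by blast+
  obtain p where p: "\<And>t. t \<in> {0..1} \<Longrightarrow> D (c t) (velocity c t) = p" using geodesic_pullback[OF g] by blast
  define K where "K t = D (c t) (J t)" for t
  have Ks: "smooth_map_on {0..1} K" unfolding K_def by (rule smooth_D_curve[OF c(1) J])
  define K' where "K' = velocity K"
  have K's: "smooth_map_on {0..1} K'" unfolding K'_def by (rule smooth_map_on_velocity[OF Ks])
  have K'eq: "K' t = D2 (c t) (J t) (velocity c t) + D (c t) (velocity J t)" if "t \<in> {0..1}" for t
    unfolding K'_def D2_sym[of _ "J t"]
    by (rule vector_derivative_within_closed_interval[OF zero_less_one that])
       (use curve_derivatives(2)[OF c(1) J that] in \<open>simp add: K_def[abs_def]\<close>)
  have "velocity K' t = 0" if t: "t \<in> {0..1}" for t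
  proof (rule D_orthogonal_zero)
    fix w
    let ?v = "velocity c t"
    have "((\<lambda>s. p \<bullet> D2 (c s) w (J s) + K' s \<bullet> D (c s) w) has_vector_derivative
        p \<bullet> (D3 (c t) ?v w (J t) + D2 (c t) w (velocity J t)) + (K' t \<bullet> D2 (c t) ?v w + velocity K' t \<bullet> D (c t) w)) (at t within {0..1})"
      by (intro has_vector_derivative_add bounded_linear.has_vector_derivative[OF bounded_linear_inner_right]
          bounded_bilinear.has_vector_derivative[OF bounded_bilinear_inner]
          curve_derivatives(3)[OF c(1) J t] smooth_velocity[OF K's t] curve_D_derivative[OF c(1) t])
    note 1 = this
    have dd: "ddenergy pullback (c s, velocity c s) (0, w) (J s, velocity J s) = p \<bullet> D2 (c s) w (J s) + K' s \<bullet> D (c s) w"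
      if "s \<in> {0..1}" for s
      unfolding ddenergy_vertical[OF c(2)[OF that] c(3)[OF that]] p[OF that] K'eq[OF that]
      by (simp add: D2_sym[of _ w])
    have "ddenergy pullback (c t, ?v) (w, 0) (J t, velocity J t) = p \<bullet> (D3 (c t) (J t) w ?v + D2 (c t) w (velocity J t)) + K' t \<bullet> D2 (c t) w ?v"
      unfolding ddenergy_horizontal[OF c(2)[OF t] c(3)[OF t]] p[OF t] K'eq[OF t] by simp
    then have "((\<lambda>s. ddenergy pullback (c s, velocity c s) (0, w) (J s, velocity J s)) has_vector_derivative
        p \<bullet> (D3 (c t) (J t) w ?v + D2 (c t) w (velocity J t)) + K' t \<bullet> D2 (c t) w ?v) (at t within {0..1})"
      using JE[OF t, of w] by (simp add: has_real_derivative_iff_has_vector_derivative)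
    then have 2: "((\<lambda>s. p \<bullet> D2 (c s) w (J s) + K' s \<bullet> D (c s) w) has_vector_derivative
        p \<bullet> (D3 (c t) (J t) w ?v + D2 (c t) w (velocity J t)) + K' t \<bullet> D2 (c t) w ?v) (at t within {0..1})"
      by (rule has_vector_derivative_transform[OF t, rotated]) (simp add: dd)
    have "D3 (c t) (J t) w ?v = D3 (c t) ?v w (J t)" by (simp only: D3_swap[of "c t" "J t" w] D3_sym[of "c t" w "J t" ?v] D3_sym[of "c t" "J t" ?v w])
    moreover have "p \<bullet> (D3 (c t) ?v w (J t) + D2 (c t) w (velocity J t)) + (K' t \<bullet> D2 (c t) ?v w + velocity K' t \<bullet> D (c t) w)
        = p \<bullet> (D3 (c t) (J t) w ?v + D2 (c t) w (velocity J t)) + K' t \<bullet> D2 (c t) w ?v"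
      using vector_derivative_within_closed_interval[OF zero_less_one t 1]
        vector_derivative_within_closed_interval[OF zero_less_one t 2] by simp
    ultimately show "velocity K' t \<bullet> D (c t) w = 0" using D2_sym[of "c t" w ?v] by simp
  qed
  then have "(K' has_vector_derivative 0) (at t within {0..1})" if "t \<in> {0..1}" for t
    using smooth_velocity[OF K's that] that by simp
  from constant_if_vector_derivative_zero[OF this] have "K' t = K' 0" if "t \<in> {0..1}" for t using that by blast
  note K'c = this
  have "(K has_vector_derivative K' 0) (at t within {0..1})" if "t \<in> {0..1}" for t
  proof -
    have "(K has_vector_derivative K' t) (at t within {0..1})"
      unfolding K'_def by (rule smooth_velocity[OF Ks that])
    then show ?thesis by (simp only: K'c[OF that])
  qed
  from affine_if_vector_derivative_constant[OF this]
  have K: "K t = K 0 + t *\<^sub>R K' 0" if "t \<in> {0..1}" for t using that by blast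
  have "K 0 = 0" "K 1 = 0" using J01 by (simp_all add: K_def linear_0[OF linear_D])
  then have "K' 0 = 0" using K[of 1] by simp
  then have "K t = 0" using K[OF t] \<open>K 0 = 0\<close> by simp
  then show "J t = 0" by (simp add: K_def D_eq_0)
qed

definition straight :: "real^3 \<Rightarrow> real^3 \<Rightarrow> real \<Rightarrow> real^3" where
  "straight x y t = \<psi> (\<phi> x + t *\<^sub>R (\<phi> y - \<phi> x))"

lemma straight:
  assumes xy: "x \<in> Ball3" "y \<in> Ball3"
  shows "smooth_map_on {0..1} (straight x y)" "straight x y ` {0..1} \<subseteq> Ball3"
    "straight x y 0 = x" "straight x y 1 = y"
    "\<And>t. t \<in> {0..1} \<Longrightarrow> D (straight x y t) (velocity (straight x y) t) = \<phi> y - \<phi> x"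
proof -
  have "Cinf_on UNIV (straight x y)"
    unfolding straight_def[abs_def]
    by (rule Cinf_on_compose[OF open_UNIV open_UNIV smooth(2)])
       (auto intro!: Cinf_on_add[OF _ Cinf_on_const Cinf_on_linear] bounded_linear_scaleR_left)
  then show s: "smooth_map_on {0..1} (straight x y)" by (rule smooth_map_onI[OF open_UNIV, rotated]) auto
  show "straight x y ` {0..1} \<subseteq> Ball3"
  proof (rule image_subsetI)
    fix t :: real assume t: "t \<in> {0..1}"
    have "\<phi> x \<in> cball 0 R" "\<phi> y \<in> cball 0 R" using xy R by (auto simp: norm_\<phi>)
    from convexD_alt[OF convex_cball this, of t] t have "norm (\<phi> x + t *\<^sub>R (\<phi> y - \<phi> x)) \<le> R"
      by (simp add: algebra_simps)
    moreover have "norm (\<phi> x + t *\<^sub>R (\<phi> y - \<phi> x)) = R * norm (straight x y t)"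
      using norm_\<phi>[of "straight x y t"] by (simp add: straight_def inv)
    ultimately show "straight x y t \<in> Ball3" using R by simp
  qed
  show "straight x y 0 = x" "straight x y 1 = y" by (simp_all add: straight_def inv)
  fix t :: real assume t: "t \<in> {0..1}"
  have e: "\<phi> (straight x y t) = \<phi> x + t *\<^sub>R (\<phi> y - \<phi> x)" for t by (simp add: straight_def inv)
  have 1: "((\<lambda>t. \<phi> (straight x y t)) has_vector_derivative \<phi> y - \<phi> x) (at t within {0..1})"
    unfolding e by (auto intro!: derivative_eq_intros)
  from vector_derivative_within_closed_interval[OF zero_less_one t curve_derivatives(1)[OF s s t]]
    vector_derivative_within_closed_interval[OF zero_less_one t 1]
  show "D (straight x y t) (velocity (straight x y) t) = \<phi> y - \<phi> x" by simp
qed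

lemma inj_\<phi>: "\<phi> x = \<phi> y \<Longrightarrow> x = y" by (metis inv(2))

lemma uniquely_geodesic_pullback: "uniquely_geodesic pullback"
  unfolding uniquely_geodesic_def
proof (intro ballI impI)
  fix x y assume xy: "x \<in> Ball3" "y \<in> Ball3" "x \<noteq> y"
  let ?c = "straight x y"
  note s = straight[OF xy(1,2)]
  have B: "?c t \<in> Ball3" if "t \<in> {0..1}" for t using s(2) that by blast
  have nz: "velocity ?c t \<noteq> 0" if "t \<in> {0..1}" for t
    using s(5)[OF that] xy(3) inj_\<phi> by (auto simp: linear_0[OF linear_D])
  have geo: "geodesic pullback ?c"
    unfolding geodesic_def
  proof (intro conjI ballI allI)
    fix t :: real and w assume t: "t \<in> {0..1}"
    show "velocity ?c t \<noteq> 0" by (rule nz[OF t])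
    have "((\<lambda>s. (\<phi> y - \<phi> x) \<bullet> D (?c s) w) has_vector_derivative (\<phi> y - \<phi> x) \<bullet> D2 (?c t) (velocity ?c t) w) (at t within {0..1})"
      by (intro bounded_linear.has_vector_derivative[OF bounded_linear_inner_right] curve_D_derivative s t)
    then have "((\<lambda>s. denergy pullback (?c s, velocity ?c s) (0, w)) has_vector_derivative (\<phi> y - \<phi> x) \<bullet> D2 (?c t) (velocity ?c t) w) (at t within {0..1})"
      by (rule has_vector_derivative_transform[OF t, rotated])
         (simp add: denergy_pullback[OF B nz] s(5) linear_0[OF linear_D2(1)])
    moreover have "denergy pullback (?c t, velocity ?c t) (w, 0) = (\<phi> y - \<phi> x) \<bullet> D2 (?c t) (velocity ?c t) w"
      unfolding denergy_pullback[OF B[OF t] nz[OF t]] s(5)[OF t]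
      by (simp add: linear_0[OF linear_D] D2_sym[of _ w])
    ultimately show "((\<lambda>s. denergy pullback (?c s, velocity ?c s) (0, w)) has_real_derivative
        denergy pullback (?c t, velocity ?c t) (w, 0)) (at t within {0..1})"
      by (simp only: has_real_derivative_iff_has_vector_derivative)
  qed (rule s(1) s(2))+
  have aff: "\<phi> (b t) = \<phi> x + t *\<^sub>R (\<phi> y - \<phi> x)"
    if b: "geodesic pullback b" "b 0 = x" "b 1 = y" and t: "t \<in> {0..1}" for b t
  proof -
    obtain p where p: "\<And>t. t \<in> {0..1} \<Longrightarrow> D (b t) (velocity b t) = p"
      "\<And>t. t \<in> {0..1} \<Longrightarrow> \<phi> (b t) = \<phi> (b 0) + t *\<^sub>R p"
      using geodesic_pullback[OF b(1)] by blast
    show ?thesis using p(2)[of 1] p(2)[OF t] b(2,3) by simp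
  qed
  have "b t = ?c t" if "geodesic pullback b \<and> b 0 = x \<and> b 1 = y" "t \<in> {0..1}" for b t
  proof (rule inj_\<phi>)
    show "\<phi> (b t) = \<phi> (?c t)" using aff[of b t] that by (simp add: straight_def inv)
  qed
  then show "\<exists>c. geodesic pullback c \<and> c 0 = x \<and> c 1 = y \<and>
      (\<forall>b. geodesic pullback b \<and> b 0 = x \<and> b 1 = y \<longrightarrow> (\<forall>t\<in>{0..1}. b t = c t))"
    using geo s(3,4) by blast
qed

theorem simple_Riemannian_pullback: "simple_Riemannian pullback"
  unfolding simple_Riemannian_def simple_Finsler_def
  by (intro conjI Riemannian_pullback reversible_Finsler_pullback convex_pullback
      no_conjugate_points_pullback uniquely_geodesic_pullback)

text \<open>The velocity of the image of any admissible curve integrates to the chord, which bounds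
  all lengths from below; \<open>straight\<close> attains the bound.\<close>

theorem induced_dist_pullback:
  assumes xy: "x \<in> Ball3" "y \<in> Ball3"
  shows "induced_dist pullback x y = norm (\<phi> x - \<phi> y)"
proof -
  let ?L = "{integral {0..1} (\<lambda>t. pullback (c t) (velocity c t)) | c.
            smooth_map_on {0..1} c \<and> c ` {0..1} \<subseteq> Ball3 \<and> c 0 = x \<and> c 1 = y}"
  note s = straight[OF xy]
  have "integral {0..1} (\<lambda>t. pullback (straight x y t) (velocity (straight x y) t)) = integral {0..1} (\<lambda>t::real. norm (\<phi> x - \<phi> y))"
    by (rule integral_cong) (simp add: pullback_def s(5) norm_minus_commute)
  then have "integral {0..1} (\<lambda>t. pullback (straight x y t) (velocity (straight x y) t)) = norm (\<phi> x - \<phi> y)" by simp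
  then have in_L: "norm (\<phi> x - \<phi> y) \<in> ?L"
    by (intro CollectI exI[of _ "straight x y"] conjI s(1-4)) (rule sym)
  have low: "norm (\<phi> x - \<phi> y) \<le> l" if "l \<in> ?L" for l
  proof -
    obtain c where c: "l = integral {0..1} (\<lambda>t. pullback (c t) (velocity c t))" "smooth_map_on {0..1} c" "c 0 = x" "c 1 = y"
      using \<open>l \<in> ?L\<close> by blast
    let ?p = "\<lambda>t. D (c t) (velocity c t)"
    have "smooth_map_on {0..1} ?p" by (rule smooth_D_curve[OF c(2) smooth_map_on_velocity[OF c(2)]])
    then have pc: "continuous_on {0..1} ?p" by (rule C1_curve_continuous[OF smooth_map_on_C1_curve])
    have "(?p has_integral \<phi> (c 1) - \<phi> (c 0)) {0..1}"
      by (rule fundamental_theorem_of_calculus) (use curve_derivatives(1)[OF c(2) c(2)] in auto)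
    then have "norm (\<phi> y - \<phi> x) = norm (integral {0..1} ?p)" using c by (simp add: integral_unique)
    also have "\<dots> \<le> integral {0..1} (\<lambda>t. norm (?p t))"
      by (intro integral_norm_bound_integral integrable_continuous_real continuous_intros pc) auto
    finally show ?thesis unfolding c(1) pullback_def by (simp add: norm_minus_commute)
  qed
  show ?thesis unfolding induced_dist_def
    by (rule cInf_eq_minimum[OF in_L low])
qed

end

section \<open>Wedge products on a four-dimensional space\<close>

text \<open>Reindexing the sum by composition with \<open>\<pi>\<close> produces the sign. It is
  needed because \<open>wedge_scalar\<close> will be applied to a factor that is itself a wedge
  product.\<close>

lemma wedge_alternating:
  assumes \<pi>: "\<pi> permutes {..<k + l}"
  shows "wedge k l \<alpha> \<beta> p (\<lambda>i. a (\<pi> i)) = of_int (sign \<pi>) * wedge k l \<alpha> \<beta> p a"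
proof -
  let ?S = "{..<k + l}"
  let ?f = "\<lambda>\<sigma>. of_int (sign \<sigma>) * \<alpha> p (\<lambda>i. a (\<sigma> i)) * \<beta> p (\<lambda>i. a (\<sigma> (k + i)))"
  have inv: "\<pi> (inv \<pi> i) = i" for i using \<pi> by (rule permutes_inverses)
  have s: "sign (\<pi> \<circ> \<sigma>) = sign \<pi> * sign \<sigma>" if "\<sigma> permutes ?S" for \<sigma>
    by (rule sign_compose) (use \<pi> that permutation_permutes in blast)+
  have ss: "real_of_int (sign \<pi>) * real_of_int (sign \<pi>) = 1" by (simp add: sign_def)
  have "sum ?f {\<sigma>. \<sigma> permutes ?S} = (\<Sum>\<sigma> | \<sigma> permutes ?S. ?f (\<pi> \<circ> \<sigma>))"
    by (rule sum.reindex_bij_witness[where i = "\<lambda>\<sigma>. \<pi> \<circ> \<sigma>" and j = "\<lambda>\<sigma>. inv \<pi> \<circ> \<sigma>"])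
       (use \<pi> in \<open>auto simp: permutes_compose permutes_inv o_assoc permutes_inv_o inv fun_eq_iff permutes_inverses\<close>)
  also have "\<dots> = (\<Sum>\<sigma> | \<sigma> permutes ?S. of_int (sign \<pi>) *
      (of_int (sign \<sigma>) * \<alpha> p (\<lambda>i. a (\<pi> (\<sigma> i))) * \<beta> p (\<lambda>i. a (\<pi> (\<sigma> (k + i))))))"
    by (intro sum.cong refl) (simp add: s)
  finally have "sum ?f {\<sigma>. \<sigma> permutes ?S} = of_int (sign \<pi>) * (\<Sum>\<sigma> | \<sigma> permutes ?S.
      of_int (sign \<sigma>) * \<alpha> p (\<lambda>i. a (\<pi> (\<sigma> i))) * \<beta> p (\<lambda>i. a (\<pi> (\<sigma> (k + i)))))"
    by (simp only: sum_distrib_left)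
  then have "of_int (sign \<pi>) * sum ?f {\<sigma>. \<sigma> permutes ?S} = (\<Sum>\<sigma> | \<sigma> permutes ?S.
      of_int (sign \<sigma>) * \<alpha> p (\<lambda>i. a (\<pi> (\<sigma> i))) * \<beta> p (\<lambda>i. a (\<pi> (\<sigma> (k + i)))))"
    by (simp only: mult.assoc[symmetric] ss mult_1_left)
  then show ?thesis unfolding wedge_def by simp
qed

text \<open>Every permutation contributes the same value, and their number cancels the
  normalization. This disposes of the zeroth wedge powers in \<open>eta_hat\<close>.\<close>

lemma wedge_scalar:
  assumes "\<And>\<pi>. \<pi> permutes {..<k} \<Longrightarrow> \<alpha> p (\<lambda>i. a (\<pi> i)) = of_int (sign \<pi>) * \<alpha> p a"
  shows "wedge k 0 \<alpha> (\<lambda>p a. 1) p a = \<alpha> p a" "wedge 0 k (\<lambda>p a. 1) \<alpha> p a = \<alpha> p a"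
proof -
  have 1: "of_int (sign \<pi>) * \<alpha> p (\<lambda>i. a (\<pi> i)) = \<alpha> p a" if "\<pi> permutes {..<k}" for \<pi>
  proof -
    show ?thesis using assms[OF that] by (simp add: sign_def)
  qed
  have "(\<Sum>\<pi> | \<pi> permutes {..<k}. of_int (sign \<pi>) * \<alpha> p (\<lambda>i. a (\<pi> i))) = (\<Sum>\<pi> | \<pi> permutes {..<k}. \<alpha> p a)"
    by (intro sum.cong refl) (use 1 in auto)
  also have "\<dots> = fact k * \<alpha> p a" by (simp add: card_permutations[of "{..<k}" k])
  finally show "wedge k 0 \<alpha> (\<lambda>p a. 1) p a = \<alpha> p a" "wedge 0 k (\<lambda>p a. 1) \<alpha> p a = \<alpha> p a"
    by (simp_all add: wedge_def)
qed

text \<open>The 24 permutations group into 6 shuffles, each occurring 4 times because both factors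
  are alternating; this cancels \<open>fact 2 * fact 2\<close>.\<close>

lemma wedge_2_2:
  fixes A B :: "(real^3) \<times> (real^3) \<Rightarrow> (real^3) \<times> (real^3) \<Rightarrow> real"
  assumes \<alpha>: "\<And>a. \<alpha> p a = A (a 0) (a 1)" "\<And>x y. A y x = - A x y"
    and \<beta>: "\<And>a. \<beta> p a = B (a 0) (a 1)" "\<And>x y. B y x = - B x y"
  shows "wedge 2 2 \<alpha> \<beta> p a =
    A (a 0) (a 1) * B (a 2) (a 3) - A (a 0) (a 2) * B (a 1) (a 3) + A (a 0) (a 3) * B (a 1) (a 2)
    + A (a 1) (a 2) * B (a 0) (a 3) - A (a 1) (a 3) * B (a 0) (a 2) + A (a 2) (a 3) * B (a 0) (a 1)"
proof -
  have S: "{..<2 + 2} = {0, 1, 2, 3 :: nat}" by auto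
  have f: "finite {1, 2, 3 :: nat}" "0 \<notin> {1, 2, 3 :: nat}" "finite {2, 3 :: nat}" "1 \<notin> {2, 3 :: nat}"
    "finite {3 :: nat}" "2 \<notin> {3 :: nat}" by auto
  have t: "2 + 1 = (3 :: nat)" by simp
  show ?thesis
    unfolding wedge_def S \<alpha>(1) \<beta>(1) sum_over_permutations_insert[OF f(1,2)]
      sum_over_permutations_insert[OF f(3,4)] sum_over_permutations_insert[OF f(5,6)]
    unfolding permutes_sing
    by (simp add: sign_swap_id permutation_swap_id sign_compose permutation_compose sign_id transpose_def
        numeral_3_eq_3[symmetric] \<alpha>(2)[of "a 0"] \<alpha>(2)[of "a (Suc 0)" "a 2"] \<alpha>(2)[of "a (Suc 0)" "a 3"] \<alpha>(2)[of "a 2" "a 3"]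
        \<beta>(2)[of "a 0"] \<beta>(2)[of "a (Suc 0)" "a 2"] \<beta>(2)[of "a (Suc 0)" "a 3"] \<beta>(2)[of "a 2" "a 3"])
qed

lemma dd2_alternating: "dd2 l p a = (\<lambda>x y. mixed_diff l p (fst x) (snd y) - mixed_diff l p (fst y) (snd x)) (a 0) (a 1)"
  by (simp add: dd2_def)

lemma wedge_power_1: "wedge_power (dd2 l) 1 p a = dd2 l p a"
proof -
  have S: "{..<2 + 0} = {0, 1 :: nat}" by auto
  have f: "finite {1 :: nat}" "0 \<notin> {1 :: nat}" by auto
  have "wedge_power (dd2 l) 1 p a = wedge 2 0 (dd2 l) (\<lambda>p a. 1) p a" by simp
  also have "\<dots> = dd2 l p a"
    unfolding wedge_def S sum_over_permutations_insert[OF f] permutes_sing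
    by (simp add: sign_swap_id permutation_swap_id sign_compose permutation_compose sign_id transpose_def dd2_def)
  finally show ?thesis .
qed

lemma eta_hat_eq:
  "eta_hat l' l p a = wedge 2 2 (dd2 l) (dd2 l) p a + wedge 2 2 (dd2 l') (dd2 l) p a + wedge 2 2 (dd2 l') (dd2 l') p a"
proof -
  have w1: "wedge_power (dd2 l) (Suc 0) = dd2 l" for l
    using wedge_power_1[of l] by (intro ext) simp
  have w2: "wedge_power (dd2 l) 2 = wedge 2 2 (dd2 l) (dd2 l)" for l
    by (simp only: numeral_2_eq_2 wedge_power.simps(2)[of _ "Suc 0"] w1) simp
  have alt: "wedge 2 2 (dd2 l) (dd2 l) p (\<lambda>i. a (\<pi> i)) = of_int (sign \<pi>) * wedge 2 2 (dd2 l) (dd2 l) p a"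
    if "\<pi> permutes {..<4}" for l \<pi>
    using wedge_alternating[of \<pi> 2 2] that by simp
  note s = wedge_scalar[where k = 4 and \<alpha> = "wedge 2 2 (dd2 l) (dd2 l)" and p = p and a = a for l, OF alt]
  have "eta_hat l' l p a = wedge 0 4 (\<lambda>p a. 1) (wedge_power (dd2 l) 2) p a
      + wedge 2 2 (wedge_power (dd2 l') (Suc 0)) (wedge_power (dd2 l) (Suc 0)) p a
      + wedge 4 0 (wedge_power (dd2 l') 2) (\<lambda>p a. 1) p a"
    unfolding eta_hat_def by (simp add: numeral_2_eq_2 atMost_Suc del: wedge_power.simps(2)) (simp add: eval_nat_numeral)
  then show ?thesis by (simp only: s w1 w2)
qed

section \<open>The twisted metric\<close>

definition twist :: "real \<Rightarrow> real \<Rightarrow> real^3 \<Rightarrow> real^3" where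
  "twist \<tau> R x = R *\<^sub>R ((x $ 1 * cos (\<tau> * x $ 3) - x $ 2 * sin (\<tau> * x $ 3)) *\<^sub>R axis 1 1
     + (x $ 1 * sin (\<tau> * x $ 3) + x $ 2 * cos (\<tau> * x $ 3)) *\<^sub>R axis 2 1 + x $ 3 *\<^sub>R axis 3 1)"

lemma twist_nth:
  "twist \<tau> R x $ 1 = R * (x $ 1 * cos (\<tau> * x $ 3) - x $ 2 * sin (\<tau> * x $ 3))"
  "twist \<tau> R x $ 2 = R * (x $ 1 * sin (\<tau> * x $ 3) + x $ 2 * cos (\<tau> * x $ 3))"
  "twist \<tau> R x $ 3 = R * x $ 3"
  by (simp_all add: twist_def axis_def)

lemma inner_3: "x \<bullet> y = x $ 1 * y $ 1 + x $ 2 * y $ 2 + x $ 3 * y $ 3" for x y :: "real^3"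
  by (simp add: inner_vec_def sum_3)

lemma vec_eq_3: "x = y \<longleftrightarrow> x $ 1 = y $ 1 \<and> x $ 2 = y $ 2 \<and> x $ 3 = y $ 3" for x y :: "real^3"
  by (simp add: vec_eq_iff forall_3)

lemma rotation_inverse:
  fixes a b c s :: real
  assumes "c\<^sup>2 + s\<^sup>2 = 1"
  shows "(a * c - b * s) * c + (a * s + b * c) * s = a" "(a * s + b * c) * c - (a * c - b * s) * s = b"
proof -
  have "(a * c - b * s) * c + (a * s + b * c) * s = a * (c\<^sup>2 + s\<^sup>2)"
    "(a * s + b * c) * c - (a * c - b * s) * s = b * (c\<^sup>2 + s\<^sup>2)"
    by (simp_all add: power2_eq_square algebra_simps)
  then show "(a * c - b * s) * c + (a * s + b * c) * s = a" "(a * s + b * c) * c - (a * c - b * s) * s = b"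
    using assms by simp_all
qed

text \<open>The twist multiplies heights by \<open>R\<close>, so the inverse has to turn back by
  \<open>\<tau> / R\<close> per unit of height.\<close>

lemma twist_inverse: "R \<noteq> 0 \<Longrightarrow> twist (- \<tau> / R) (1 / R) (twist \<tau> R x) = x"
  using rotation_inverse[of "cos (\<tau> * x $ 3)" "sin (\<tau> * x $ 3)" "x $ 1" "x $ 2"]
  by (simp add: vec_eq_3 twist_nth) (simp add: algebra_simps add_divide_distrib)

lemma norm_twist: "R \<ge> 0 \<Longrightarrow> norm (twist \<tau> R x) = R * norm x"
proof -
  assume R: "R \<ge> 0"
  let ?c = "cos (\<tau> * x $ 3)" and ?s = "sin (\<tau> * x $ 3)"
  have "twist \<tau> R x \<bullet> twist \<tau> R x = R\<^sup>2 * (((x $ 1)\<^sup>2 + (x $ 2)\<^sup>2) * (?c\<^sup>2 + ?s\<^sup>2) + (x $ 3)\<^sup>2)"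
    unfolding inner_3 twist_nth by (simp only: power2_eq_square) algebra
  also have "\<dots> = R\<^sup>2 * (x \<bullet> x)" by (simp add: inner_3 power2_eq_square)
  finally show ?thesis using R by (simp add: norm_eq_sqrt_inner real_sqrt_mult)
qed

lemma Cinf_twist: "Cinf_on UNIV (twist \<tau> R)"
proof -
  have n: "Cinf_on UNIV (\<lambda>x :: real^3. x $ i)" for i
    by (rule Cinf_on_linear[OF open_UNIV bounded_linear_vec_nth])
  have "Cinf_on UNIV (\<lambda>x :: real^3. \<tau> * x $ 3)" by (intro Cinf_on_mult n Cinf_on_const open_UNIV)
  then have sc: "Cinf_on UNIV (\<lambda>x :: real^3. sin (\<tau> * x $ 3))" "Cinf_on UNIV (\<lambda>x :: real^3. cos (\<tau> * x $ 3))"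
    by (auto intro!: Cinf_on_compose[OF open_UNIV open_UNIV Cinf_on_sin_cos(1)[OF open_UNIV]]
        Cinf_on_compose[OF open_UNIV open_UNIV Cinf_on_sin_cos(2)[OF open_UNIV]])
  show ?thesis unfolding twist_def[abs_def]
    by (intro Cinf_on_scaleR Cinf_on_add Cinf_on_diff Cinf_on_mult n sc Cinf_on_const open_UNIV)
qed

lemma twist_radial_diffeomorphism:
  assumes "R > 0"
  shows "radial_diffeomorphism (twist \<tau> R) (twist (- \<tau> / R) (1 / R)) R"
proof
  show "twist (- \<tau> / R) (1 / R) (twist \<tau> R x) = x" for x using twist_inverse[of R \<tau> x] assms by simp
  show "twist \<tau> R (twist (- \<tau> / R) (1 / R) x) = x" for x
    using twist_inverse[of "1 / R" "- \<tau> / R" x] assms by simp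
  show "norm (twist \<tau> R x) = R * norm x" for x using assms by (simp add: norm_twist)
qed (use assms Cinf_twist in auto)

lemma twist_derivative:
  assumes "R > 0"
  shows "radial_diffeomorphism.D (twist \<tau> R) x v = R *\<^sub>R
    ((v $ 1 * cos (\<tau> * x $ 3) - v $ 2 * sin (\<tau> * x $ 3)
        - \<tau> * v $ 3 * (x $ 1 * sin (\<tau> * x $ 3) + x $ 2 * cos (\<tau> * x $ 3))) *\<^sub>R axis 1 1
     + (v $ 1 * sin (\<tau> * x $ 3) + v $ 2 * cos (\<tau> * x $ 3)
        + \<tau> * v $ 3 * (x $ 1 * cos (\<tau> * x $ 3) - x $ 2 * sin (\<tau> * x $ 3))) *\<^sub>R axis 2 1 + v $ 3 *\<^sub>R axis 3 1)"
proof -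
  interpret radial_diffeomorphism "twist \<tau> R" "twist (- \<tau> / R) (1 / R)" R
    by (rule twist_radial_diffeomorphism[OF assms])
  note n = bounded_linear.has_derivative[OF bounded_linear_vec_nth has_derivative_ident]
  have "(twist \<tau> R has_derivative (\<lambda>v. R *\<^sub>R
    ((v $ 1 * cos (\<tau> * x $ 3) - v $ 2 * sin (\<tau> * x $ 3)
        - \<tau> * v $ 3 * (x $ 1 * sin (\<tau> * x $ 3) + x $ 2 * cos (\<tau> * x $ 3))) *\<^sub>R axis 1 1
     + (v $ 1 * sin (\<tau> * x $ 3) + v $ 2 * cos (\<tau> * x $ 3)
        + \<tau> * v $ 3 * (x $ 1 * cos (\<tau> * x $ 3) - x $ 2 * sin (\<tau> * x $ 3))) *\<^sub>R axis 2 1 + v $ 3 *\<^sub>R axis 3 1))) (at x)"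
    unfolding twist_def[abs_def]
    by (rule derivative_eq_intros n refl | simp)+ (simp add: fun_eq_iff vec_eq_3 axis_def algebra_simps)
  from has_derivative_unique[OF D this] show ?thesis by metis
qed

text \<open>A chord is no longer than its arc, on the circle of radius
  \<open>sqrt (c\<^sup>2 + d\<^sup>2)\<close>.\<close>

lemma rotation_lipschitz:
  fixes a b c d :: real
  shows "(c * cos a - d * sin a - (c * cos b - d * sin b))\<^sup>2 + (c * sin a + d * cos a - (c * sin b + d * cos b))\<^sup>2
    \<le> (c\<^sup>2 + d\<^sup>2) * (a - b)\<^sup>2"
proof -
  have "(c * cos a - d * sin a - (c * cos b - d * sin b))\<^sup>2 + (c * sin a + d * cos a - (c * sin b + d * cos b))\<^sup>2
    = (c\<^sup>2 + d\<^sup>2) * ((cos a)\<^sup>2 + (sin a)\<^sup>2 + ((cos b)\<^sup>2 + (sin b)\<^sup>2) - 2 * (cos a * cos b + sin a * sin b))"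
    by (simp only: power2_eq_square) algebra
  also have "\<dots> = (c\<^sup>2 + d\<^sup>2) * (2 - 2 * cos (a - b))" by (simp add: cos_diff)
  also have "2 - 2 * cos (a - b) = (2 * sin ((a - b) / 2))\<^sup>2"
  proof -
    have "2 * ((a - b) / 2) = a - b" by simp
    from cos_double_sin[of "(a - b) / 2", unfolded this] show ?thesis by (simp add: power_mult_distrib)
  qed
  also have "\<dots> \<le> (a - b)\<^sup>2"
  proof -
    have "\<bar>2 * sin ((a - b) / 2)\<bar> \<le> \<bar>a - b\<bar>" using abs_sin_x_le_abs_x[of "(a - b) / 2"] by (simp add: abs_mult)
    then show ?thesis by (rule abs_le_square_iff[THEN iffD1])
  qed
  finally show ?thesis by (simp add: mult_left_mono)
qed

text \<open>For the images \<open>Y\<close> and \<open>Z\<close> under the twist of scale 1, turn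
  \<open>Z\<close> back by the angle belonging to \<open>Y\<close> to obtain \<open>W\<close>. The
  common rotation preserves the distance to \<open>y\<close>, and the discrepancy of the angles
  costs at most \<open>\<bar>\<tau>\<bar>\<close> times the difference of heights, as
  \<open>norm z = 1\<close>. The scale \<open>R\<close> then compensates the factor
  \<open>1 + \<bar>\<tau>\<bar>\<close>.\<close>

lemma twist_expanding:
  assumes R: "R \<ge> 1 + \<bar>\<tau>\<bar>" and z: "norm z = 1"
  shows "norm (y - z) \<le> norm (twist \<tau> R y - twist \<tau> R z)"
proof -
  define Y where "Y = twist \<tau> 1 y"
  define Z where "Z = twist \<tau> 1 z"
  have yY: "y = twist (- \<tau>) 1 Y" and zZ: "z = twist (- \<tau>) 1 Z"
    using twist_inverse[of 1 \<tau>] by (simp_all add: Y_def Z_def)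
  \<comment> \<open>\<open>twist 0 1\<close> is the identity; it only makes the components
    accessible through \<open>twist_nth\<close>.\<close>
  define W where "W = twist 0 1 (\<chi> i. if i = 1 then Z $ 1 * cos (- \<tau> * Y $ 3) - Z $ 2 * sin (- \<tau> * Y $ 3)
    else if i = 2 then Z $ 1 * sin (- \<tau> * Y $ 3) + Z $ 2 * cos (- \<tau> * Y $ 3) else Z $ 3)"
  have W: "W $ 1 = Z $ 1 * cos (- \<tau> * Y $ 3) - Z $ 2 * sin (- \<tau> * Y $ 3)"
    "W $ 2 = Z $ 1 * sin (- \<tau> * Y $ 3) + Z $ 2 * cos (- \<tau> * Y $ 3)" "W $ 3 = Z $ 3"
    unfolding W_def twist_nth by simp_all
  have 1: "norm (y - W) = norm (Y - Z)"
  proof -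
    let ?c = "cos (- \<tau> * Y $ 3)" and ?s = "sin (- \<tau> * Y $ 3)"
    have "(y - W) \<bullet> (y - W) = ((Y $ 1 - Z $ 1)\<^sup>2 + (Y $ 2 - Z $ 2)\<^sup>2) * (?c\<^sup>2 + ?s\<^sup>2) + (Y $ 3 - Z $ 3)\<^sup>2"
      unfolding inner_3 vector_minus_component W yY twist_nth by (simp only: power2_eq_square) algebra
    also have "\<dots> = (Y - Z) \<bullet> (Y - Z)" by (simp add: inner_3 power2_eq_square)
    finally show ?thesis by (simp add: norm_eq_sqrt_inner)
  qed
  have nZ: "norm Z = 1" using z norm_twist[of 1 \<tau> z] by (simp add: Z_def)
  have 2: "norm (W - z) \<le> \<bar>\<tau>\<bar> * norm (Y - Z)"
  proof -
    have "(W - z) \<bullet> (W - z) \<le> ((Z $ 1)\<^sup>2 + (Z $ 2)\<^sup>2) * (- \<tau> * Y $ 3 - - \<tau> * Z $ 3)\<^sup>2"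
      using rotation_lipschitz[of "Z $ 1" "- \<tau> * Y $ 3" "Z $ 2" "- \<tau> * Z $ 3"]
      unfolding inner_3 vector_minus_component W zZ twist_nth by (simp add: power2_eq_square)
    also have "\<dots> \<le> 1 * (- \<tau> * Y $ 3 - - \<tau> * Z $ 3)\<^sup>2"
    proof (rule mult_right_mono)
      have "Z \<bullet> Z = 1" using nZ by (simp add: norm_eq_1)
      then show "(Z $ 1)\<^sup>2 + (Z $ 2)\<^sup>2 \<le> 1" using zero_le_square[of "Z $ 3"]
        unfolding inner_3 power2_eq_square by linarith
    qed simp
    also have "\<dots> = (\<tau> * (Y - Z) $ 3)\<^sup>2" by (simp add: power2_eq_square algebra_simps)
    finally have "(norm (W - z))\<^sup>2 \<le> (\<tau> * (Y - Z) $ 3)\<^sup>2" by (simp add: power2_norm_eq_inner)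
    then have "norm (W - z) \<le> \<bar>\<tau> * (Y - Z) $ 3\<bar>" using abs_le_square_iff[of "norm (W - z)"] by simp
    also have "\<dots> \<le> \<bar>\<tau>\<bar> * norm (Y - Z)" unfolding abs_mult by (intro mult_left_mono component_le_norm_cart) auto
    finally show ?thesis .
  qed
  have "norm (y - z) \<le> norm (y - W) + norm (W - z)" using norm_triangle_ineq[of "y - W" "W - z"] by simp
  also have "\<dots> \<le> (1 + \<bar>\<tau>\<bar>) * norm (Y - Z)" using 1 2 by (simp add: algebra_simps)
  also have "\<dots> \<le> R * norm (Y - Z)" by (intro mult_right_mono R) auto
  also have "\<dots> = norm (R *\<^sub>R Y - R *\<^sub>R Z)" using R by (simp add: scaleR_diff_right[symmetric])
  also have "R *\<^sub>R Y - R *\<^sub>R Z = twist \<tau> R y - twist \<tau> R z" by (simp add: Y_def Z_def twist_def)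
  finally show ?thesis .
qed

section \<open>Mixed second differentials of pulled back distances\<close>

lemma sgn_has_derivative:
  fixes z :: "real^3"
  assumes "norm z = 1"
  shows "(sgn has_derivative (\<lambda>w. w - (z \<bullet> w) *\<^sub>R z)) (at z)"
proof -
  have nz: "z \<noteq> 0" using assms by auto
  have sz: "sgn z = z" using assms by (simp add: sgn_div_norm)
  have n: "(norm has_derivative (\<lambda>w. w \<bullet> z)) (at z)"
    using has_derivative_norm[OF nz] by (simp add: sz)
  have "((\<lambda>x. inverse (norm x)) has_derivative (\<lambda>w. - (inverse (norm z) * (w \<bullet> z) * inverse (norm z)))) (at z)"
    by (rule Deriv.has_derivative_inverse[OF _ n]) (use nz in simp)
  then have i: "((\<lambda>x. inverse (norm x)) has_derivative (\<lambda>w. - (w \<bullet> z))) (at z)" by (simp add: assms)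
  have "((\<lambda>x. inverse (norm x) *\<^sub>R x) has_derivative (\<lambda>w. inverse (norm z) *\<^sub>R w + (- (w \<bullet> z)) *\<^sub>R z)) (at z)"
    by (rule has_derivative_scaleR[OF i has_derivative_ident])
  then show ?thesis by (simp add: assms inner_commute sgn_div_norm[abs_def])
qed

text \<open>The derivative of \<open>sgn\<close> at a unit vector is the tangential projection, so
  on tangent vectors the radial extension may be replaced by \<open>f\<close> itself.\<close>

lemma S2_diff_eq:
  assumes "norm z = 1" "(f has_derivative f') (at z)" "z \<bullet> w = 0"
  shows "S2_diff f z w = f' w"
proof -
  have "sgn z = z" using assms(1) by (simp add: sgn_div_norm)
  then have "((\<lambda>x. f (sgn x)) has_derivative (\<lambda>w. f' (w - (z \<bullet> w) *\<^sub>R z))) (at z)"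
    using has_derivative_compose[OF sgn_has_derivative[OF assms(1)], of f f'] assms(2) by simp
  from fun_cong[OF frechet_derivative_at[OF this], of w] show ?thesis
    using assms(3) by (simp add: S2_diff_def)
qed

lemma S2_diff_cong_at:
  assumes "open S" "y \<in> S" "\<And>x. x \<in> S \<Longrightarrow> f (sgn x) = g (sgn x)"
  shows "S2_diff f y u = S2_diff g y u"
proof -
  have "((\<lambda>x. f (sgn x)) has_derivative D) (at y) \<longleftrightarrow> ((\<lambda>x. g (sgn x)) has_derivative D) (at y)" for D
    using has_derivative_transform_within_open[OF _ assms(1,2), of "\<lambda>x. f (sgn x)" D UNIV "\<lambda>x. g (sgn x)"]
      has_derivative_transform_within_open[OF _ assms(1,2), of "\<lambda>x. g (sgn x)" D UNIV "\<lambda>x. f (sgn x)"] assms(3)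
    by auto
  then show ?thesis by (simp add: S2_diff_def frechet_derivative_def)
qed

context radial_diffeomorphism
begin

lemma dist_pullback_has_derivative:
  assumes "y' \<noteq> \<phi> z"
  shows "((\<lambda>x. norm (y' - \<phi> x)) has_derivative (\<lambda>w. - (D z w \<bullet> (y' - \<phi> z)) / norm (y' - \<phi> z))) (at z)"
proof -
  have 1: "((\<lambda>x. y' - \<phi> x) has_derivative (\<lambda>w. 0 - D z w)) (at z)"
    by (intro has_derivative_diff has_derivative_const D)
  have "((\<lambda>x. norm (y' - \<phi> x)) has_derivative (\<lambda>w. (0 - D z w) \<bullet> sgn (y' - \<phi> z))) (at z)"
    by (rule has_derivative_compose[OF 1 has_derivative_norm]) (use assms in simp)
  then show ?thesis by (simp add: sgn_div_norm divide_inverse mult.commute)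
qed

text \<open>When the images are antipodal too, the chord is the common normal of the image sphere at
  both ends, of length \<open>2 * R\<close>. In the derivative of the quotient the term from the
  denominator drops out, leaving the inner product of the two tangential images.\<close>

lemma mixed_diff_antipodal:
  assumes y: "norm y = 1" and antipodal: "\<phi> (- y) = - \<phi> y" and uw: "y \<bullet> u = 0" "y \<bullet> w = 0"
  shows "mixed_diff (induced_dist pullback) (y, - y) u w = - (D y u \<bullet> D (- y) w) / (2 * R)"
proof -
  let ?l = "induced_dist pullback"
  have l: "?l y' x = norm (\<phi> y' - \<phi> x)" if "norm y' \<le> 1" "norm x \<le> 1" for y' x
    using induced_dist_pullback[of y' x] that by simp
  have n\<phi>: "norm (\<phi> y) = R" using norm_\<phi>[of y] y by simp
  define p where "p = D (- y) w"
  define h where "h y' = - (p \<bullet> (\<phi> y' - \<phi> (- y))) / norm (\<phi> y' - \<phi> (- y))" for y'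
  have inner: "S2_diff (?l y') (- y) w = h y'" if y': "norm y' \<le> 1" "y' \<noteq> - y" for y'
  proof -
    have "S2_diff (?l y') (- y) w = S2_diff (\<lambda>x. norm (\<phi> y' - \<phi> x)) (- y) w"
      by (rule S2_diff_cong_at[OF open_UNIV]) (use y' in \<open>auto simp: l norm_sgn\<close>)
    also have "\<dots> = h y'"
      unfolding h_def p_def
      by (rule S2_diff_eq[OF _ dist_pullback_has_derivative]) (use y y' uw inj_\<phi> in auto)
    finally show ?thesis .
  qed
  have "mixed_diff ?l (y, - y) u w = S2_diff (\<lambda>y'. S2_diff (?l y') (- y) w) y u" by (simp add: mixed_diff_def)
  also have "\<dots> = S2_diff h y u"
  \<comment> \<open>The formula for the inner differential fails at \<open>- y\<close>, where the
    two points collide; points of this ball do not retract to \<open>- y\<close>.\<close>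
  proof (rule S2_diff_cong_at[OF open_ball, of y y 1])
    fix x assume x: "x \<in> ball y 1"
    show "S2_diff (?l (sgn x)) (- y) w = h (sgn x)"
    proof (rule inner)
      show "norm (sgn x) \<le> 1" by (simp add: norm_sgn)
      show "sgn x \<noteq> - y"
      proof
        assume s: "sgn x = - y"
        have "x = norm x *\<^sub>R sgn x" by (cases "x = 0") (simp_all add: sgn_div_norm)
        then have "x = - (norm x *\<^sub>R y)" unfolding s by simp
        from arg_cong[OF this, of uminus] have "- x = norm x *\<^sub>R y" by simp
        then have "y + - x = (1 + norm x) *\<^sub>R y" by (simp only: scaleR_add_left scaleR_one)
        then have "y - x = (1 + norm x) *\<^sub>R y" by simp
        then have "norm (y - x) = (1 + norm x) * norm y" by (simp only: norm_scaleR) simp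
        then show False using x y by (simp add: dist_norm)
      qed
    qed
  qed simp
  also have "\<dots> = - (D y u \<bullet> D (- y) w) / (2 * R)"
  proof -
    have q: "\<phi> y - \<phi> (- y) = 2 *\<^sub>R \<phi> y" unfolding antipodal by (simp add: scaleR_2)
    have Nq: "norm (\<phi> y - \<phi> (- y)) = 2 * R" unfolding q using R by (simp add: n\<phi>)
    have q0: "\<phi> y - \<phi> (- y) \<noteq> 0" using Nq R by auto
    have 1: "((\<lambda>x. \<phi> x - \<phi> (- y)) has_derivative (\<lambda>u. D y u - 0)) (at y)"
      by (intro has_derivative_diff has_derivative_const D)
    have 2: "((\<lambda>x. norm (\<phi> x - \<phi> (- y))) has_derivative (\<lambda>u. (D y u - 0) \<bullet> sgn (\<phi> y - \<phi> (- y)))) (at y)"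
      by (rule has_derivative_compose[OF 1 has_derivative_norm[OF q0]])
    have 3: "((\<lambda>x. - (p \<bullet> (\<phi> x - \<phi> (- y)))) has_derivative (\<lambda>u. - (p \<bullet> (D y u - 0)))) (at y)"
      by (intro has_derivative_minus has_derivative_inner_right 1)
    have tan: "D y u \<bullet> \<phi> y = 0" using radial_identity(1)[of y u] uw(1) by (simp add: inner_commute)
    have tan': "p \<bullet> \<phi> y = 0" using radial_identity(1)[of "- y" w] uw(2) unfolding antipodal p_def by (simp add: inner_commute)
    have pq: "p \<bullet> (\<phi> y - \<phi> (- y)) = 0" unfolding q by (simp add: tan')
    have nz: "norm (\<phi> y - \<phi> (- y)) \<noteq> 0" using q0 by simp
    from has_derivative_divide'[OF 3 2 nz, folded h_def]
    have "(h has_derivative (\<lambda>u. (- (p \<bullet> (D y u - 0)) * norm (\<phi> y - \<phi> (- y)) - - (p \<bullet> (\<phi> y - \<phi> (- y))) * ((D y u - 0) \<bullet> sgn (\<phi> y - \<phi> (- y))))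
        / (norm (\<phi> y - \<phi> (- y)) * norm (\<phi> y - \<phi> (- y))))) (at y)" .
    from S2_diff_eq[OF y this uw(1)] show ?thesis
      unfolding pq Nq using R by (simp add: p_def inner_commute)
  qed
  finally show ?thesis .
qed

lemma dist_along_curve:
  assumes "(c has_vector_derivative c') (at 0)" "\<phi> (c 0) \<noteq> q"
  shows "((\<lambda>\<theta>. norm (\<phi> (c \<theta>) - q)) has_real_derivative (D (c 0) c' \<bullet> (\<phi> (c 0) - q)) / norm (\<phi> (c 0) - q)) (at 0)"
proof -
  have 0: "(c has_derivative (\<lambda>a. a *\<^sub>R c')) (at 0)" using assms(1) by (simp add: has_vector_derivative_def)
  have 1: "((\<lambda>\<theta>. \<phi> (c \<theta>) - q) has_derivative (\<lambda>a. D (c 0) (a *\<^sub>R c') - 0)) (at 0)"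
    by (intro has_derivative_diff has_derivative_const has_derivative_compose[OF 0 D])
  have "((\<lambda>\<theta>. norm (\<phi> (c \<theta>) - q)) has_derivative (\<lambda>a. (D (c 0) (a *\<^sub>R c') - 0) \<bullet> sgn (\<phi> (c 0) - q))) (at 0)"
    by (rule has_derivative_compose[OF 1 has_derivative_norm]) (use assms(2) in simp)
  then show ?thesis unfolding has_field_derivative_def
    by (rule has_derivative_eq_rhs)
       (simp add: fun_eq_iff linear_scale[OF linear_D] sgn_div_norm divide_inverse mult.commute)
qed

end

text \<open>Equality would make \<open>x - y\<close> and \<open>y - z\<close> positively parallel,
  yet their inner products with \<open>y\<close> have opposite signs.\<close>

lemma strict_triangle_sphere:
  fixes x y z :: "real^3"
  assumes "norm x = 1" "norm y = 1" "norm z = 1" "x \<noteq> y" "y \<noteq> z"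
  shows "norm (x - z) < norm (x - y) + norm (y - z)"
proof (rule ccontr)
  assume "\<not> ?thesis"
  then have "dist x z = dist x y + dist y z" using dist_triangle[of x z y] by (simp add: dist_norm)
  then have e: "norm (x - y) *\<^sub>R (y - z) = norm (y - z) *\<^sub>R (x - y)" by (simp only: dist_triangle_eq)
  have pos: "1 - p \<bullet> q > 0" if "norm p = 1" "norm q = 1" "p \<noteq> q" for p q :: "real^3"
  proof -
    have "(p - q) \<bullet> (p - q) > 0" using that by simp
    then show ?thesis using that(1,2) by (simp add: inner_diff_left inner_diff_right inner_commute norm_eq_1)
  qed
  have "y \<bullet> (norm (x - y) *\<^sub>R (y - z)) = y \<bullet> (norm (y - z) *\<^sub>R (x - y))" by (simp only: e)
  then have "norm (x - y) * (1 - y \<bullet> z) = - (norm (y - z) * (1 - x \<bullet> y))"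
    using assms(2) by (simp add: inner_diff_right inner_commute norm_eq_1 algebra_simps)
  moreover have "norm (x - y) * (1 - y \<bullet> z) > 0" using pos[OF assms(2,3,5)] assms(4) by simp
  moreover have "norm (y - z) * (1 - x \<bullet> y) > 0" using pos[OF assms(1,2,4)] assms(5) by simp
  ultimately show False by simp
qed

section \<open>Signs of the form at the poles and at the equator\<close>

abbreviation twist_metric :: "real \<Rightarrow> real \<Rightarrow> metric" where
  "twist_metric \<tau> R \<equiv> radial_diffeomorphism.pullback (twist \<tau> R)"

lemma induced_dist_twist:
  assumes "R > 0" "x \<in> S2" "y \<in> S2"
  shows "induced_dist (twist_metric \<tau> R) x y = norm (twist \<tau> R x - twist \<tau> R y)"
  by (rule radial_diffeomorphism.induced_dist_pullback[OF twist_radial_diffeomorphism[OF assms(1)]])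
     (use assms(2,3) in auto)

lemma twist_0_1: "twist 0 1 x = x"
  by (simp add: vec_eq_3 twist_nth)

lemma norm_axis_1: "norm (axis i 1 :: real^3) = 1"
  by (simp add: norm_eq_1 inner_axis_axis)

text \<open>The shear of the twist has opposite signs at the two antipodal points,
  \<open>+ \<tau>\<close> at \<open>axis 1 1\<close> and \<open>- \<tau>\<close> at its antipode;
  the resulting skew part of the bilinear form is what the middle term of \<open>eta_hat\<close>
  detects.\<close>

lemma mixed_diff_equator:
  assumes "R > 0" "u $ 1 = 0" "w $ 1 = 0"
  shows "mixed_diff (induced_dist (twist_metric \<tau> R)) (axis 1 1, - axis 1 1) u w =
    - (R / 2) * ((u $ 2 + \<tau> * u $ 3) * (w $ 2 - \<tau> * w $ 3) + u $ 3 * w $ 3)"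
proof -
  have t: "axis 1 1 \<bullet> u = 0" "axis 1 1 \<bullet> w = 0" using assms by (simp_all add: inner_axis inner_axis')
  have a: "twist \<tau> R (- axis 1 1) = - twist \<tau> R (axis 1 1)" by (simp add: vec_eq_3 twist_nth axis_def)
  show ?thesis
    unfolding radial_diffeomorphism.mixed_diff_antipodal[OF twist_radial_diffeomorphism[OF assms(1)] norm_axis_1 a t]
      twist_derivative[OF assms(1)] inner_3
    using assms by (simp add: axis_def field_simps)
qed

lemma mixed_diff_pole:
  assumes "R > 0" "u $ 3 = 0" "w $ 3 = 0" "cos \<tau> = 1" "sin \<tau> = 0"
  shows "mixed_diff (induced_dist (twist_metric \<tau> R)) (axis 3 1, - axis 3 1) u w =
    - (R / 2) * (u $ 1 * w $ 1 + u $ 2 * w $ 2)"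
proof -
  have t: "axis 3 1 \<bullet> u = 0" "axis 3 1 \<bullet> w = 0" using assms by (simp_all add: inner_axis inner_axis')
  have a: "twist \<tau> R (- axis 3 1) = - twist \<tau> R (axis 3 1)" by (simp add: vec_eq_3 twist_nth axis_def)
  show ?thesis
    unfolding radial_diffeomorphism.mixed_diff_antipodal[OF twist_radial_diffeomorphism[OF assms(1)] norm_axis_1 a t]
      twist_derivative[OF assms(1)] inner_3
    using assms by (simp add: axis_def field_simps)
qed

lemma axis_components:
  "(axis 1 1 :: real^3) $ 1 = 1" "(axis 1 1 :: real^3) $ 2 = 0" "(axis 1 1 :: real^3) $ 3 = 0"
  "(axis 2 1 :: real^3) $ 1 = 0" "(axis 2 1 :: real^3) $ 2 = 1" "(axis 2 1 :: real^3) $ 3 = 0"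
  "(axis 3 1 :: real^3) $ 1 = 0" "(axis 3 1 :: real^3) $ 2 = 0" "(axis 3 1 :: real^3) $ 3 = 1"
  by (simp_all add: axis_def)

definition split_frame :: "real^3 \<Rightarrow> real^3 \<Rightarrow> real^3 \<Rightarrow> real^3 \<Rightarrow> nat \<Rightarrow> (real^3) \<times> (real^3)" where
  "split_frame u v w x i = (if i = 0 then (u, 0) else if i = 1 then (v, 0) else if i = 2 then (0, w) else (0, x))"

text \<open>Each \<open>dd2\<close> pairs a vector of one factor with a vector of the other, so only
  four terms survive. The set \<open>T\<close> confines the closed formulas for
  \<open>mixed_diff\<close> to the tangent vectors on which they hold.\<close>

lemma wedge_dd2_split_frame:
  assumes M: "\<And>u w. u \<in> T \<Longrightarrow> w \<in> T \<Longrightarrow> mixed_diff l p u w = M u w"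
    and N: "\<And>u w. u \<in> T \<Longrightarrow> w \<in> T \<Longrightarrow> mixed_diff l' p u w = N u w"
    and z: "\<And>u. M u 0 = 0" "\<And>u. M 0 u = 0" "\<And>u. N u 0 = 0" "\<And>u. N 0 u = 0"
    and T: "0 \<in> T" "u \<in> T" "v \<in> T" "w \<in> T" "x \<in> T"
  shows "wedge 2 2 (dd2 l) (dd2 l') p (split_frame u v w x) =
    M u x * N v w + M v w * N u x - M u w * N v x - M v x * N u w"
proof -
  have A: "(\<lambda>x y. mixed_diff l p (fst x) (snd y) - mixed_diff l p (fst y) (snd x)) y x
      = - (\<lambda>x y. mixed_diff l p (fst x) (snd y) - mixed_diff l p (fst y) (snd x)) x y" for x y l by simp
  show ?thesis
    unfolding wedge_2_2[where \<alpha> = "dd2 l" and \<beta> = "dd2 l'" and p = p, OF dd2_alternating A dd2_alternating A]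
    by (simp add: split_frame_def M N T z)
qed

lemma positive_split_frame:
  assumes "y \<bullet> cross3 u v * (z \<bullet> cross3 w x) > 0" "y \<bullet> u = 0" "y \<bullet> v = 0" "z \<bullet> w = 0" "z \<bullet> x = 0"
  shows "positive_frame (y, z) (split_frame u v w x)"
proof -
  have A: "fst (y, z) \<bullet> cross3 (fst b) (fst a) = - (fst (y, z) \<bullet> cross3 (fst a) (fst b))"
    "snd (y, z) \<bullet> cross3 (snd b) (snd a) = - (snd (y, z) \<bullet> cross3 (snd a) (snd b))"
    for a b :: "(real^3) \<times> (real^3)"
    by (simp_all add: cross_skew[of "fst b"] cross_skew[of "snd b"])
  have "orientation_form (y, z) (split_frame u v w x) = (y \<bullet> cross3 u v) * (z \<bullet> cross3 w x)"
    unfolding orientation_form_def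
    by (subst wedge_2_2[where \<alpha> = "\<lambda>p a. fst p \<bullet> cross3 (fst (a 0)) (fst (a 1))" and
          \<beta> = "\<lambda>p a. snd p \<bullet> cross3 (snd (a 0)) (snd (a 1))" and p = "(y, z)" and A = "\<lambda>a b. fst (y, z) \<bullet> cross3 (fst a) (fst b)" and B = "\<lambda>a b. snd (y, z) \<bullet> cross3 (snd a) (snd b)", OF refl A(1) refl A(2)])
       (simp add: split_frame_def)
  then show ?thesis using assms
    by (simp add: positive_frame_def tangent_Pairs_def split_frame_def)
qed

lemma indefinite_eta_hat_twist:
  assumes R: "R > 0" and \<tau>: "cos \<tau> = 1" "sin \<tau> = 0" "\<tau>\<^sup>2 > 2 * R + 2 + 2 / R"
  shows "indefinite_top_form (eta_hat (induced_dist (twist_metric \<tau> R)) (induced_dist (twist_metric 0 1)))"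
    (is "indefinite_top_form (eta_hat ?l' ?l)")
  unfolding indefinite_top_form_def
proof
  let ?e = "\<lambda>i. axis i 1 :: real^3"
  have ne: "?e i \<noteq> - ?e i" for i :: 3
  proof
    assume "?e i = - ?e i"
    from arg_cong[OF this, of "\<lambda>v. v $ i"] show False by (simp add: axis_def)
  qed
  have P: "(?e i, - ?e i) \<in> Pairs" for i using ne by (simp add: Pairs_def norm_axis_1)
  let ?T3 = "{u :: real^3. u $ 3 = 0}" and ?T1 = "{u :: real^3. u $ 1 = 0}"
  show "\<exists>p\<in>Pairs. \<exists>a. positive_frame p a \<and> eta_hat ?l' ?l p a > 0"
  \<comment> \<open>The basis is reversed in the second factor because its outward normal is
    \<open>- ?e 3\<close>; likewise at the equator below.\<close>
  proof (intro bexI[OF _ P[of 3]] exI[of _ "split_frame (?e 1) (?e 2) (?e 2) (?e 1)"] conjI)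
    show "positive_frame (?e 3, - ?e 3) (split_frame (?e 1) (?e 2) (?e 2) (?e 1))"
      by (rule positive_split_frame) (simp_all add: cross3_def inner_3 axis_def)
    have w: "wedge 2 2 (dd2 (induced_dist (twist_metric s Q))) (dd2 (induced_dist (twist_metric s' Q'))) (?e 3, - ?e 3)
        (split_frame (?e 1) (?e 2) (?e 2) (?e 1)) = Q * Q' / 2"
      if "Q > 0" "Q' > 0" "cos s = 1" "sin s = 0" "cos s' = 1" "sin s' = 0" for Q Q' s s'
      by (subst wedge_dd2_split_frame[where T = ?T3 and M = "\<lambda>u w. - (Q / 2) * (u $ 1 * w $ 1 + u $ 2 * w $ 2)"
            and N = "\<lambda>u w. - (Q' / 2) * (u $ 1 * w $ 1 + u $ 2 * w $ 2)"])
         (use that in \<open>simp_all add: mixed_diff_pole axis_components\<close>)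
    show "eta_hat ?l' ?l (?e 3, - ?e 3) (split_frame (?e 1) (?e 2) (?e 2) (?e 1)) > 0"
      unfolding eta_hat_eq using R \<tau>(1,2) by (simp add: w add_pos_pos)
  qed
  show "\<exists>p\<in>Pairs. \<exists>a. positive_frame p a \<and> eta_hat ?l' ?l p a < 0"
  proof (intro bexI[OF _ P[of 1]] exI[of _ "split_frame (?e 2) (?e 3) (?e 3) (?e 2)"] conjI)
    show "positive_frame (?e 1, - ?e 1) (split_frame (?e 2) (?e 3) (?e 3) (?e 2))"
      by (rule positive_split_frame) (simp_all add: cross3_def inner_3 axis_def)
    \<comment> \<open>For \<open>s = s'\<close> the shear cancels and the squares keep the sign
      found at the poles; only the product of differently twisted distances can become
      negative.\<close>
    have w: "wedge 2 2 (dd2 (induced_dist (twist_metric s Q))) (dd2 (induced_dist (twist_metric s' Q'))) (?e 1, - ?e 1)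
        (split_frame (?e 2) (?e 3) (?e 3) (?e 2)) = Q * Q' * (2 - (s - s')\<^sup>2) / 4"
      if "Q > 0" "Q' > 0" for Q Q' s s'
      by (subst wedge_dd2_split_frame[where T = ?T1 and M = "\<lambda>u w. - (Q / 2) * ((u $ 2 + s * u $ 3) * (w $ 2 - s * w $ 3) + u $ 3 * w $ 3)"
            and N = "\<lambda>u w. - (Q' / 2) * ((u $ 2 + s' * u $ 3) * (w $ 2 - s' * w $ 3) + u $ 3 * w $ 3)"])
         (use that in \<open>simp_all add: mixed_diff_equator axis_components, simp add: field_simps power2_eq_square\<close>)
    have "R * (2 * R + 2 + 2 / R) = 2 * (R * R) + 2 * R + 2" using R by (simp add: field_simps)
    then have lt: "2 * (R * R) + 2 * R + 2 < R * \<tau>\<^sup>2"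
      using mult_strict_left_mono[OF \<tau>(3) R] by (simp only:)
    have "1 * 1 * 2 / 4 + R * 1 * (2 - \<tau>\<^sup>2) / 4 + R * R * 2 / 4 = (2 * (R * R) + 2 * R + 2 - R * \<tau>\<^sup>2) / 4"
      by (simp add: field_simps)
    also have "\<dots> < 0" by (rule divide_neg_pos) (use lt in \<open>simp_all only: diff_less_0_iff_less zero_less_numeral\<close>)
    finally have "1 * 1 * 2 / 4 + R * 1 * (2 - \<tau>\<^sup>2) / 4 + R * R * 2 / 4 < 0" .
    then show "eta_hat ?l' ?l (?e 1, - ?e 1) (split_frame (?e 2) (?e 3) (?e 3) (?e 2)) < 0"
      unfolding eta_hat_eq using R by (simp add: w)
  qed
qed

text \<open>After a whole number of turns the pole is fixed up to scale and the differential there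
  is \<open>R\<close> times the identity on tangent vectors; as \<open>u\<close> is orthogonal to
  the axis, only its product with \<open>q\<close> survives.\<close>

lemma pole_distance_derivative:
  assumes R: "R > 0" and \<tau>: "cos \<tau> = 1" "sin \<tau> = 0" and u: "axis 3 1 \<bullet> u = 0"
    and q: "q \<noteq> R *\<^sub>R axis 3 1"
  shows "((\<lambda>\<theta>. norm (twist \<tau> R (cos \<theta> *\<^sub>R axis 3 1 + sin \<theta> *\<^sub>R u) - q)) has_real_derivative
    - R * (u \<bullet> q) / norm (R *\<^sub>R axis 3 1 - q)) (at 0)"
proof -
  interpret radial_diffeomorphism "twist \<tau> R" "twist (- \<tau> / R) (1 / R)" R
    by (rule twist_radial_diffeomorphism[OF R])
  let ?c = "\<lambda>\<theta>. cos \<theta> *\<^sub>R axis 3 1 + sin \<theta> *\<^sub>R u"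
  have u3: "u $ 3 = 0" using u by (simp add: inner_axis')
  have c: "(?c has_vector_derivative u) (at 0)" by (auto intro!: derivative_eq_intros)
  have e: "twist \<tau> R (?c 0) = R *\<^sub>R axis 3 1" by (simp add: vec_eq_3 twist_nth axis_def)
  have D: "D (?c 0) u = R *\<^sub>R u"
    unfolding twist_derivative[OF R] using \<tau> u3 by (simp add: vec_eq_3 axis_def)
  have "D (?c 0) u \<bullet> (twist \<tau> R (?c 0) - q) = - R * (u \<bullet> q)"
    unfolding e D using u by (simp add: inner_diff_right inner_commute)
  then show ?thesis using dist_along_curve[OF c, of q] q unfolding e by simp
qed

theorem proposition5p1:
  shows "\<exists>F F' :: metric.
    simple_Riemannian F \<and> simple_Riemannian F' \<and>
    (\<forall>y\<in>S2. \<forall>z\<in>S2. induced_dist F' y z \<ge> induced_dist F y z) \<and>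
    indefinite_top_form (eta_hat (induced_dist F') (induced_dist F)) \<and>
    \<not> (\<exists>G :: metric. simple_Finsler G \<and>
          (\<forall>y\<in>S2. \<forall>z\<in>S2. induced_dist G y z = induced_dist F' y z + induced_dist F y z))"
proof -
  \<comment> \<open>The larger root of \<open>R^2 - 10 R + 1 = 0\<close>, which is the square of the
    balance condition \<open>(1 + R) / sqrt 2 = (R - 1) * sqrt 3 / 2\<close> verified at the end;
    the other root is \<open>1 / R\<close>.\<close>
  define R where "R = 5 + 2 * sqrt 6"
  \<comment> \<open>A full turn between the equator and a pole: the differential is untwisted at
    both poles, while height 1/2 gets half a turn.\<close>
  define \<tau> where "\<tau> = 2 * pi"
  let ?F = "twist_metric 0 1" and ?F' = "twist_metric \<tau> R"
  let ?e = "\<lambda>i. axis i 1 :: real^3"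
  have s6: "sqrt 6 \<ge> 2" by (rule real_le_rsqrt) simp
  have R: "R > 0" "R \<ge> 9" using s6 by (simp_all add: R_def)
  have \<tau>: "cos \<tau> = 1" "sin \<tau> = 0" "\<bar>\<tau>\<bar> = \<tau>" by (simp_all add: \<tau>_def)
  have pi: "3 < pi" "pi < 4" using pi_gt3 pi_less_4 by auto
  have lF: "induced_dist ?F y z = norm (y - z)" if "y \<in> S2" "z \<in> S2" for y z
    using induced_dist_twist[of 1 y z 0] that by (simp add: twist_0_1)
  have lF': "induced_dist ?F' y z = norm (twist \<tau> R y - twist \<tau> R z)" if "y \<in> S2" "z \<in> S2" for y z
    by (rule induced_dist_twist[OF R(1) that])
  \<comment> \<open>Numerically \<open>1 + 2 * pi \<le> 9 \<le> R\<close>.\<close>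
  have "R \<ge> 1 + \<bar>\<tau>\<bar>" using R(2) pi(2) unfolding \<tau>(3) by (simp add: \<tau>_def)
  then have dom: "\<forall>y\<in>S2. \<forall>z\<in>S2. induced_dist ?F' y z \<ge> induced_dist ?F y z"
    using twist_expanding by (simp add: lF lF')
  have RR: "R + 1 / R = 10"
  proof -
    have "R * (5 - 2 * sqrt 6) = 1" by (simp add: R_def algebra_simps)
    then have "1 / R = 5 - 2 * sqrt 6" using R(1) by (simp add: field_simps)
    then show ?thesis by (simp add: R_def)
  qed
  \<comment> \<open>The threshold is \<open>2 * (R + 1 / R) + 2 = 22\<close>, and
    \<open>\<tau>\<^sup>2\<close> exceeds 36.\<close>
  have "(2 * 3)\<^sup>2 < \<tau>\<^sup>2" unfolding \<tau>_def using pi(1) by (intro power_strict_mono) auto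
  moreover have "2 * R + 2 + 2 / R = 22" using RR by (simp add: field_simps)
  ultimately have "\<tau>\<^sup>2 > 2 * R + 2 + 2 / R" by simp
  then have ind: "indefinite_top_form (eta_hat (induced_dist ?F') (induced_dist ?F))"
    using indefinite_eta_hat_twist[OF R(1) \<tau>(1,2)] by blast
  have noG: False if G: "simple_Finsler G" "\<forall>y\<in>S2. \<forall>z\<in>S2. induced_dist G y z = induced_dist ?F' y z + induced_dist ?F y z" for G
  proof -
    obtain g U where "Finsler_ball G g U"
      using reversible_Finsler_imp_Finsler_ball G(1) unfolding simple_Finsler_def by blast
    then interpret Finsler_ball G g U .
    have dG: "d y z = norm (twist \<tau> R y - twist \<tau> R z) + norm (y - z)" if "y \<in> S2" "z \<in> S2" for y z
      using G(2) lF[OF that] lF'[OF that] that unfolding d_def by simp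
    \<comment> \<open>Before and after twisting, both points lie in the plane of the first and third
      axes, so every derivative at the pole is a multiple of \<open>u $ 1\<close> and a single
      scalar equation has to be solved. Their distances from the pole are \<open>sqrt 2\<close> and
      1.\<close>
    define z where "z i = (if i then ?e 1 else - (sqrt 3 / 2) *\<^sub>R ?e 1 + (1 / 2) *\<^sub>R ?e 3)" for i
    have z1: "z True = ?e 1" and z2: "z False = - (sqrt 3 / 2) *\<^sub>R ?e 1 + (1 / 2) *\<^sub>R ?e 3" by (simp_all add: z_def)
    have nz: "norm (z i) = 1" for i
    proof (cases i)
      case True
      then show ?thesis by (simp add: z1 norm_axis_1)
    next
      case False
      have "z False \<bullet> z False = (sqrt 3)\<^sup>2 / 4 + 1 / 4"
        unfolding z2 inner_3 by (simp add: axis_components power2_eq_square)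
      then have "z False \<bullet> z False = 1" by simp
      then show ?thesis using False by (simp add: norm_eq_1)
    qed
    have t1: "twist \<tau> R (z True) = R *\<^sub>R ?e 1" by (simp add: z1 vec_eq_3 twist_nth axis_def)
    have t2: "twist \<tau> R (z False) = R *\<^sub>R ((sqrt 3 / 2) *\<^sub>R ?e 1 + (1 / 2) *\<^sub>R ?e 3)"
      by (simp add: z2 vec_eq_3 twist_nth axis_def \<tau>_def)
    show False
    proof (rule no_common_derivative[of "?e 3" z])
      show "?e 3 \<in> S2" by (simp add: norm_axis_1)
      have zi3: "z i $ 3 \<noteq> 1" for i by (cases i) (simp_all add: z1 z2 axis_components)
      have e3z: "?e 3 \<noteq> z i" for i
      proof
        assume "?e 3 = z i"
        from arg_cong[OF this, of "\<lambda>v. v $ 3"] show False using zi3[of i] by (simp add: axis_components)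
      qed
      with nz show "\<forall>i. z i \<in> S2 \<and> ?e 3 \<noteq> z i" by simp
      show "z True \<noteq> z False" by (simp add: z1 z2 vec_eq_3 axis_def)
      show "\<forall>p\<in>S2. \<forall>q\<in>S2. \<forall>r\<in>S2. p \<noteq> q \<longrightarrow> q \<noteq> r \<longrightarrow> p \<noteq> r \<longrightarrow> d p r < d p q + d q r"
      proof (intro ballI impI)
        fix p q r assume S: "p \<in> S2" "q \<in> S2" "r \<in> S2" and n: "p \<noteq> q" "q \<noteq> r"
        \<comment> \<open>Strictness is taken from the Euclidean summand; the twisted one
          contributes the plain triangle inequality.\<close>
        have "norm (twist \<tau> R p - twist \<tau> R r) \<le> norm (twist \<tau> R p - twist \<tau> R q) + norm (twist \<tau> R q - twist \<tau> R r)"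
          using norm_triangle_ineq[of "twist \<tau> R p - twist \<tau> R q" "twist \<tau> R q - twist \<tau> R r"] by simp
        moreover have "norm (p - r) < norm (p - q) + norm (q - r)"
          by (rule strict_triangle_sphere) (use S n in simp_all)
        ultimately show "d p r < d p q + d q r" using S by (simp add: dG)
      qed
      show "\<forall>u. norm u = 1 \<longrightarrow> ?e 3 \<bullet> u = 0 \<longrightarrow>
        (\<exists>D. \<forall>i. ((\<lambda>\<theta>. d (cos \<theta> *\<^sub>R ?e 3 + sin \<theta> *\<^sub>R u) (z i)) has_real_derivative D) (at 0))"
      proof (intro allI impI)
        fix u :: "real^3" assume u: "norm u = 1" "?e 3 \<bullet> u = 0"
        have u3: "u $ 3 = 0" using u(2) by (simp add: inner_axis')
        let ?c = "\<lambda>\<theta>. cos \<theta> *\<^sub>R ?e 3 + sin \<theta> *\<^sub>R u"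
        have cS: "?c \<theta> \<in> S2" for \<theta>
        proof -
          have "?c \<theta> \<bullet> ?c \<theta> = (cos \<theta>)\<^sup>2 * (?e 3 \<bullet> ?e 3) + 2 * cos \<theta> * sin \<theta> * (?e 3 \<bullet> u) + (sin \<theta>)\<^sup>2 * (u \<bullet> u)"
            by (simp add: inner_add_left inner_add_right inner_commute power2_eq_square algebra_simps)
          also have "\<dots> = 1"
          proof -
            have "u \<bullet> u = 1" "?e 3 \<bullet> ?e 3 = 1" using u(1) norm_axis_1[of 3] by (simp_all add: norm_eq_1)
            then show ?thesis using u(2) by simp
          qed
          finally show ?thesis by (simp add: norm_eq_1)
        qed
        define D where "D i = - R * (u \<bullet> twist \<tau> R (z i)) / norm (R *\<^sub>R ?e 3 - twist \<tau> R (z i))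
            + - 1 * (u \<bullet> z i) / norm (1 *\<^sub>R ?e 3 - z i)" for i
        have D: "((\<lambda>\<theta>. d (?c \<theta>) (z i)) has_real_derivative D i) (at 0)" for i
        proof -
          have "twist \<tau> R (z i) $ 3 \<noteq> (R *\<^sub>R ?e 3) $ 3" using R(1) zi3[of i] by (simp add: twist_nth axis_components)
          then have ne: "twist \<tau> R (z i) \<noteq> R *\<^sub>R ?e 3" by metis
          have ne': "z i \<noteq> 1 *\<^sub>R ?e 3" using e3z[of i] by auto
          have "((\<lambda>\<theta>. norm (twist \<tau> R (?c \<theta>) - twist \<tau> R (z i)) + norm (twist 0 1 (?c \<theta>) - z i)) has_real_derivative D i) (at 0)"
            unfolding D_def
            by (rule DERIV_add[OF pole_distance_derivative[OF R(1) \<tau>(1,2) u(2) ne] pole_distance_derivative[OF zero_less_one _ _ u(2) ne']])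
               simp_all
          then show ?thesis using cS nz by (simp add: dG twist_0_1)
        qed
        have DD: "D False = D True"
        proof -
          have n1: "norm (R *\<^sub>R ?e 3 - twist \<tau> R (z True)) = R * sqrt 2"
          proof -
            have "(R *\<^sub>R ?e 3 - twist \<tau> R (z True)) \<bullet> (R *\<^sub>R ?e 3 - twist \<tau> R (z True)) = R\<^sup>2 * 2"
              by (simp add: t1 inner_3 axis_def power2_eq_square)
            then show ?thesis using R(1) by (simp add: norm_eq_sqrt_inner real_sqrt_mult)
          qed
          have n2: "norm (1 *\<^sub>R ?e 3 - z True) = sqrt 2"
            by (simp add: z1 norm_eq_sqrt_inner inner_3 axis_def)
          have n3: "norm (R *\<^sub>R ?e 3 - twist \<tau> R (z False)) = R"
          proof -
            have "(R *\<^sub>R ?e 3 - twist \<tau> R (z False)) \<bullet> (R *\<^sub>R ?e 3 - twist \<tau> R (z False)) = R\<^sup>2 * ((sqrt 3)\<^sup>2 / 4 + 1 / 4)"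
              unfolding t2 inner_3 by (simp add: axis_def power2_eq_square field_simps)
            also have "\<dots> = R\<^sup>2" by simp
            finally show ?thesis using R(1) by (simp add: norm_eq_sqrt_inner)
          qed
          have n4: "norm (1 *\<^sub>R ?e 3 - z False) = 1"
          proof -
            have "(1 *\<^sub>R ?e 3 - z False) \<bullet> (1 *\<^sub>R ?e 3 - z False) = (sqrt 3)\<^sup>2 / 4 + 1 / 4"
              unfolding z2 inner_3 by (simp add: axis_def power2_eq_square field_simps)
            then show ?thesis by (simp add: norm_eq_1)
          qed
          have i1: "u \<bullet> z True = u $ 1" unfolding z1 by (simp add: inner_3 axis_components)
          have j1: "u \<bullet> twist \<tau> R (z True) = R * u $ 1"
            unfolding t1 by (simp add: inner_3 axis_components)
          have i2: "u \<bullet> z False = - (sqrt 3 / 2) * u $ 1"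
            unfolding z2 using u3 by (simp add: inner_3 axis_components)
          have j2: "u \<bullet> twist \<tau> R (z False) = R * ((sqrt 3 / 2) * u $ 1)"
            unfolding t2 using u3 by (simp add: inner_3 axis_components)
          have s2: "sqrt 2 \<noteq> 0" by simp
          have D1: "D True = - (u $ 1) * ((1 + R) / sqrt 2)"
            unfolding D_def n1 n2 i1 j1 using R(1) s2 by (simp add: divide_simps) (simp add: algebra_simps)
          have D2: "D False = - (u $ 1) * ((R - 1) * sqrt 3 / 2)"
            unfolding D_def n3 n4 i2 j2 using R(1) by (simp add: divide_simps) (simp add: algebra_simps)
          have eq: "(1 + R) / sqrt 2 = (R - 1) * sqrt 3 / 2"
          proof -
            have s: "sqrt 6 = sqrt 2 * sqrt 3" by (simp flip: real_sqrt_mult)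
            have "(R - 1) * sqrt 3 * sqrt 2 = 2 * (1 + R)"
              unfolding R_def s by (simp add: algebra_simps)
            moreover have "(1 + R) / sqrt 2 = (1 + R) * sqrt 2 / 2" by (simp add: field_simps)
            ultimately show ?thesis by (simp add: field_simps)
          qed
          show ?thesis unfolding D1 D2 eq ..
        qed
        show "\<exists>D. \<forall>i. ((\<lambda>\<theta>. d (?c \<theta>) (z i)) has_real_derivative D) (at 0)"
        proof (intro exI allI)
          fix i show "((\<lambda>\<theta>. d (?c \<theta>) (z i)) has_real_derivative D True) (at 0)"
          proof (cases i)
            case True
            then show ?thesis using D[of True] by (simp only:)
          next
            case False
            then show ?thesis using D[of False] by (simp only: DD)
          qed
        qed
      qed
    qed
  qed
  have noG: "\<not> (\<exists>G :: metric. simple_Finsler G \<and>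
      (\<forall>y\<in>S2. \<forall>z\<in>S2. induced_dist G y z = induced_dist ?F' y z + induced_dist ?F y z))"
    using noG by iprover
  have sR: "simple_Riemannian ?F" "simple_Riemannian ?F'"
    by (intro radial_diffeomorphism.simple_Riemannian_pullback[OF twist_radial_diffeomorphism] R(1) zero_less_one)+
  show ?thesis
    by (rule exI[of _ ?F], rule exI[of _ ?F'], intro conjI, rule sR(1), rule sR(2), rule dom, rule ind, rule noG)
qed

end
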